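(* Let $k$ be an algebraically closed field of characteristic $p\geq 3$ and let $G=SL_2$ over $k$ with first Frobenius kernel $G_1$. Then there are isomorphisms of $G$-modules: (a) $\operatorname{HH}^{0}(G_{1})^{(-1)}\cong k^{\oplus \frac{3p-1}{2}}$; (b) $\operatorname{HH}^{2m}(G_{1})^{(-1)}\cong k[\mathcal{N}]_{m}^{\oplus (p-1)}$ for every integer $m>0$; (c) $\operatorname{HH}^{2m+1}(G_{1})^{(-1)}\cong \big[\operatorname{ind}_{B}^{G}\big(S^{m}(\mathfrak{u}^{*})\otimes\omega\big)\otimes L(1)\big]^{\oplus\frac{p-1}{2}}$ for every integer $m\geq 0$.
   Context: $G=SL_2$ is regarded as defined over $\mathbb{F}_p$ with Frobenius morphism $F:G\to G$; $G_1=\ker F$ is the first Frobenius kernel (scheme-theoretic), and $\operatorname{Dist}(G_1)$ is its distribution algebra, a finite-dimensional cocommutative Hopf algebra isomorphic to the restricted enveloping algebra $u(\mathfrak{g})$, $\mathfrak{g}=\mathfrak{sl}_2=\operatorname{Lie} G$. $T$ is a maximal torus, $B\supset T$ is the Borel subgroup corresponding to the negative root, $U$ is the unipotent radical of $B$, and $\mathfrak{u}=\operatorname{Lie} U$. The weight $\omega$ is the fundamental dominant weight; a weight is also used to denote the one-dimensional $B$-module on which $T$ acts by that weight and $U$ acts trivially. The module $\mathfrak{u}^*$ has weight $2\omega$ (the positive root), and $S^m(\mathfrak{u}^* )$ is its $m$th symmetric power as a $B$-module. $\operatorname{ind}_B^G$ is induction of rational modules from $B$ to $G$. $L(1)$ is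 the two-dimensional natural $G$-module. $\mathcal{N}\subset\mathfrak{g}$ is the nilpotent cone, and $k[\mathcal{N}]_m$ is the degree $m$ homogeneous component of its coordinate ring, where linear functions on $\mathfrak{g}$ have degree $1$. $\operatorname{HH}^{\bullet}(G_1)$ denotes the Hochschild cohomology of the algebra $\operatorname{Dist}(G_1)$ (with coefficients in itself); it is isomorphic to $\operatorname{H}^{\bullet}(G_1,\operatorname{Dist}(G_1)_{\operatorname{ad}})$, where $\operatorname{Dist}(G_1)_{\operatorname{ad}}$ is $\operatorname{Dist}(G_1)$ with the adjoint action. The adjoint action of $G$ on $\operatorname{Dist}(G_1)$ makes this a $G$-module on which $G_1$ acts trivially. For a $G$-module $N$ on which $G_1$ acts trivially, $N^{(-1)}$ denotes the $G$-module whose Frobenius twist (composition of the action with $F$) is $N$. *)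

theory Defs
  imports
    "HOL-Analysis.Determinants"
    "HOL-Algebra.Algebraic_Closure_Type"
begin

no_notation fps_nth (infixl \<open>$\<close> 75)

section \<open>Modules with a group action\<close>

text \<open>
  Scalars range over a whole type \<open>'k\<close>; as a ring record this is \<open>ring_of_type_algebra\<close>.
  The record inherits \<open>mult\<close> and \<open>one\<close> from \<^typ>\<open>('k, 'v) module\<close>. They are meaningful only when
  the record is used for a (possibly noncommutative) algebra.

  A rational module for \<open>SL\<^sub>2\<close> over an algebraically closed field is given by the action of the
  group of \<open>k\<close>-points; since \<open>SL\<^sub>2\<close> and its Borel subgroup are reduced, a linear map between
  rational modules is a module homomorphism iff it commutes with the action of the points.
\<close>

record ('k, 'v, 'g) gmodule = "('k, 'v) module" +
  act :: "'g \<Rightarrow> 'v \<Rightarrow> 'v"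

definition gmod ::
    "'v set \<Rightarrow> ('v \<Rightarrow> 'v \<Rightarrow> 'v) \<Rightarrow> 'v \<Rightarrow> ('k \<Rightarrow> 'v \<Rightarrow> 'v) \<Rightarrow> ('g \<Rightarrow> 'v \<Rightarrow> 'v)
      \<Rightarrow> ('k, 'v, 'g) gmodule"
  where "gmod V a z s \<rho> =
    \<lparr>carrier = V, mult = undefined, one = undefined, ring.zero = z, add = a, module.smult = s, act = \<rho>\<rparr>"

definition gmod_iso :: "('k, 'v, 'g) gmodule \<Rightarrow> ('k, 'w, 'g) gmodule \<Rightarrow> bool"  (infix \<open>\<cong>\<^sub>G\<close> 50)
  where "M \<cong>\<^sub>G N \<longleftrightarrow> (\<exists>\<phi>. bij_betw \<phi> (carrier M) (carrier N) \<and>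
    (\<forall>x\<in>carrier M. \<forall>y\<in>carrier M. \<phi> (x \<oplus>\<^bsub>M\<^esub> y) = \<phi> x \<oplus>\<^bsub>N\<^esub> \<phi> y) \<and>
    (\<forall>c. \<forall>x\<in>carrier M. \<phi> (c \<odot>\<^bsub>M\<^esub> x) = c \<odot>\<^bsub>N\<^esub> \<phi> x) \<and>
    (\<forall>g. \<forall>x\<in>carrier M. \<phi> (act M g x) = act N g (\<phi> x)))"

definition triv_gmod :: "('k::comm_ring_1, 'k, 'g) gmodule"
  where "triv_gmod = gmod UNIV (+) 0 (*) (\<lambda>g x. x)"

text \<open>A set \<open>F\<close> of (extensional) functions \<open>D \<rightarrow> M\<close> with pointwise operations.\<close>

definition fun_gmod ::
    "('k, 'v, 'm) module_scheme \<Rightarrow> 'x set \<Rightarrow> ('x \<Rightarrow> 'v) set \<Rightarrow> ('g \<Rightarrow> ('x \<Rightarrow> 'v) \<Rightarrow> 'x \<Rightarrow> 'v)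
      \<Rightarrow> ('k, 'x \<Rightarrow> 'v, 'g) gmodule"
  where "fun_gmod M D F \<rho> =
    gmod F (\<lambda>f h. \<lambda>x\<in>D. f x \<oplus>\<^bsub>M\<^esub> h x) (\<lambda>x\<in>D. \<zero>\<^bsub>M\<^esub>) (\<lambda>c f. \<lambda>x\<in>D. c \<odot>\<^bsub>M\<^esub> f x) \<rho>"

definition power_gmod :: "nat \<Rightarrow> ('k, 'v, 'g) gmodule \<Rightarrow> ('k, nat \<Rightarrow> 'v, 'g) gmodule"
  where "power_gmod n M =
    fun_gmod M {..<n} ({..<n} \<rightarrow>\<^sub>E carrier M) (\<lambda>g x. \<lambda>i\<in>{..<n}. act M g (x i))"

definition dual_gmod ::
    "('k::comm_ring_1, 'v, 'g::inverse) gmodule \<Rightarrow> ('k, 'v \<Rightarrow> 'k, 'g) gmodule"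
  where "dual_gmod M =
    fun_gmod (triv_gmod :: ('k, 'k, 'g) gmodule) (carrier M)
      {l \<in> carrier M \<rightarrow>\<^sub>E UNIV.
        (\<forall>x\<in>carrier M. \<forall>y\<in>carrier M. l (x \<oplus>\<^bsub>M\<^esub> y) = l x + l y) \<and>
        (\<forall>c. \<forall>x\<in>carrier M. l (c \<odot>\<^bsub>M\<^esub> x) = c * l x)}
      (\<lambda>g l. \<lambda>x\<in>carrier M. l (act M (inverse g) x))"

text \<open>The quotient by a stable submodule, with cosets as elements.\<close>

definition quot_gmod :: "('k, 'v, 'g) gmodule \<Rightarrow> 'v set \<Rightarrow> ('k, 'v set, 'g) gmodule"
  where "quot_gmod M H =
    gmod (a_rcosets\<^bsub>M\<^esub> H) (\<lambda>Z W. Z <+>\<^bsub>M\<^esub> W) H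
      (\<lambda>c Z. \<Union>x\<in>Z. H +>\<^bsub>M\<^esub> (c \<odot>\<^bsub>M\<^esub> x))
      (\<lambda>g Z. \<Union>x\<in>Z. H +>\<^bsub>M\<^esub> act M g x)"

definition submod_gen :: "('k::comm_ring_1, 'v, 'g) gmodule \<Rightarrow> 'v set \<Rightarrow> 'v set"
  where "submod_gen M R = (\<lambda>H. submodule H (ring_of_type_algebra :: 'k ring) M) hull R"

text \<open>The free module on \<open>S\<close>, with the linear extension of an action \<open>\<alpha>\<close> on \<open>S\<close>.\<close>

definition free_gmod ::
    "'x set \<Rightarrow> ('g \<Rightarrow> 'x \<Rightarrow> 'x) \<Rightarrow> ('k::comm_ring_1, 'x \<Rightarrow> 'k, 'g) gmodule"
  where "free_gmod S \<alpha> =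
    fun_gmod (triv_gmod :: ('k, 'k, 'g) gmodule) S
      {f \<in> S \<rightarrow>\<^sub>E UNIV. finite {x \<in> S. f x \<noteq> 0}}
      (\<lambda>g f. \<lambda>y\<in>S. \<Sum>x | x \<in> S \<and> f x \<noteq> 0 \<and> \<alpha> g x = y. f x)"

definition free_gen :: "'x set \<Rightarrow> 'x \<Rightarrow> 'x \<Rightarrow> 'k::comm_ring_1"
  where "free_gen S x = (\<lambda>y\<in>S. if y = x then 1 else 0)"

definition tensor_gmod ::
    "('k::comm_ring_1, 'v, 'g) gmodule \<Rightarrow> ('k, 'w, 'g) gmodule
      \<Rightarrow> ('k, ('v \<times> 'w \<Rightarrow> 'k) set, 'g) gmodule"
  where "tensor_gmod M N =
    (let S = carrier M \<times> carrier N;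
         F = free_gmod S (\<lambda>g (v, w). (act M g v, act N g w));
         e = (\<lambda>v w. free_gen S (v, w))
     in quot_gmod F (submod_gen F
       ({e (v \<oplus>\<^bsub>M\<^esub> v') w \<ominus>\<^bsub>F\<^esub> (e v w \<oplus>\<^bsub>F\<^esub> e v' w) | v v' w.
           v \<in> carrier M \<and> v' \<in> carrier M \<and> w \<in> carrier N} \<union>
        {e v (w \<oplus>\<^bsub>N\<^esub> w') \<ominus>\<^bsub>F\<^esub> (e v w \<oplus>\<^bsub>F\<^esub> e v w') | v w w'.
           v \<in> carrier M \<and> w \<in> carrier N \<and> w' \<in> carrier N} \<union>
        {e (c \<odot>\<^bsub>M\<^esub> v) w \<ominus>\<^bsub>F\<^esub> c \<odot>\<^bsub>F\<^esub> e v w | c v w. v \<in> carrier M \<and> w \<in> carrier N} \<union>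
        {e v (c \<odot>\<^bsub>N\<^esub> w) \<ominus>\<^bsub>F\<^esub> c \<odot>\<^bsub>F\<^esub> e v w | c v w. v \<in> carrier M \<and> w \<in> carrier N})))"

definition tuples :: "('v, 'm) partial_object_scheme \<Rightarrow> nat \<Rightarrow> 'v list set"
  where "tuples M n = {xs. length xs = n \<and> set xs \<subseteq> carrier M}"

definition sym_power_gmod ::
    "nat \<Rightarrow> ('k::comm_ring_1, 'v, 'g) gmodule \<Rightarrow> ('k, ('v list \<Rightarrow> 'k) set, 'g) gmodule"
  where "sym_power_gmod m M =
    (let S = tuples M m;
         F = free_gmod S (\<lambda>g. map (act M g));
         e = free_gen S
     in quot_gmod F (submod_gen F
       ({e (xs[i := v \<oplus>\<^bsub>M\<^esub> w]) \<ominus>\<^bsub>F\<^esub> (e (xs[i := v]) \<oplus>\<^bsub>F\<^esub> e (xs[i := w])) | xs i v w.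
           xs \<in> S \<and> i < m \<and> v \<in> carrier M \<and> w \<in> carrier M} \<union>
        {e (xs[i := c \<odot>\<^bsub>M\<^esub> v]) \<ominus>\<^bsub>F\<^esub> c \<odot>\<^bsub>F\<^esub> e (xs[i := v]) | xs i c v.
           xs \<in> S \<and> i < m \<and> v \<in> carrier M} \<union>
        {e xs \<ominus>\<^bsub>F\<^esub> e ys | xs ys. xs \<in> S \<and> ys \<in> S \<and> mset xs = mset ys})))"


section \<open>Hochschild cohomology of an algebra with coefficients in itself\<close>

text \<open>
  Here \<open>A\<close> is an associative unital algebra, on which a group acts by algebra automorphisms.
  The group acts on a cochain \<open>f\<close> by
  \<open>(g f) (a\<^sub>1, \<dots>, a\<^sub>n) = g (f (g\<inverse> a\<^sub>1, \<dots>, g\<inverse> a\<^sub>n))\<close>.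
\<close>

definition hoch_cochains ::
    "('k, 'a, 'g::inverse) gmodule \<Rightarrow> nat \<Rightarrow> ('k, 'a list \<Rightarrow> 'a, 'g) gmodule"
  where "hoch_cochains A n =
    fun_gmod A (tuples A n)
      {f \<in> tuples A n \<rightarrow>\<^sub>E carrier A. \<forall>as\<in>tuples A n. \<forall>i<n.
        (\<forall>x\<in>carrier A. \<forall>y\<in>carrier A.
          f (as[i := x \<oplus>\<^bsub>A\<^esub> y]) = f (as[i := x]) \<oplus>\<^bsub>A\<^esub> f (as[i := y])) \<and>
        (\<forall>c. \<forall>x\<in>carrier A. f (as[i := c \<odot>\<^bsub>A\<^esub> x]) = c \<odot>\<^bsub>A\<^esub> f (as[i := x]))}
      (\<lambda>g f. \<lambda>as\<in>tuples A n. act A g (f (map (act A (inverse g)) as)))"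

definition hoch_diff ::
    "('k::comm_ring_1, 'a, 'g) gmodule \<Rightarrow> nat \<Rightarrow> ('a list \<Rightarrow> 'a) \<Rightarrow> 'a list \<Rightarrow> 'a"
  where "hoch_diff A n f = (\<lambda>as\<in>tuples A (Suc n).
    hd as \<otimes>\<^bsub>A\<^esub> f (tl as)
    \<oplus>\<^bsub>A\<^esub> (\<Oplus>\<^bsub>A\<^esub>i\<in>{..<n}. (- 1) ^ Suc i \<odot>\<^bsub>A\<^esub>
          f (take i as @ (as ! i \<otimes>\<^bsub>A\<^esub> as ! Suc i) # drop (i + 2) as))
    \<oplus>\<^bsub>A\<^esub> (- 1) ^ Suc n \<odot>\<^bsub>A\<^esub> (f (butlast as) \<otimes>\<^bsub>A\<^esub> last as))"

definition hoch_cocycles ::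
    "('k::comm_ring_1, 'a, 'g::inverse) gmodule \<Rightarrow> nat \<Rightarrow> ('a list \<Rightarrow> 'a) set"
  where "hoch_cocycles A n =
    {f \<in> carrier (hoch_cochains A n). hoch_diff A n f = \<zero>\<^bsub>hoch_cochains A (Suc n)\<^esub>}"

definition hoch_coboundaries ::
    "('k::comm_ring_1, 'a, 'g::inverse) gmodule \<Rightarrow> nat \<Rightarrow> ('a list \<Rightarrow> 'a) set"
  where "hoch_coboundaries A n =
    (case n of 0 \<Rightarrow> {\<zero>\<^bsub>hoch_cochains A 0\<^esub>}
     | Suc m \<Rightarrow> hoch_diff A m ` carrier (hoch_cochains A m))"

definition HH ::
    "nat \<Rightarrow> ('k::comm_ring_1, 'a, 'g::inverse) gmodule \<Rightarrow> ('k, ('a list \<Rightarrow> 'a) set, 'g) gmodule"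
  where "HH n A =
    quot_gmod ((hoch_cochains A n)\<lparr>carrier := hoch_cocycles A n\<rparr>) (hoch_coboundaries A n)"


section \<open>The group \<open>SL\<^sub>2\<close>\<close>

typedef (overloaded) 'k sl2 = "{A :: 'k::comm_ring_1 ^ 2 ^ 2. det A = 1}"
  morphisms sl2_mat Abs_sl2
  by (rule exI[of _ "mat 1"]) simp

setup_lifting type_definition_sl2

lemma matrix_inv_det_1:
  fixes A :: "'a::field ^ 'n ^ 'n"
  assumes "det A = 1"
  shows "A ** matrix_inv A = mat 1" and "matrix_inv A ** A = mat 1"
proof -
  have "\<exists>A'. A ** A' = mat 1 \<and> A' ** A = mat 1"
    using assms invertible_det_nz[of A] by (simp add: invertible_def)
  from someI_ex[OF this] show "A ** matrix_inv A = mat 1" and "matrix_inv A ** A = mat 1"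
    by (simp_all add: matrix_inv_def)
qed

instantiation sl2 :: (field) "{monoid_mult, inverse}"
begin

lift_definition one_sl2 :: "'a sl2" is "mat 1" by simp
lift_definition times_sl2 :: "'a sl2 \<Rightarrow> 'a sl2 \<Rightarrow> 'a sl2" is "(**)"
  by (simp add: det_mul)
lift_definition inverse_sl2 :: "'a sl2 \<Rightarrow> 'a sl2" is matrix_inv
proof -
  fix A :: "'a ^ 2 ^ 2" assume "det A = 1"
  then have "A ** matrix_inv A = mat 1" by (rule matrix_inv_det_1)
  then have "det A * det (matrix_inv A) = 1" by (metis det_I det_mul)
  with \<open>det A = 1\<close> show "det (matrix_inv A) = 1" by simp
qed
definition divide_sl2 :: "'a sl2 \<Rightarrow> 'a sl2 \<Rightarrow> 'a sl2"
  where "divide_sl2 g h = g * inverse h"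

instance by standard (transfer; simp add: matrix_mul_assoc)+

end

lemma sl2_left_inverse: "inverse g * g = 1" for g :: "'k::field sl2"
  by transfer (simp add: matrix_inv_det_1)

lemma sl2_right_inverse: "g * inverse g = 1" for g :: "'k::field sl2"
  by transfer (simp add: matrix_inv_det_1)

text \<open>The coordinate ring \<open>k[SL\<^sub>2]\<close>, as functions on the points (\<open>k\<close> is algebraically closed).\<close>

inductive_set regular_funs :: "('k::comm_ring_1 sl2 \<Rightarrow> 'k) set" where
  const: "(\<lambda>g. c) \<in> regular_funs"
| entry: "(\<lambda>g. sl2_mat g $ i $ j) \<in> regular_funs"
| add: "\<lbrakk>\<phi> \<in> regular_funs; \<psi> \<in> regular_funs\<rbrakk> \<Longrightarrow> (\<lambda>g. \<phi> g + \<psi> g) \<in> regular_funs"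
| mult: "\<lbrakk>\<phi> \<in> regular_funs; \<psi> \<in> regular_funs\<rbrakk> \<Longrightarrow> (\<lambda>g. \<phi> g * \<psi> g) \<in> regular_funs"

definition frob :: "'k::field sl2 \<Rightarrow> 'k sl2"
  where "frob g = Abs_sl2 (\<chi> i j. (sl2_mat g $ i $ j) ^ CHAR('k))"

lemma sl2_mat_frob:
  fixes g :: "'k::field sl2"
  assumes "CHAR('k) > 0"
  shows "sl2_mat (frob g) = (\<chi> i j. (sl2_mat g $ i $ j) ^ CHAR('k))"
proof -
  have p: "prime CHAR('k)" using assms by (rule prime_CHAR_semidom)
  have "sl2_mat g $ 1 $ 1 * sl2_mat g $ 2 $ 2 = sl2_mat g $ 1 $ 2 * sl2_mat g $ 2 $ 1 + 1"
    using sl2_mat[of g] by (simp add: det_2 algebra_simps)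
  then have "(sl2_mat g $ 1 $ 1 * sl2_mat g $ 2 $ 2) ^ CHAR('k) =
      (sl2_mat g $ 1 $ 2 * sl2_mat g $ 2 $ 1) ^ CHAR('k) + 1"
    by (simp add: freshmans_dream[OF p refl])
  then show ?thesis
    unfolding frob_def by (intro Abs_sl2_inverse) (simp add: det_2 power_mult_distrib)
qed

lemma bij_frob:
  assumes "CHAR('k::alg_closed_field) > 0"
  shows "bij (frob :: 'k sl2 \<Rightarrow> 'k sl2)"
proof (rule bijI)
  have p: "prime CHAR('k)" using assms by (rule prime_CHAR_semidom)
  have inj: "x = y" if "x ^ CHAR('k) = y ^ CHAR('k)" for x y :: 'k
  proof -
    have "y ^ CHAR('k) = (x - y) ^ CHAR('k) + y ^ CHAR('k)"
      using freshmans_dream[OF p refl, of "x - y" y] that by simp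
    then have "(x - y) ^ CHAR('k) = 0" by (metis add_cancel_left_left)
    then show ?thesis by simp
  qed
  show "inj (frob :: 'k sl2 \<Rightarrow> 'k sl2)"
  proof (rule injI)
    fix g h :: "'k sl2" assume "frob g = frob h"
    then have "sl2_mat (frob g) = sl2_mat (frob h)" by simp
    then have "(sl2_mat g $ i $ j) ^ CHAR('k) = (sl2_mat h $ i $ j) ^ CHAR('k)" for i j
      by (simp add: sl2_mat_frob[OF assms] vec_eq_iff)
    then have "sl2_mat g $ i $ j = sl2_mat h $ i $ j" for i j
      by (rule inj)
    then show "g = h" by (simp add: sl2_mat_inject[symmetric] vec_eq_iff)
  qed
  show "surj (frob :: 'k sl2 \<Rightarrow> 'k sl2)"
  proof (rule surjI)
    fix h :: "'k sl2"
    define r :: "'k \<Rightarrow> 'k" where "r x = (SOME y. y ^ CHAR('k) = x)" for x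
    have r: "r x ^ CHAR('k) = x" for x
      unfolding r_def by (rule someI_ex, rule nth_root_exists) (use assms in simp)
    define A :: "'k ^ 2 ^ 2" where "A = (\<chi> i j. r (sl2_mat h $ i $ j))"
    have A: "(A $ i $ j) ^ CHAR('k) = sl2_mat h $ i $ j" for i j
      by (simp add: A_def r)
    have "A $ 1 $ 1 * A $ 2 $ 2 = det A + A $ 1 $ 2 * A $ 2 $ 1"
      by (simp add: det_2)
    then have "(A $ 1 $ 1 * A $ 2 $ 2) ^ CHAR('k) =
        det A ^ CHAR('k) + (A $ 1 $ 2 * A $ 2 $ 1) ^ CHAR('k)"
      by (simp only: freshmans_dream[OF p refl])
    then have "det A ^ CHAR('k) = det (sl2_mat h)"
      by (simp add: det_2 power_mult_distrib A)
    then have "det A ^ CHAR('k) = 1 ^ CHAR('k)" using sl2_mat[of h] by simp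
    then have "det A = 1" by (rule inj)
    then have "sl2_mat (frob (Abs_sl2 A)) = sl2_mat h"
      by (simp add: sl2_mat_frob[OF assms] Abs_sl2_inverse A vec_eq_iff)
    then show "frob (Abs_sl2 (\<chi> i j. r (sl2_mat h $ i $ j))) = h"
      by (simp add: sl2_mat_inject A_def)
  qed
qed

definition frob_twist :: "('k::field, 'v, 'k sl2) gmodule \<Rightarrow> ('k, 'v, 'k sl2) gmodule"
  where "frob_twist M = M\<lparr>act := \<lambda>g. act M (frob g)\<rparr>"

definition frob_untwist :: "('k::field, 'v, 'k sl2) gmodule \<Rightarrow> ('k, 'v, 'k sl2) gmodule"
  where "frob_untwist M = M\<lparr>act := \<lambda>g. act M (inv_into UNIV frob g)\<rparr>"

lemma frob_twist_untwist:
  fixes M :: "('k::alg_closed_field, 'v, 'k sl2) gmodule"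
  assumes "CHAR('k) > 0"
  shows "frob_twist (frob_untwist M) = M"
  using bij_frob[OF assms] by (simp add: frob_twist_def frob_untwist_def bij_is_inj)


section \<open>The distribution algebra of the first Frobenius kernel\<close>

text \<open>
  The ideal of \<open>G\<^sub>1 = ker F\<close> in \<open>k[G]\<close> is generated by the functions \<open>\<phi> \<circ> F\<close> with \<open>\<phi> 1 = 0\<close>.
  Distributions on \<open>G\<^sub>1\<close> are the linear forms on \<open>k[G]\<close> that vanish on this ideal (that is, linear
  forms on \<open>k[G\<^sub>1]\<close>) and on some power of the augmentation ideal. The product is convolution,
  \<open>\<mu> \<nu> = (\<mu> \<otimes> \<nu>) \<circ> \<Delta>\<close> with \<open>\<Delta> \<phi> (g, h) = \<phi> (g h)\<close>, and the unit is evaluation at \<open>1\<close>.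
\<close>

definition aug_ideal :: "('k::field sl2 \<Rightarrow> 'k) set"
  where "aug_ideal = {\<phi> \<in> regular_funs. \<phi> 1 = 0}"

definition distributions_G1 :: "(('k::field sl2 \<Rightarrow> 'k) \<Rightarrow> 'k) set"
  where "distributions_G1 = {\<mu> \<in> regular_funs \<rightarrow>\<^sub>E UNIV.
    (\<forall>\<phi>\<in>regular_funs. \<forall>\<psi>\<in>regular_funs. \<mu> (\<lambda>x. \<phi> x + \<psi> x) = \<mu> \<phi> + \<mu> \<psi>) \<and>
    (\<forall>c. \<forall>\<phi>\<in>regular_funs. \<mu> (\<lambda>x. c * \<phi> x) = c * \<mu> \<phi>) \<and>
    (\<forall>\<phi>\<in>aug_ideal. \<forall>\<psi>\<in>regular_funs. \<mu> (\<lambda>x. \<psi> x * \<phi> (frob x)) = 0) \<and>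
    (\<exists>n. \<forall>\<phi>s. length \<phi>s = Suc n \<and> set \<phi>s \<subseteq> aug_ideal \<longrightarrow> \<mu> (\<lambda>x. \<Prod>\<phi>\<leftarrow>\<phi>s. \<phi> x) = 0)}"

definition Dist_G1 :: "('k::field, ('k sl2 \<Rightarrow> 'k) \<Rightarrow> 'k, 'k sl2) gmodule"
  where "Dist_G1 =
    (fun_gmod (triv_gmod :: ('k, 'k, 'k sl2) gmodule) regular_funs distributions_G1
      (\<lambda>g \<mu>. \<lambda>\<phi>\<in>regular_funs. \<mu> (\<lambda>x. \<phi> (g * x * inverse g))))
    \<lparr>mult := \<lambda>\<mu> \<nu>. \<lambda>\<phi>\<in>regular_funs. \<mu> (\<lambda>g. \<nu> (\<lambda>h. \<phi> (g * h))),
     one := \<lambda>\<phi>\<in>regular_funs. \<phi> 1\<rparr>"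


section \<open>Modules for \<open>SL\<^sub>2\<close> and its Borel subgroup\<close>

definition L1 :: "('k::field, 'k ^ 2, 'k sl2) gmodule"
  where "L1 = gmod UNIV (+) 0 (*s) (\<lambda>g v. sl2_mat g *v v)"

definition adjoint_gmod :: "('k::field ^ 2 ^ 2) set \<Rightarrow> ('k, 'k ^ 2 ^ 2, 'k sl2) gmodule"
  where "adjoint_gmod V = gmod V (+) 0 (\<lambda>c Z. \<chi> i. c *s Z $ i)
    (\<lambda>g Z. sl2_mat g ** Z ** sl2_mat (inverse g))"

definition lie_sl2 :: "('k::field ^ 2 ^ 2) set"
  where "lie_sl2 = {Z. trace Z = 0}"

definition nilcone :: "('k::field ^ 2 ^ 2) set"
  where "nilcone = {Z \<in> lie_sl2. \<exists>n. (((**) Z) ^^ n) (mat 1) = 0}"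

text \<open>
  The coordinate ring of the (reduced) nilpotent cone consists of the restrictions of polynomial
  functions on the Lie algebra; its degree \<open>m\<close> component is spanned by the restrictions of products
  of \<open>m\<close> linear forms.
\<close>

definition nilcone_coord :: "nat \<Rightarrow> ('k::field, 'k ^ 2 ^ 2 \<Rightarrow> 'k, 'k sl2) gmodule"
  where "nilcone_coord m =
    fun_gmod (triv_gmod :: ('k, 'k, 'k sl2) gmodule) nilcone
      {(\<lambda>Z\<in>nilcone. \<Sum>j<r. c j * (\<Prod>i<m. l j i Z)) | (r :: nat) c l.
        \<forall>j<r. \<forall>i<m. l j i \<in> carrier (dual_gmod (adjoint_gmod lie_sl2))}
      (\<lambda>g f. \<lambda>Z\<in>nilcone. f (sl2_mat (inverse g) ** Z ** sl2_mat g))"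

text \<open>
  The torus consists of the diagonal matrices and \<open>\<omega> (diag (t, t\<inverse>)) = t\<close>, so the Borel subgroup
  for the negative root consists of the lower triangular matrices. Modules for it are records
  over the type \<^typ>\<open>'k sl2\<close> whose action is only relevant on \<open>borel_sl2\<close>.
\<close>

definition borel_sl2 :: "'k::field sl2 set"
  where "borel_sl2 = {b. sl2_mat b $ 1 $ 2 = 0}"

definition lie_u :: "('k::field ^ 2 ^ 2) set"
  where "lie_u = {Z. Z $ 1 $ 1 = 0 \<and> Z $ 1 $ 2 = 0 \<and> Z $ 2 $ 2 = 0}"

definition u_dual :: "('k::field, 'k ^ 2 ^ 2 \<Rightarrow> 'k, 'k sl2) gmodule"
  where "u_dual = dual_gmod (adjoint_gmod lie_u)"

definition omega :: "('k::field, 'k, 'k sl2) gmodule"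
  where "omega = gmod UNIV (+) 0 (*) (\<lambda>b x. sl2_mat b $ 1 $ 1 * x)"

definition ind_B_G ::
    "('k::field, 'v, 'k sl2) gmodule \<Rightarrow> ('k, 'k sl2 \<Rightarrow> 'v, 'k sl2) gmodule"
  where "ind_B_G M =
    fun_gmod M UNIV
      {f. (\<exists>(r :: nat) \<phi> v. (\<forall>i<r. \<phi> i \<in> regular_funs \<and> v i \<in> carrier M) \<and>
            f = (\<lambda>g. \<Oplus>\<^bsub>M\<^esub>i\<in>{..<r}. \<phi> i g \<odot>\<^bsub>M\<^esub> v i)) \<and>
          (\<forall>g. \<forall>b\<in>borel_sl2. f (g * b) = act M (inverse b) (f g))}
      (\<lambda>g f x. f (inverse g * x))"

end

theory Submission
  imports Defs "HOL-Library.Function_Algebras"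
begin

text \<open>
 For \<open>0 < s < p\<close> the functions \<open>F(u, v)\<close>, bihomogeneous of degrees \<open>p - 1\<close> and \<open>s\<close>, whose polarisation
 \<open>\<Theta> F\<close> is divisible by \<open>\<Delta>^s\<close> with \<open>\<Delta> = det(u, v)\<close>, form an indecomposable projective
 \<open>T\<^sub>s\<close>; \<open>T\<^sub>0\<close> is the Steinberg module. The maps \<open>\<alpha>, \<beta> : T\<^sub>s \<rightarrow> T\<^bsub>p-s\<^esub>\<close> generate an exterior algebra
 acting on \<open>T = \<Oplus> T\<^sub>s\<close>, and \<open>Dist(G\<^sub>1)\<close> is its commutant \<open>KK\<close> (also commuting with the projections).
 With \<open>D = x \<alpha> + y \<beta>\<close>, the complex of \<open>End T\<close>-valued forms \<open>f\<close> of degree \<open>n\<close> in \<open>(x, y)\<close> with differential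
 \<open>D f - (-1)^n f D\<close> is a Koszul resolution of \<open>KK\<close> by Hochschild-acyclic bimodules, so \<open>HH\<close> is the cohomology of
 its invariants. These are spanned over the forms in \<open>(x, y)\<close> by the exterior algebra on each \<open>T\<^sub>s\<close>, and
 the differential on them identifies or cancels the contributions of \<open>s\<close> and \<open>p - s\<close>.
\<close>

text \<open>The commutant statement is a dimension count: PBW monomials give \<open>p ^ 3\<close>
  independent operators, and a basis of T over the exterior algebra bounds the commutant by the same
  number. In bidegree (p - 1, s) the layer \<open>Delta ^ j\<close> has
  \<open>theta\<close>-eigenvalue (p - j)(s - j), zero mod p only for j = 0 and j = s; so for 0 < s
  < p the divisibility condition leaves two layers, of dimensions p + s and p - s. The operators
  arise by writing a form of degree 2p - 1 as X^p A + Y^p B: p-th powers are constants for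
  \<open>G_1\<close>, while \<open>G\<close> moves the pair (A, B) through Frobenius. Hence (x, y)
  spans a twisted L(1), and untwisting yields ordinary binary forms. The comparison of complexes is
  made by explicit zigzags, so that scalars and the group can be followed through it. With q = (p -
  1)/2 pairs {s, p - s}, degree 0 has q + 1 scalars and 2q coefficients of \<open>eps\<close>,
  positive even degrees q scalars and q pair sums, odd degrees q vector-valued pair sums. The
  targets are forms as well: the nilpotent cone is a quadratic image of the plane, and a section
  induced from B is a function of the second column of a matrix.\<close>

abbreviation gadd ("_ +[_] _" [65, 0, 66] 65) where "x +[M] y \<equiv> x \<oplus>\<^bsub>M\<^esub> y"
abbreviation gscale ("_ *[_] _" [70, 0, 71] 70) where "c *[M] x \<equiv> c \<odot>\<^bsub>M\<^esub> x"

section \<open>Polynomial functions of two plane vectors\<close>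

text \<open>Functions of two vectors form a commutative ring, and most computations take place in
  that ring; evaluation at a point is switched on only through \<open>fun_app\<close>.\<close>

declare plus_fun_apply [simp del] times_fun_apply [simp del] zero_fun_apply [simp del] one_fun_apply [simp del]
 numeral_fun_apply [simp del] of_nat_fun_apply [simp del]

text \<open>Over a finite field the product of all X - a, increased by 1, would have no root.
  Infinitude is what lets polynomial functions stand for polynomials below.\<close>

lemma infinite_UNIV_alg_closed: "infinite (UNIV :: 'k::alg_closed_field set)"
proof
 assume fin: "finite (UNIV :: 'k set)"
 define q :: "'k poly" where "q = (\<Prod>a\<in>UNIV. [:-a, 1:]) + 1"
 have q: "poly q x = 1" for x
 proof -
  have "(\<Prod>a\<in>UNIV. poly [:-a, 1:] x) = 0"
   using fin by (subst prod_zero_iff) auto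
  thus ?thesis by (simp add: q_def poly_prod)
 qed
 have "degree (\<Prod>a\<in>(UNIV::'k set). [:-a, 1:]) = card (UNIV::'k set)"
  by (subst degree_prod_eq_sum_degree) auto
 moreover have "card (UNIV::'k set) > 0" using fin by (simp add: card_gt_0_iff)
 ultimately have "degree q > 0"
  unfolding q_def by (subst degree_add_eq_left) auto
 then obtain x where "poly q x = 0" using alg_closed_imp_poly_has_root by blast
 with q show False by simp
qed

text \<open>Well defined on polynomial functions because the field is infinite. The coefficient at 1
  serves as an algebraic derivative at 0, in every characteristic.\<close>

definition tcoeff :: "('k::alg_closed_field => 'k) => nat => 'k"
 where "tcoeff f n = coeff (THE q. \<forall>t. poly q t = f t) n"

lemma poly_fun_eq_iff: "(\<forall>t. poly p t = poly q t) \<longleftrightarrow> p = (q :: 'k::alg_closed_field poly)"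
proof
 assume "\<forall>t. poly p t = poly q t"
 hence "{t. poly (p - q) t = 0} = UNIV" by auto
 thus "p = q" using poly_roots_finite[of "p - q"] infinite_UNIV_alg_closed by force
qed simp

lemma tcoeff_eqI: "(\<And>t. f t = poly q t) ==> tcoeff f n = coeff q n"
 unfolding tcoeff_def by (rule arg_cong[where f = "%q. coeff q n"], rule the_equality)
  (auto simp flip: poly_fun_eq_iff)

definition polyfun :: "('k::alg_closed_field => 'k) => bool"
 where "polyfun f \<longleftrightarrow> (\<exists>q. \<forall>t. f t = poly q t)"

lemma polyfunE: assumes "polyfun f" obtains q where "f = poly q"
 using assms by (auto simp: polyfun_def)

lemma polyfun_const [simp, intro]: "polyfun (%t. c)"
 unfolding polyfun_def by (rule exI[of _ "[:c:]"]) simp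

lemma polyfun_id [simp, intro]: "polyfun (%t. t)"
 unfolding polyfun_def by (rule exI[of _ "[:0,1:]"]) simp

lemma polyfun_add [simp, intro]: "polyfun f ==> polyfun g ==> polyfun (%t. f t + g t)"
 unfolding polyfun_def by (metis poly_add)

lemma polyfun_diff [simp, intro]: "polyfun f ==> polyfun g ==> polyfun (%t. f t - g t)"
 unfolding polyfun_def by (metis poly_diff)

lemma polyfun_mult [simp, intro]: "polyfun f ==> polyfun g ==> polyfun (%t. f t * g t)"
 unfolding polyfun_def by (metis poly_mult)

lemma polyfun_power [simp, intro]: "polyfun f ==> polyfun (%t. f t ^ n)"
 by (induction n) auto

lemma polyfun_sum [simp, intro]: "(\<And>i. i : I ==> polyfun (f i)) ==> polyfun (%t. \<Sum>i\<in>I. f i t)"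
 by (induction I rule: infinite_finite_induct) auto

lemma tcoeff_add: "polyfun f ==> polyfun g ==> tcoeff (%t. f t + g t) n = tcoeff f n + tcoeff g n"
 by (elim polyfunE) (simp add: tcoeff_eqI[where q = "_ + _"] tcoeff_eqI[where q = q and f = "poly q" for q])

lemma tcoeff_cmult: "polyfun f ==> tcoeff (%t. c * f t) n = c * tcoeff f n"
proof -
 assume "polyfun f"
 then obtain q where q: "f = poly q" by (rule polyfunE)
 have "tcoeff (%t. c * f t) n = coeff (smult c q) n" by (rule tcoeff_eqI) (simp add: q)
 moreover have "tcoeff f n = coeff q n" by (rule tcoeff_eqI) (simp add: q)
 ultimately show ?thesis by simp
qed

lemma tcoeff_const: "tcoeff (%t. c) n = (if n = 0 then c else 0)"
 by (subst tcoeff_eqI[where q = "[:c:]"]) (auto simp: coeff_pCons split: nat.split)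

lemma tcoeff_1_mult:
 "polyfun f ==> polyfun g ==> tcoeff (%t. f t * g t) 1 = f 0 * tcoeff g 1 + tcoeff f 1 * g 0"
 by (elim polyfunE) (simp add: tcoeff_eqI[where q = "_ * _"]
  tcoeff_eqI[where q = q and f = "poly q" for q] coeff_mult poly_0_coeff_0)

lemma tcoeff_1_power:
 assumes "polyfun f" shows "tcoeff (%t. f t ^ n) 1 = of_nat n * f 0 ^ (n - 1) * tcoeff f 1"
proof (induction n)
 case (Suc n)
 show ?case using tcoeff_1_mult[OF assms polyfun_power[OF assms, of n]] Suc
  by (cases n) (simp_all add: algebra_simps)
qed (simp add: tcoeff_const)

lemma tcoeff_sum_powers: "tcoeff (%t. \<Sum>i\<le>m. a i * t ^ i) n = (if n <= m then a n else 0)"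
proof -
 have "tcoeff (%t. \<Sum>i\<le>m. a i * t ^ i) n = coeff (\<Sum>i\<le>m. monom (a i) i) n"
  by (rule tcoeff_eqI) (simp add: poly_sum poly_monom)
 thus ?thesis by (simp add: coeff_sum)
qed

lemma tcoeff_linear: "tcoeff (%t. a + t * b) 1 = b"
 by (subst tcoeff_eqI[where q = "[:a, b:]"]) (auto simp: coeff_pCons)

subsection \<open>Bihomogeneous functions\<close>

type_synonym 'k dist = "('k sl2 => 'k) => 'k"
type_synonym 'k fun2 = "'k ^ 2 => 'k ^ 2 => 'k"

definition vec2 :: "'k => 'k => 'k ^ 2" where "vec2 a b = (\<chi> i. if i = 1 then a else b)"

lemma vec2_nth [simp]: "vec2 a b $ 1 = a" "vec2 a b $ 2 = b"
 by (simp_all add: vec2_def)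

lemma vec2_eqI: "x $ 1 = a ==> x $ 2 = b ==> x = vec2 a b"
 by (simp add: vec_eq_iff forall_2)

definition Xu :: "'k fun2" where "Xu = (%u v. u $ 1)"
definition Yu :: "'k fun2" where "Yu = (%u v. u $ 2)"
definition Xv :: "'k fun2" where "Xv = (%u v. v $ 1)"
definition Yv :: "'k fun2" where "Yv = (%u v. v $ 2)"
text \<open>Scalars are embedded as constant functions, so that scalar multiples become ring
  products.\<close>

definition Cst :: "'k => 'k fun2" where "Cst c = (%u v. c)"
definition Delta :: "'k::comm_ring_1 fun2" where "Delta = Xu * Yv - Yu * Xv"

lemmas fun2_apply = Xu_def Yu_def Xv_def Yv_def Cst_def

lemma power_fun_apply: "(f ^ n) x = f x ^ n" for f :: "'a => 'b::monoid_mult"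
 by (induction n) (auto simp: times_fun_apply one_fun_apply)

lemma sum_fun_apply: "(\<Sum>i\<in>I. f i) x = (\<Sum>i\<in>I. f i x)" for f :: "'i => 'a => 'b::comm_monoid_add"
 by (induction I rule: infinite_finite_induct) (auto simp: plus_fun_apply zero_fun_apply)

lemma minus_fun_app: "(f - g) x = f x - g x" "(- f) x = - f x"
 for f :: "'a => 'b::group_add"
 by (simp_all add: fun_diff_def fun_Compl_def)

lemmas fun_app = plus_fun_apply times_fun_apply zero_fun_apply one_fun_apply numeral_fun_apply
 of_nat_fun_apply power_fun_apply sum_fun_apply minus_fun_app

lemma Cst_simps [simp]: "Cst 0 = 0" "Cst 1 = 1"
 by (auto simp: Cst_def fun_app fun_eq_iff)

lemma Cst_ring: "Cst (a + b) = Cst a + Cst b" "Cst (a * b) = Cst a * Cst b" "Cst (- c) = - Cst c"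
 "Cst (a - b) = Cst a - Cst b" "Cst (d ^ n) = Cst d ^ n" "Cst (\<Sum>i\<in>I. h i) = (\<Sum>i\<in>I. Cst (h i))"
 "Cst (of_nat n) = of_nat n"
 for a b c d :: "'k::comm_ring_1"
 by (auto simp: Cst_def fun_app fun_eq_iff)

definition mon :: "nat => nat => nat => nat => 'k::comm_ring_1 fun2"
 where "mon m s i j = Xu ^ i * Yu ^ (m - i) * Xv ^ j * Yv ^ (s - j)"

definition Bh :: "nat => nat => (nat => nat => 'k) => 'k::comm_ring_1 fun2"
 where "Bh m s c = (\<Sum>i\<le>m. \<Sum>j\<le>s. Cst (c i j) * mon m s i j)"

definition bh :: "nat => nat => 'k::comm_ring_1 fun2 set"
 where "bh m s = range (Bh m s)"

text \<open>The coefficient of \<open>x^i z^j\<close> after setting \<open>y = w = 1\<close>.\<close>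

definition bc :: "'k::alg_closed_field fun2 => nat => nat => 'k"
 where "bc F i j = tcoeff (%z. tcoeff (%x. F (vec2 x 1) (vec2 z 1)) i) j"

lemma bc_Bh: "bc (Bh m s c) i j = (if i <= m & j <= s then c i j else 0)"
proof -
 have *: "Bh m s c (vec2 x 1) (vec2 z 1) = (\<Sum>i\<le>m. (\<Sum>j\<le>s. c i j * z ^ j) * x ^ i)" for x z
  by (simp add: Bh_def mon_def fun2_apply fun_app sum_distrib_left sum_distrib_right mult_ac)
 show ?thesis
  by (cases "i <= m") (simp_all add: bc_def * tcoeff_sum_powers tcoeff_const)
qed

lemma bh_bc: "F : bh m s ==> Bh m s (bc F) = F"
proof -
 assume "F : bh m s"
 then obtain c where c: "F = Bh m s c" by (auto simp: bh_def)
 have "Bh m s (bc F) = Bh m s c"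
  by (subst (1 2) Bh_def) (auto simp: bc_Bh c intro!: sum.cong)
 with c show ?thesis by simp
qed

lemma bc_outside: "F : bh m s ==> ~ (i <= m & j <= s) ==> bc F i j = 0"
 by (auto simp: bh_def bc_Bh)

lemma bh_eqI:
 assumes "F : bh m s" "G : bh m s" "\<And>i j. i <= m ==> j <= s ==> bc F i j = bc G i j"
 shows "F = G"
proof -
 have "Bh m s (bc F) = Bh m s (bc G)"
  using assms(3) by (auto simp: Bh_def intro!: sum.cong)
 thus ?thesis by (simp add: bh_bc assms)
qed

lemma Bh_in_bh [simp, intro]: "Bh m s c : bh m s" by (simp add: bh_def)

lemma Bh_add: "Bh m s (%i j. c i j + d i j) = Bh m s c + Bh m s d"
 by (simp add: Bh_def Cst_ring distrib_right sum.distrib)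

lemma Bh_cmult: "Bh m s (%i j. a * c i j) = Cst a * Bh m s c"
 by (simp add: Bh_def Cst_ring sum_distrib_left mult.assoc)

lemma bh_0 [simp, intro]: "0 : bh m s"
 using Bh_cmult[of m s 0 "%_ _. 0"] Bh_in_bh[of m s "%_ _. 0"] by (metis Cst_simps(1) mult_zero_left)

lemma bh_add [intro]: "F : bh m s ==> G : bh m s ==> F + G : bh m s"
 by (auto simp: bh_def simp flip: Bh_add)

lemma bh_cmult [intro]: "F : bh m s ==> Cst a * F : bh m s"
 by (auto simp: bh_def simp flip: Bh_cmult)

lemma bh_uminus [intro]: "F : bh m s ==> - F : bh m s"
 using bh_cmult[of F m s "-1"] by (simp add: Cst_ring)

lemma bh_diff [intro]: "F : bh m s ==> G : bh m s ==> F - G : bh m s"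
 using bh_add[of F m s "- G"] bh_uminus by auto

lemma bh_sum [intro]: "(\<And>i. i : I ==> F i : bh m s) ==> (\<Sum>i\<in>I. F i) : bh m s"
 by (induction I rule: infinite_finite_induct) auto

lemma mon_eq_Bh:
 assumes "i <= m" "j <= s"
 shows "mon m s i j = Bh m s (%i' j'. if i' = i & j' = j then 1 else 0)"
proof -
 have "Bh m s (%i' j'. if i' = i & j' = j then 1 else 0)
   = (\<Sum>i'\<le>m. \<Sum>j'\<le>s. if j' = j then (if i' = i then mon m s i j else 0) else (0::'a fun2))"
  unfolding Bh_def by (intro sum.cong refl) auto
 thus ?thesis using assms by (simp add: sum.delta)
qed

lemma mon_in_bh [simp, intro]: "i <= m ==> j <= s ==> mon m s i j : bh m s"
 by (simp add: mon_eq_Bh)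

lemma bc_mon: "i <= m ==> j <= s ==> bc (mon m s i j) i' j' = (if i' = i & j' = j then 1 else 0)"
 by (auto simp: mon_eq_Bh bc_Bh)

lemma bh_induct [consumes 1, case_names zero add cmult mon]:
 assumes "F : bh m s" "P 0" "\<And>F G. F : bh m s ==> G : bh m s ==> P F ==> P G ==> P (F + G)"
  "\<And>c F. F : bh m s ==> P F ==> P (Cst c * F)" "\<And>i j. i <= m ==> j <= s ==> P (mon m s i j)"
 shows "P F"
proof -
 have sum: "finite I ==> (\<And>i. i : I ==> P (f i) & f i : bh m s) ==> P (sum f I) & sum f I : bh m s"
  for I :: "nat set" and f
  by (induction I rule: finite_induct) (auto simp: assms)
 obtain c where "F = Bh m s c" using assms(1) by (auto simp: bh_def)
 moreover have "P (Bh m s c) & Bh m s c : bh m s"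
  unfolding Bh_def by (intro sum) (auto simp: assms)
 ultimately show ?thesis by simp
qed

lemma bh_mult_mon:
 assumes "i <= m" "j <= s" "G : bh m' s'" shows "mon m s i j * G : bh (m + m') (s + s')"
 using assms(3)
proof (induction rule: bh_induct)
 case (mon i' j')
 have "m + m' - (i + i') = (m - i) + (m' - i')" "s + s' - (j + j') = (s - j) + (s' - j')"
  using mon assms by auto
 hence "mon m s i j * mon m' s' i' j' = mon (m + m') (s + s') (i + i') (j + j')"
  by (simp only: mon_def power_add mult_ac)
 thus ?case using mon assms by (metis mon_in_bh add_mono)
next
 case zero show ?case by (metis mult_zero_right bh_0)
next
 case (add F G) thus ?case by (metis distrib_left bh_add)
next
 case (cmult c F) thus ?case by (metis mult.left_commute bh_cmult)
qed

lemma bh_mult: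
 assumes "F : bh m s" "G : bh m' s'" shows "F * G : bh (m + m') (s + s')"
 using assms(1)
proof (induction rule: bh_induct)
 case (mon i j) thus ?case using bh_mult_mon assms by blast
next
 case zero show ?case by (metis mult_zero_left bh_0)
next
 case (add F G) thus ?case by (metis distrib_right bh_add)
next
 case (cmult c F) thus ?case by (metis mult.assoc bh_cmult)
qed

lemma Xu_in_bh: "Xu : bh 1 0"
proof -
 have "mon 1 0 1 0 = (Xu :: 'a fun2)" by (simp add: mon_def)
 thus ?thesis by (metis mon_in_bh le_refl zero_le)
qed

lemma Yu_in_bh: "Yu : bh 1 0"
proof -
 have "mon 1 0 0 0 = (Yu :: 'a fun2)" by (simp add: mon_def)
 thus ?thesis by (metis mon_in_bh le_refl zero_le)
qed

lemma Xv_in_bh: "Xv : bh 0 1"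
proof -
 have "mon 0 1 0 1 = (Xv :: 'a fun2)" by (simp add: mon_def)
 thus ?thesis by (metis mon_in_bh le_refl zero_le)
qed

lemma Yv_in_bh: "Yv : bh 0 1"
proof -
 have "mon 0 1 0 0 = (Yv :: 'a fun2)" by (simp add: mon_def)
 thus ?thesis by (metis mon_in_bh le_refl zero_le)
qed

lemma Cst_in_bh: "Cst c : bh 0 0"
proof -
 have "mon 0 0 0 0 = (1 :: 'a fun2)" by (simp add: mon_def)
 thus ?thesis by (metis mon_in_bh le_refl bh_cmult mult_1_right)
qed

lemma bh_power: "F : bh m s ==> F ^ n : bh (n * m) (n * s)"
proof (induction n)
 case 0 show ?case using Cst_in_bh[of 1] by (metis Cst_simps(2) mult_0 power_0)
next
 case (Suc n) thus ?case using bh_mult[OF Suc.prems Suc.IH] by (metis mult_Suc power_Suc)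
qed

lemma XY_power_in_bh: "Xu ^ n : bh n 0" "Yu ^ n : bh n 0"
 using bh_power[OF Xu_in_bh, of n] bh_power[OF Yu_in_bh, of n] by auto

lemma Delta_in_bh: "Delta : bh 1 1"
 unfolding Delta_def using bh_mult[OF Xu_in_bh Yv_in_bh] bh_mult[OF Yu_in_bh Xv_in_bh] by auto

lemma Delta_power_in_bh: "Delta ^ n : bh n n"
 using bh_power[OF Delta_in_bh, of n] by simp

lemma polyfun_bh_line:
 assumes "F : bh m s" shows "polyfun (%t. F (u + t *s a) (v + t *s b))"
 using assms by (induction rule: bh_induct) (auto simp: mon_def fun2_apply fun_app)

lemma bh_homogeneous_right: "F : bh m s ==> F u (c *s v) = c ^ s * F u v"
proof (induction rule: bh_induct)
 case (mon i j)
 hence "c ^ s = c ^ j * c ^ (s - j)" by (simp flip: power_add)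
 thus ?case by (simp add: mon_def fun2_apply fun_app power_mult_distrib mult_ac)
qed (simp_all add: Cst_def fun_app algebra_simps)

lemma bh_0_right_const: "F : bh m 0 ==> F u v = F u v'"
 by (induction rule: bh_induct) (auto simp: mon_def fun2_apply fun_app)

lemma polyfun_bc:
 assumes "F : bh m s"
 shows "polyfun (%x. F (vec2 x 1) (vec2 z 1))"
  "polyfun (%z. tcoeff (%x. F (vec2 x 1) (vec2 z 1)) i)"
proof -
 obtain c where F: "F = Bh m s c" using assms by (auto simp: bh_def)
 have *: "F (vec2 x 1) (vec2 z 1) = (\<Sum>i\<le>m. (\<Sum>j\<le>s. c i j * z ^ j) * x ^ i)" for x z
  by (simp add: F Bh_def mon_def fun2_apply fun_app sum_distrib_left sum_distrib_right mult_ac)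
 show "polyfun (%x. F (vec2 x 1) (vec2 z 1))" unfolding * by auto
 have "polyfun (%z. if i <= m then \<Sum>j\<le>s. c i j * z ^ j else 0)" by (cases "i <= m") auto
 thus "polyfun (%z. tcoeff (%x. F (vec2 x 1) (vec2 z 1)) i)"
  unfolding * tcoeff_sum_powers .
qed

lemma bc_add: "F : bh m s ==> G : bh m' s' ==> bc (F + G) i j = bc F i j + bc G i j"
 by (simp add: bc_def fun_app tcoeff_add polyfun_bc)

lemma bc_cmult: "F : bh m s ==> bc (Cst a * F) i j = a * bc F i j"
 by (simp add: bc_def Cst_def fun_app tcoeff_cmult polyfun_bc)

lemma bc_0 [simp]: "bc 0 i j = 0"
 by (simp add: bc_def fun_app tcoeff_const)

lemma bc_uminus: "F : bh m s ==> bc (- F) i j = - bc F i j"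
 using bc_cmult[of F m s "-1"] by (simp add: Cst_ring)

lemma bc_sum: "(\<And>a. a : I ==> F a : bh m s) ==> bc (\<Sum>a\<in>I. F a) i j = (\<Sum>a\<in>I. bc (F a) i j)"
proof (induction I rule: infinite_finite_induct)
 case (insert x I)
 hence "F x : bh m s" "(\<Sum>a\<in>I. F a) : bh m s" by auto
 from bc_add[OF this, of i j] insert show ?case by simp
qed simp_all

subsection \<open>Restriction to the diagonal\<close>

text \<open>Multiplication from bidegree (m, s) to binary forms of degree m + s; for positive m and
  s its kernel is \<open>Delta\<close> times bidegree (m - 1, s - 1).\<close>

definition dg :: "'k fun2 => 'k fun2" where "dg F = (%u v. F u u)"

lemma dg_simps [simp]: "dg (F + G) = dg F + dg G" "dg (F * G) = dg F * dg G" "dg (F - G) = dg F - dg G"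
 "dg (- F) = - dg F" "dg (F ^ n) = dg F ^ n" "dg (Cst c) = Cst c" "dg 0 = 0" "dg 1 = 1"
 "dg Xu = Xu" "dg Yu = Yu" "dg Xv = Xu" "dg Yv = Yu" "dg Delta = 0" "dg (dg F) = dg F"
 for F :: "'k::comm_ring_1 fun2"
 by (simp_all add: dg_def fun_eq_iff fun2_apply fun_app Delta_def)

lemma dg_sum: "dg (\<Sum>a\<in>I. F a) = (\<Sum>a\<in>I. dg (F a))"
 by (auto simp: dg_def fun_app fun_eq_iff)

lemma dg_mon: "i <= m ==> j <= s ==> dg (mon m s i j) = mon (m + s) 0 (i + j) 0"
proof -
 assume "i <= m" "j <= s"
 hence "m + s - (i + j) = (m - i) + (s - j)" by simp
 thus ?thesis by (simp only: mon_def dg_simps) (simp add: power_add mult_ac)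
qed

lemma dg_in_bh: "F : bh m s ==> dg F : bh (m + s) 0"
proof (induction rule: bh_induct)
 case (mon i j) thus ?case by (simp only: dg_mon) (rule mon_in_bh; simp)
next
 case zero show ?case by (metis dg_simps(7) bh_0)
next
 case (add F G) thus ?case by (metis dg_simps(1) bh_add)
next
 case (cmult c F) thus ?case by (metis dg_simps(2,6) bh_cmult)
qed

lemma dg_bh_0: "F : bh m 0 ==> dg F = F"
 using bh_0_right_const by (force simp: dg_def fun_eq_iff)

text \<open>One representative for each exponent e, with as many X as possible in the v-part: the
  standard monomials of straightening modulo \<open>Delta\<close>.\<close>

definition stdmon :: "nat => nat => nat => 'k::comm_ring_1 fun2"
 where "stdmon m s e = (if e <= s then mon m s 0 e else mon m s (e - s) s)"

definition stdlift :: "nat => nat => 'k::alg_closed_field fun2 => 'k fun2"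
 where "stdlift m s H = (\<Sum>e\<le>m + s. Cst (bc H e 0) * stdmon m s e)"

lemma stdmon_in_bh: "e <= m + s ==> stdmon m s e : bh m s"
 by (auto simp: stdmon_def)

lemma stdlift_in_bh: "stdlift m s H : bh m s"
 unfolding stdlift_def by (intro bh_sum bh_cmult stdmon_in_bh) auto

lemma dg_stdmon: "e <= m + s ==> dg (stdmon m s e) = mon (m + s) 0 e 0"
 by (auto simp: stdmon_def dg_mon)

lemma dg_stdlift:
 assumes "H : bh (m + s) 0" shows "dg (stdlift m s H) = H"
proof -
 have "dg (stdlift m s H) = Bh (m + s) 0 (bc H)"
  by (simp add: stdlift_def Bh_def dg_sum dg_stdmon)
 thus ?thesis using bh_bc[OF assms] by simp
qed

text \<open>The relation \<open>Xu * Yv = Delta + Yu * Xv\<close> moves one X from the u-part to the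
  v-part at the price of a multiple of \<open>Delta\<close>; the induction is on the number i of X
  left in the u-part.\<close>

lemma mon_straighten:
 assumes "i <= m" "j <= s"
 shows "\<exists>G\<in>bh (m - 1) (s - 1). (mon m s i j :: 'k::comm_ring_1 fun2) = Delta * G + stdmon m s (i + j)"
 using assms
proof (induction i arbitrary: j)
 case 0
 thus ?case by (auto simp: stdmon_def intro!: bexI[of _ 0])
next
 case (Suc i)
 show ?case
 proof (cases "j = s")
  case True
  thus ?thesis by (auto simp: stdmon_def intro!: bexI[of _ 0])
 next
  case False
  have "i <= m" "Suc j <= s" using Suc.prems False by auto
  then obtain G where G: "G : bh (m - 1) (s - 1)" "mon m s i (Suc j) = (Delta :: 'k fun2) * G + stdmon m s (i + Suc j)"
   using Suc.IH[of "Suc j"] by blast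
  obtain d where d: "m = Suc i + d" using Suc.prems le_Suc_ex by blast
  obtain e where e: "s = Suc j + e" using Suc.prems False less_iff_Suc_add[of j s] by auto
  have "mon m s (Suc i) j = (Delta :: 'k fun2) * mon (m - 1) (s - 1) i j + mon m s i (Suc j)"
   by (simp add: mon_def d e Delta_def algebra_simps)
  moreover have "(mon (m - 1) (s - 1) i j :: 'k fun2) : bh (m - 1) (s - 1)" using d e by auto
  ultimately show ?thesis using G
   by (intro bexI[of _ "G + mon (m - 1) (s - 1) i j"]) (auto simp: algebra_simps)
 qed
qed

text \<open>\<open>stdlift\<close> splits \<open>dg\<close>, so F minus the lift of its restriction
  is divisible by \<open>Delta\<close>. Iterating this gives the Clebsch-Gordan layers
  \<open>Delta ^ j\<close>.\<close>

lemma bh_straighten: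
 fixes F :: "'k::alg_closed_field fun2"
 assumes "F : bh m s"
 shows "\<exists>G\<in>bh (m - 1) (s - 1). F = Delta * G + stdlift m s (dg F)"
 using assms
proof (induction rule: bh_induct)
 case (mon i j)
 have "stdlift m s (dg (mon m s i j :: 'k fun2)) = (\<Sum>e\<le>m + s. if e = i + j then stdmon m s e else (0::'k fun2))"
  unfolding stdlift_def using mon by (intro sum.cong) (auto simp: dg_mon bc_mon)
 also have "... = stdmon m s (i + j)" using mon by (subst sum.delta) auto
 finally show ?case using mon_straighten[OF mon] by simp
next
 case (add F G)
 have "stdlift m s (dg (F + G)) = stdlift m s (dg F) + stdlift m s (dg G)"
  using add dg_in_bh[of F m s] dg_in_bh[of G m s]
  by (simp add: stdlift_def bc_add Cst_ring distrib_right sum.distrib)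
 moreover obtain A where A: "A\<in>bh (m - 1) (s - 1)" "F = Delta * A + stdlift m s (dg F)" using add by blast
 moreover obtain B where B: "B\<in>bh (m - 1) (s - 1)" "G = Delta * B + stdlift m s (dg G)" using add by blast
 moreover have "f = d * a + x ==> g = d * b + y ==> f + g = d * (a + b) + (x + y)" for f g d a b x y :: "'k fun2"
  by (simp add: algebra_simps)
 ultimately have "F + G = Delta * (A + B) + stdlift m s (dg (F + G))" by metis
 thus ?case using A B by (meson bh_add)
next
 case (cmult c F)
 have "stdlift m s (dg (Cst c * F)) = Cst c * stdlift m s (dg F)"
  using cmult dg_in_bh[of F m s]
  by (simp add: stdlift_def bc_cmult Cst_ring sum_distrib_left mult.assoc)
 moreover obtain A where A: "A\<in>bh (m - 1) (s - 1)" "F = Delta * A + stdlift m s (dg F)" using cmult by blast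
 moreover have "f = d * a + x ==> e * f = d * (e * a) + e * x" for f d e a x :: "'k fun2"
  by (simp add: algebra_simps)
 ultimately have "Cst c * F = Delta * (Cst c * A) + stdlift m s (dg (Cst c * F))"
  by metis
 thus ?case using A by (meson bh_cmult)
qed (auto simp: stdlift_def intro!: bexI[of _ 0])

lemma dg_eq_0_imp:
 fixes F :: "'k::alg_closed_field fun2"
 assumes "F : bh m s" "dg F = 0"
 obtains G where "G : bh (m - 1) (s - 1)" "F = Delta * G"
 using bh_straighten[OF assms(1)] assms(2) by (auto simp: stdlift_def)

subsection \<open>Polarisation operators\<close>

text \<open>The polarisation operator u d/dv, the derivative being the linear coefficient in t;
  \<open>e21\<close> is v d/du. Their product \<open>theta\<close> plays the part of a Casimir
  operator: it commutes with substitutions and with \<open>Delta\<close>.\<close>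

definition e12 :: "'k::alg_closed_field fun2 => 'k fun2"
 where "e12 F = (%u v. tcoeff (%t. F u (v + t *s u)) 1)"

definition swp :: "'k fun2 => 'k fun2" where "swp F = (%u v. F v u)"

definition e21 :: "'k::alg_closed_field fun2 => 'k fun2"
 where "e21 F = swp (e12 (swp F))"

definition theta :: "'k::alg_closed_field fun2 => 'k fun2"
 where "theta F = e21 (e12 F)"

lemma swp_simps [simp]: "swp (swp F) = F" "swp (F + G) = swp F + swp G" "swp (F * G) = swp F * swp G"
 "swp (Cst c) = Cst c" "swp 0 = 0" "swp (mon m s i j) = mon s m j i"
 for F G :: "'k::comm_ring_1 fun2"
 by (simp_all add: swp_def fun_eq_iff fun_app fun2_apply mon_def mult_ac)

lemma swp_in_bh: "F : bh m s ==> swp F : bh s m"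
proof (induction rule: bh_induct)
 case zero show ?case by (metis bh_0 swp_simps(5))
next
 case (add F G) thus ?case by (metis bh_add swp_simps(2))
next
 case (cmult c F) thus ?case by (metis bh_cmult swp_simps(3,4))
next
 case (mon i j) thus ?case by (metis mon_in_bh swp_simps(6))
qed

lemma polyfun_line: "F : bh m s ==> polyfun (%t. F u (v + t *s w))"
 using polyfun_bh_line[of F m s u 0 v w] by simp

lemma e12_add: "F : bh m s ==> G : bh m' s' ==> e12 (F + G) = e12 F + e12 G"
 by (simp add: e12_def fun_eq_iff fun_app tcoeff_add polyfun_line)

lemma e12_mult: "F : bh m s ==> G : bh m' s' ==> e12 (F * G) = F * e12 G + e12 F * G"
 unfolding e12_def fun_eq_iff fun_app
 by (subst tcoeff_1_mult) (auto intro: polyfun_line)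

lemma e12_mult_invariant:
 "(\<And>u v t. G u (v + t *s u) = G u v) ==> F : bh m s ==> e12 (G * F) = G * e12 F"
 unfolding e12_def fun_eq_iff fun_app by (auto simp: tcoeff_cmult polyfun_line)

lemma e12_cmult: "F : bh m s ==> e12 (Cst c * F) = Cst c * e12 F"
 by (rule e12_mult_invariant) (simp_all add: fun2_apply)

lemma e12_0 [simp]: "e12 0 = 0"
 by (simp add: e12_def fun_eq_iff fun_app tcoeff_const)

lemma e12_mon:
 assumes "i <= m" "j <= s"
 shows "e12 (mon m s i j) = Cst (of_nat j) * mon (Suc m) (s - 1) (Suc i) (j - 1)
  + Cst (of_nat (s - j)) * mon (Suc m) (s - 1) i j"
proof (intro ext)
 fix u v :: "'a ^ 2"
 have "e12 (mon m s i j) u v = tcoeff (%t. (u $ 1 ^ i * u $ 2 ^ (m - i)) *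
   ((v $ 1 + t * u $ 1) ^ j * (v $ 2 + t * u $ 2) ^ (s - j))) 1"
  by (simp add: e12_def mon_def fun_app fun2_apply mult_ac)
 also have "... = (u $ 1 ^ i * u $ 2 ^ (m - i)) * (v $ 1 ^ j * (of_nat (s - j) * v $ 2 ^ (s - j - 1) * u $ 2)
   + of_nat j * v $ 1 ^ (j - 1) * u $ 1 * v $ 2 ^ (s - j))"
  by (subst tcoeff_cmult, simp, subst tcoeff_1_mult) (simp_all only: polyfun_power polyfun_add polyfun_const
   polyfun_id polyfun_mult tcoeff_1_power tcoeff_linear mult_zero_left add_0_right)
 also have "... = (Cst (of_nat j) * mon (Suc m) (s - 1) (Suc i) (j - 1)
  + Cst (of_nat (s - j)) * mon (Suc m) (s - 1) i j) u v"
 proof -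
  have 1: "j ~= 0 ==> s - Suc 0 - (j - Suc 0) = s - j" using assms by auto
  have 2: "Suc m - i = Suc (m - i)" using assms by auto
  have 3: "s - Suc (0 + j) = s - Suc j" by simp
  show ?thesis using 1
   by (cases "j = 0"; cases "s = j") (simp_all add: fun_app fun2_apply mon_def 2 algebra_simps)
 qed
 finally show "e12 (mon m s i j) u v = (Cst (of_nat j) * mon (Suc m) (s - 1) (Suc i) (j - 1)
  + Cst (of_nat (s - j)) * mon (Suc m) (s - 1) i j) u v" .
qed

lemma e12_in_bh: "F : bh m s ==> e12 F : bh (Suc m) (s - 1)"
proof (induction rule: bh_induct)
 case zero show ?case by (metis bh_0 e12_0)
next
 case (add F G) thus ?case by (metis bh_add e12_add)
next
 case (cmult c F) thus ?case by (metis bh_cmult e12_cmult)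
next
 case (mon i j)
 have "Cst (of_nat j) * mon (Suc m) (s - 1) (Suc i) (j - 1) : (bh (Suc m) (s - 1) :: 'a fun2 set)"
  using mon by (cases j) (auto intro!: bh_cmult mon_in_bh)
 moreover have "Cst (of_nat (s - j)) * mon (Suc m) (s - 1) i j : (bh (Suc m) (s - 1) :: 'a fun2 set)"
  using mon by (cases "s = j") (auto intro!: bh_cmult mon_in_bh)
 ultimately show ?case using mon by (simp only: e12_mon bh_add)
qed

lemma e21_in_bh: "F : bh m s ==> e21 F : bh (m - 1) (Suc s)"
 unfolding e21_def by (intro swp_in_bh e12_in_bh)

lemma e21_add: "F : bh m s ==> G : bh m' s' ==> e21 (F + G) = e21 F + e21 G"
 by (simp add: e21_def e12_add[OF swp_in_bh swp_in_bh])

lemma e21_cmult: "F : bh m s ==> e21 (Cst c * F) = Cst c * e21 F"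
 by (simp add: e21_def e12_cmult[OF swp_in_bh])

lemma e21_mult: "F : bh m s ==> G : bh m' s' ==> e21 (F * G) = F * e21 G + e21 F * G"
 by (simp add: e21_def e12_mult[OF swp_in_bh swp_in_bh])

lemma theta_in_bh: "F : bh m s ==> s > 0 ==> theta F : bh m s"
 unfolding theta_def using e21_in_bh[OF e12_in_bh, of F m s] by simp

lemma theta_add: "F : bh m s ==> G : bh m' s' ==> theta (F + G) = theta F + theta G"
 unfolding theta_def using e12_add[of F m s G m' s'] e21_add[OF e12_in_bh e12_in_bh] by metis

lemma theta_cmult: "F : bh m s ==> theta (Cst c * F) = Cst c * theta F"
 unfolding theta_def using e12_cmult[of F m s] e21_cmult[OF e12_in_bh] by metis

lemma theta_0 [simp]: "theta 0 = 0"
 by (simp add: theta_def e21_def)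

lemma theta_diff:
 assumes "F : bh m s" "G : bh m' s'" shows "theta (F - G) = theta F - theta G"
proof -
 have "Cst (- 1) * G : bh m' s'" using assms by (intro bh_cmult)
 from theta_add[OF assms(1) this] theta_cmult[OF assms(2), of "-1"] show ?thesis
  by (simp add: Cst_ring)
qed

lemma e12_right_const: assumes "F : bh m 0" shows "e12 F = 0"
proof (intro ext)
 fix u v
 have "F u (v + t *s u) = F u v" for t using bh_0_right_const[OF assms] by blast
 thus "e12 F u v = 0 u v" by (simp add: e12_def tcoeff_const fun_app)
qed

lemma theta_right_const: "F : bh m 0 ==> theta F = 0"
 by (simp add: theta_def e12_right_const e21_def)

text \<open>Euler's identity: at v = u the shift by t u scales v by 1 + t, so F is multiplied by (1
  + t)^s.\<close>

lemma dg_e12: assumes "F : bh m s" shows "dg (e12 F) = Cst (of_nat s) * dg F"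
proof (intro ext)
 fix u v :: "'a ^ 2"
 have *: "u + t *s u = (1 + t) *s u" for t by (simp add: vec_eq_iff algebra_simps)
 have "dg (e12 F) u v = tcoeff (%t. F u u * (1 + t * 1) ^ s) 1"
  by (simp add: dg_def e12_def * bh_homogeneous_right[OF assms] mult.commute)
 also have "... = of_nat s * F u u"
  by (subst tcoeff_cmult, simp, subst tcoeff_1_power) (simp_all add: tcoeff_linear[unfolded One_nat_def] del: mult_1_right)
 finally show "dg (e12 F) u v = (Cst (of_nat s) * dg F) u v"
  by (simp add: fun_app fun2_apply dg_def)
qed

lemma dg_swp: "dg (swp F) = dg F" by (simp add: dg_def swp_def)

text \<open>The eigenvalue of \<open>theta\<close> on the top layer. On the layer
  \<open>Delta ^ j\<close> it becomes (m - j + 1)(s - j), so this one formula decides which layers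
  survive in \<open>Tsp\<close>.\<close>

lemma dg_theta: assumes "F : bh m s" shows "dg (theta F) = Cst (of_nat (Suc m * s)) * dg F"
 unfolding theta_def e21_def using e12_in_bh[OF assms] swp_in_bh
 by (simp add: dg_swp dg_e12[OF assms] dg_e12[OF swp_in_bh, of "e12 F" "Suc m" "s - 1"] Cst_ring algebra_simps)

lemma Delta_line: "Delta u (v + t *s u) = Delta u v" "Delta (u + t *s v) v = Delta u v"
 by (simp_all add: Delta_def fun_app fun2_apply algebra_simps)

lemma e12_Delta: "F : bh m s ==> e12 (Delta * F) = Delta * e12 F"
 by (rule e12_mult_invariant) (simp_all add: Delta_line)

lemma e21_Delta: assumes "F : bh m s" shows "e21 (Delta * F) = Delta * e21 F"
proof -
 have "e12 (swp Delta * swp F) = swp Delta * e12 (swp F)"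
  using assms by (intro e12_mult_invariant[OF _ swp_in_bh]) (simp_all add: swp_def Delta_line)
 thus ?thesis by (simp add: e21_def)
qed

lemma theta_Delta: "F : bh m s ==> theta (Delta * F) = Delta * theta F"
 unfolding theta_def by (metis e12_Delta e21_Delta e12_in_bh)

lemma theta_Delta_power: assumes "F : bh m s" shows "theta (Delta ^ n * F) = Delta ^ n * theta F"
proof (induction n)
 case (Suc n)
 have "theta (Delta * (Delta ^ n * F)) = Delta * theta (Delta ^ n * F)"
  using bh_mult[OF Delta_power_in_bh assms] by (rule theta_Delta)
 thus ?case using Suc by (simp add: mult.assoc)
qed simp

text \<open>The ring of all functions has zero divisors, so cancellation is done for polynomials in
  one variable: along the direction (a, b) given by the standard basis, \<open>Delta\<close> is a
  monic quadratic in t whatever u and v are.\<close>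

lemma Delta_cancel:
 fixes F :: "'k::alg_closed_field fun2"
 assumes F: "F : bh m s" and 0: "Delta * F = 0" shows "F = 0"
proof (intro ext)
 fix u v
 define a b :: "'k ^ 2" where "a = vec2 1 0" and "b = vec2 0 1"
 obtain q where q: "\<And>t. F (u + t *s a) (v + t *s b) = poly q t"
  using polyfun_bh_line[OF F, of u a v b] by (auto simp: polyfun_def)
 define r where "r = [:u $ 1 * v $ 2 - u $ 2 * v $ 1, u $ 1 + v $ 2, 1:]"
 have "poly (r * q) t = 0" for t
 proof -
  have "poly r t = Delta (u + t *s a) (v + t *s b)"
   by (simp add: r_def Delta_def fun_app fun2_apply a_def b_def algebra_simps)
  moreover have "(Delta * F) (u + t *s a) (v + t *s b) = 0" using 0 by (simp add: fun_app)
  ultimately show ?thesis by (simp add: fun_app q)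
 qed
 hence "r * q = 0" by (subst poly_fun_eq_iff[symmetric]) simp
 moreover have "r ~= 0" by (simp add: r_def)
 ultimately have "q = 0" by simp
 thus "F u v = 0 u v" using q[of 0] by (simp add: fun_app)
qed

lemma Delta_power_cancel:
 fixes F :: "'k::alg_closed_field fun2"
 assumes "F : bh m s" and "Delta ^ n * F = 0" shows "F = 0"
 using assms(2)
proof (induction n)
 case (Suc n)
 have "Delta * (Delta ^ n * F) = 0" using Suc.prems by (simp add: mult.assoc)
 hence "Delta ^ n * F = 0" using Delta_cancel bh_mult[OF Delta_power_in_bh assms(1)] by blast
 thus ?case by (rule Suc.IH)
qed simp

lemma Delta_inject:
 fixes F :: "'k::alg_closed_field fun2"
 assumes "F : bh m s" "G : bh m s" "Delta ^ n * F = Delta ^ n * G" shows "F = G"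
proof -
 have "Delta ^ n * (F - G) = 0" using assms(3) by (simp add: right_diff_distrib)
 thus ?thesis using Delta_power_cancel[OF bh_diff[OF assms(1,2)]] by simp
qed

subsection \<open>Substitution by matrices\<close>

definition subm :: "'k::comm_ring_1 ^ 2 ^ 2 => 'k fun2 => 'k fun2"
 where "subm M F = (%u v. F (M *v u) (M *v v))"

lemma matvec_2: "(M *v u) $ i = M $ i $ 1 * u $ 1 + M $ i $ 2 * u $ 2"
 for M :: "'k::comm_ring_1 ^ 2 ^ 2"
 by (simp add: matrix_vector_mult_def sum_2)

lemma subm_simps [simp]: "subm M (F + G) = subm M F + subm M G" "subm M (F * G) = subm M F * subm M G"
 "subm M (F - G) = subm M F - subm M G" "subm M (- F) = - subm M F" "subm M (F ^ n) = subm M F ^ n"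
 "subm M (Cst c) = Cst c" "subm M 0 = 0" "subm M 1 = 1"
 "subm M Xu = Cst (M $ 1 $ 1) * Xu + Cst (M $ 1 $ 2) * Yu"
 "subm M Yu = Cst (M $ 2 $ 1) * Xu + Cst (M $ 2 $ 2) * Yu"
 "subm M Xv = Cst (M $ 1 $ 1) * Xv + Cst (M $ 1 $ 2) * Yv"
 "subm M Yv = Cst (M $ 2 $ 1) * Xv + Cst (M $ 2 $ 2) * Yv"
 "subm M (dg F) = dg (subm M F)"
 by (simp_all add: subm_def fun_eq_iff fun_app fun2_apply matvec_2 dg_def)

lemma subm_Delta: "subm M Delta = Cst (det M) * Delta"
 by (simp add: Delta_def det_2 Cst_ring algebra_simps)

lemma subm_in_bh: "F : bh m s ==> subm M F : bh m s"
proof (induction rule: bh_induct)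
 case zero show ?case by (metis bh_0 subm_simps(7))
next
 case (add F G) thus ?case by (metis bh_add subm_simps(1))
next
 case (cmult c F) thus ?case by (metis bh_cmult subm_simps(2,6))
next
 case (mon i j)
 have l: "Cst a * Xu + Cst b * Yu : bh 1 0" "Cst a * Xv + Cst b * Yv : bh 0 1" for a b :: 'a
  by (intro bh_add bh_cmult Xu_in_bh Yu_in_bh Xv_in_bh Yv_in_bh)+
 have "subm M Xu ^ i * subm M Yu ^ (m - i) * subm M Xv ^ j * subm M Yv ^ (s - j)
   : bh (i * 1 + (m - i) * 1 + j * 0 + (s - j) * 0) (i * 0 + (m - i) * 0 + j * 1 + (s - j) * 1)"
  unfolding subm_simps by (intro bh_mult bh_power l)
 thus ?case using mon by (simp add: mon_def)
qed

lemma matvec_line: "M *v (u + t *s v) = M *v u + t *s (M *v v)" for M :: "'k::comm_ring_1 ^ 2 ^ 2"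
 by (simp add: vec_eq_iff forall_2 matvec_2 algebra_simps)

lemma subm_e12: "subm M (e12 F) = e12 (subm M F)"
 by (simp add: subm_def e12_def matvec_line)

lemma subm_swp: "subm M (swp F) = swp (subm M F)"
 by (simp add: subm_def swp_def)

lemma subm_theta: "subm M (theta F) = theta (subm M F)"
 by (simp add: theta_def e21_def subm_e12 subm_swp)

subsection \<open>The spaces of polynomial functions carrying the indecomposable projectives\<close>

text \<open>In bidegree (p - 1, s) only the layers j = 0 and j = s have
  \<open>theta\<close>-eigenvalue 0; the condition on \<open>theta F\<close> selects what is built
  from these two. The value {0} for larger s lets the direct sum below run over all s.\<close>

definition Tsp :: "nat => 'k::alg_closed_field fun2 set"
 where "Tsp s = (if s <= CHAR('k) - 1
  then {F : bh (CHAR('k) - 1) s. \<exists>r\<in>bh (CHAR('k) - 1 - s) 0. theta F = Delta ^ s * r} else {0})"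

lemma Tsp_0: "0 : Tsp s"
 by (auto simp: Tsp_def intro!: bexI[of _ 0])

lemma Tsp_add: assumes "F : Tsp s" "G : Tsp s" shows "F + G : Tsp s"
proof (cases "s <= CHAR('a) - 1")
 case True
 with assms obtain r r' where F: "F : bh (CHAR('a) - 1) s" "theta F = Delta ^ s * r" "r : bh (CHAR('a) - 1 - s) 0"
  and G: "G : bh (CHAR('a) - 1) s" "theta G = Delta ^ s * r'" "r' : bh (CHAR('a) - 1 - s) 0"
  by (auto simp: Tsp_def)
 hence "theta (F + G) = Delta ^ s * (r + r')" by (simp add: theta_add[OF F(1) G(1)] distrib_left)
 with True F G show ?thesis unfolding Tsp_def using bh_add[OF F(1) G(1)] bh_add[OF F(3) G(3)] by auto
qed (use assms in \<open>simp add: Tsp_def\<close>)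

lemma Tsp_cmult: assumes "F : Tsp s" shows "Cst c * F : Tsp s"
proof (cases "s <= CHAR('a) - 1")
 case True
 with assms obtain r where F: "F : bh (CHAR('a) - 1) s" "theta F = Delta ^ s * r" "r : bh (CHAR('a) - 1 - s) 0"
  by (auto simp: Tsp_def)
 hence "theta (Cst c * F) = Delta ^ s * (Cst c * r)" by (simp add: theta_cmult[OF F(1)] mult.left_commute)
 with True F show ?thesis unfolding Tsp_def using bh_cmult[OF F(1)] bh_cmult[OF F(3)] by auto
qed (use assms in \<open>simp add: Tsp_def\<close>)

lemma Tsp_subm: assumes "F : Tsp s" "det M = 1" shows "subm M F : Tsp s"
proof (cases "s <= CHAR('a) - 1")
 case True
 with assms obtain r where F: "F : bh (CHAR('a) - 1) s" "theta F = Delta ^ s * r" "r : bh (CHAR('a) - 1 - s) 0"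
  by (auto simp: Tsp_def)
 hence "theta (subm M F) = Delta ^ s * subm M r"
  using assms(2) by (simp add: subm_Delta flip: subm_theta)
 with True F show ?thesis unfolding Tsp_def using subm_in_bh[OF F(1)] subm_in_bh[OF F(3)] by auto
qed (use assms in \<open>simp add: Tsp_def\<close>)

locale charp =
 fixes p :: nat and k :: "'k::alg_closed_field itself"
 assumes CHAR: "CHAR('k) = p" and p3: "p >= 3"
begin

lemma prime_p: "prime p"
 using prime_CHAR_semidom[where 'a = 'k] CHAR p3 by auto

lemma of_nat_0_iff: "of_nat n = (0::'k) \<longleftrightarrow> p dvd n"
 by (simp add: of_nat_eq_0_iff_char_dvd CHAR)

lemma of_nat_p [simp]: "of_nat p = (0::'k)"
 by (simp add: of_nat_0_iff)

lemma of_nat_neq_0: "0 < n ==> n < p ==> of_nat n ~= (0::'k)"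
 by (auto simp: of_nat_0_iff dest: dvd_imp_le)

lemma Tsp_iff: "s < p ==> F : Tsp s \<longleftrightarrow> F : bh (p - 1) s & (\<exists>r\<in>bh (p - 1 - s) 0. theta F = Delta ^ s * r)"
 for F :: "'k fun2"
 using p3 by (auto simp: Tsp_def CHAR)

lemma Tsp_in_bh: "F : Tsp s ==> F : bh (p - 1) s" for F :: "'k fun2"
 by (auto simp: Tsp_def CHAR split: if_splits)

lemma Tsp_ge: "p <= s ==> F : Tsp s ==> F = (0 :: 'k fun2)"
proof -
 assume "p <= s" "F : Tsp s"
 moreover have "~ s <= p - 1" using \<open>p <= s\<close> p3 by linarith
 ultimately show ?thesis by (simp add: Tsp_def CHAR)
qed

lemma Delta_power_in_Tsp:
 fixes r :: "'k fun2"
 assumes "s < p" "r : bh (p - 1 - s) 0" shows "Delta ^ s * r : Tsp s"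
proof -
 have "Delta ^ s * r : bh (p - 1) s"
  using bh_mult[OF Delta_power_in_bh assms(2), of s] assms(1) by simp
 moreover have "theta (Delta ^ s * r) = Delta ^ s * 0"
  by (simp add: theta_Delta_power[OF assms(2)] theta_right_const[OF assms(2)])
 ultimately show ?thesis using assms(1) unfolding Tsp_iff[OF assms(1)] by (blast intro: bh_0)
qed

lemma theta_layer_nonzero: "m + Suc d + 1 < p ==> of_nat (Suc (m + Suc d) * Suc d) ~= (0::'k)"
 using of_nat_neq_0[of "Suc (m + Suc d)"] of_nat_neq_0[of "Suc d"]
 by (simp only: of_nat_mult) auto

text \<open>In bidegree (m + j, j) the top eigenvalue (m + j + 1) j is nonzero for 0 < j <= d
  because m + d + 1 < p; so the layers vanish one after the other, each time giving a factor
  \<open>Delta\<close>, until only the last remains.\<close>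

lemma theta_layer_kernel:
 fixes G :: "'k fun2"
 assumes "m + d + 1 < p" "G : bh (m + d) d" "r : bh m 0" "theta G = Delta ^ d * r"
 shows "\<exists>r\<in>bh m 0. G = Delta ^ d * r"
 using assms(1,2,4)
proof (induction d arbitrary: G)
 case (Suc d)
 have "Cst (of_nat (Suc (m + Suc d) * Suc d)) * dg G = 0"
  using dg_theta[OF Suc.prems(2)] Suc.prems(3) by simp
 hence "dg G = 0" using theta_layer_nonzero[OF Suc.prems(1)]
  by (auto simp: fun_eq_iff fun_app fun2_apply simp del: of_nat_Suc of_nat_mult)
 then obtain G1 where G1: "G1 : bh (m + d) d" "G = Delta * G1"
  using dg_eq_0_imp[OF Suc.prems(2)] by auto
 have "Delta ^ 1 * theta G1 = Delta ^ 1 * (Delta ^ d * r)"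
  using Suc.prems(3) G1 theta_Delta[OF G1(1)] by (simp add: mult.assoc)
 moreover have "theta G1 : bh (m + d) d"
  using theta_in_bh[OF G1(1)] theta_right_const[of G1 m] G1(1) by (cases "d = 0") auto
 moreover have "Delta ^ d * r : bh (m + d) d"
  using bh_mult[OF Delta_power_in_bh assms(3), of d] by (simp add: add.commute)
 ultimately have "theta G1 = Delta ^ d * r" using Delta_inject by blast
 then obtain r' where "r' : bh m 0" "G1 = Delta ^ d * r'" using Suc.IH[of G1] Suc.prems G1 by auto
 thus ?case using G1(2) by (auto simp: mult.assoc)
next
 case 0
 thus ?case by (intro bexI[of _ G]) simp_all
qed

text \<open>The same eigenvalues, now inverted: the top layer of G is hit by a multiple of its
  standard lift, the difference is divisible by \<open>Delta\<close>, and only the last layer, where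
  \<open>theta\<close> is 0, stays as an error term.\<close>

lemma theta_layer_surj:
 fixes G :: "'k fun2"
 assumes "m + d + 1 < p" "G : bh (m + d) d"
 shows "\<exists>G'\<in>bh (m + d) d. \<exists>r\<in>bh m 0. theta G' = G + Delta ^ d * r"
 using assms
proof (induction d arbitrary: G)
 case 0
 have "theta 0 = G + Delta ^ 0 * - G" "- G : bh m 0" using 0 by auto
 thus ?case by (metis bh_0)
next
 case (Suc d)
 define c :: 'k where "c = inverse (of_nat (Suc (m + Suc d) * Suc d))"
 define G0 where "G0 = Cst c * stdlift (m + Suc d) (Suc d) (dg G)"
 have G0: "G0 : bh (m + Suc d) (Suc d)" unfolding G0_def by (intro bh_cmult stdlift_in_bh)
 have "of_nat (Suc (m + Suc d) * Suc d) * c = 1"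
  using theta_layer_nonzero[OF Suc.prems(1)] unfolding c_def by (rule right_inverse)
 moreover have "dg (stdlift (m + Suc d) (Suc d) (dg G)) = dg G"
  by (rule dg_stdlift[OF dg_in_bh[OF Suc.prems(2)]])
 ultimately have "dg (theta G0) = dg G"
  using dg_theta[OF G0] unfolding G0_def by (simp only: dg_simps flip: mult.assoc Cst_ring) simp
 then obtain G1 where G1: "G1 : bh (m + d) d" "theta G0 - G = Delta * G1"
  using dg_eq_0_imp[OF bh_diff[OF theta_in_bh[OF G0] Suc.prems(2)]] by auto
 then obtain G1' r where G1': "G1' : bh (m + d) d" "r : bh m 0" "theta G1' = G1 + Delta ^ d * r"
  using Suc.IH[of G1] Suc.prems(1) by auto
 have D: "Delta * G1' : bh (m + Suc d) (Suc d)"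
  using bh_mult[OF Delta_in_bh G1'(1)] by simp
 have "theta (G0 - Delta * G1') = G + Delta ^ Suc d * (- r)"
  using G1(2) theta_diff[OF G0 D] theta_Delta[OF G1'(1)] G1'(3) by (simp add: algebra_simps)
 moreover have "G0 - Delta * G1' : bh (m + Suc d) (Suc d)" using G0 D by (rule bh_diff)
 ultimately show ?case using G1'(2) by (meson bh_uminus)
qed

text \<open>After division by \<open>Delta\<close> the function lies in bidegree (p - 2, s - 1),
  where all eigenvalues but the last are nonzero. So restriction to the diagonal loses exactly the
  lower layer of \<open>Tsp s\<close>, of dimension p - s, when s > 0.\<close>

lemma Tsp_dg_eq_0:
 fixes F :: "'k fun2"
 assumes "s < p" "F : Tsp s" "dg F = 0"
 obtains r where "r : bh (p - 1 - s) 0" "F = Delta ^ s * r"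
proof (cases s)
 case 0
 thus ?thesis using assms that[of 0] dg_bh_0[of F "p - 1"] by (auto simp: Tsp_iff)
next
 case (Suc d)
 define m where "m = p - 1 - s"
 have m: "p - 1 = m + Suc d" using assms(1) Suc by (simp add: m_def)
 have md: "m + d + 1 < p" using m p3 by simp
 have "F : bh (m + Suc d) (Suc d)" using Tsp_in_bh[OF assms(2)] m Suc by simp
 moreover from assms(2)[unfolded Tsp_iff[OF assms(1)]]
 obtain r where "r : bh (p - 1 - s) 0" "theta F = Delta ^ s * r" by blast
 hence "r : bh m 0" "theta F = Delta ^ Suc d * r" using Suc by (simp_all only: m_def)
 ultimately have F: "F : bh (m + Suc d) (Suc d)" "r : bh m 0" "theta F = Delta ^ Suc d * r" by auto
 obtain G1 where G1: "G1 : bh (m + d) d" "F = Delta * G1"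
  using dg_eq_0_imp[OF F(1) assms(3)] by auto
 have "Delta ^ 1 * theta G1 = Delta ^ 1 * (Delta ^ d * r)"
  using F(3) G1 theta_Delta[OF G1(1)] by (simp add: mult.assoc)
 moreover have "theta G1 : bh (m + d) d"
  using theta_in_bh[OF G1(1)] theta_right_const[of G1 m] G1(1) by (cases "d = 0") auto
 moreover have "Delta ^ d * r : bh (m + d) d"
  using bh_mult[OF Delta_power_in_bh F(2), of d] by (simp add: add.commute)
 ultimately have "theta G1 = Delta ^ d * r" using Delta_inject by blast
 then obtain r' where "r' : bh m 0" "G1 = Delta ^ d * r'"
  using theta_layer_kernel[OF md G1(1) F(2)] by blast
 thus ?thesis using that[of r'] G1(2) by (simp add: Suc m_def mult.assoc)
qed

text \<open>For a standard lift \<open>theta F0\<close> is divisible by \<open>Delta\<close>, since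
  the top eigenvalue p * s is zero; \<open>theta_layer_surj\<close> in the smaller bidegree supplies
  the correction that moves the lift into \<open>Tsp s\<close>.\<close>

lemma Tsp_lift:
 fixes H :: "'k fun2"
 assumes "s < p" "H : bh (p - 1 + s) 0"
 obtains F where "F : Tsp s" "dg F = H"
proof (cases s)
 case 0
 have "H : Tsp 0" using assms 0 by (auto simp: Tsp_iff theta_right_const intro!: bexI[of _ 0])
 thus ?thesis using that[of H] 0 dg_bh_0[of H "p - 1"] assms by simp
next
 case (Suc d)
 define m where "m = p - 1 - s"
 have m: "p - 1 = m + Suc d" using assms(1) Suc by (simp add: m_def)
 define F0 where "F0 = stdlift (m + Suc d) (Suc d) H"
 have F0: "F0 : bh (m + Suc d) (Suc d)" unfolding F0_def by (rule stdlift_in_bh)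
 have "p - 1 + s = m + Suc d + Suc d" using m Suc by simp
 hence dgF0: "dg F0 = H" unfolding F0_def using assms(2) by (intro dg_stdlift) (simp only:)
 have md: "m + d + 1 < p" using m p3 by simp
 have "Suc (m + Suc d) = p" using m p3 by simp
 hence "dg (theta F0) = 0" using dg_theta[OF F0] by (simp add: Cst_ring(2))
 then obtain G1 where G1: "G1 : bh (m + d) d" "theta F0 = Delta * G1"
  using dg_eq_0_imp[OF theta_in_bh[OF F0]] by auto
 obtain G' r where G': "G' : bh (m + d) d" "r : bh m 0" "theta G' = G1 + Delta ^ d * r"
  using theta_layer_surj[OF md G1(1)] by blast
 have D: "Delta * G' : bh (m + Suc d) (Suc d)"
  using bh_mult[OF Delta_in_bh G'(1)] by simp
 have "theta (F0 - Delta * G') = Delta ^ Suc d * (- r)"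
  unfolding theta_diff[OF F0 D] theta_Delta[OF G'(1)] G'(3) G1(2) by (simp add: distrib_left mult.assoc)
 moreover have "F0 - Delta * G' : bh (m + Suc d) (Suc d)" using F0 D by (rule bh_diff)
 ultimately have "F0 - Delta * G' : Tsp s"
  using assms(1) m G'(2) unfolding Suc by (auto simp: Tsp_iff m_def Suc intro!: bexI[of _ "- r"] bh_uminus)
 moreover have "dg (F0 - Delta * G') = H" using dgF0 by simp
 ultimately show ?thesis by (rule that)
qed

end

subsection \<open>Coefficients of products\<close>

text \<open>\<open>bc\<close> sets both y-coordinates to 1, so powers of \<open>Yu\<close> and
  \<open>Yv\<close> are invisible to it.\<close>

lemma bc_Yu_power: "bc (Yu ^ n * G) i j = bc G i j" and bc_Yv_power: "bc (Yv ^ n * G) i j = bc G i j"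
 by (simp_all add: bc_def fun_app fun2_apply)

lemma bc_Xu_power:
 assumes "G : bh m s"
 shows "bc (Xu ^ n * G) i j = (if n <= i then bc G (i - n) j else 0)"
 using assms
proof (induction rule: bh_induct)
 case (mon a b)
 have "Xu ^ n * mon m s a b = (mon (m + n) s (a + n) b :: 'a fun2)"
  by (simp add: mon_def power_add mult_ac)
 thus ?case using mon by (auto simp: bc_mon)
next
 case (add F G)
 have "Xu ^ n * F : bh (n + m) (0 + s)" "Xu ^ n * G : bh (n + m) (0 + s)"
  using add bh_mult XY_power_in_bh by blast+
 from bc_add[OF this, of i j] add show ?case by (simp add: distrib_left bc_add)
next
 case (cmult c F)
 have "Xu ^ n * F : bh (n + m) (0 + s)" using cmult bh_mult XY_power_in_bh by blast
 from bc_cmult[OF this, of c i j] cmult show ?case by (simp add: mult.left_commute[of _ "Cst c"] bc_cmult)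
qed simp

lemma bc_swp: assumes "F : bh m s" shows "bc (swp F) i j = bc F j i"
 using assms
proof (induction rule: bh_induct)
 case (add F G)
 thus ?case by (simp add: bc_add[OF swp_in_bh swp_in_bh] bc_add)
next
 case (cmult c F)
 thus ?case by (simp add: bc_cmult[OF swp_in_bh] bc_cmult)
qed (auto simp: bc_mon)

lemma bc_Xv_power:
 assumes "G : bh m s"
 shows "bc (Xv ^ n * G) i j = (if n <= j then bc G i (j - n) else 0)"
proof -
 have *: "swp (Xu ^ n * swp G) = Xv ^ n * G"
  by (simp add: swp_def fun_eq_iff fun_app fun2_apply)
 from bc_swp[OF bh_mult[OF XY_power_in_bh(1) swp_in_bh[OF assms]], of n i j] show ?thesis
  unfolding * by (simp add: bc_Xu_power[OF swp_in_bh[OF assms]] bc_swp[OF assms])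
qed

text \<open>As H is free of v, only the summand with \<open>Xv ^ j\<close> of the binomial expansion
  reaches the exponent j of z.\<close>

lemma bc_Delta_power:
 fixes H :: "'k::alg_closed_field fun2"
 assumes H: "H : bh d 0"
 shows "bc (Delta ^ n * H) i j = (if j <= n & n - j <= i
  then (- 1) ^ j * of_nat (n choose j) * bc H (i - (n - j)) 0 else 0)"
proof -
 define f where "f l = Cst ((- 1) ^ l * of_nat (n choose l)) * (Yu ^ l * (Yv ^ (n - l) * (Xv ^ l * (Xu ^ (n - l) * H))))" for l
 have "Delta ^ n = ((- (Yu * Xv)) + Xu * Yv :: 'k fun2) ^ n" by (simp add: Delta_def)
 hence "Delta ^ n * H = (\<Sum>l\<le>n. of_nat (n choose l) * (- (Yu * Xv)) ^ l * (Xu * Yv) ^ (n - l)) * H"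
  by (simp only: binomial_ring)
 also have "... = (\<Sum>l\<le>n. f l)"
  unfolding sum_distrib_right f_def
  by (intro sum.cong refl) (subst power_minus, simp add: power_mult_distrib Cst_ring mult_ac)
 finally have *: "Delta ^ n * H = (\<Sum>l\<le>n. f l)" .
 have h1: "Xu ^ (n - l) * H : bh (n - l + d) (0 + 0)" for l
  using bh_mult[OF XY_power_in_bh(1) H] .
 have z: "Xv ^ l : (bh 0 l :: 'k fun2 set)" "Yv ^ l : (bh 0 l :: 'k fun2 set)" for l
  using bh_power[OF Xv_in_bh, of l] bh_power[OF Yv_in_bh, of l] by simp_all
 have h2: "Yu ^ l * (Yv ^ (n - l) * (Xv ^ l * (Xu ^ (n - l) * H))) : bh (l + (0 + (0 + (n - l + d)))) (0 + (n - l + (l + (0 + 0))))"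
  for l
  by (rule bh_mult[OF XY_power_in_bh(2) bh_mult[OF z(2) bh_mult[OF z(1) h1]]])
 have f: "f l : bh (n + d) n" if "l <= n" for l
  unfolding f_def using bh_cmult[OF h2[of l]] that by simp
 have "bc (Delta ^ n * H) i j = (\<Sum>l\<le>n. bc (f l) i j)"
  unfolding * using f by (intro bc_sum) auto
 also have "... = (\<Sum>l\<le>n. if l = j & n - j <= i
  then (- 1) ^ j * of_nat (n choose j) * bc H (i - (n - j)) 0 else 0)"
 proof (rule sum.cong[OF refl])
  fix l
  show "bc (f l) i j = (if l = j & n - j <= i
  then (- 1) ^ j * of_nat (n choose j) * bc H (i - (n - j)) 0 else 0)"
   using bc_outside[OF H, of "i - (n - l)" "j - l"]
   by (auto simp: f_def bc_cmult[OF h2] bc_Yu_power bc_Yv_power bc_Xv_power[OF h1] bc_Xu_power[OF H])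
 qed
 finally show ?thesis by (auto simp: sum.delta if_distrib cong: if_cong)
qed

lemma bc_dg:
 assumes F: "F : bh m s" and e: "e <= s" "e <= m"
 shows "bc (dg F) e 0 = (\<Sum>j\<le>e. bc F (e - j) j)"
proof -
 have "dg (Bh m s (bc F)) = (\<Sum>i\<le>m. \<Sum>j\<le>s. Cst (bc F i j) * mon (m + s) 0 (i + j) 0)"
  unfolding Bh_def dg_sum by (intro sum.cong refl) (simp add: dg_mon)
 hence "bc (dg F) e 0 = bc (\<Sum>i\<le>m. \<Sum>j\<le>s. Cst (bc F i j) * mon (m + s) 0 (i + j) 0) e 0"
  by (simp only: bh_bc[OF F])
 also have "... = (\<Sum>i\<le>m. bc (\<Sum>j\<le>s. Cst (bc F i j) * mon (m + s) 0 (i + j) 0) e 0)"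
  by (rule bc_sum[of _ _ "m + s" 0], rule bh_sum, rule bh_cmult, rule mon_in_bh) auto
 also have "... = (\<Sum>i\<le>m. \<Sum>j\<le>s. bc (Cst (bc F i j) * mon (m + s) 0 (i + j) 0) e 0)"
  by (rule sum.cong[OF refl], rule bc_sum[of _ _ "m + s" 0], rule bh_cmult, rule mon_in_bh) auto
 also have "... = (\<Sum>i\<le>m. \<Sum>j\<le>s. if i + j = e then bc F i j else 0)"
  by (intro sum.cong[OF refl]) (simp add: bc_cmult[OF mon_in_bh] bc_mon)
 also have "... = (\<Sum>j\<le>s. \<Sum>i\<le>m. if i + j = e then bc F i j else 0)" by (rule sum.swap)
 also have "... = (\<Sum>j\<le>s. if j <= e then bc F (e - j) j else 0)"
 proof (intro sum.cong refl)
  fix j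
  have "(\<Sum>i\<le>m. if i + j = e then bc F i j else 0) = (\<Sum>i\<le>m. if i = e - j then (if j <= e then bc F i j else 0) else 0)"
   by (intro sum.cong) auto
  also have "... = (if j <= e then bc F (e - j) j else 0)" using e by (subst sum.delta) auto
  finally show "(\<Sum>i\<le>m. if i + j = e then bc F i j else 0) = (if j <= e then bc F (e - j) j else 0)" .
 qed
 also have "... = (\<Sum>j\<in>{..s} \<inter> {j. j <= e}. bc F (e - j) j)" by (simp add: sum.inter_restrict)
 also have "{..s} \<inter> {j. j <= e} = {..e}" using e by auto
 finally show ?thesis .
qed

lemma alternating_binomial_sum:
 "(\<Sum>j\<le>e. (- 1) ^ j * of_nat (Suc n choose j)) = ((- 1) ^ e * of_nat (n choose e) :: 'a::comm_ring_1)"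
 by (induction e) (simp_all add: algebra_simps)

section \<open>The maps between the summands s and p - s\<close>

context charp
begin

text \<open>\<open>Delta ^ (p - s) * dg F\<close> has degree 2p - 1 in u, so each of its monomials
  is divisible by exactly one of \<open>Xu ^ p\<close> and \<open>Yu ^ p\<close>; \<open>alf\<close>
  and \<open>bef\<close> are the two quotients, of bidegree (p - 1, p - s).\<close>

definition alf :: "nat => 'k fun2 => 'k fun2"
 where "alf s F = Bh (p - 1) (p - s) (%i j. bc (Delta ^ (p - s) * dg F) (p + i) j)"

definition bef :: "nat => 'k fun2 => 'k fun2"
 where "bef s F = Bh (p - 1) (p - s) (%i j. bc (Delta ^ (p - s) * dg F) i j)"

lemma bc_decomposition:
 fixes A B :: "'k fun2"
 assumes A: "A : bh (p - 1) r" and B: "B : bh (p - 1) r"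
 shows "bc (Xu ^ p * A + Yu ^ p * B) i j = (if p <= i then bc A (i - p) j else bc B i j)"
  "Xu ^ p * A + Yu ^ p * B : bh (p + (p - 1)) r"
proof -
 have X: "Xu ^ p * A : bh (p + (p - 1)) (0 + r)" and Y: "Yu ^ p * B : bh (p + (p - 1)) (0 + r)"
  using A B bh_mult XY_power_in_bh by blast+
 show "bc (Xu ^ p * A + Yu ^ p * B) i j = (if p <= i then bc A (i - p) j else bc B i j)"
  using bc_outside[OF B, of i j] le_diff_conv2[of 1 p i] p3
  by (auto simp: bc_add[OF X Y] bc_Xu_power[OF A] bc_Yu_power)
 show "Xu ^ p * A + Yu ^ p * B : bh (p + (p - 1)) r" using bh_add[OF X Y] by simp
qed

lemma decomposition_unique:
 fixes A B :: "'k fun2"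
 assumes "A : bh (p - 1) r" "B : bh (p - 1) r" "A' : bh (p - 1) r" "B' : bh (p - 1) r"
  and eq: "Xu ^ p * A + Yu ^ p * B = Xu ^ p * A' + Yu ^ p * B'"
 shows "A = A'" "B = B'"
proof -
 have *: "(if p <= i then bc A (i - p) j else bc B i j) = (if p <= i then bc A' (i - p) j else bc B' i j)" for i j
  using bc_decomposition(1)[OF assms(1,2), of i j] bc_decomposition(1)[OF assms(3,4), of i j] eq by simp
 show "A = A'" by (rule bh_eqI[OF assms(1,3)]) (use *[of "p + i" for i] in auto)
 show "B = B'"
 proof (rule bh_eqI[OF assms(2,4)])
  fix i j assume "i <= p - 1"
  hence "~ p <= i" using p3 by simp
  thus "bc B i j = bc B' i j" using *[of i j] by simp
 qed
qed

context
 fixes s :: nat and F :: "'k fun2"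
 assumes s: "0 < s" "s < p" and F: "F : Tsp s"
begin

lemma dg_Tsp_in_bh: "dg F : bh (p - 1 + s) 0"
 using dg_in_bh[OF Tsp_in_bh[OF F]] .

lemma alf_in_bh: "alf s F : bh (p - 1) (p - s)" and bef_in_bh: "bef s F : bh (p - 1) (p - s)"
 by (simp_all add: alf_def bef_def)

lemma Delta_dg_in_bh: "Delta ^ (p - s) * dg F : bh (p + (p - 1)) (p - s)"
proof -
 have "p - s + (p - 1 + s) = p + (p - 1)" using s by simp
 thus ?thesis using bh_mult[OF Delta_power_in_bh dg_Tsp_in_bh, of "p - s"] by simp
qed

lemma Delta_dg: "Delta ^ (p - s) * dg F = Xu ^ p * alf s F + Yu ^ p * bef s F"
proof (rule bh_eqI[OF Delta_dg_in_bh bc_decomposition(2)[OF alf_in_bh bef_in_bh]])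
 fix i j assume "i <= p + (p - 1)" "j <= p - s"
 thus "bc (Delta ^ (p - s) * dg F) i j = bc (Xu ^ p * alf s F + Yu ^ p * bef s F) i j"
  unfolding bc_decomposition(1)[OF alf_in_bh bef_in_bh] by (auto simp: alf_def bef_def bc_Bh)
qed

lemma alf_bef_unique:
 assumes "A : bh (p - 1) (p - s)" "B : bh (p - 1) (p - s)"
  "Delta ^ (p - s) * dg F = Xu ^ p * A + Yu ^ p * B"
 shows "alf s F = A" "bef s F = B"
 using decomposition_unique[OF alf_in_bh bef_in_bh assms(1,2)] Delta_dg assms(3) by auto

text \<open>p-th powers in u are killed by v d/du and do not involve v, so they are constants for
  both polarisation operators.\<close>

lemma theta_decomposition:
 fixes A B :: "'k fun2"
 assumes A: "A : bh m r" and B: "B : bh m r"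
 shows "theta (Xu ^ p * A + Yu ^ p * B) = Xu ^ p * theta A + Yu ^ p * theta B"
proof -
 have e21: "e21 (Xu ^ p) = (0 :: 'k fun2)" "e21 (Yu ^ p) = (0 :: 'k fun2)"
  by (simp_all add: e21_def e12_def swp_def fun_eq_iff fun_app fun2_apply
   tcoeff_1_power[unfolded One_nat_def])
 have X: "theta (Xu ^ p * A) = Xu ^ p * theta A"
 proof -
  have "e12 (Xu ^ p * A) = Xu ^ p * e12 A"
   by (rule e12_mult_invariant[OF _ A]) (simp add: fun_app fun2_apply)
  thus ?thesis
   unfolding theta_def using e21_mult[OF XY_power_in_bh(1)[of p] e12_in_bh[OF A]] e21 by simp
 qed
 have Y: "theta (Yu ^ p * B) = Yu ^ p * theta B"
 proof -
  have "e12 (Yu ^ p * B) = Yu ^ p * e12 B"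
   by (rule e12_mult_invariant[OF _ B]) (simp add: fun_app fun2_apply)
  thus ?thesis
   unfolding theta_def using e21_mult[OF XY_power_in_bh(2)[of p] e12_in_bh[OF B]] e21 by simp
 qed
 show ?thesis
  using theta_add[OF bh_mult[OF XY_power_in_bh(1) A] bh_mult[OF XY_power_in_bh(2) B], of p p] X Y by simp
qed

text \<open>\<open>dg F\<close> does not depend on v, hence \<open>theta\<close> kills
  \<open>Delta ^ (p - s) * dg F\<close>; uniqueness of the decomposition passes this on to both
  parts.\<close>

lemma alf_in_Tsp: "alf s F : Tsp (p - s)" and bef_in_Tsp: "bef s F : Tsp (p - s)"
proof -
 have "theta (Delta ^ (p - s) * dg F) = Delta ^ (p - s) * 0"
  using theta_Delta_power[OF dg_Tsp_in_bh] theta_right_const[OF dg_Tsp_in_bh] by simp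
 hence "Xu ^ p * theta (alf s F) + Yu ^ p * theta (bef s F) = Xu ^ p * 0 + Yu ^ p * 0"
  using theta_decomposition[OF alf_in_bh bef_in_bh] Delta_dg by simp
 hence "theta (alf s F) = 0" "theta (bef s F) = 0"
  using decomposition_unique[OF theta_in_bh[OF alf_in_bh] theta_in_bh[OF bef_in_bh], of 0 0] s by auto
 moreover have "p - s < p" using s by simp
 ultimately show "alf s F : Tsp (p - s)" "bef s F : Tsp (p - s)"
  using alf_in_bh bef_in_bh by (auto simp: Tsp_iff intro!: bexI[of _ 0])
qed

text \<open>On the diagonal the left side of \<open>Delta_dg\<close> vanishes because p - s > 0.
  What remains is a syzygy between X^p and Y^p, and it yields one common form w.\<close>

lemma dg_alf_bef:
 "\<exists>w\<in>bh (p - 1 - s) 0. dg (alf s F) = Yu ^ p * w & dg (bef s F) = - (Xu ^ p * w) \<and>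
  (\<forall>m. bc w m 0 = bc (dg (alf s F)) m 0)"
proof -
 define A where "A = dg (alf s F)"
 define B where "B = dg (bef s F)"
 have AB: "A : bh (p - 1 + (p - s)) 0" "B : bh (p - 1 + (p - s)) 0"
  using dg_in_bh alf_in_bh bef_in_bh unfolding A_def B_def by blast+
 have "dg (Delta ^ (p - s) * dg F) = 0" using s by (simp add: zero_power)
 hence 0: "Xu ^ p * A + Yu ^ p * B = 0" unfolding Delta_dg A_def B_def by simp
 have X: "Xu ^ p * A : bh (p + (p - 1 + (p - s))) (0 + 0)" and Y: "Yu ^ p * B : bh (p + (p - 1 + (p - s))) (0 + 0)"
  using AB bh_mult XY_power_in_bh by blast+
 have c: "(if p <= i then bc A (i - p) 0 else 0) + bc B i 0 = 0" for i
  using bc_add[OF X Y, of i 0] by (simp add: 0 bc_Xu_power[OF AB(1)] bc_Yu_power)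
 have cA: "bc A m 0 = 0" if "p - 1 - s < m" for m
  using c[of "p + m"] bc_outside[OF AB(2), of "p + m" 0] that s by auto
 define w where "w = Bh (p - 1 - s) 0 (%i j. bc A i 0)"
 have w: "w : bh (p - 1 - s) 0" by (simp add: w_def)
 have bw: "bc w m 0 = bc A m 0" for m using cA by (auto simp: w_def bc_Bh)
 have Yw: "Yu ^ p * w : bh (p - 1 + (p - s)) 0" and Xw: "Xu ^ p * w : bh (p - 1 + (p - s)) 0"
  using bh_mult[OF XY_power_in_bh(1) w, of p] bh_mult[OF XY_power_in_bh(2) w, of p] s
  by (simp_all add: algebra_simps)
 have "A = Yu ^ p * w" by (rule bh_eqI[OF AB(1) Yw]) (simp add: bc_Yu_power bw)
 moreover have "B = - (Xu ^ p * w)"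
 proof (rule bh_eqI[OF AB(2) bh_uminus[OF Xw]])
  fix i j :: nat assume "j <= 0"
  thus "bc B i j = bc (- (Xu ^ p * w)) i j"
   using c[of i] by (auto simp: bc_uminus[OF Xw] bc_Xu_power[OF w] bw eq_neg_iff_add_eq_0 add.commute split: if_splits)
 qed
 ultimately show ?thesis using w bw unfolding A_def B_def by blast
qed

text \<open>These are, up to sign, the coefficients of the common form w: the signed binomials of
  \<open>Delta ^ (p - s)\<close> are summed along an antidiagonal, and the partial sum collapses to
  a single binomial. The result is the source of the constant \<open>kap\<close>.\<close>

lemma bc_dg_bef: assumes "m < p - s"
 shows "bc (dg (bef s F)) (p + m) 0 = - ((- 1) ^ m * of_nat ((p - s - 1) choose m) * bc (dg F) (m + s) 0)"
proof -
 obtain w where w: "w : bh (p - 1 - s) 0" "dg (alf s F) = Yu ^ p * w" "dg (bef s F) = - (Xu ^ p * w)"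
  "\<And>m. bc w m 0 = bc (dg (alf s F)) m 0"
  using dg_alf_bef by blast
 have Xw: "Xu ^ p * w : bh (p + (p - 1 - s)) (0 + 0)"
  using bh_mult[OF XY_power_in_bh(1) w(1), of p] .
 have "bc (dg (bef s F)) (p + m) 0 = - bc (dg (alf s F)) m 0"
  by (simp add: w(3) w(4) bc_uminus[OF Xw] bc_Xu_power[OF w(1)])
 also have "bc (dg (alf s F)) m 0 = (\<Sum>j\<le>m. bc (alf s F) (m - j) j)"
  using assms by (intro bc_dg[OF alf_in_bh]) auto
 also have "... = (\<Sum>j\<le>m. (- 1) ^ j * of_nat (Suc (p - s - 1) choose j) * bc (dg F) (m + s) 0)"
 proof (intro sum.cong refl)
  fix j assume "j : {..m}"
  moreover from this assms s have "p + (m - j) - (p - s - j) = m + s" "Suc (p - s - 1) = p - s" by auto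
  ultimately show "bc (alf s F) (m - j) j = (- 1) ^ j * of_nat (Suc (p - s - 1) choose j) * bc (dg F) (m + s) 0"
   using assms by (auto simp: alf_def bc_Bh bc_Delta_power[OF dg_Tsp_in_bh])
 qed
 also have "... = (- 1) ^ m * of_nat ((p - s - 1) choose m) * bc (dg F) (m + s) 0"
  by (simp only: alternating_binomial_sum flip: sum_distrib_right)
 finally show ?thesis .
qed

text \<open>The coefficients of \<open>x^m y^(p-1-m) z^(p-s)\<close> for \<open>m < s\<close> detect the socle \<open>\<Delta>^(p-s)\<close>.\<close>

lemma bc_alf_top: "m < s ==> bc (alf s F) m (p - s) = (- 1) ^ (p - s) * bc (dg F) (p + m) 0"
 and bc_bef_top: "m < s ==> bc (bef s F) m (p - s) = (- 1) ^ (p - s) * bc (dg F) m 0"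
 using s by (auto simp: alf_def bef_def bc_Bh bc_Delta_power[OF dg_Tsp_in_bh])

end

text \<open>All products are read off from the common form w: after \<open>alf\<close> only
  \<open>Yu ^ p\<close> occurs, after \<open>bef\<close> only \<open>Xu ^ p\<close>, and the mixed
  products are \<open>Delta ^ s * w\<close> and its negative.\<close>

lemma alf_bef_square:
 assumes s: "0 < s" "s < p" and F: "F : Tsp s"
 shows "alf (p - s) (alf s F) = 0" "bef (p - s) (bef s F) = 0"
  "bef (p - s) (alf s F) = - alf (p - s) (bef s F)"
proof -
 obtain w where w: "w : bh (p - 1 - s) 0" "dg (alf s F) = Yu ^ p * w" "dg (bef s F) = - (Xu ^ p * w)"
  "\<And>m. bc w m 0 = bc (dg (alf s F)) m 0"
  using dg_alf_bef[OF s F] by blast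
 have s': "0 < p - s" "p - s < p" and ps: "p - (p - s) = s" using s by auto
 have Dw: "Delta ^ s * w : bh (p - 1) s" using bh_mult[OF Delta_power_in_bh w(1), of s] s by simp
 have 1: "Delta ^ s * dg (alf s F) = Xu ^ p * 0 + Yu ^ p * (Delta ^ s * w)" by (simp add: w(2) mult_ac)
 have 2: "Delta ^ s * dg (bef s F) = Xu ^ p * (- (Delta ^ s * w)) + Yu ^ p * 0" by (simp add: w(3) mult_ac)
 note A = alf_bef_unique[OF s' alf_in_Tsp[OF s F], unfolded ps, OF bh_0 Dw 1]
 note B = alf_bef_unique[OF s' bef_in_Tsp[OF s F], unfolded ps, OF bh_uminus[OF Dw] bh_0 2]
 from A B show "alf (p - s) (alf s F) = 0" "bef (p - s) (bef s F) = 0"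
  "bef (p - s) (alf s F) = - alf (p - s) (bef s F)" by simp_all
qed

lemma alf_bef_add:
 assumes s: "0 < s" "s < p" and F: "F : Tsp s" and G: "G : Tsp s"
 shows "alf s (F + G) = alf s F + alf s G" "bef s (F + G) = bef s F + bef s G"
proof -
 have *: "Delta ^ (p - s) * dg (F + G) = Xu ^ p * (alf s F + alf s G) + Yu ^ p * (bef s F + bef s G)"
  using Delta_dg[OF s F] Delta_dg[OF s G] by (simp add: algebra_simps)
 show "alf s (F + G) = alf s F + alf s G" "bef s (F + G) = bef s F + bef s G"
  using alf_bef_unique[OF s Tsp_add[OF F G] bh_add[OF alf_in_bh[OF s F] alf_in_bh[OF s G]]
   bh_add[OF bef_in_bh[OF s F] bef_in_bh[OF s G]] *] by auto
qed

lemma alf_bef_cmult: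
 assumes s: "0 < s" "s < p" and F: "F : Tsp s"
 shows "alf s (Cst c * F) = Cst c * alf s F" "bef s (Cst c * F) = Cst c * bef s F"
proof -
 have *: "Delta ^ (p - s) * dg (Cst c * F) = Xu ^ p * (Cst c * alf s F) + Yu ^ p * (Cst c * bef s F)"
  using arg_cong[OF Delta_dg[OF s F], of "(*) (Cst c)"] by (simp add: algebra_simps)
 show "alf s (Cst c * F) = Cst c * alf s F" "bef s (Cst c * F) = Cst c * bef s F"
  using alf_bef_unique[OF s Tsp_cmult[OF F] bh_cmult[OF alf_in_bh[OF s F]] bh_cmult[OF bef_in_bh[OF s F]] *]
  by auto
qed

text \<open>A lift is unique up to some \<open>Delta ^ s * r\<close>, whose coefficients at z^s are
  those of r up to the sign (-1)^s; subtracting the matching r makes the lift canonical.\<close>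

lemma Tsp_lift_normalized:
 fixes H :: "'k fun2"
 assumes s: "s < p" and H: "H : bh (p - 1 + s) 0"
 obtains F where "F : Tsp s" "dg F = H" "s > 0 ==> (\<forall>m<p - s. bc F m s = 0)"
proof -
 obtain F1 where F1: "F1 : Tsp s" "dg F1 = H" using Tsp_lift[OF assms] .
 show ?thesis
 proof (cases "s = 0")
  case False
  define r where "r = Bh (p - 1 - s) 0 (%m j. - ((- 1) ^ s * bc F1 m s))"
  have r: "r : bh (p - 1 - s) 0" by (simp add: r_def)
  note D = Delta_power_in_Tsp[OF s r]
  have "bc (F1 + Delta ^ s * r) m s = 0" if "m < p - s" for m
   using that by (simp add: bc_add[OF Tsp_in_bh[OF F1(1)] Tsp_in_bh[OF D]] bc_Delta_power[OF r])
    (auto simp: r_def bc_Bh simp flip: power_add mult.assoc)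
  moreover have "dg (F1 + Delta ^ s * r) = H" using F1 False by (simp add: zero_power)
  ultimately show ?thesis using that[OF Tsp_add[OF F1(1) D]] by auto
 qed (use F1 that in blast)
qed

text \<open>The restriction sees the upper layer, the coefficients at z^s the lower one.\<close>

lemma Tsp_eq_0I:
 fixes F :: "'k fun2"
 assumes s: "s < p" and F: "F : Tsp s" and h: "\<And>e. e <= p - 1 + s ==> bc (dg F) e 0 = 0"
  and t: "s > 0 ==> (\<forall>m<p - s. bc F m s = 0)"
 shows "F = 0"
proof -
 have d: "dg F : bh (p - 1 + s) 0" using dg_in_bh[OF Tsp_in_bh[OF F]] .
 have "dg F = 0" by (rule bh_eqI[OF d bh_0]) (use h in auto)
 then obtain r where r: "r : bh (p - 1 - s) 0" "F = Delta ^ s * r" using Tsp_dg_eq_0[OF s F] by blast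
 show ?thesis
 proof (cases "s = 0")
  case True
  thus ?thesis using \<open>dg F = 0\<close> dg_bh_0[of F] Tsp_in_bh[OF F] by simp
 next
  case False
  have "r = 0"
  proof (rule bh_eqI[OF r(1) bh_0])
   fix i j :: nat assume i: "i <= p - 1 - s" "j <= 0"
   hence "bc F i s = 0" using t False s by auto
   thus "bc r i j = bc 0 i j" using i by (simp add: r(2) bc_Delta_power[OF r(1)])
  qed
  thus ?thesis by (simp add: r(2))
 qed
qed

end

subsection \<open>The module and its endomorphism ring as types\<close>

text \<open>A type for the direct sum, so that its endomorphisms form a ring type and the Hochschild
  recursion can be written in ring notation. For s >= p the summands are 0, so families over all s
  are the finite direct sum.\<close>

typedef (overloaded) 'k tv = "{F :: nat => 'k::alg_closed_field fun2. \<forall>s. F s : Tsp s}"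
 morphisms tv_fun Abs_tv
 by (rule exI[of _ "%s. 0"]) (simp add: Tsp_0)

setup_lifting type_definition_tv

lemma tv_fun_in_Tsp [simp]: "tv_fun x s : Tsp s"
 using tv_fun[of x] by simp

lemma tv_eqI: "(\<And>s. tv_fun x s = tv_fun y s) ==> x = y"
 by (auto simp: fun_eq_iff simp flip: tv_fun_inject)

lemma Tsp_uminus: "F : Tsp s ==> - F : Tsp s"
 using Tsp_cmult[of F s "-1"] by (simp add: Cst_ring)

instantiation tv :: (alg_closed_field) ab_group_add
begin

lift_definition zero_tv :: "'a tv" is "%s. 0" by (simp add: Tsp_0)
lift_definition plus_tv :: "'a tv => 'a tv => 'a tv" is "%F G s. F s + G s" by (simp add: Tsp_add)
lift_definition uminus_tv :: "'a tv => 'a tv" is "%F s. - F s" by (simp add: Tsp_uminus)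
lift_definition minus_tv :: "'a tv => 'a tv => 'a tv" is "%F G s. F s - G s"
 by (metis Tsp_add Tsp_uminus uminus_add_conv_diff add.commute)

instance by standard (transfer; simp add: fun_eq_iff fun_app algebra_simps)+

end

lift_definition tvs :: "'k::alg_closed_field => 'k tv => 'k tv" is "%c F s. Cst c * F s"
 by (simp add: Tsp_cmult)

lemma tv_fun_simps [simp]: "tv_fun 0 s = 0" "tv_fun (x + y) s = tv_fun x s + tv_fun y s"
 "tv_fun (- x) s = - tv_fun x s" "tv_fun (x - y) s = tv_fun x s - tv_fun y s"
 "tv_fun (tvs c x) s = Cst c * tv_fun x s"
 by (transfer; simp)+

lemma tv_fun_sum: "tv_fun (\<Sum>i\<in>I. f i) s = (\<Sum>i\<in>I. tv_fun (f i) s)"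
 by (induction I rule: infinite_finite_induct) auto

lemma tvs_simps [simp]: "tvs c (x + y) = tvs c x + tvs c y" "tvs 0 x = 0" "tvs 1 x = x" "tvs c 0 = 0"
 "tvs a (tvs b x) = tvs (a * b) x" "tvs c (- x) = - tvs c x" "tvs c (x - y) = tvs c x - tvs c y"
 by (auto intro!: tv_eqI simp: Cst_ring algebra_simps)

lemma tvs_add_left: "tvs (a + b) x = tvs a x + tvs b x" and tvs_uminus_left: "tvs (- a) x = - tvs a x"
 and tvs_diff_left: "tvs (a - b) x = tvs a x - tvs b x"
 by (auto intro!: tv_eqI simp: Cst_ring algebra_simps)

typedef (overloaded) 'k te = "{f :: 'k::alg_closed_field tv => 'k tv.
  (\<forall>x y. f (x + y) = f x + f y) & (\<forall>c x. f (tvs c x) = tvs c (f x))}"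
 morphisms ap Abs_te
 by (rule exI[of _ "%x. x"]) simp

type_synonym 'k tef = "'k ^ 2 => 'k te"

setup_lifting type_definition_te

lemma ap_linear [simp]: "ap a (x + y) = ap a x + ap a y" "ap a (tvs c x) = tvs c (ap a x)"
 using ap[of a] by auto

lemma ap_0 [simp]: "ap a 0 = 0"
 using ap_linear(1)[of a 0 0] by simp

lemma ap_uminus [simp]: "ap a (- x) = - ap a x"
 using ap_linear(1)[of a x "- x"] by (simp add: eq_neg_iff_add_eq_0 add.commute)

lemma ap_diff [simp]: "ap a (x - y) = ap a x - ap a y"
 using ap_linear(1)[of a x "- y"] by simp

lemma ap_sum: "ap a (\<Sum>i\<in>I. f i) = (\<Sum>i\<in>I. ap a (f i))"
 by (induction I rule: infinite_finite_induct) auto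

lemma te_eqI: "(\<And>x. ap a x = ap b x) ==> a = b"
 by (auto simp: fun_eq_iff simp flip: ap_inject)

instantiation te :: (alg_closed_field) ring_1
begin

lift_definition zero_te :: "'a te" is "%x. 0" by simp
lift_definition one_te :: "'a te" is "%x. x" by simp
lift_definition plus_te :: "'a te => 'a te => 'a te" is "%f g x. f x + g x" by (simp add: algebra_simps)
lift_definition uminus_te :: "'a te => 'a te" is "%f x. - f x" by simp
lift_definition minus_te :: "'a te => 'a te => 'a te" is "%f g x. f x - g x" by (simp add: algebra_simps)
lift_definition times_te :: "'a te => 'a te => 'a te" is "%f g x. f (g x)" by simp

instance
proof
 \<comment> \<open>The instance must hold in every characteristic, so a nonzero vector is found
   outside \<open>charp\<close>: the monomial y^(CHAR - 1) in \<open>Tsp 0\<close>.\<close>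
 show "(0 :: 'a te) ~= 1"
 proof
  assume "(0 :: 'a te) = 1"
  hence *: "x = 0" for x :: "'a tv" by transfer (simp add: fun_eq_iff)
  have "mon (CHAR('a) - 1) 0 0 0 : (bh (CHAR('a) - 1) 0 :: 'a fun2 set)" by (rule mon_in_bh) auto
  moreover from this have "theta (mon (CHAR('a) - 1) 0 0 0) = (0 :: 'a fun2)" by (rule theta_right_const)
  ultimately have "mon (CHAR('a) - 1) 0 0 0 : (Tsp 0 :: 'a fun2 set)"
   by (auto simp: Tsp_def)
  hence "tv_fun (Abs_tv ((%s. 0)(0 := mon (CHAR('a) - 1) 0 0 0))) 0 = (mon (CHAR('a) - 1) 0 0 0 :: 'a fun2)"
   by (subst Abs_tv_inverse) (auto simp: Tsp_0)
  hence "(mon (CHAR('a) - 1) 0 0 0 :: 'a fun2) = 0" using * by (metis tv_fun_simps(1))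
  moreover have "bc (mon (CHAR('a) - 1) 0 0 0 :: 'a fun2) 0 0 = 1"
   using bc_mon[of 0 "CHAR('a) - 1" 0 0 0 0] by simp
  ultimately show False by (metis bc_0 zero_neq_one)
 qed
qed (transfer; simp add: fun_eq_iff fun_app algebra_simps)+

end

lemma ap_ring [simp]: "ap 0 x = 0" "ap 1 x = x" "ap (a + b) x = ap a x + ap b x" "ap (- a) x = - ap a x"
 "ap (a - b) x = ap a x - ap b x" "ap (a * b) x = ap a (ap b x)"
 by (transfer; simp)+

lemma ap_sum_left: "ap (\<Sum>i\<in>I. f i) x = (\<Sum>i\<in>I. ap (f i) x)"
 by (induction I rule: infinite_finite_induct) auto

lift_definition sc :: "'k::alg_closed_field => 'k te" is tvs by (simp add: mult.commute)

lemma ap_sc [simp]: "ap (sc c) x = tvs c x" by transfer simp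

lemma sc_simps [simp]: "sc 0 = 0" "sc 1 = 1" and sc_add: "sc (a + b) = sc a + sc b"
 and sc_mult: "sc (a * b) = sc a * sc b" and sc_uminus: "sc (- a) = - sc a"
 and sc_diff: "sc (a - b) = sc a - sc b"
 by (auto intro!: te_eqI simp: tvs_add_left tvs_uminus_left tvs_diff_left mult.commute)

lemma sc_commute: "a * sc c = sc c * a"
 by (auto intro!: te_eqI)

lemma sc_left_commute: "a * (sc c * b) = sc c * (a * b)"
 by (auto intro!: te_eqI)

lemma sc_sum: "sc (\<Sum>i\<in>I. f i) = (\<Sum>i\<in>I. sc (f i))"
 by (induction I rule: infinite_finite_induct) (auto simp: sc_add)

lift_definition pr :: "nat => 'k::alg_closed_field te"
 is "%s x. Abs_tv ((%t. 0)(s := tv_fun x s))"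
 by (auto intro!: tv_eqI simp: Abs_tv_inverse Tsp_0 Tsp_add Tsp_cmult)

lemma tv_fun_pr: "tv_fun (ap (pr s) x) t = (if t = s then tv_fun x s else 0)"
 by transfer (simp add: Abs_tv_inverse Tsp_0)

lemma pr_mult: "pr s * pr t = (if s = t then pr s else 0)"
 by (auto intro!: te_eqI tv_eqI simp: tv_fun_pr)

definition emb :: "nat => 'k::alg_closed_field fun2 => 'k tv"
 where "emb s F = Abs_tv ((%t. 0)(s := F))"

lemma tv_fun_emb: "F : Tsp s ==> tv_fun (emb s F) t = (if t = s then F else 0)"
 by (simp add: emb_def Abs_tv_inverse Tsp_0)

lemma sl2_inverse_unique:
 fixes g h :: "'k::field sl2" assumes "g * h = 1" shows "h = inverse g"
 by (metis assms mult.assoc mult_1_left mult_1_right sl2_left_inverse)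

lemma sl2_inverse_simps [simp]: "inverse (1 :: 'k::field sl2) = 1" "inverse (inverse g) = g"
 "inverse (g * h) = inverse h * inverse g" "g * inverse g = 1" "inverse g * g = 1"
 "g * (inverse g * h) = h" "inverse g * (g * h) = h" for g h :: "'k::field sl2"
proof -
 show "inverse (1 :: 'k sl2) = 1" using sl2_inverse_unique[of "1 :: 'k sl2" 1] by simp
 show "inverse (inverse g) = g" using sl2_inverse_unique[of "inverse g" g] by (simp add: sl2_left_inverse)
 have "g * h * (inverse h * inverse g) = 1"
  by (metis mult.assoc mult_1_left sl2_right_inverse)
 from sl2_inverse_unique[OF this] show "inverse (g * h) = inverse h * inverse g" by simp
qed (simp_all add: sl2_left_inverse sl2_right_inverse flip: mult.assoc)

lemma sl2_mat_1 [simp]: "sl2_mat 1 = mat 1" and sl2_mat_mult: "sl2_mat (g * h) = sl2_mat g ** sl2_mat h"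
 by (transfer; simp)+

lemma det_sl2_mat [simp]: "det (sl2_mat g) = 1"
 using sl2_mat[of g] by simp

lift_definition rho :: "'k::alg_closed_field sl2 => 'k te"
 is "%g x. Abs_tv (%s. subm (sl2_mat (inverse g)) (tv_fun x s))"
 by (auto intro!: tv_eqI simp: Abs_tv_inverse Tsp_subm Tsp_add Tsp_cmult)

lemma tv_fun_rho [simp]: "tv_fun (ap (rho g) x) s = subm (sl2_mat (inverse g)) (tv_fun x s)"
 by transfer (simp add: Abs_tv_inverse Tsp_subm)

lemma rho_1 [simp]: "rho 1 = 1" and rho_mult: "rho (g * h) = rho g * rho h"
 by (auto intro!: te_eqI tv_eqI simp: subm_def sl2_mat_mult matrix_vector_mul_assoc)

lemma rho_inverse [simp]: "rho g * rho (inverse g) = 1" "rho (inverse g) * rho g = 1"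
 "rho g * (rho (inverse g) * a) = a" "rho (inverse g) * (rho g * a) = a"
 by (simp_all flip: rho_mult mult.assoc)

lemma rho_pr: "rho g * pr s = pr s * rho g"
 by (auto intro!: te_eqI tv_eqI simp: tv_fun_pr)

context charp
begin

lemma pr_ge: "p <= s ==> pr s = (0 :: 'k te)"
 using Tsp_ge[OF _ tv_fun_in_Tsp] by (auto intro!: te_eqI tv_eqI simp: tv_fun_pr)

lemma pr_sum: "(\<Sum>s<p. pr s) = (1 :: 'k te)"
proof (intro te_eqI tv_eqI)
 fix x :: "'k tv" and t
 have "tv_fun (ap (\<Sum>s<p. pr s) x) t = (\<Sum>s<p. if s = t then tv_fun x t else 0)"
  by (auto simp: ap_sum_left tv_fun_sum tv_fun_pr intro!: sum.cong)
 thus "tv_fun (ap (\<Sum>s<p. pr s) x) t = tv_fun (ap 1 x) t"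
  using Tsp_ge[OF _ tv_fun_in_Tsp, of t x] by (cases "t < p") (auto simp: sum.delta)
qed

subsection \<open>The two square-zero endomorphisms\<close>

definition alpha :: "'k te"
 where "alpha = Abs_te (%x. Abs_tv (%s. if 0 < s & s < p then alf (p - s) (tv_fun x (p - s)) else 0))"

definition beta :: "'k te"
 where "beta = Abs_te (%x. Abs_tv (%s. if 0 < s & s < p then bef (p - s) (tv_fun x (p - s)) else 0))"

lemma tv_fun_alpha: "tv_fun (ap alpha x) s = (if 0 < s & s < p then alf (p - s) (tv_fun x (p - s)) else 0)"
 and tv_fun_beta: "tv_fun (ap beta x) s = (if 0 < s & s < p then bef (p - s) (tv_fun x (p - s)) else 0)"
proof -
 have T: "alf (p - s) (tv_fun x (p - s)) : Tsp s" "bef (p - s) (tv_fun x (p - s)) : Tsp s" if "0 < s & s < p" for x s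
  using alf_in_Tsp[of "p - s" "tv_fun x (p - s)"] bef_in_Tsp[of "p - s" "tv_fun x (p - s)"] that by auto
 have A: "tv_fun (Abs_tv (%s. if 0 < s & s < p then alf (p - s) (tv_fun x (p - s)) else 0)) s
   = (if 0 < s & s < p then alf (p - s) (tv_fun x (p - s)) else 0)"
  "tv_fun (Abs_tv (%s. if 0 < s & s < p then bef (p - s) (tv_fun x (p - s)) else 0)) s
   = (if 0 < s & s < p then bef (p - s) (tv_fun x (p - s)) else 0)" for x s
  using T by (subst Abs_tv_inverse; auto simp: Tsp_0)+
 have "ap alpha = (%x. Abs_tv (%s. if 0 < s & s < p then alf (p - s) (tv_fun x (p - s)) else 0))"
  "ap beta = (%x. Abs_tv (%s. if 0 < s & s < p then bef (p - s) (tv_fun x (p - s)) else 0))"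
  unfolding alpha_def beta_def
  by (subst Abs_te_inverse, auto intro!: tv_eqI simp: A alf_bef_add alf_bef_cmult)+
 thus "tv_fun (ap alpha x) s = (if 0 < s & s < p then alf (p - s) (tv_fun x (p - s)) else 0)"
  "tv_fun (ap beta x) s = (if 0 < s & s < p then bef (p - s) (tv_fun x (p - s)) else 0)" using A by auto
qed

lemma alpha_alpha [simp]: "alpha * alpha = 0" and beta_beta [simp]: "beta * beta = 0"
 and beta_alpha: "beta * alpha = - (alpha * beta)"
 using alf_bef_square[OF _ _ tv_fun_in_Tsp]
 by (auto intro!: te_eqI tv_eqI simp: tv_fun_alpha tv_fun_beta)

lemma alpha_alpha_left [simp]: "alpha * (alpha * a) = 0" and beta_beta_left [simp]: "beta * (beta * a) = 0"
 and beta_alpha_left: "beta * (alpha * a) = - (alpha * (beta * a))"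
 by (simp_all add: beta_alpha flip: mult.assoc)

lemma alf_bef_0 [simp]: "0 < s ==> s < p ==> alf s 0 = 0" "0 < s ==> s < p ==> bef s 0 = 0"
 using alf_bef_cmult[OF _ _ Tsp_0, of s 0] by auto

lemma pr_alpha: "pr s * alpha = (if 0 < s & s < p then alpha * pr (p - s) else 0)"
 and pr_beta: "pr s * beta = (if 0 < s & s < p then beta * pr (p - s) else 0)"
 by (auto intro!: te_eqI tv_eqI simp: tv_fun_alpha tv_fun_beta tv_fun_pr)

lemma alpha_pr: "alpha * pr s = (if 0 < s & s < p then pr (p - s) * alpha else 0)"
 and beta_pr: "beta * pr s = (if 0 < s & s < p then pr (p - s) * beta else 0)"
 by (auto intro!: te_eqI tv_eqI simp: tv_fun_alpha tv_fun_beta tv_fun_pr)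

lemma frobenius_linear: "(Cst a * Xu + Cst b * Yu) ^ p = Cst (a ^ p) * Xu ^ p + Cst (b ^ p) * (Yu :: 'k fun2) ^ p"
 using freshmans_dream[OF prime_p[folded CHAR] CHAR[symmetric]]
 by (auto simp: fun_eq_iff fun_app fun2_apply power_mult_distrib)

text \<open>A linear substitution turns X^p and Y^p into combinations of each other with p-th powers
  of the matrix entries; uniqueness of the decomposition then shows that the pair transforms by the
  Frobenius twist.\<close>

lemma alf_bef_subm:
 fixes M :: "'k ^ 2 ^ 2"
 assumes s: "0 < s" "s < p" and F: "F : Tsp s" and M: "det M = 1"
 shows "alf s (subm M F) = Cst (M $ 1 $ 1 ^ p) * subm M (alf s F) + Cst (M $ 2 $ 1 ^ p) * subm M (bef s F)"
  "bef s (subm M F) = Cst (M $ 1 $ 2 ^ p) * subm M (alf s F) + Cst (M $ 2 $ 2 ^ p) * subm M (bef s F)"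
proof -
 have "Delta ^ (p - s) * dg (subm M F) = subm M (Delta ^ (p - s) * dg F)"
  by (simp add: subm_Delta M)
 also have "... = Xu ^ p * (Cst (M $ 1 $ 1 ^ p) * subm M (alf s F) + Cst (M $ 2 $ 1 ^ p) * subm M (bef s F))
  + Yu ^ p * (Cst (M $ 1 $ 2 ^ p) * subm M (alf s F) + Cst (M $ 2 $ 2 ^ p) * subm M (bef s F))"
  unfolding Delta_dg[OF s F] by (simp only: subm_simps frobenius_linear) (simp add: algebra_simps)
 finally have *: "Delta ^ (p - s) * dg (subm M F) = ..." .
 show "alf s (subm M F) = Cst (M $ 1 $ 1 ^ p) * subm M (alf s F) + Cst (M $ 2 $ 1 ^ p) * subm M (bef s F)"
  "bef s (subm M F) = Cst (M $ 1 $ 2 ^ p) * subm M (alf s F) + Cst (M $ 2 $ 2 ^ p) * subm M (bef s F)"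
  by (rule alf_bef_unique[OF s Tsp_subm[OF F M] _ _ *];
   intro bh_add bh_cmult subm_in_bh alf_in_bh[OF s F] bef_in_bh[OF s F])+
qed

text \<open>The Koszul differential, an element of \<open>Hom(k^2, End T)\<close>.\<close>

definition D :: "'k tef" where "D x = sc (x $ 1) * alpha + sc (x $ 2) * beta"

text \<open>Equivariance of the Koszul element: passing a group element through \<open>D\<close>
  moves x by the Frobenius image of its inverse. The untwist of the cohomology originates
  here.\<close>

lemma D_rho: "D x * rho g = rho g * D (sl2_mat (frob (inverse g)) *v x)"
proof -
 have "CHAR('k) > 0" using CHAR p3 by simp
 hence N: "sl2_mat (frob (inverse g)) $ i $ j = sl2_mat (inverse g) $ i $ j ^ p" for i j
  by (simp add: sl2_mat_frob CHAR)
 have a: "alpha * rho g = rho g * (sc (sl2_mat (inverse g) $ 1 $ 1 ^ p) * alpha + sc (sl2_mat (inverse g) $ 2 $ 1 ^ p) * beta)"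
  and b: "beta * rho g = rho g * (sc (sl2_mat (inverse g) $ 1 $ 2 ^ p) * alpha + sc (sl2_mat (inverse g) $ 2 $ 2 ^ p) * beta)"
  by (auto intro!: te_eqI tv_eqI simp: tv_fun_alpha tv_fun_beta alf_bef_subm)
 have "D x * rho g = sc (x $ 1) * (alpha * rho g) + sc (x $ 2) * (beta * rho g)"
  by (simp add: D_def distrib_right mult.assoc)
 also have "... = rho g * D (sl2_mat (frob (inverse g)) *v x)"
  unfolding a b by (rule te_eqI) (simp add: D_def matvec_2 N tvs_add_left mult.commute add_ac)
 finally show ?thesis .
qed

end

context charp
begin

subsection \<open>A basis over the exterior algebra\<close>

definition eps :: "'k te" where "eps = alpha * beta"

lemma eps_simps [simp]: "alpha * eps = 0" "eps * alpha = 0" "beta * eps = 0" "eps * beta = 0" "eps * eps = 0"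
 "alpha * (eps * a) = 0" "eps * (alpha * a) = 0" "beta * (eps * a) = 0" "eps * (beta * a) = 0"
 "eps * (eps * a) = 0"
 by (simp_all add: eps_def mult.assoc beta_alpha beta_alpha_left)

lemma ap_alpha_beta [simp]: "ap alpha (ap alpha v) = 0" "ap beta (ap beta v) = 0" "ap alpha (ap beta v) = ap eps v"
 "ap beta (ap alpha v) = - ap eps v" "ap alpha (ap eps v) = 0" "ap beta (ap eps v) = 0"
 "ap eps (ap alpha v) = 0" "ap eps (ap beta v) = 0" "ap eps (ap eps v) = 0"
 by (simp_all add: eps_def beta_alpha beta_alpha_left mult.assoc flip: ap_ring(6))

text \<open>The sign (-1)^s comes from the top coefficient of \<open>alf\<close>, the rest from
  \<open>bc_dg_bef\<close>. Dividing by it makes \<open>tf s m\<close> take the value 1 on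
  \<open>eps\<close> applied to the generator \<open>lb s m\<close>, for s > 0.\<close>

definition kap :: "nat => nat => 'k"
 where "kap s m = (if s = 0 then 1 else - ((- 1) ^ s * ((- 1) ^ m * of_nat ((p - s - 1) choose m))))"

definition tf :: "nat => nat => 'k tv => 'k"
 where "tf s m v = bc (tv_fun v s) m s / kap s m"

lemma kap_neq_0: "m < p - s ==> kap s m ~= 0"
proof (cases "s = 0")
 case False
 assume m: "m < p - s"
 have "~ p dvd ((p - s - 1) choose m)"
 proof
  assume "p dvd ((p - s - 1) choose m)"
  also have "... dvd fact m * fact (p - s - 1 - m) * ((p - s - 1) choose m)" by simp
  also have "... = fact (p - s - 1)" using m by (intro binomial_fact_lemma) simp
  finally show False using prime_dvd_fact_iff[OF prime_p, of "p - s - 1"] m False by simp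
 qed
 thus ?thesis using False by (simp add: kap_def of_nat_0_iff)
qed (simp add: kap_def)

lemma tf_linear [simp]: "tf s m (x + y) = tf s m x + tf s m y" "tf s m (tvs c x) = c * tf s m x"
 "tf s m 0 = 0" "tf s m (- x) = - tf s m x"
 using bc_add[OF Tsp_in_bh Tsp_in_bh, of "tv_fun x s" s "tv_fun y s" s]
  bc_cmult[OF Tsp_in_bh, of "tv_fun x s" s c] bc_uminus[OF Tsp_in_bh, of "tv_fun x s" s]
 by (simp_all add: tf_def add_divide_distrib)

lemma tf_sum: "tf s m (\<Sum>i\<in>I. f i) = (\<Sum>i\<in>I. tf s m (f i))"
 by (induction I rule: infinite_finite_induct) auto

lemma tf_alpha: "0 < s ==> s < p ==> m < p - s ==>
  tf s m (ap alpha v) = (- 1) ^ s * bc (dg (tv_fun v (p - s))) (p + m) 0 / kap s m"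
 and tf_beta: "0 < s ==> s < p ==> m < p - s ==>
  tf s m (ap beta v) = (- 1) ^ s * bc (dg (tv_fun v (p - s))) m 0 / kap s m"
 using bc_alf_top[of "p - s" "tv_fun v (p - s)" m] bc_bef_top[of "p - s" "tv_fun v (p - s)" m]
 by (simp_all add: tf_def tv_fun_alpha tv_fun_beta)

lemma tf_eps:
 assumes "0 < s" "s < p" "m < p - s"
 shows "tf s m (ap eps v) = bc (dg (tv_fun v s)) (s + m) 0"
proof -
 have "tf s m (ap alpha (ap beta v)) = (- 1) ^ s * bc (dg (bef s (tv_fun v s))) (p + m) 0 / kap s m"
  using assms by (subst tf_alpha) (simp_all add: tv_fun_beta)
 also have "... = kap s m * bc (dg (tv_fun v s)) (s + m) 0 / kap s m"
  using assms by (subst bc_dg_bef) (simp_all add: kap_def add.commute)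
 finally show ?thesis using kap_neq_0[OF assms(3)] by simp
qed

lemma tf_pr: "tf s m (ap (pr t) v) = (if s = t then tf s m v else 0)"
 by (auto simp: tf_def tv_fun_pr)

text \<open>Generators over the exterior algebra. The images of \<open>alpha\<close> and
  \<open>beta\<close> restrict to multiples of Y^p and X^p, which occupy the exponents below s and
  from p on; the middle exponents s + j with j < p - s need generators. The last condition removes
  the socle part of the lift.\<close>

definition lb :: "nat => nat => 'k tv"
 where "lb s j = emb s (SOME F. F : Tsp s & dg F = mon (p - 1 + s) 0 (s + j) 0 \<and>
  (s > 0 --> (\<forall>m<p - s. bc F m s = 0)))"

definition Idx :: "(nat \<times> nat) set" where "Idx = (SIGMA s:{..<p}. {..<p - s})"

lemma finite_Idx [simp]: "finite Idx" by (simp add: Idx_def)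

lemma Idx_iff: "(s, j) : Idx \<longleftrightarrow> s < p & j < p - s" by (auto simp: Idx_def)

lemma lb_props:
 assumes "s < p" "j < p - s"
 shows "dg (tv_fun (lb s j) s) = mon (p - 1 + s) 0 (s + j) 0" "t ~= s ==> tv_fun (lb s j) t = 0"
  "s > 0 ==> m < p - s ==> bc (tv_fun (lb s j) s) m s = 0" "ap (pr t) (lb s j) = (if t = s then lb s j else 0)"
proof -
 define P where "P F \<longleftrightarrow> F : Tsp s & dg F = mon (p - 1 + s) 0 (s + j) 0 & (s > 0 --> (\<forall>m<p - s. bc F m s = 0))"
  for F :: "'k fun2"
 define F where "F = (SOME F. P F)"
 have mb: "(mon (p - 1 + s) 0 (s + j) 0 :: 'k fun2) : bh (p - 1 + s) 0"
  using assms by (intro mon_in_bh) auto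
 from Tsp_lift_normalized[OF assms(1) mb] obtain F' where "P F'" unfolding P_def by metis
 hence "P F" unfolding F_def by (rule someI[of P])
 hence F: "F : Tsp s" "dg F = mon (p - 1 + s) 0 (s + j) 0" "s > 0 ==> \<forall>m<p - s. bc F m s = 0"
  by (auto simp: P_def)
 have l: "lb s j = emb s F" by (simp add: lb_def F_def P_def)
 show "dg (tv_fun (lb s j) s) = mon (p - 1 + s) 0 (s + j) 0" "t ~= s ==> tv_fun (lb s j) t = 0"
  "s > 0 ==> m < p - s ==> bc (tv_fun (lb s j) s) m s = 0"
  using F by (simp_all add: l tv_fun_emb)
 show "ap (pr t) (lb s j) = (if t = s then lb s j else 0)"
  using F by (auto intro!: tv_eqI simp: l tv_fun_emb tv_fun_pr)
qed

lemma bc_dg_lb: "(s', j) : Idx ==> bc (dg (tv_fun (lb s' j) s)) e 0 = (if s = s' & e = s' + j then 1 else 0)"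
 by (cases "s = s'") (auto simp: Idx_iff lb_props bc_mon)

lemma tf_lb:
 assumes "0 < s" "(s, m) : Idx" "(s', j) : Idx"
 shows "tf s m (lb s' j) = 0" "tf s m (ap alpha (lb s' j)) = 0" "tf s m (ap beta (lb s' j)) = 0"
  "tf s m (ap eps (lb s' j)) = (if s' = s & j = m then 1 else 0)"
proof -
 show "tf s m (lb s' j) = 0"
  using assms by (cases "s' = s") (auto simp: Idx_iff tf_def lb_props)
 show "tf s m (ap alpha (lb s' j)) = 0" "tf s m (ap beta (lb s' j)) = 0"
  "tf s m (ap eps (lb s' j)) = (if s' = s & j = m then 1 else 0)"
  using assms bc_dg_lb[OF assms(3)] by (auto simp: Idx_iff tf_alpha tf_beta tf_eps)
qed

lemma tf_0_lb: "(s', j) : Idx ==> tf 0 m (lb s' j) = (if s' = 0 & j = m then 1 else 0)"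
 using bc_dg_lb[of s' j 0 m] dg_bh_0[OF Tsp_in_bh[OF tv_fun_in_Tsp], of "lb s' j"]
 by (auto simp: tf_def kap_def)

lemma tf_0_alpha_beta [simp]: "tf 0 m (ap alpha v) = 0" "tf 0 m (ap beta v) = 0" "tf 0 m (ap eps v) = 0"
 by (simp_all add: tf_def tv_fun_alpha tv_fun_beta flip: ap_alpha_beta(3))

text \<open>Coordinates of v along \<open>lb\<close>, \<open>alpha lb\<close>,
  \<open>beta lb\<close>, \<open>eps lb\<close>. An exterior algebra is a Frobenius algebra:
  \<open>tf\<close> reads the \<open>eps\<close>-coordinate, and the others are read after
  multiplication by the complementary monomial; the sign in \<open>c1\<close> is that of
  \<open>beta * alpha = - eps\<close>. For s = 0 only the first coordinate exists.\<close>

definition c0 where "c0 s m v = (if s = 0 then tf 0 m v else tf s m (ap eps v))"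
definition c1 where "c1 s m v = (if s = 0 then 0 else - tf s m (ap beta v))"
definition c2 where "c2 s m v = (if s = 0 then 0 else tf s m (ap alpha v))"
definition c3 where "c3 s m v = (if s = 0 then 0 else tf s m v)"

lemmas c_defs = c0_def c1_def c2_def c3_def

lemma c_linear: "c0 s m (x + y) = c0 s m x + c0 s m y" "c1 s m (x + y) = c1 s m x + c1 s m y"
 "c2 s m (x + y) = c2 s m x + c2 s m y" "c3 s m (x + y) = c3 s m x + c3 s m y"
 "c0 s m (tvs a x) = a * c0 s m x" "c1 s m (tvs a x) = a * c1 s m x"
 "c2 s m (tvs a x) = a * c2 s m x" "c3 s m (tvs a x) = a * c3 s m x"
 by (simp_all add: c_defs)

lemma eps_pr: "eps * pr s = pr s * eps"
 by (auto intro!: te_eqI tv_eqI simp: tv_fun_alpha tv_fun_beta tv_fun_pr simp flip: ap_alpha_beta(3))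

lemma ap_pr_alpha_beta:
 "ap alpha (ap (pr s) v) = (if 0 < s & s < p then ap (pr (p - s)) (ap alpha v) else 0)"
 "ap beta (ap (pr s) v) = (if 0 < s & s < p then ap (pr (p - s)) (ap beta v) else 0)"
 "ap eps (ap (pr s) v) = ap (pr s) (ap eps v)"
 using arg_cong[OF alpha_pr, of "%a. ap a v" s] arg_cong[OF beta_pr, of "%a. ap a v" s]
  arg_cong[OF eps_pr, of "%a. ap a v" s]
 by (auto split: if_splits)

text \<open>The endomorphism over the exterior algebra sending the generator \<open>(s, m)\<close> to \<open>q\<close> and the others to \<open>0\<close>.\<close>

definition mkf :: "nat => nat => 'k tv => 'k tv => 'k tv"
 where "mkf s m q v = tvs (c0 s m v) (ap (pr s) q) + tvs (c1 s m v) (ap alpha (ap (pr s) q))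
  + tvs (c2 s m v) (ap beta (ap (pr s) q)) + tvs (c3 s m v) (ap eps (ap (pr s) q))"

definition mk :: "nat => nat => 'k tv => 'k te" where "mk s m q = Abs_te (mkf s m q)"

lemma ap_mk: "ap (mk s m q) v = mkf s m q v"
 unfolding mk_def by (subst Abs_te_inverse) (auto simp: mkf_def c_linear tvs_add_left)

definition KK :: "'k te set"
 where "KK = {f. f * alpha = alpha * f & f * beta = beta * f & (\<forall>s. f * pr s = pr s * f)}"

lemma c_alpha: "s > 0 ==> c0 s m (ap alpha v) = 0" "s > 0 ==> c1 s m (ap alpha v) = c0 s m v"
 "s > 0 ==> c2 s m (ap alpha v) = 0" "s > 0 ==> c3 s m (ap alpha v) = c2 s m v"
 "s > 0 ==> c0 s m (ap beta v) = 0" "s > 0 ==> c1 s m (ap beta v) = 0"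
 "s > 0 ==> c2 s m (ap beta v) = c0 s m v" "s > 0 ==> c3 s m (ap beta v) = - c1 s m v"
 by (simp_all add: c_defs)

text \<open>By \<open>c_alpha\<close> the coordinates change under \<open>alpha\<close> and
  \<open>beta\<close> like those of a free module of rank one, so sending the generator to any
  vector of its component extends linearly over the exterior algebra.\<close>

lemma mk_in_KK: "mk s m q : KK"
proof (cases "s < p")
 case False
 hence "mk s m q = 0" by (intro te_eqI) (simp add: ap_mk mkf_def pr_ge)
 thus ?thesis by (simp add: KK_def)
next
 case sp: True
 have "mk s m q * alpha = alpha * mk s m q & mk s m q * beta = beta * mk s m q"
  using sp by (cases "s = 0"; intro conjI te_eqI)
   (simp_all add: ap_mk mkf_def c_alpha ap_pr_alpha_beta tvs_uminus_left, simp_all add: c_defs)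
 moreover have "mk s m q * pr t = pr t * mk s m q" for t
 proof (cases "s < p & t < p")
  case True
  have pp: "ap (pr a) (ap (pr b) x) = (if a = b then ap (pr a) x else 0)" for a b and x :: "'k tv"
   by (simp add: pr_mult flip: ap_ring(6))
  show ?thesis
  proof (cases "s = 0")
   case 0: True
   show ?thesis
    by (rule te_eqI) (auto simp: 0 ap_mk mkf_def c_defs tf_pr ap_pr_alpha_beta pp)
  next
   case False
   have *: "c0 s m (ap (pr t) v) = (if t = s then c0 s m v else 0)" "c3 s m (ap (pr t) v) = (if t = s then c3 s m v else 0)"
    "c1 s m (ap (pr t) v) = (if t = p - s then c1 s m v else 0)" "c2 s m (ap (pr t) v) = (if t = p - s then c2 s m v else 0)" for v
    using False True by (auto simp: c_defs ap_pr_alpha_beta tf_pr)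
   show ?thesis
    by (rule te_eqI) (use False True in \<open>auto simp: ap_mk mkf_def * ap_pr_alpha_beta pp\<close>)
  qed
 next
  case False
  hence "pr t = (0 :: 'k te) | pr s = (0 :: 'k te)" using pr_ge[of t] pr_ge[of s] by auto
  thus ?thesis by (intro te_eqI) (auto simp: ap_mk mkf_def c_linear c_defs)
 qed
 ultimately show ?thesis by (simp add: KK_def)
qed

lemma KK_ap: "f : KK ==> ap f (ap alpha v) = ap alpha (ap f v)" "f : KK ==> ap f (ap beta v) = ap beta (ap f v)"
 "f : KK ==> ap f (ap (pr s) v) = ap (pr s) (ap f v)" "f : KK ==> ap f (ap eps v) = ap eps (ap f v)"
proof -
 assume *: "f : KK"
 hence a: "ap (f * alpha) v = ap (alpha * f) v" and b: "ap (f * beta) v = ap (beta * f) v"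
  and c: "ap (f * pr s) v = ap (pr s * f) v" for v by (auto simp: KK_def)
 thus "ap f (ap alpha v) = ap alpha (ap f v)" "ap f (ap beta v) = ap beta (ap f v)"
  "ap f (ap (pr s) v) = ap (pr s) (ap f v)" "ap f (ap eps v) = ap eps (ap f v)"
  by (simp_all flip: ap_alpha_beta(3))
qed

lemma KK_mult_mk: "f : KK ==> f * mk s m q = mk s m (ap f q)"
 by (rule te_eqI) (simp add: ap_mk mkf_def KK_ap)

lemma mk_lb:
 assumes "(s, m) : Idx" "(s', j) : Idx"
 shows "ap (mk s m q) (lb s' j) = (if s' = s & j = m then ap (pr s) q else 0)"
 using tf_lb[OF _ assms] tf_0_lb[OF assms(2)]
 by (cases "s = 0") (auto simp: ap_mk mkf_def c_defs)

text \<open>The four families exhaust the data of a vector in \<open>Tsp s\<close>: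
  \<open>tf\<close> sees the socle, and among the exponents of the restriction \<open>beta\<close>
  detects those below s, \<open>alpha\<close> those from p on, \<open>eps\<close> the middle
  ones.\<close>

lemma tf_nondegenerate:
 assumes "\<And>s m. (s, m) : Idx ==> tf s m v = 0"
  "\<And>s m. 0 < s ==> (s, m) : Idx ==> tf s m (ap alpha v) = 0"
  "\<And>s m. 0 < s ==> (s, m) : Idx ==> tf s m (ap beta v) = 0"
  "\<And>s m. 0 < s ==> (s, m) : Idx ==> tf s m (ap eps v) = 0"
 shows "v = 0"
proof (rule tv_eqI)
 fix s
 show "tv_fun v s = tv_fun 0 s"
 proof (cases "s < p")
  case True
  have t: "bc (tv_fun v s) m s = 0" if "m < p - s" for m
   using assms(1)[of s m] kap_neq_0[OF that] True that by (simp add: tf_def Idx_iff)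
  have "tv_fun v s = 0"
  proof (rule Tsp_eq_0I[OF True tv_fun_in_Tsp])
   fix e assume e: "e <= p - 1 + s"
   show "bc (dg (tv_fun v s)) e 0 = 0"
   proof (cases "s = 0")
    case True
    thus ?thesis
     using t[of e] e p3 dg_bh_0[OF Tsp_in_bh[OF tv_fun_in_Tsp], of v] by simp
   next
    case False
    consider "e < s" | "p <= e" | m where "e = s + m" "m < p - s"
     using le_Suc_ex[of s e] by (metis add_less_cancel_left le_add_diff_inverse less_imp_le not_le True)
    thus ?thesis
    proof cases
     case 1
     thus ?thesis using assms(3)[of "p - s" e] kap_neq_0[of e "p - s"] True False
      by (simp add: Idx_iff tf_beta)
    next
     case 2
     then obtain m where m: "e = p + m" using le_Suc_ex by blast
     hence "m < s" using e p3 by simp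
     thus ?thesis using assms(2)[of "p - s" m] kap_neq_0[of m "p - s"] True False
      by (simp add: Idx_iff tf_alpha m)
    next
     case 3
     thus ?thesis using assms(4)[of s m] True False by (simp add: Idx_iff tf_eps)
    qed
   qed
  qed (use t in auto)
  thus ?thesis by simp
 qed (use Tsp_ge[OF _ tv_fun_in_Tsp, of s v] in auto)
qed

text \<open>A dual basis identity. Both sides commute with \<open>alpha\<close>, \<open>beta\<close>
  and \<open>eps\<close>, so by nondegeneracy it suffices to compare the values of
  \<open>tf\<close>.\<close>

lemma mk_lb_expansion: "(\<Sum>(s, j)\<in>Idx. mk s j (lb s j)) = 1"
proof (rule te_eqI)
 fix v
 define P where "P = (\<Sum>(s, j)\<in>Idx. mk s j (lb s j))"
 have P: "ap P v = (\<Sum>(s, j)\<in>Idx. mkf s j (lb s j) v)" for v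
  by (simp add: P_def ap_sum_left case_prod_unfold ap_mk)
 have "P * alpha = alpha * P" "P * beta = beta * P"
  unfolding P_def sum_distrib_left sum_distrib_right using mk_in_KK
  by (auto simp: KK_def case_prod_unfold intro!: sum.cong)
 hence "ap (P * alpha) v = ap (alpha * P) v" "ap (P * beta) v = ap (beta * P) v" for v by simp_all
 hence comm: "ap P (ap alpha v) = ap alpha (ap P v)" "ap P (ap beta v) = ap beta (ap P v)"
  "ap P (ap eps v) = ap eps (ap P v)" for v
  by (simp_all flip: ap_alpha_beta(3))
 have tfP: "tf s m (ap P v) = tf s m v" if sm: "(s, m) : Idx" for s m v
 proof -
  have "tf s m (ap P v) = (\<Sum>i\<in>Idx. tf s m (mkf (fst i) (snd i) (lb (fst i) (snd i)) v))"
   by (simp add: P tf_sum case_prod_unfold)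
  also have "... = (\<Sum>i\<in>Idx. if i = (s, m) then tf s m v else 0)"
  proof (intro sum.cong refl)
   fix i assume "i : Idx"
   then obtain s' j where i: "i = (s', j)" "(s', j) : Idx" by (cases i) auto
   hence pl: "ap (pr s') (lb s' j) = lb s' j" by (simp add: Idx_iff lb_props)
   show "tf s m (mkf (fst i) (snd i) (lb (fst i) (snd i)) v) = (if i = (s, m) then tf s m v else 0)"
    using tf_lb[OF _ sm i(2)] tf_0_lb[OF i(2)]
    by (cases "s = 0") (auto simp: i(1) mkf_def pl c_defs)
  qed
  also have "... = tf s m v" using sm by simp
  finally show ?thesis .
 qed
 have d: "tf s m (x - y) = tf s m x - tf s m y" for s m x y
  using tf_linear(1)[of s m x "- y"] by simp
 have "ap P v - v = 0"
  by (rule tf_nondegenerate) (simp_all add: d tfP flip: comm)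
 thus "ap (\<Sum>(s, j)\<in>Idx. mk s j (lb s j)) v = ap 1 v" by (simp add: P_def)
qed

lemma KK_expansion:
 assumes "f : KK" shows "f = (\<Sum>(s, j)\<in>Idx. mk s j (ap f (lb s j)))"
proof -
 have "f = f * (\<Sum>(s, j)\<in>Idx. mk s j (lb s j))" by (simp add: mk_lb_expansion)
 thus ?thesis by (simp add: sum_distrib_left case_prod_unfold KK_mult_mk[OF assms])
qed

end

subsection \<open>Distributions acting on polynomial functions\<close>

lemma sl2_mat_entries_det: "sl2_mat g $ 1 $ 1 * sl2_mat g $ 2 $ 2 - sl2_mat g $ 1 $ 2 * sl2_mat g $ 2 $ 1 = 1"
 using det_sl2_mat[of g] by (simp add: det_2)

lemma sl2_mat_inverse_entries: fixes g :: "'k::field sl2"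
 shows "sl2_mat (inverse g) $ 1 $ 1 = sl2_mat g $ 2 $ 2" "sl2_mat (inverse g) $ 1 $ 2 = - sl2_mat g $ 1 $ 2"
 "sl2_mat (inverse g) $ 2 $ 1 = - sl2_mat g $ 2 $ 1" "sl2_mat (inverse g) $ 2 $ 2 = sl2_mat g $ 1 $ 1"
proof -
 define A :: "'k ^ 2 ^ 2" where "A = (\<chi> i j. if i = 1 then (if j = 1 then sl2_mat g $ 2 $ 2 else - sl2_mat g $ 1 $ 2)
  else (if j = 1 then - sl2_mat g $ 2 $ 1 else sl2_mat g $ 1 $ 1))"
 have A: "A $ 1 $ 1 = sl2_mat g $ 2 $ 2" "A $ 1 $ 2 = - sl2_mat g $ 1 $ 2"
  "A $ 2 $ 1 = - sl2_mat g $ 2 $ 1" "A $ 2 $ 2 = sl2_mat g $ 1 $ 1" by (simp_all add: A_def)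
 have "det A = 1" using sl2_mat_entries_det[of g] by (simp add: det_2 A algebra_simps)
 hence m: "sl2_mat (Abs_sl2 A) = A" by (simp add: Abs_sl2_inverse)
 have "sl2_mat (g * Abs_sl2 A) = sl2_mat 1"
  using sl2_mat_entries_det[of g]
  by (simp add: sl2_mat_mult m vec_eq_iff forall_2 matrix_matrix_mult_def sum_2 A mat_def algebra_simps)
 hence "g * Abs_sl2 A = 1" by (metis sl2_mat_inject)
 hence "inverse g = Abs_sl2 A" using sl2_inverse_unique by metis
 thus "sl2_mat (inverse g) $ 1 $ 1 = sl2_mat g $ 2 $ 2" "sl2_mat (inverse g) $ 1 $ 2 = - sl2_mat g $ 1 $ 2"
  "sl2_mat (inverse g) $ 2 $ 1 = - sl2_mat g $ 2 $ 1" "sl2_mat (inverse g) $ 2 $ 2 = sl2_mat g $ 1 $ 1"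
  using m A by simp_all
qed

lemma regular_cmult: "f : regular_funs ==> (%g. c * f g) : regular_funs"
 by (rule regular_funs.mult[OF regular_funs.const])

lemma regular_uminus: "f : regular_funs ==> (%g. - f g) : regular_funs"
 using regular_cmult[of f "-1"] by simp

lemma regular_power: "f : regular_funs ==> (%g. f g ^ n) : regular_funs"
 by (induction n) (auto intro: regular_funs.intros)

lemma regular_entry_inverse: "(%g :: 'k::field sl2. sl2_mat (inverse g) $ i $ j) : regular_funs"
 using exhaust_2[of i] exhaust_2[of j]
 by (auto simp: sl2_mat_inverse_entries intro: regular_uminus[OF regular_funs.entry] regular_funs.entry)

lemma sl2_mat_mult_entry: "sl2_mat (g * h) $ i $ j = sl2_mat g $ i $ 1 * sl2_mat h $ 1 $ j + sl2_mat g $ i $ 2 * sl2_mat h $ 2 $ j"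
 by (simp add: sl2_mat_mult matrix_matrix_mult_def sum_2)

lemma regular_translate: "f : regular_funs ==> (%g. f (a * g * b)) : regular_funs"
proof (induction rule: regular_funs.induct)
 case (entry i j)
 show ?case unfolding sl2_mat_mult_entry
  by (intro regular_funs.add regular_funs.mult regular_funs.entry regular_funs.const)
qed (auto intro: regular_funs.intros)

text \<open>The tensors in k[G] (x) \<open>bh m s\<close>, seen as functions of g: the families on
  which a distribution can be evaluated coefficientwise.\<close>

inductive_set regfam :: "nat => nat => ('k::alg_closed_field sl2 => 'k fun2) set" for m s where
 base: "f : regular_funs ==> F : bh m s ==> (%g. Cst (f g) * F) : regfam m s"
| add: "A : regfam m s ==> H : regfam m s ==> (%g. A g + H g) : regfam m s"

lemma regfam_mult_base:
 assumes "H : regfam m' s'" "f : regular_funs" "F : bh m s"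
 shows "(%g. (Cst (f g) * F) * H g) : regfam (m + m') (s + s')"
 using assms(1)
proof (induction rule: regfam.induct)
 case (base h G)
 have "(%g. Cst (f g * h g) * (F * G)) : regfam (m + m') (s + s')"
  using base assms by (intro regfam.base regular_funs.mult bh_mult)
 thus ?case by (simp add: Cst_ring mult_ac)
next
 case (add H1 H2) thus ?case by (simp add: distrib_left regfam.add)
qed

lemma regfam_mult: "A : regfam m s ==> H : regfam m' s' ==> (%g. A g * H g) : regfam (m + m') (s + s')"
proof (induction rule: regfam.induct)
 case (base f F) thus ?case by (intro regfam_mult_base)
next
 case (add A1 A2) thus ?case by (simp add: distrib_right regfam.add)
qed

lemma regfam_power: "F : regfam m s ==> (%g. F g ^ n) : regfam (n * m) (n * s)"
proof (induction n)
 case 0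
 show ?case using regfam.base[OF regular_funs.const[of 1] Cst_in_bh[of 1]] by simp
next
 case (Suc n) thus ?case using regfam_mult[OF Suc.prems Suc.IH[OF Suc.prems]] by simp
qed

lemma regfam_cmult: "F : regfam m s ==> (%g. Cst c * F g) : regfam m s"
 using regfam_mult_base[of F m s "%g. c" 1 0 0] Cst_in_bh[of 1]
 by (simp add: regular_funs.const)

lemma regfam_linear:
 "(%g. Cst (sl2_mat (inverse g) $ i $ j) * Xu + Cst (sl2_mat (inverse g) $ i' $ j') * Yu) : regfam 1 0"
 "(%g. Cst (sl2_mat (inverse g) $ i $ j) * Xv + Cst (sl2_mat (inverse g) $ i' $ j') * Yv) : regfam 0 1"
 by (rule regfam.add; rule regfam.base; rule regular_entry_inverse Xu_in_bh Yu_in_bh Xv_in_bh Yv_in_bh)+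

lemma regfam_subm:
 fixes F :: "'k::alg_closed_field fun2"
 shows "F : bh m s ==> (%g. subm (sl2_mat (inverse g)) F) : regfam m s"
proof (induction rule: bh_induct)
 case zero
 show ?case using regfam.base[OF regular_funs.const[of 0] bh_0, of m s] by simp
next
 case (add F G) thus ?case by (simp add: regfam.add)
next
 case (cmult c F) thus ?case by (simp add: regfam_cmult)
next
 case (mon i j)
 have "(%g. subm (sl2_mat (inverse g)) (mon m s i j)) : regfam (i * 1 + (m - i) * 1 + j * 0 + (s - j) * 0)
   (i * 0 + (m - i) * 0 + j * 1 + (s - j) * 1)"
  unfolding mon_def subm_simps
  by (intro regfam_mult regfam_power regfam_linear)
 thus ?case using mon by simp
qed

text \<open>Linear forms that factor through k[G_1]; \<open>distributions_G1_eq\<close> identifies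
  them with the distributions, by nilpotency of the augmentation ideal.\<close>

definition dist0 :: "'k::field dist set"
 where "dist0 = {m : regular_funs \<rightarrow>\<^sub>E UNIV.
  (\<forall>f\<in>regular_funs. \<forall>h\<in>regular_funs. m (%x. f x + h x) = m f + m h) \<and>
  (\<forall>c. \<forall>f\<in>regular_funs. m (%x. c * f x) = c * m f) \<and>
  (\<forall>f\<in>aug_ideal. \<forall>h\<in>regular_funs. m (%x. h x * f (frob x)) = 0)}"

lemma dist0_add: "m : dist0 ==> f : regular_funs ==> h : regular_funs ==> m (%x. f x + h x) = m f + m h"
 and dist0_cmult: "m : dist0 ==> f : regular_funs ==> m (%x. c * f x) = c * m f"
 by (auto simp: dist0_def)

lemma dist0_0: "m : dist0 ==> m (%x. 0) = 0"
 using dist0_cmult[OF _ regular_funs.const, of m 0 0] by simp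

text \<open>A function pulled back along Frobenius differs from its value at 1 by a generator of the
  ideal of \<open>G_1\<close>, so a distribution treats it as a constant.\<close>

lemma dist0_frob:
 assumes "m : dist0" "h : regular_funs" "f : regular_funs" "(%x. f (frob x)) : regular_funs"
 shows "m (%x. h x * f (frob x)) = f 1 * m h"
proof -
 define f' where "f' = (%x. f x + (- f 1))"
 have "f' : regular_funs" unfolding f'_def by (intro regular_funs.add assms regular_funs.const)
 hence a: "f' : aug_ideal" by (simp add: aug_ideal_def) (simp add: f'_def)
 have "(%x. f' (frob x)) : regular_funs" unfolding f'_def by (intro regular_funs.add assms regular_funs.const)
 hence r: "(%x. h x * f' (frob x)) : regular_funs" by (rule regular_funs.mult[OF assms(2)])
 have "m (%x. h x * f (frob x)) = m (%x. h x * f' (frob x) + f 1 * h x)"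
  by (simp add: f'_def algebra_simps)
 also have "... = 0 + f 1 * m h"
  using assms(1,2) a unfolding dist0_add[OF assms(1) r regular_cmult[OF assms(2)]]
  by (auto simp: dist0_def)
 finally show ?thesis by simp
qed

text \<open>The action of a distribution on a rational module: apply it to the comodule map, here g
  -> F(g^-1 u, g^-1 v).\<close>

definition conv :: "(('k::alg_closed_field sl2 => 'k) => 'k) => 'k fun2 => 'k fun2"
 where "conv m F = (%u v. m (%g. subm (sl2_mat (inverse g)) F u v))"

lemma regfam_regular: "A : regfam m s ==> (%g. A g u v) : regular_funs"
proof (induction rule: regfam.induct)
 case (base f F)
 thus ?case unfolding fun_app fun2_apply by (intro regular_funs.mult regular_funs.const)
qed (simp add: fun_app regular_funs.add)

text \<open>Both claims share one induction over the tensors: for a sum, the second claim uses the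
  first for the summands, so the conditions on R are kept inside the statement.\<close>

lemma regfam_dist:
 assumes "A : regfam m s" "w : dist0"
 shows "(%u v. w (%g. A g u v)) : bh m s \<and>
  ((\<forall>F\<in>bh m s. \<forall>G\<in>bh m s. R (F + G) = R F + R G) --> (\<forall>F\<in>bh m s. \<forall>c. R (Cst c * F) = Cst c * R F) -->
  (\<forall>F\<in>bh m s. R F : bh m' s') -->
  (\<forall>u v. w (%g. R (A g) u v) = R (%u v. w (%g. A g u v)) u v))"
 using assms(1)
proof (induction rule: regfam.induct)
 case (base f F)
 have *: "w (%g. f g * c) = c * w f" for c
  using dist0_cmult[OF assms(2) base(1), of c] by (simp add: mult.commute)
 have c: "w (%g. (Cst (f g) * G) u v) = (Cst (w f) * G) u v" for G u v
  by (simp add: fun_app fun2_apply * mult.commute)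
 hence "(%u v. w (%g. (Cst (f g) * F) u v)) = Cst (w f) * F" by (intro ext)
 thus ?case using base(2) by (auto simp: c)
next
 case (add A H)
 have in_bh: "\<Xi> g : bh m s" if "\<Xi> : regfam m s" for \<Xi> g
  using that by (induction rule: regfam.induct) auto
 have 1: "(%u v. w (%g. (A g + H g) u v)) = (%u v. w (%g. A g u v)) + (%u v. w (%g. H g u v))"
  using dist0_add[OF assms(2) regfam_regular[OF add(1)] regfam_regular[OF add(2)]]
  by (simp add: fun_app fun_eq_iff)
 show ?case
 proof (intro conjI impI allI)
  show "(%u v. w (%g. (A g + H g) u v)) : bh m s" unfolding 1 using add by (intro bh_add) auto
  fix u v
  assume R: "\<forall>F\<in>bh m s. \<forall>G\<in>bh m s. R (F + G) = R F + R G" "\<forall>F\<in>bh m s. \<forall>c. R (Cst c * F) = Cst c * R F"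
   "\<forall>F\<in>bh m s. R F : bh m' s'"
  have rr: "(%g. R (\<Xi> g) u v) : regular_funs" if "\<Xi> : regfam m s" for \<Xi>
   using that
  proof (induction rule: regfam.induct)
   case (base f F)
   have "R (Cst (f g) * F) u v = f g * R F u v" for g
    unfolding R(2)[rule_format, OF base(2)] by (simp add: fun_app Cst_def)
   thus ?case by (simp only:) (intro regular_funs.mult regular_funs.const base)
  next
   case (add A H)
   have "R (A g + H g) u v = R (A g) u v + R (H g) u v" for g
    using R(1) in_bh[OF add(1), of g] in_bh[OF add(2), of g] by (simp only: plus_fun_apply)
   thus ?case by (simp only:) (intro regular_funs.add add)
  qed
  have "w (%g. R (A g + H g) u v) = w (%g. R (A g) u v + R (H g) u v)"
   using R(1) in_bh[OF add(1)] in_bh[OF add(2)] by (simp only: plus_fun_apply)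
  also have "... = R (%u v. w (%g. A g u v)) u v + R (%u v. w (%g. H g u v)) u v"
   using dist0_add[OF assms(2) rr[OF add(1)] rr[OF add(2)]] add R by auto
  also have "... = R ((%u v. w (%g. A g u v)) + (%u v. w (%g. H g u v))) u v"
   using R add by (simp add: fun_app)
  finally show "w (%g. R (A g + H g) u v) = R (%u v. w (%g. (A g + H g) u v)) u v" by (simp only: 1)
 qed
qed

lemma conv_in_bh: "F : bh m s ==> u : dist0 ==> conv u F : bh m s"
 unfolding conv_def using regfam_dist[OF regfam_subm] by blast

text \<open>The principle behind the next commutation lemmas: a linear operator that commutes with
  the points of the group commutes with distributions.\<close>

lemma conv_commute:
 assumes "F : bh m s" "w : dist0"
  and "\<And>F G. F : bh m s ==> G : bh m s ==> R (F + G) = R F + R G"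
  and "\<And>c F. F : bh m s ==> R (Cst c * F) = Cst c * R F"
  and "\<And>F. F : bh m s ==> R F : bh m' s'"
  and "\<And>M F. det M = 1 ==> F : bh m s ==> subm M (R F) = R (subm M F)"
 shows "conv w (R F) = R (conv w F)"
proof (intro ext)
 fix u v
 have "conv w (R F) u v = w (%g. R (subm (sl2_mat (inverse g)) F) u v)"
  by (simp add: conv_def assms(1,6))
 also have "... = R (conv w F) u v"
  unfolding conv_def using regfam_dist[OF regfam_subm[OF assms(1)] assms(2), of R m' s'] assms by blast
 finally show "conv w (R F) u v = R (conv w F) u v" .
qed

lemma conv_add:
 assumes "F : bh m s" "G : bh m s" "u : dist0" shows "conv u (F + G) = conv u F + conv u G"
 using dist0_add[OF assms(3) regfam_regular[OF regfam_subm[OF assms(1)]] regfam_regular[OF regfam_subm[OF assms(2)]]]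
 by (simp add: conv_def fun_eq_iff fun_app)

lemma conv_cmult: assumes "F : bh m s" "u : dist0" shows "conv u (Cst c * F) = Cst c * conv u F"
 using dist0_cmult[OF assms(2) regfam_regular[OF regfam_subm[OF assms(1)]], of c]
 by (simp add: conv_def fun_eq_iff times_fun_apply) (simp add: fun2_apply)

lemma conv_0: "m : dist0 ==> conv m 0 = 0"
 by (simp add: conv_def fun_app dist0_0 fun_eq_iff)

lemma conv_theta: assumes "F : bh m s" "u : dist0" "s > 0" shows "conv u (theta F) = theta (conv u F)"
 by (rule conv_commute[OF assms(1,2)])
  (use assms(3) in \<open>auto simp: theta_add theta_cmult subm_theta intro: theta_in_bh\<close>)

lemma conv_Delta_power: assumes "F : bh m s" "u : dist0" shows "conv u (Delta ^ n * F) = Delta ^ n * conv u F"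
 by (rule conv_commute[OF assms, of _ "n + m" "n + s"])
  (auto simp: distrib_left mult.left_commute subm_Delta intro: bh_mult[OF Delta_power_in_bh])

lemma conv_dg: assumes "F : bh m s" "u : dist0" shows "conv u (dg F) = dg (conv u F)"
 by (rule conv_commute[OF assms, of _ "m + s" 0]) (auto intro: dg_in_bh)

context charp
begin

lemma CHAR_pos: "CHAR('k) > 0" using CHAR p3 by simp

lemma frob_entry: "sl2_mat (frob g) $ i $ j = (sl2_mat (g :: 'k sl2) $ i $ j) ^ p"
 by (simp add: sl2_mat_frob[OF CHAR_pos] CHAR)

lemma regular_frob: "f : regular_funs ==> (%g :: 'k sl2. f (frob g)) : regular_funs"
proof (induction rule: regular_funs.induct)
 case (entry i j)
 thus ?case unfolding frob_entry by (intro regular_power regular_funs.entry)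
qed (auto intro: regular_funs.intros)

lemma frob_mult: "frob (g * h) = frob g * frob (h :: 'k sl2)"
proof -
 have "sl2_mat (frob (g * h)) $ i $ j = sl2_mat (frob g * frob h) $ i $ j" for i j
  using freshmans_dream[OF prime_p[folded CHAR] CHAR[symmetric]]
  by (simp add: frob_entry sl2_mat_mult_entry power_mult_distrib)
 thus ?thesis by (simp add: sl2_mat_inject[symmetric] vec_eq_iff)
qed

lemma frob_1 [simp]: "frob 1 = (1 :: 'k sl2)"
proof -
 have "sl2_mat (frob 1) $ i $ j = sl2_mat (1 :: 'k sl2) $ i $ j" for i j
  using p3 by (simp add: frob_entry mat_def)
 thus ?thesis by (simp add: sl2_mat_inject[symmetric] vec_eq_iff)
qed

lemma frob_inverse: "frob (inverse g) = inverse (frob (g :: 'k sl2))"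
 by (rule sl2_inverse_unique) (simp flip: frob_mult)

text \<open>Substitution in X^p depends on g only through its Frobenius image, and a distribution on
  \<open>G_1\<close> evaluates that at 1. This makes \<open>alf\<close> and \<open>bef\<close>
  linear over the distributions.\<close>

lemma conv_frobenius:
 fixes A B :: "'k fun2"
 assumes A: "A : bh m s" and B: "B : bh m s" and w: "w : dist0"
 shows "conv w (Xu ^ p * A + Yu ^ p * B) = Xu ^ p * conv w A + Yu ^ p * conv w B"
proof -
 have X: "conv w (Xu ^ p * A) = Xu ^ p * conv w A"
 proof (intro ext)
  fix u v :: "'k ^ 2"
  define f where "f h = sl2_mat (inverse h) $ 1 $ 1 * (u $ 1) ^ p + sl2_mat (inverse h) $ 1 $ 2 * (u $ 2) ^ p" for h :: "'k sl2"
  have f: "f : regular_funs" unfolding f_def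
   by (intro regular_funs.add regular_funs.mult regular_funs.const regular_entry_inverse)
  have "conv w (Xu ^ p * A) u v = w (%g. subm (sl2_mat (inverse g)) A u v * f (frob g))"
   unfolding conv_def subm_simps frobenius_linear
   by (simp add: f_def frob_entry fun_app fun2_apply mult.commute flip: frob_inverse)
  also have "... = f 1 * conv w A u v"
   unfolding conv_def by (rule dist0_frob[OF w regfam_regular[OF regfam_subm[OF A]] f regular_frob[OF f]])
  also have "f 1 = (Xu ^ p) u v" by (simp add: f_def fun_app fun2_apply mat_def)
  also have "(Xu ^ p) u v * conv w A u v = (Xu ^ p * conv w A) u v" by (simp only: times_fun_apply)
  finally show "conv w (Xu ^ p * A) u v = (Xu ^ p * conv w A) u v" .
 qed
 have Y: "conv w (Yu ^ p * B) = Yu ^ p * conv w B"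
 proof (intro ext)
  fix u v :: "'k ^ 2"
  define f where "f h = sl2_mat (inverse h) $ 2 $ 1 * (u $ 1) ^ p + sl2_mat (inverse h) $ 2 $ 2 * (u $ 2) ^ p" for h :: "'k sl2"
  have f: "f : regular_funs" unfolding f_def
   by (intro regular_funs.add regular_funs.mult regular_funs.const regular_entry_inverse)
  have "conv w (Yu ^ p * B) u v = w (%g. subm (sl2_mat (inverse g)) B u v * f (frob g))"
   unfolding conv_def subm_simps frobenius_linear
   by (simp add: f_def frob_entry fun_app fun2_apply mult.commute flip: frob_inverse)
  also have "... = f 1 * conv w B u v"
   unfolding conv_def by (rule dist0_frob[OF w regfam_regular[OF regfam_subm[OF B]] f regular_frob[OF f]])
  also have "f 1 = (Yu ^ p) u v" by (simp add: f_def fun_app fun2_apply mat_def)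
  also have "(Yu ^ p) u v * conv w B u v = (Yu ^ p * conv w B) u v" by (simp only: times_fun_apply)
  finally show "conv w (Yu ^ p * B) u v = (Yu ^ p * conv w B) u v" .
 qed
 have "Xu ^ p * A : bh (p + m) (0 + s)" "Yu ^ p * B : bh (p + m) (0 + s)"
  using A B bh_mult XY_power_in_bh by blast+
 thus ?thesis using X Y by (simp add: conv_add[OF _ _ w])
qed

lemma conv_Tsp:
 assumes "s < p" "F : Tsp s" "m : dist0" shows "conv m F : (Tsp s :: 'k fun2 set)"
proof -
 obtain r where F: "F : bh (p - 1) s" "r : bh (p - 1 - s) 0" "theta F = Delta ^ s * r"
  using assms Tsp_iff by blast
 have "theta (conv m F) = Delta ^ s * conv m r"
 proof (cases "s = 0")
  case True
  hence "theta F = 0" "theta (conv m F) = 0"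
   using F conv_in_bh[OF F(1) assms(3)] by (auto intro: theta_right_const)
  hence "r = 0" using F True by simp
  thus ?thesis using \<open>theta (conv m F) = 0\<close> conv_0[OF assms(3)] by simp
 next
  case False
  thus ?thesis using conv_theta[OF F(1) assms(3)] F conv_Delta_power[OF F(2) assms(3), of s] by simp
 qed
 thus ?thesis using Tsp_iff[OF assms(1)] conv_in_bh F assms(3) by blast
qed

lemma conv_alf_bef:
 assumes s: "0 < s" "s < p" and F: "F : Tsp s" and m: "m : dist0"
 shows "conv m (alf s F) = alf s (conv m F)" "conv m (bef s F) = bef s (conv m F)"
proof -
 have "Delta ^ (p - s) * dg (conv m F) = conv m (Delta ^ (p - s) * dg F)"
  using conv_Delta_power[OF dg_in_bh[OF Tsp_in_bh[OF F]] m] conv_dg[OF Tsp_in_bh[OF F] m] by simp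
 also have "... = Xu ^ p * conv m (alf s F) + Yu ^ p * conv m (bef s F)"
  unfolding Delta_dg[OF s F] by (rule conv_frobenius[OF alf_in_bh[OF s F] bef_in_bh[OF s F] m])
 finally show "conv m (alf s F) = alf s (conv m F)" "conv m (bef s F) = bef s (conv m F)"
  using alf_bef_unique[OF s conv_Tsp[OF s(2) F m] conv_in_bh[OF alf_in_bh[OF s F] m] conv_in_bh[OF bef_in_bh[OF s F] m]]
  by auto
qed

text \<open>The representation of Dist(G_1) on the direct sum; it will turn out to be an isomorphism
  onto the commutant (\<open>pim_bij\<close>).\<close>

definition pim :: "'k dist => 'k te"
 where "pim m = Abs_te (%x. Abs_tv (%s. conv m (tv_fun x s)))"

lemma tv_fun_pim: assumes "m : dist0" shows "tv_fun (ap (pim m) x) s = conv m (tv_fun x s)"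
proof -
 have "conv m (tv_fun x s) : Tsp s" for x s
  using conv_Tsp[OF _ tv_fun_in_Tsp assms] Tsp_ge[OF _ tv_fun_in_Tsp, of s x] conv_0[OF assms]
  by (cases "s < p") (auto simp: Tsp_0)
 define f where "f x = Abs_tv (%s. conv m (tv_fun x s))" for x
 have A: "tv_fun (f x) s = conv m (tv_fun x s)" for x s
  using \<open>\<And>x s. conv m (tv_fun x s) : Tsp s\<close> by (simp add: f_def Abs_tv_inverse)
 have "f (x + y) = f x + f y" "f (tvs c x) = tvs c (f x)" for x y c
  by (auto intro!: tv_eqI simp: A conv_cmult[OF Tsp_in_bh[OF tv_fun_in_Tsp] assms]
   conv_add[OF Tsp_in_bh[OF tv_fun_in_Tsp] Tsp_in_bh[OF tv_fun_in_Tsp] assms])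
 hence "ap (pim m) = f"
  unfolding pim_def by (subst Abs_te_inverse) (auto simp: f_def)
 thus ?thesis using A by simp
qed

lemma pim_in_KK: assumes "m : dist0" shows "pim m : KK"
 unfolding KK_def using conv_alf_bef[OF _ _ tv_fun_in_Tsp assms] conv_0[OF assms]
 by (auto intro!: te_eqI tv_eqI simp: tv_fun_alpha tv_fun_beta tv_fun_pr tv_fun_pim[OF assms])

end

subsection \<open>The algebra of distributions\<close>

text \<open>The tensors in k[G] (x) k[G], as functions of two group elements; being closed under
  products, they contain the comultiplication of every regular function.\<close>

inductive_set regfun2 :: "('k::field sl2 => 'k sl2 => 'k) set" where
 base: "f : regular_funs ==> v : regular_funs ==> (%g h. f g * v h) : regfun2"
| add: "F : regfun2 ==> H : regfun2 ==> (%g h. F g h + H g h) : regfun2"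

lemma regfun2_mult_base:
 assumes "H : regfun2" "f : regular_funs" "v : regular_funs"
 shows "(%g h. (f g * v h) * H g h) : regfun2"
 using assms(1)
proof (induction rule: regfun2.induct)
 case (base \<alpha> \<beta>)
 have "(%g h. (f g * \<alpha> g) * (v h * \<beta> h)) : regfun2"
  using base assms by (intro regfun2.base regular_funs.mult)
 thus ?case by (simp add: mult_ac)
next
 case (add F H) thus ?case by (simp add: distrib_left regfun2.add)
qed

lemma regfun2_mult: "F : regfun2 ==> H : regfun2 ==> (%g h. F g h * H g h) : regfun2"
proof (induction rule: regfun2.induct)
 case (base f v) thus ?case by (intro regfun2_mult_base)
next
 case (add F F') thus ?case by (simp add: distrib_right regfun2.add)
qed

lemma regfun2_comult: "f : regular_funs ==> (%g h. f (g * h)) : regfun2"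
proof (induction rule: regular_funs.induct)
 case (const c)
 show ?case using regfun2.base[OF regular_funs.const[of c] regular_funs.const[of 1]] by simp
next
 case (entry i j)
 show ?case unfolding sl2_mat_mult_entry by (intro regfun2.add regfun2.base regular_funs.entry)
qed (auto intro: regfun2.add regfun2_mult)

lemma regfun2_section: "F : regfun2 ==> (%h. F g h) : regular_funs"
 by (induction rule: regfun2.induct) (auto intro: regular_funs.intros)

lemma regfun2_dist: "F : regfun2 ==> n : dist0 ==> (%g. n (%h. F g h)) : regular_funs"
proof (induction rule: regfun2.induct)
 case (base f v)
 thus ?case by (simp add: dist0_cmult) (intro regular_funs.mult regular_funs.const base)
next
 case (add F H)
 thus ?case by (simp add: dist0_add regfun2_section) (intro regular_funs.add)
qed

lemma regular_left: "f : regular_funs ==> (%x. f (a * x)) : regular_funs"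
 using regular_translate[of f a 1] by simp

text \<open>The operations of the record \<open>Dist_G1\<close>, extracted so that they can be
  handled directly on \<open>dist0\<close>.\<close>

definition dmul :: "'k::field dist => 'k dist => 'k dist"
 where "dmul m n = (\<lambda>f\<in>regular_funs. m (%g. n (%h. f (g * h))))"
definition dact :: "'k::field sl2 => 'k dist => 'k dist"
 where "dact g m = (\<lambda>f\<in>regular_funs. m (%x. f (g * x * inverse g)))"
definition dadd :: "'k::field dist => 'k dist => 'k dist"
 where "dadd m n = (\<lambda>f\<in>regular_funs. m f + n f)"
definition dscale :: "'k::field => 'k dist => 'k dist"
 where "dscale c m = (\<lambda>f\<in>regular_funs. c * m f)"
definition done1 :: "('k::field sl2 => 'k) => 'k" where "done1 = (\<lambda>f\<in>regular_funs. f 1)"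
definition dzero :: "('k::field sl2 => 'k) => 'k" where "dzero = (\<lambda>f\<in>regular_funs. 0)"

lemma aug_in_regular: "f : aug_ideal ==> f : regular_funs" by (simp add: aug_ideal_def)

lemma dist0_extensional: "m : dist0 ==> f \<notin> regular_funs ==> m f = undefined"
 by (auto simp: dist0_def PiE_def extensional_def)

lemma dist0_eqI: "m : dist0 ==> n : dist0 ==> (\<And>f. f : regular_funs ==> m f = n f) ==> m = n"
 using dist0_extensional by (metis ext)

context charp
begin

lemma dist0I:
 fixes m :: "'k dist"
 assumes "\<And>f h. f : regular_funs ==> h : regular_funs ==> m (%x. f x + h x) = m f + m h"
  "\<And>c f. f : regular_funs ==> m (%x. c * f x) = c * m f"
  "\<And>f h. f : aug_ideal ==> h : regular_funs ==> m (%x. h x * f (frob x)) = 0"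
 shows "(\<lambda>f\<in>regular_funs. m f) : dist0"
proof -
 have "(%x. h x * f (frob x)) : regular_funs" if "f : aug_ideal" "h : regular_funs" for f h :: "'k sl2 => 'k"
  by (rule regular_funs.mult[OF that(2) regular_frob[OF aug_in_regular[OF that(1)]]])
 thus ?thesis
  unfolding dist0_def using assms by (intro CollectI conjI ballI allI) (simp_all add: regular_funs.add regular_cmult)
qed

lemma dist0_vanish: "m : dist0 ==> f : aug_ideal ==> h : regular_funs ==> m (%x. h x * f (frob x)) = 0"
 by (auto simp: dist0_def)

lemma dadd_in: "m : dist0 ==> n : dist0 ==> dadd m n : (dist0 :: 'k dist set)"
 unfolding dadd_def by (rule dist0I) (simp_all add: dist0_add dist0_cmult dist0_vanish algebra_simps)

lemma dscale_in: "m : dist0 ==> dscale c m : (dist0 :: 'k dist set)"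
 unfolding dscale_def by (rule dist0I) (simp_all add: dist0_add dist0_cmult dist0_vanish algebra_simps)

lemma done1_in: "done1 : (dist0 :: 'k dist set)"
 unfolding done1_def by (rule dist0I) (simp_all add: aug_ideal_def)

lemma dzero_in: "dzero : (dist0 :: 'k dist set)"
 unfolding dzero_def by (rule dist0I) auto

lemma dmul_in:
 fixes m n :: "'k dist"
 assumes m: "m : dist0" and n: "n : dist0" shows "dmul m n : dist0"
 unfolding dmul_def
proof (rule dist0I)
 note r = regfun2_dist[OF regfun2_comult n]
 show "m (%g. n (%h. f (g * h) + v (g * h))) = m (%g. n (%h. f (g * h))) + m (%g. n (%h. v (g * h)))"
  if "f : regular_funs" "v : regular_funs" for f v
  using that by (simp add: dist0_add[OF n regular_left regular_left] dist0_add[OF m r r])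
 show "m (%g. n (%h. c * f (g * h))) = c * m (%g. n (%h. f (g * h)))" if "f : regular_funs" for c f
  using that by (simp add: dist0_cmult[OF n regular_left] dist0_cmult[OF m r])
 show "m (%g. n (%h. v (g * h) * f (frob (g * h)))) = 0" if f: "f : aug_ideal" and v: "v : regular_funs" for f v
 proof -
  have "n (%h. v (g * h) * f (frob (g * h))) = n (%h. v (g * h)) * f (frob g)" for g
   using dist0_frob[OF n regular_left[OF v] regular_left[OF aug_in_regular[OF f], of "frob g"]
    regular_frob[OF regular_left[OF aug_in_regular[OF f], of "frob g"]], of g]
   by (simp add: frob_mult mult.commute)
  thus ?thesis using dist0_vanish[OF m f r[OF v]] by simp
 qed
qed

lemma dact_in:
 fixes m :: "'k dist"
 assumes m: "m : dist0" shows "dact g m : dist0"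
 unfolding dact_def
proof (rule dist0I)
 note r = regular_translate[of _ g "inverse g"]
 show "m (%x. f (g * x * inverse g) + h (g * x * inverse g)) = m (%x. f (g * x * inverse g)) + m (%x. h (g * x * inverse g))"
  if "f : regular_funs" "h : regular_funs" for f h
  using that by (simp add: dist0_add[OF m r r])
 show "m (%x. c * f (g * x * inverse g)) = c * m (%x. f (g * x * inverse g))" if "f : regular_funs" for c f
  using that by (simp add: dist0_cmult[OF m r])
 show "m (%x. h (g * x * inverse g) * f (frob (g * x * inverse g))) = 0" if f: "f : aug_ideal" and h: "h : regular_funs" for f h
 proof -
  have "(%x. f (frob g * x * inverse (frob g))) : aug_ideal"
   using f regular_translate[of f "frob g" "inverse (frob g)"] by (simp add: aug_ideal_def)
  from dist0_vanish[OF m this r[OF h]] show ?thesis by (simp add: frob_mult frob_inverse)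
 qed
qed

lemmas subm_regular = regfam_regular[OF regfam_subm]

lemma pim_dadd: assumes "m : dist0" "n : dist0" shows "pim (dadd m n) = pim m + pim n"
 using subm_regular[OF Tsp_in_bh[OF tv_fun_in_Tsp]]
 by (intro te_eqI tv_eqI)
  (simp add: tv_fun_pim assms dadd_in, auto simp: conv_def dadd_def fun_eq_iff plus_fun_apply)

lemma pim_dscale: assumes "m : dist0" shows "pim (dscale c m) = sc c * pim m"
 using subm_regular[OF Tsp_in_bh[OF tv_fun_in_Tsp]]
 by (intro te_eqI tv_eqI)
  (simp add: tv_fun_pim assms dscale_in, auto simp: conv_def dscale_def fun_eq_iff times_fun_apply Cst_def)

lemma pim_dmul: assumes "m : dist0" "n : dist0" shows "pim (dmul m n) = pim m * pim n"
 using subm_regular[OF Tsp_in_bh[OF tv_fun_in_Tsp]]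
 by (intro te_eqI tv_eqI)
  (simp add: tv_fun_pim assms dmul_in,
  auto simp: conv_def dmul_def fun_eq_iff sl2_mat_mult subm_def simp flip: matrix_vector_mul_assoc)

lemma pim_dact: assumes "m : dist0" shows "pim (dact g m) = rho g * pim m * rho (inverse g)"
 using subm_regular[OF Tsp_in_bh[OF tv_fun_in_Tsp]]
 by (intro te_eqI tv_eqI)
  (simp add: tv_fun_pim assms dact_in,
  auto simp: conv_def dact_def fun_eq_iff sl2_mat_mult subm_def simp flip: matrix_vector_mul_assoc)

lemma pim_done1: "pim done1 = 1"
 using subm_regular[OF Tsp_in_bh[OF tv_fun_in_Tsp]]
 by (intro te_eqI tv_eqI)
  (simp add: tv_fun_pim done1_in, auto simp: conv_def done1_def fun_eq_iff subm_def)

text \<open>Nilpotency of the augmentation ideal of \<open>k[G\<^sub>1]\<close>: distributions need not be required to vanish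
 on a power of it.\<close>

inductive_set Waug :: "nat => ('k sl2 => 'k) set" for n where
 base: "h : regular_funs ==> n <= i + j + l + r ==>
  (%x. h x * ((sl2_mat x $ 1 $ 1 - 1) ^ i * (sl2_mat x $ 1 $ 2) ^ j * (sl2_mat x $ 2 $ 1) ^ l * (sl2_mat x $ 2 $ 2 - 1) ^ r)) : Waug n"
| add: "f : Waug n ==> g : Waug n ==> (%x. f x + g x) : Waug n"

lemma Waug_mult: "f : Waug m ==> g : Waug n ==> (%x. f x * g x) : Waug (m + n)"
proof (induction rule: Waug.induct)
 case 1: (base u i j l r)
 from 1(3) show ?case
 proof (induction rule: Waug.induct)
  case 2: (base h i' j' l' r')
  have "(%x. (u x * h x) * ((sl2_mat x $ 1 $ 1 - 1) ^ (i + i') * (sl2_mat x $ 1 $ 2) ^ (j + j') *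
   (sl2_mat x $ 2 $ 1) ^ (l + l') * (sl2_mat x $ 2 $ 2 - 1) ^ (r + r'))) : Waug (m + n)"
   using 1(2) 2(2) by (intro Waug.base regular_funs.mult 1(1) 2(1)) simp
  thus ?case by (simp only: power_add mult_ac)
 next
  case (add f g) thus ?case by (simp add: distrib_left Waug.add)
 qed
next
 case (add f f') thus ?case by (simp add: distrib_right Waug.add)
qed

lemma regular_Waug: "h : regular_funs ==> h : Waug 0"
 using Waug.base[of h 0 0 0 0 0] by simp

lemma aug_Waug: "f : regular_funs ==> (%x. f x - f 1) : Waug 1"
proof (induction rule: regular_funs.induct)
 case (const c)
 show ?case using Waug.base[OF regular_funs.const[of 0], of 1 1 0 0 0] by simp
next
 case (entry i j)
 note b = Waug.base[OF regular_funs.const[of 1], of 1]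
 show ?case using exhaust_2[of i] exhaust_2[of j] b[of 1 0 0 0] b[of 0 1 0 0] b[of 0 0 1 0] b[of 0 0 0 1]
  by (auto simp: mat_def)
next
 case (add f h)
 have "(%x. (f x - f 1) + (h x - h 1)) : Waug 1" using add by (intro Waug.add)
 thus ?case by (simp add: algebra_simps)
next
 case (mult f h)
 have "(%x. (f x - f 1) * h x) : Waug (1 + 0)" "(%x. f 1 * (h x - h 1)) : Waug (0 + 1)"
  by (rule Waug_mult[OF mult.IH(1) regular_Waug[OF mult.hyps(2)]])
   (rule Waug_mult[OF regular_Waug[OF regular_funs.const] mult.IH(2)])
 hence "(%x. (f x - f 1) * h x + f 1 * (h x - h 1)) : Waug 1" by (intro Waug.add) simp_all
 thus ?case by (simp add: algebra_simps)
qed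

lemma Waug_regular: "f : Waug n ==> f : regular_funs"
proof (induction rule: Waug.induct)
 case (base h i j l r)
 have "(%x :: 'k sl2. sl2_mat x $ m $ m - 1) : regular_funs" for m
  using regular_funs.add[OF regular_funs.entry regular_funs.const[of "-1"]] by simp
 thus ?case using base by (intro regular_funs.mult regular_power regular_funs.entry)
qed (rule regular_funs.add)

text \<open>Four generators and total degree at least 4p: some exponent is at least p, and the p-th
  power of that generator is its own Frobenius pullback, hence in the ideal of
  \<open>G_1\<close>.\<close>

lemma dist0_Waug:
 fixes m :: "'k dist"
 assumes m: "m : dist0" shows "f : Waug (4 * p) ==> m f = 0"
proof (induction rule: Waug.induct)
 case (base v i j l r)
 define a b c d :: "'k sl2 => 'k" where "a x = sl2_mat x $ 1 $ 1 - 1" and "b x = sl2_mat x $ 1 $ 2"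
  and "c x = sl2_mat x $ 2 $ 1" and "d x = sl2_mat x $ 2 $ 2 - 1" for x
 have aug: "a : aug_ideal" "b : aug_ideal" "c : aug_ideal" "d : aug_ideal"
  using regular_funs.add[OF regular_funs.entry regular_funs.const[of "-1"]]
  by (auto simp: aug_ideal_def a_def[abs_def] b_def[abs_def] c_def[abs_def] d_def[abs_def] mat_def intro: regular_funs.entry)
 have odd: "(x - 1) ^ p = x ^ p - 1" for x :: 'k
  using freshmans_dream[OF prime_p[folded CHAR] CHAR[symmetric], of "x - 1" 1] by simp
 have fr: "f x ^ n = f x ^ (n - p) * f (frob x)" if "f : {a, b, c, d}" "p <= n" for f x n
 proof -
  have "f (frob x) = f x ^ p"
   using that(1) by (auto simp: a_def b_def c_def d_def frob_entry odd)
  thus ?thesis using that(2) by (simp flip: power_add)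
 qed
 have kill: "m (%x. h x * f x ^ n) = 0" if "f : {a, b, c, d}" "p <= n" "h : regular_funs" for f h n
 proof -
  have "f : aug_ideal" using that(1) aug by auto
  hence "(%x. h x * f x ^ (n - p)) : regular_funs"
   by (intro regular_funs.mult[OF that(3)] regular_power[OF aug_in_regular])
  hence "m (%x. (h x * f x ^ (n - p)) * f (frob x)) = 0"
   by (rule dist0_vanish[OF m \<open>f : aug_ideal\<close>])
  thus ?thesis using fr[OF that(1,2)] by (simp add: mult.assoc)
 qed
 have R: "(%x. v x * (f x ^ i' * g x ^ j' * h x ^ l')) : regular_funs" if "{f, g, h} \<subseteq> {a, b, c, d}" for f g h i' j' l'
  using that aug aug_in_regular by (intro regular_funs.mult[OF base(1)] regular_funs.mult regular_power) auto
 have "p <= i | p <= j | p <= l | p <= r" using base by linarith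
 moreover have "p <= i ==> ?case" using kill[of a i, OF _ _ R[of b c d j l r]] by (simp add: a_def b_def c_def d_def mult_ac)
 moreover have "p <= j ==> ?case" using kill[of b j, OF _ _ R[of a c d i l r]] by (simp add: a_def b_def c_def d_def mult_ac)
 moreover have "p <= l ==> ?case" using kill[of c l, OF _ _ R[of a b d i j r]] by (simp add: a_def b_def c_def d_def mult_ac)
 moreover have "p <= r ==> ?case" using kill[of d r, OF _ _ R[of a b c i j l]] by (simp add: a_def b_def c_def d_def mult_ac)
 ultimately show ?case by blast
next
 case (add f g)
 thus ?case using dist0_add[OF m Waug_regular Waug_regular] by simp
qed

lemma prod_list_Waug: "set fs \<subseteq> aug_ideal ==> (%x. \<Prod>f\<leftarrow>fs. f x) : Waug (length fs)"
proof (induction fs)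
 case Nil
 show ?case using Waug.base[of "%x. 1" 0 0 0 0 0] by (simp add: regular_funs.const)
next
 case (Cons f fs)
 hence "f : Waug 1" using aug_Waug[of f] by (simp add: aug_ideal_def)
 from Waug_mult[OF this Cons.IH] Cons.prems show ?case by simp
qed

lemma distributions_G1_eq: "distributions_G1 = (dist0 :: 'k dist set)"
proof -
 have "\<exists>n. \<forall>fs. length fs = Suc n & set fs \<subseteq> aug_ideal --> m (%x. \<Prod>f\<leftarrow>fs. f x) = 0"
  if m: "m : dist0" for m :: "'k dist"
 proof (intro exI[of _ "4 * p - 1"] allI impI)
  fix fs assume "length fs = Suc (4 * p - 1) & set (fs :: ('k sl2 => 'k) list) \<subseteq> aug_ideal"
  hence "(%x. \<Prod>f\<leftarrow>fs. f x) : Waug (4 * p)" using prod_list_Waug[of fs] p3 by simp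
  thus "m (%x. \<Prod>f\<leftarrow>fs. f x) = 0" by (rule dist0_Waug[OF m])
 qed
 thus ?thesis unfolding distributions_G1_def dist0_def by blast
qed

end

subsection \<open>Tangent vectors\<close>

text \<open>One-parameter unipotent groups. The determinant is 1 for all t only if b * c = 0; the
  parameters (1, 0) and (0, 1) give the root vectors e and f as tangents.\<close>

definition gam :: "'k::field => 'k => 'k => 'k sl2"
 where "gam b c t = Abs_sl2 (\<chi> i j. if i = j then 1 else if i = 1 then t * b else t * c)"

lemma gam_entry:
 assumes "b * c = 0"
 shows "sl2_mat (gam b c t) $ i $ j = (if i = j then 1 else if i = 1 then t * b else t * c)"
proof -
 have "det (\<chi> i j. if i = j then 1 else if (i::2) = 1 then t * b else t * c) = 1"
  using assms by (auto simp: det_2)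
 thus ?thesis by (simp add: gam_def Abs_sl2_inverse)
qed

lemma gam_0: assumes "b * c = 0" shows "gam b c 0 = 1"
proof -
 have "sl2_mat (gam b c 0) $ i $ j = sl2_mat 1 $ i $ j" for i j
  by (simp add: gam_entry[OF assms] mat_def)
 hence "sl2_mat (gam b c 0) = sl2_mat 1" by (simp add: vec_eq_iff)
 thus ?thesis by (metis sl2_mat_inject)
qed

definition tang :: "'k => 'k => ('k::alg_closed_field sl2 => 'k) => 'k"
 where "tang b c = (\<lambda>f\<in>regular_funs. tcoeff (%t. f (gam b c t)) 1)"

lemma polyfun_gam: assumes "b * c = 0" shows "f : regular_funs ==> polyfun (%t. f (gam b c t))"
proof (induction rule: regular_funs.induct)
 case (entry i j) show ?case by (cases "i = j"; cases "i = 1") (auto simp: gam_entry[OF assms])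
qed auto

section \<open>Independent families and counting\<close>

lemma (in vector_space) family_independent:
 assumes "finite I" "\<And>c i. (\<Sum>i\<in>I. scale (c i) (b i)) = 0 ==> i : I ==> c i = 0"
 shows "inj_on b I" "independent (b ` I)"
proof -
 show inj: "inj_on b I"
 proof (rule inj_onI, rule ccontr)
  fix x y assume xy: "x : I" "y : I" "b x = b y" "x ~= y"
  define c where "c i = (if i = x then 1 else if i = y then - 1 else 0 :: 'a)" for i
  have "(\<Sum>i\<in>I. scale (c i) (b i)) = (\<Sum>i\<in>{x, y}. scale (c i) (b i))"
   using assms(1) xy by (intro sum.mono_neutral_right) (auto simp: c_def)
  also have "... = 0" using xy by (simp add: c_def)
  finally have "c x = 0" using assms(2) xy by blast
  thus False by (simp add: c_def)
 qed
 show "independent (b ` I)"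
 proof (rule independent_if_scalars_zero)
  fix f v assume "(\<Sum>x\<in>b ` I. scale (f x) x) = 0" "v : b ` I"
  thus "f v = 0" using assms(2)[of "f \<circ> b"] by (auto simp: sum.reindex[OF inj])
 qed (use assms(1) in simp)
qed

text \<open>A vector of the span of S outside the span of B would enlarge B to an independent set
  with more elements than S, against the exchange bound.\<close>

lemma (in vector_space) span_subset_span_if_card_le:
 assumes "independent B" "finite S" "B \<subseteq> span S" "card S <= card B"
 shows "span S \<subseteq> span B"
proof
 fix x assume x: "x : span S"
 show "x : span B"
 proof (rule ccontr)
  assume n: "x \<notin> span B"
  hence i: "independent (insert x B)" using assms(1) by (rule independent_insertI)
  have fB: "finite B" using independent_span_bound[OF assms(2,1,3)] by simp
  have "card (insert x B) <= card S"
   using independent_span_bound[OF assms(2) i] x assms(3) by auto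
  moreover have "x \<notin> B" using n span_base by blast
  ultimately show False using assms(4) fB by simp
 qed
qed

context charp
begin

text \<open>In characteristic p a p-th power has zero derivative, so Frobenius pullbacks are
  constant to first order along \<open>gam\<close>; therefore the tangents are distributions on
  \<open>G_1\<close>.\<close>

lemma frob_gam:
 assumes bc: "b * c = 0" and "f : regular_funs"
 shows "tcoeff (%t :: 'k. f (frob (gam b c t))) 1 = 0 & polyfun (%t. f (frob (gam b c t)))"
 using assms(2)
proof (induction rule: regular_funs.induct)
 case (entry i j)
 show ?case
  by (cases "i = j"; cases "i = 1")
   (auto simp: frob_entry gam_entry[OF bc] tcoeff_1_power[unfolded One_nat_def] tcoeff_const)
next
 case (mult f h)
 thus ?case using tcoeff_1_mult[of "%t. f (frob (gam b c t))" "%t. h (frob (gam b c t))"] by auto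
qed (auto simp: tcoeff_const tcoeff_add)

lemma tang_in: assumes bc: "b * c = (0 :: 'k)" shows "tang b c : dist0"
 unfolding tang_def
proof (rule dist0I)
 note P = polyfun_gam[OF bc]
 show "tcoeff (%t. f (gam b c t) + h (gam b c t)) 1 = tcoeff (%t. f (gam b c t)) 1 + tcoeff (%t. h (gam b c t)) 1"
  if "f : regular_funs" "h : regular_funs" for f h using that by (intro tcoeff_add P)
 show "tcoeff (%t. a * f (gam b c t)) 1 = a * tcoeff (%t. f (gam b c t)) 1" if "f : regular_funs" for a f
  using that by (intro tcoeff_cmult P)
 show "tcoeff (%t. h (gam b c t) * f (frob (gam b c t))) 1 = 0" if "f : aug_ideal" "h : regular_funs" for f h
  using tcoeff_1_mult[OF P[OF that(2)] conjunct2[OF frob_gam[OF bc aug_in_regular[OF that(1)]]]]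
   frob_gam[OF bc aug_in_regular[OF that(1)]] that by (simp add: gam_0[OF bc] aug_ideal_def)
qed

text \<open>With u = (x, y) and v = (z, w) these are the derivations -(y d/dx + w d/dz) and, for
  \<open>df\<close>, -(x d/dy + z d/dw); the signs come from the inverse in the action.\<close>

definition de where "de = conv (tang (1 :: 'k) 0)"
definition df where "df = conv (tang 0 (1 :: 'k))"

lemma conv_tang: "F : bh m s ==> conv (tang b c) F u v = tcoeff (%t. subm (sl2_mat (inverse (gam b c t))) F u v) 1"
 using subm_regular[of F m s u v] by (simp add: conv_def tang_def)

lemma df_mon:
 assumes "i <= m" "j <= s"
 shows "df (mon m s i j) = Cst (- of_nat (m - i)) * mon m s (Suc i) j + Cst (- of_nat (s - j)) * mon m s i (Suc j)"
proof (intro ext)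
 fix u v :: "'k ^ 2"
 have "subm (sl2_mat (inverse (gam 0 1 t))) (mon m s i j) u v = (u $ 1 ^ i * v $ 1 ^ j) *
   ((u $ 2 + t * - u $ 1) ^ (m - i) * (v $ 2 + t * - v $ 1) ^ (s - j))" for t
  by (simp add: mon_def) (simp add: fun_app fun2_apply sl2_mat_inverse_entries gam_entry mult_ac)
 hence "df (mon m s i j) u v = tcoeff (%t. (u $ 1 ^ i * v $ 1 ^ j) *
   ((u $ 2 + t * - u $ 1) ^ (m - i) * (v $ 2 + t * - v $ 1) ^ (s - j))) 1"
  unfolding df_def by (subst conv_tang[OF mon_in_bh[OF assms]]) (simp only:)
 also have "... = (u $ 1 ^ i * v $ 1 ^ j) * (u $ 2 ^ (m - i) * (of_nat (s - j) * v $ 2 ^ (s - j - 1) * - v $ 1)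
   + of_nat (m - i) * u $ 2 ^ (m - i - 1) * - u $ 1 * v $ 2 ^ (s - j))"
  by (subst tcoeff_cmult, simp, subst tcoeff_1_mult) (simp_all only: polyfun_power polyfun_add polyfun_const
   polyfun_id polyfun_mult tcoeff_1_power tcoeff_linear mult_zero_left add_0_right)
 also have "... = (Cst (- of_nat (m - i)) * mon m s (Suc i) j + Cst (- of_nat (s - j)) * mon m s i (Suc j)) u v"
  by (simp add: fun_app fun2_apply mon_def algebra_simps)
 finally show "df (mon m s i j) u v
  = (Cst (- of_nat (m - i)) * mon m s (Suc i) j + Cst (- of_nat (s - j)) * mon m s i (Suc j)) u v" .
qed

lemma de_mon:
 assumes "i <= m" "j <= s"
 shows "de (mon m s i j) = Cst (- of_nat i) * mon m s (i - 1) j + Cst (- of_nat j) * mon m s i (j - 1)"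
proof (intro ext)
 fix u v :: "'k ^ 2"
 have "subm (sl2_mat (inverse (gam 1 0 t))) (mon m s i j) u v = (u $ 2 ^ (m - i) * v $ 2 ^ (s - j)) *
   ((u $ 1 + t * - u $ 2) ^ i * (v $ 1 + t * - v $ 2) ^ j)" for t
  by (simp add: mon_def) (simp add: fun_app fun2_apply sl2_mat_inverse_entries gam_entry mult_ac)
 hence "de (mon m s i j) u v = tcoeff (%t. (u $ 2 ^ (m - i) * v $ 2 ^ (s - j)) *
   ((u $ 1 + t * - u $ 2) ^ i * (v $ 1 + t * - v $ 2) ^ j)) 1"
  unfolding de_def by (subst conv_tang[OF mon_in_bh[OF assms]]) (simp only:)
 also have "... = (u $ 2 ^ (m - i) * v $ 2 ^ (s - j)) * (u $ 1 ^ i * (of_nat j * v $ 1 ^ (j - 1) * - v $ 2)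
   + of_nat i * u $ 1 ^ (i - 1) * - u $ 2 * v $ 1 ^ j)"
  by (subst tcoeff_cmult, simp, subst tcoeff_1_mult) (simp_all only: polyfun_power polyfun_add polyfun_const
   polyfun_id polyfun_mult tcoeff_1_power tcoeff_linear mult_zero_left add_0_right)
 also have "... = (Cst (- of_nat i) * mon m s (i - 1) j + Cst (- of_nat j) * mon m s i (j - 1)) u v"
 proof -
  have "m - (i - Suc 0) = Suc (m - i)" if "i ~= 0" using that assms by auto
  moreover have "s - (j - Suc 0) = Suc (s - j)" if "j ~= 0" using that assms by auto
  ultimately show ?thesis
   by (cases "i = 0"; cases "j = 0") (simp_all add: fun_app fun2_apply mon_def algebra_simps)
 qed
 finally show "de (mon m s i j) u v
  = (Cst (- of_nat i) * mon m s (i - 1) j + Cst (- of_nat j) * mon m s i (j - 1)) u v" .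
qed

lemma tang_01: "tang 0 1 : (dist0 :: 'k dist set)" "tang 1 0 : (dist0 :: 'k dist set)"
 by (auto intro: tang_in)

lemma df_in_bh: "F : bh m s ==> df F : bh m s" and de_in_bh: "F : bh m s ==> de F : bh m s"
 and df_Delta: "F : bh m s ==> df (Delta ^ n * F) = Delta ^ n * df F"
 unfolding df_def de_def by (auto intro: conv_in_bh conv_Delta_power tang_01)

lemma bc_df:
 assumes "F : bh m s"
 shows "bc (df F) (Suc i) 0 = - of_nat (m - i) * bc F i 0" "bc (df F) 0 0 = 0"
proof -
 have *: "bc (df F) i 0 = (case i of 0 => 0 | Suc i => - of_nat (m - i) * bc F i 0)" for i
  using assms
 proof (induction rule: bh_induct)
  case (mon i' j)
  have 1: "Cst (- of_nat (m - i')) * mon m s (Suc i') j : (bh m s :: 'k fun2 set)"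
   "bc (Cst (- of_nat (m - i')) * mon m s (Suc i') j :: 'k fun2) i 0
    = (if i = Suc i' & j = 0 then - of_nat (m - i') else 0)"
   using mon by (cases "i' = m"; auto simp: bc_cmult[OF mon_in_bh] bc_mon)+
  have 2: "Cst (- of_nat (s - j)) * mon m s i' (Suc j) : (bh m s :: 'k fun2 set)"
   "bc (Cst (- of_nat (s - j)) * mon m s i' (Suc j) :: 'k fun2) i 0 = 0"
   using mon by (cases "j = s"; auto simp: bc_cmult[OF mon_in_bh] bc_mon)+
  show ?case unfolding df_mon[OF mon] bc_add[OF 1(1) 2(1)] 1(2) 2(2)
   using mon by (auto simp: bc_mon split: nat.split)
 next
  case zero show ?case by (simp add: df_def conv_0[OF tang_01(1)] split: nat.split)
 next
  case (add F G)
  have "df (F + G) = df F + df G" using conv_add[OF add(1,2) tang_01(1)] by (simp add: df_def)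
  thus ?case using add bc_add[OF df_in_bh[OF add(1)] df_in_bh[OF add(2)]]
   by (simp add: bc_add algebra_simps split: nat.split)
 next
  case (cmult c F)
  have "df (Cst c * F) = Cst c * df F" using conv_cmult[OF cmult(1) tang_01(1)] by (simp add: df_def)
  thus ?case using cmult bc_cmult[OF df_in_bh[OF cmult(1)]]
   by (simp add: bc_cmult split: nat.split)
 qed
 show "bc (df F) (Suc i) 0 = - of_nat (m - i) * bc F i 0" "bc (df F) 0 0 = 0"
  using *[of "Suc i"] *[of 0] by simp_all
qed

lemma df_pow_in_bh: "F : bh m s ==> (df ^^ n) F : bh m s"
 by (induction n) (auto intro: df_in_bh)

lemma bc_df_pow_low: "F : bh m s ==> i < n ==> bc ((df ^^ n) F) i 0 = 0"
 by (induction n arbitrary: i) (auto simp: bc_df[OF df_pow_in_bh] less_Suc_eq_0_disj)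

lemma bc_df_pow_top: "n <= p - 1 ==> bc ((df ^^ n) (mon (p - 1) s 0 0)) n 0 ~= 0"
proof (induction n)
 case (Suc n)
 have "mon (p - 1) s 0 0 : (bh (p - 1) s :: 'k fun2 set)" by auto
 from bc_df(1)[OF df_pow_in_bh[OF this]] show ?case
  using Suc of_nat_neq_0[of "p - 1 - n"] p3 by simp
qed (simp add: bc_mon)

lemma df_pow_eq_0: assumes "r : bh d 0" "d < n" shows "(df ^^ n) r = 0"
proof (rule bh_eqI[OF df_pow_in_bh[OF assms(1)] bh_0])
 fix i j :: nat assume "i <= d" "j <= 0"
 thus "bc ((df ^^ n) r) i j = bc 0 i j" using bc_df_pow_low[OF assms(1), of i n] assms(2) by simp
qed

lemma de_pow_mon:
 "n <= i ==> i <= m ==> i < p ==> \<exists>c. c ~= 0 & (de ^^ n) (mon m 0 i 0) = Cst c * mon m 0 (i - n) 0"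
proof (induction n)
 case 0 show ?case by (intro exI[of _ 1]) simp
next
 case (Suc n)
 then obtain c where c: "c ~= 0" "(de ^^ n) (mon m 0 i 0) = Cst c * mon m 0 (i - n) 0" by auto
 have b: "mon m 0 (i - n) 0 : (bh m 0 :: 'k fun2 set)" using Suc by auto
 have "de (Cst c * mon m 0 (i - n) 0) = Cst c * de (mon m 0 (i - n) 0)"
  using conv_cmult[OF b tang_01(2)] by (simp add: de_def)
 also have "... = Cst (- (c * of_nat (i - n))) * mon m 0 (i - Suc n) 0"
 proof -
  have "de (mon m 0 (i - n) 0) = Cst (- of_nat (i - n)) * (mon m 0 (i - Suc n) 0 :: 'k fun2)"
   using Suc.prems de_mon[of "i - n" m 0 0] by simp
  moreover have "Cst c * (Cst (- x) * M) = Cst (- (c * x)) * M" for x and M :: "'k fun2"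
   by (simp add: Cst_ring mult_ac)
  ultimately show ?thesis by simp
 qed
 finally show ?case using c of_nat_neq_0[of "i - n"] Suc.prems
  by (intro exI[of _ "- (c * of_nat (i - n))"]) simp
qed

definition Ee where "Ee = pim (tang (1 :: 'k) 0)"
definition Ef where "Ef = pim (tang 0 (1 :: 'k))"
definition Eh where "Eh = Ee * Ef - Ef * Ee"

lemma tv_fun_Ef_pow: "tv_fun (ap (Ef ^ n) x) s = (df ^^ n) (tv_fun x s)"
 and tv_fun_Ee_pow: "tv_fun (ap (Ee ^ n) x) s = (de ^^ n) (tv_fun x s)"
 by (induction n) (simp_all add: Ef_def Ee_def df_def de_def tv_fun_pim tang_01)

lemma tv_fun_Ef: "tv_fun (ap Ef x) s = df (tv_fun x s)" and tv_fun_Ee: "tv_fun (ap Ee x) s = de (tv_fun x s)"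
 using tv_fun_Ef_pow[of 1 x s] tv_fun_Ee_pow[of 1 x s] by simp_all

text \<open>Socle of the \<open>s\<close>-th summand; for the simple summand \<open>s = 0\<close> it plays no role.\<close>

definition soc :: "nat => 'k tv set"
 where "soc s = {x. (\<forall>t. t ~= s --> tv_fun x t = 0) & (\<exists>r\<in>bh (p - 1 - s) 0. tv_fun x s = Delta ^ s * r) & (s = 0 --> x = 0)}"

lemma soc_pim: assumes "m : dist0" "x : soc s" shows "ap (pim m) x : soc s"
proof -
 obtain r where r: "r : bh (p - 1 - s) 0" "tv_fun x s = Delta ^ s * r" using assms by (auto simp: soc_def)
 have "conv m (Delta ^ s * r) = Delta ^ s * conv m r" using r assms by (intro conv_Delta_power)
 thus ?thesis using assms r conv_in_bh[OF r(1) assms(1)]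
  by (auto simp: soc_def tv_fun_pim conv_0)
qed

lemma soc_diff: assumes "x : soc s" "y : soc s" shows "x - y : soc s"
proof -
 obtain r r' where r: "r : bh (p - 1 - s) 0" "tv_fun x s = Delta ^ s * r" "r' : bh (p - 1 - s) 0" "tv_fun y s = Delta ^ s * r'"
  using assms by (auto simp: soc_def)
 hence "tv_fun (x - y) s = Delta ^ s * (r - r')" by (simp add: right_diff_distrib)
 thus ?thesis using assms bh_diff[OF r(1,3)] by (auto simp: soc_def)
qed

lemma soc_stable: "x : soc s ==> ap (Ee ^ n) x : soc s" "x : soc s ==> ap (Eh ^ n) x : soc s"
proof -
 have e: "y : soc s ==> ap Ee y : soc s" and f: "y : soc s ==> ap Ef y : soc s" for y
  by (auto simp: Ee_def Ef_def intro: soc_pim tang_01)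
 have h: "y : soc s ==> ap Eh y : soc s" for y by (auto simp: Eh_def intro: soc_diff e f)
 show "x : soc s ==> ap (Ee ^ n) x : soc s" "x : soc s ==> ap (Eh ^ n) x : soc s"
  by (induction n) (auto intro: e h)
qed

text \<open>For s > 0 the forms in the socle have degree p - 1 - s < p - 1, while each application
  of f raises the exponent of x; p - 1 of them leave nothing.\<close>

lemma Ef_pow_soc: assumes "x : soc s" "s < p" shows "ap (Ef ^ (p - 1)) x = 0"
proof (cases "s = 0")
 case False
 obtain r where r: "r : bh (p - 1 - s) 0" "tv_fun x s = Delta ^ s * r" using assms by (auto simp: soc_def)
 have "(df ^^ n) (Delta ^ s * r) = Delta ^ s * (df ^^ n) r" for n
  by (induction n) (simp_all add: df_Delta[OF df_pow_in_bh[OF r(1)]])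
 hence "(df ^^ (p - 1)) (Delta ^ s * r) = 0"
  using df_pow_eq_0[OF r(1), of "p - 1"] False assms(2) by simp
 moreover have "(df ^^ n) 0 = 0" for n by (induction n) (simp_all add: df_def conv_0[OF tang_01(1)])
 moreover have "tv_fun x t = 0" if "t ~= s" for t using assms that by (simp add: soc_def)
 ultimately have "(df ^^ (p - 1)) (tv_fun x t) = 0" for t by (cases "t = s") (simp_all add: r(2))
 thus ?thesis by (intro tv_eqI) (simp add: tv_fun_Ef_pow)
qed (use assms in \<open>simp add: soc_def\<close>)

definition hw :: "nat => 'k tv" where "hw s = emb s (mon (p - 1) s 0 0)"

text \<open>The vector y^(p-1) w^s is killed by e and has weight p - 1 + s. Applying e^(p-1) reaches
  it only modulo the socle: on the diagonal it is reached from x^(p-1) y^s, and a lift of that form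
  to \<open>Tsp s\<close> is taken.\<close>

lemma highest_weight_vectors:
 assumes s: "s < p"
 shows "tv_fun (hw s) s = mon (p - 1) s 0 0" "ap Ee (hw s) = 0" "ap Eh (hw s) = tvs (of_nat (p - 1 + s)) (hw s)"
  "\<exists>v c. c ~= 0 & ap (Ee ^ (p - 1)) v - tvs c (hw s) : soc s"
proof -
 have b: "mon (p - 1) s 0 0 : (bh (p - 1) s :: 'k fun2 set)" by auto
 have "theta (mon (p - 1) s 0 0) = (0 :: 'k fun2)"
  using p3 by (simp add: theta_def e21_def e12_mon e12_cmult[OF mon_in_bh])
 hence "mon (p - 1) s 0 0 : (Tsp s :: 'k fun2 set)" using b by (auto simp: Tsp_iff[OF s] intro!: bexI[of _ 0])
 hence t: "tv_fun (hw s) t = (if t = s then mon (p - 1) s 0 0 else 0)" for t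
  by (simp add: hw_def tv_fun_emb)
 have d0: "df 0 = 0" "de 0 = 0" by (simp_all add: df_def de_def conv_0 tang_01)
 show t': "tv_fun (hw s) s = mon (p - 1) s 0 0" using t by simp
 have e0: "de (mon (p - 1) s 0 0) = (0 :: 'k fun2)" by (simp add: de_mon)
 show e: "ap Ee (hw s) = 0" using e0 d0 by (intro tv_eqI) (simp add: tv_fun_Ee t)
 have "de (df (mon (p - 1) s 0 0)) = Cst (of_nat (p - 1 + s)) * (mon (p - 1) s 0 0 :: 'k fun2)"
 proof -
  have c: "de (Cst a * mon (p - 1) s i j) = Cst a * de (mon (p - 1) s i j)" if "i <= p - 1" "j <= s" for a i j
   unfolding de_def using that by (intro conv_cmult[OF mon_in_bh tang_01(2)])
  have 1: "de (Cst (- of_nat (p - 1)) * mon (p - 1) s 1 0) = Cst (of_nat (p - 1)) * (mon (p - 1) s 0 0 :: 'k fun2)"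
   using p3 by (subst c) (simp_all add: de_mon Cst_ring)
  have 2: "de (Cst (- of_nat s) * mon (p - 1) s 0 1) = Cst (of_nat s) * (mon (p - 1) s 0 0 :: 'k fun2)"
  proof (cases "s = 0")
   case False thus ?thesis by (subst c) (simp_all add: de_mon Cst_ring)
  qed (simp add: d0)
  have "de (Cst (- of_nat (p - 1)) * mon (p - 1) s 1 0 + Cst (- of_nat s) * mon (p - 1) s 0 1)
   = de (Cst (- of_nat (p - 1)) * mon (p - 1) s 1 0) + de (Cst (- of_nat s) * mon (p - 1) s 0 1)"
  proof -
   have "Cst (- of_nat s) * mon (p - 1) s 0 1 : (bh (p - 1) s :: 'k fun2 set)"
    by (cases "s = 0") (auto intro!: bh_cmult mon_in_bh)
   moreover have "Cst (- of_nat (p - 1)) * mon (p - 1) s 1 0 : (bh (p - 1) s :: 'k fun2 set)"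
    using p3 by (intro bh_cmult mon_in_bh) auto
   ultimately show ?thesis unfolding de_def by (intro conv_add tang_01)
  qed
  thus ?thesis unfolding 1 2 by (simp add: df_mon Cst_ring distrib_right)
 qed
 thus "ap Eh (hw s) = tvs (of_nat (p - 1 + s)) (hw s)"
  by (intro tv_eqI) (auto simp: Eh_def e tv_fun_Ee tv_fun_Ef t d0)
 have H: "mon (p - 1 + s) 0 (p - 1) 0 : (bh (p - 1 + s) 0 :: 'k fun2 set)" by auto
 obtain V :: "'k fun2" where V: "V : Tsp s" "dg V = mon (p - 1 + s) 0 (p - 1) 0"
  using Tsp_lift[OF s H] by blast
 have pl: "p - 1 < p" using p3 by simp
 obtain c where c: "c ~= 0" "(de ^^ (p - 1)) (mon (p - 1 + s) 0 (p - 1) 0) = Cst c * mon (p - 1 + s) 0 0 0"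
  using de_pow_mon[OF le_refl le_add1 pl, of s, unfolded diff_self_eq_0] by blast
 define y where "y = ap (Ee ^ (p - 1)) (emb s V) - tvs c (hw s)"
 have dgp: "dg ((de ^^ n) F) = (de ^^ n) (dg F) & (de ^^ n) F : bh (p - 1) s" if "F : bh (p - 1) s" for n F
 proof (induction n)
  case (Suc n)
  thus ?case using conv_dg[OF conjunct2[OF Suc] tang_01(2)] de_in_bh by (simp add: de_def)
 qed (use that in simp)
 have "dg (tv_fun y s) = 0"
  unfolding y_def using dgp[OF Tsp_in_bh[OF V(1)], of "p - 1"] c(2) V
  by (simp add: tv_fun_Ee_pow tv_fun_emb t dg_mon)
 then obtain r where r: "r : bh (p - 1 - s) 0" "tv_fun y s = Delta ^ s * r"
  using Tsp_dg_eq_0[OF s tv_fun_in_Tsp] by blast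
 have "(de ^^ n) 0 = 0" for n by (induction n) (simp_all add: d0)
 hence off: "tv_fun y t' = 0" if "t' ~= s" for t'
  using that by (simp add: y_def tv_fun_Ee_pow tv_fun_emb[OF V(1)] t)
 have "y = 0" if "s = 0"
  using off \<open>dg (tv_fun y s) = 0\<close> dg_bh_0[OF Tsp_in_bh[OF tv_fun_in_Tsp], of y] that
  by (intro tv_eqI) (metis tv_fun_simps(1))
 hence "y : soc s" using r off by (auto simp: soc_def)
 thus "\<exists>v c. c ~= 0 & ap (Ee ^ (p - 1)) v - tvs c (hw s) : soc s" using c(1) unfolding y_def by blast
qed

end

context charp
begin

subsection \<open>The distribution algebra is the commutant\<close>

lemma bc_df_pow_zero: "p <= n ==> F : bh (p - 1) s ==> bc ((df ^^ n) F) (p - 1) 0 = 0"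
 using bc_df_pow_low[of F "p - 1" s "p - 1" n] p3 by simp

lemma Eh_pow_hw: "s < p ==> ap (Eh ^ j) (hw s) = tvs (of_nat (p - 1 + s) ^ j) (hw s)"
 by (induction j) (simp_all add: highest_weight_vectors(3) mult.commute)

lemma te_vector_space: "vector_space (%c (a :: 'k te). sc c * a)"
 by unfold_locales (simp_all add: distrib_left distrib_right sc_add sc_mult mult.assoc)

text \<open>Extract the lexicographically first coefficient block by multiplying with powers of \<open>f\<close> on the left
 and of \<open>e\<close> on the right; what remains is a polynomial in \<open>h\<close> of degree \<open>< p\<close> with \<open>p\<close> roots.\<close>

lemma PBW_independent:
 fixes c :: "nat => nat => nat => 'k"
 assumes 0: "(\<Sum>i<p. \<Sum>j<p. \<Sum>l<p. sc (c i j l) * (Ef ^ i * Eh ^ j * Ee ^ l)) = 0"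
  and ijl: "i < p" "j < p" "l < p"
 shows "c i j l = 0"
proof (rule ccontr)
 assume "c i j l ~= 0"
 hence ex: "\<exists>i. i < p & (\<exists>j<p. \<exists>l<p. c i j l ~= 0)" using ijl by blast
 define i0 where "i0 = (LEAST i. i < p & (\<exists>j<p. \<exists>l<p. c i j l ~= 0))"
 have i0: "i0 < p" "\<exists>j<p. \<exists>l<p. c i0 j l ~= 0" using LeastI_ex[OF ex] unfolding i0_def by blast+
 have i0_min: "c i j l = 0" if "i < i0" "j < p" "l < p" for i j l
  using not_less_Least[of i "%i. i < p & (\<exists>j<p. \<exists>l<p. c i j l ~= 0)"] that i0(1) unfolding i0_def[symmetric] by auto
 have ex2: "\<exists>l. l < p & (\<exists>j<p. c i0 j l ~= 0)" using i0 by blast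
 define l0 where "l0 = (LEAST l. l < p & (\<exists>j<p. c i0 j l ~= 0))"
 have l0: "l0 < p" "\<exists>j<p. c i0 j l0 ~= 0" using LeastI_ex[OF ex2] unfolding l0_def by blast+
 have l0_min: "c i0 j l = 0" if "l < l0" "j < p" for j l
  using not_less_Least[of l "%l. l < p & (\<exists>j<p. c i0 j l ~= 0)"] that l0(1) unfolding l0_def[symmetric] by auto
 define q where "q = (\<Sum>j<p. monom (c i0 j l0) j)"
 have roots: "poly q (of_nat (p - 1 + s)) = 0" if s: "s < p" for s
 proof -
  obtain v d where d: "d ~= 0" and n: "ap (Ee ^ (p - 1)) v - tvs d (hw s) : soc s"
   using highest_weight_vectors(4)[OF s] by blast
  define n where "n = ap (Ee ^ (p - 1)) v - tvs d (hw s)"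
  have Ev: "ap (Ee ^ (p - 1)) v = tvs d (hw s) + n" by (simp add: n_def)
  \<comment> \<open>The coefficient at x^(p-1) z^0 vanishes on the image of f^n for n >= p. After
    multiplication by f^(p-1-i0) this disposes of all blocks with i > i0.\<close>
  define L where "L x = bc (tv_fun x s) (p - 1) 0" for x :: "'k tv"
  have L: "L (x + y) = L x + L y" "L (tvs a x) = a * L x" "L 0 = 0" for x y a
   using bc_add[OF Tsp_in_bh Tsp_in_bh, of "tv_fun x s" s "tv_fun y s" s]
    bc_cmult[OF Tsp_in_bh, of "tv_fun x s" s a] by (simp_all add: L_def)
  have Lsum: "L (\<Sum>i\<in>I. f i) = (\<Sum>i\<in>I. L (f i))" for I and f :: "nat => 'k tv"
   by (induction I rule: infinite_finite_induct) (auto simp: L)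
  have Lf: "L (ap (Ef ^ n) x) = 0" if "p <= n" for n x
   using bc_df_pow_zero[OF that Tsp_in_bh[OF tv_fun_in_Tsp]] by (simp add: L_def tv_fun_Ef_pow)
  define \<tau> where "\<tau> = L (ap (Ef ^ (p - 1)) (hw s))"
  have \<tau>: "\<tau> ~= 0"
   using bc_df_pow_top[of "p - 1" s] by (simp add: \<tau>_def L_def tv_fun_Ef_pow highest_weight_vectors[OF s])
  define T where "T i j l = L (ap (Ef ^ (p - 1 - i0 + i)) (ap (Eh ^ j) (ap (Ee ^ (l + (p - 1 - l0))) v)))" for i j l
  have "ap (Ef ^ (p - 1 - i0) * (\<Sum>i<p. \<Sum>j<p. \<Sum>l<p. sc (c i j l) * (Ef ^ i * Eh ^ j * Ee ^ l)) * Ee ^ (p - 1 - l0)) v = 0"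
   unfolding 0 by simp
  hence "L (\<Sum>i<p. \<Sum>j<p. \<Sum>l<p. tvs (c i j l) (ap (Ef ^ (p - 1 - i0 + i)) (ap (Eh ^ j) (ap (Ee ^ (l + (p - 1 - l0))) v)))) = 0"
   by (simp add: ap_sum_left ap_sum power_add L)
  hence "(\<Sum>i<p. \<Sum>j<p. \<Sum>l<p. c i j l * T i j l) = 0"
   by (simp add: Lsum L T_def)
  moreover have inner: "(\<Sum>l<p. c i j l * T i j l) = (if i = i0 then c i0 j l0 * (of_nat (p - 1 + s) ^ j * (d * \<tau>)) else 0)"
   if ij: "i < p" "j < p" for i j
  proof -
   have "c i j l * T i j l = (if l = l0 then if i = i0 then c i0 j l0 * (of_nat (p - 1 + s) ^ j * (d * \<tau>)) else 0 else 0)"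
    if l: "l < p" for l
   proof -
    consider "i < i0" | "i > i0" | "i = i0" "l < l0" | "i = i0" "l > l0" | "i = i0" "l = l0" by linarith
    thus ?thesis
    proof cases
     case 1 thus ?thesis using i0_min ij l by auto
    next
     case 2
     hence "p <= p - 1 - i0 + i" using i0(1) by simp
     thus ?thesis using 2 by (simp add: T_def Lf)
    next
     case 3 thus ?thesis using l0_min ij by simp
    next
     case 4
     \<comment> \<open>For l > l0 the vector e^(p-1) v meets at least one more e, which kills
       \<open>hw\<close>; only the socle part n survives, and f^(p-1) kills that.\<close>
     define r where "r = l - l0 - 1"
     have r: "l + (p - 1 - l0) = Suc r + (p - 1)" using 4 l0(1) by (simp add: r_def)
     have e0: "ap (Ee ^ Suc r) (hw s) = 0"
      unfolding power_Suc2 by (simp add: highest_weight_vectors(2)[OF s])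
     have "ap (Ee ^ (l + (p - 1 - l0))) v = ap (Ee ^ Suc r) n"
      unfolding r power_add ap_ring Ev using e0 by simp
     hence "ap (Eh ^ j) (ap (Ee ^ (l + (p - 1 - l0))) v) : soc s"
      using \<open>ap (Ee ^ (p - 1)) v - tvs d (hw s) : soc s\<close> soc_stable by (metis n_def)
     moreover have "p - 1 - i0 + i = p - 1" using 4 i0 by simp
     ultimately have "T i j l = 0" unfolding T_def using Ef_pow_soc[OF _ s] by (simp add: L)
     thus ?thesis using 4 by simp
    next
     case 5
     have e: "p - 1 - i0 + i = p - 1" "l + (p - 1 - l0) = p - 1" using 5 i0 l0 by auto
     have "ap (Ef ^ (p - 1)) (ap (Eh ^ j) n) = 0"
      using \<open>ap (Ee ^ (p - 1)) v - tvs d (hw s) : soc s\<close> soc_stable Ef_pow_soc[OF _ s] by (metis n_def)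
     hence "T i j l = of_nat (p - 1 + s) ^ j * (d * \<tau>)"
      unfolding T_def e Ev by (simp add: Eh_pow_hw[OF s] L \<tau>_def mult_ac)
     thus ?thesis using 5 by simp
    qed
   qed
   hence "(\<Sum>l<p. c i j l * T i j l) = (\<Sum>l<p. if l = l0 then if i = i0 then c i0 j l0 * (of_nat (p - 1 + s) ^ j * (d * \<tau>)) else 0 else 0)"
    by (intro sum.cong) auto
   thus ?thesis using l0(1) by (simp add: sum.delta)
  qed
  moreover have "(\<Sum>i<p. \<Sum>j<p. \<Sum>l<p. c i j l * T i j l)
   = (\<Sum>i<p. if i = i0 then \<Sum>j<p. c i0 j l0 * (of_nat (p - 1 + s) ^ j * (d * \<tau>)) else 0)"
  proof (rule sum.cong[OF refl])
   fix i assume "i : {..<p}"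
   hence "(\<Sum>j<p. \<Sum>l<p. c i j l * T i j l)
    = (\<Sum>j<p. if i = i0 then c i0 j l0 * (of_nat (p - 1 + s) ^ j * (d * \<tau>)) else 0)"
    by (intro sum.cong inner) auto
   thus "(\<Sum>j<p. \<Sum>l<p. c i j l * T i j l)
    = (if i = i0 then \<Sum>j<p. c i0 j l0 * (of_nat (p - 1 + s) ^ j * (d * \<tau>)) else 0)" by simp
  qed
  ultimately have "(\<Sum>i<p. if i = i0 then \<Sum>j<p. c i0 j l0 * (of_nat (p - 1 + s) ^ j * (d * \<tau>)) else 0) = 0"
   by simp
  hence "(\<Sum>j<p. c i0 j l0 * of_nat (p - 1 + s) ^ j) * (d * \<tau>) = 0"
   using i0(1) by (simp add: sum.delta sum_distrib_right mult.assoc)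
  thus ?thesis using d \<tau> by (simp add: q_def poly_sum poly_monom)
 qed
 have q0: "q ~= 0"
 proof
  assume "q = 0"
  obtain j where j: "j < p" "c i0 j l0 ~= 0" using l0 by blast
  have "coeff q j = (\<Sum>i<p. if i = j then c i0 j l0 else 0)"
   by (auto simp: q_def coeff_sum intro!: sum.cong)
  thus False using j \<open>q = 0\<close> by (simp add: sum.delta)
 qed
 have "degree q <= p - 1"
  unfolding q_def by (intro degree_sum_le) (auto intro: order.trans[OF degree_monom_le])
 moreover have "(%s. of_nat (p - 1 + s)) ` {..<p} \<subseteq> {x. poly q x = 0}" using roots by auto
 hence "card ((%s. of_nat (p - 1 + s) :: 'k) ` {..<p}) <= degree q"
  using card_poly_roots_bound[OF q0] poly_roots_finite[OF q0] card_mono le_trans by blast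
 moreover have "inj_on (%s. of_nat (p - 1 + s) :: 'k) {..<p}"
 proof (rule inj_onI)
  have *: "x = y" if "x <= y" "y < p" "of_nat (p - 1 + x) = (of_nat (p - 1 + y) :: 'k)" for x y
  proof -
   have "of_nat (y - x) = (0 :: 'k)" using that by (simp add: of_nat_diff)
   moreover have "0 < y - x & y - x < p" if "x ~= y" using \<open>x <= y\<close> \<open>y < p\<close> that by auto
   ultimately show ?thesis using of_nat_neq_0[of "y - x"] by blast
  qed
  fix x y assume "x : {..<p}" "y : {..<p}" "of_nat (p - 1 + x) = (of_nat (p - 1 + y) :: 'k)"
  thus "x = y" using *[of x y] *[of y x] by (cases "x <= y") auto
 qed
 ultimately show False using p3 by (simp add: card_image)
qed

definition box :: "(nat \<times> nat \<times> nat) set" where "box = {..<p} \<times> {..<p} \<times> {..<p}"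

definition pbw :: "nat \<times> nat \<times> nat => 'k te" where "pbw = (%(i, j, l). Ef ^ i * Eh ^ j * Ee ^ l)"

lemma finite_box [simp]: "finite box" and card_box: "card box = p ^ 3"
 by (simp_all add: box_def card_cartesian_product power3_eq_cube)

lemma pbw_relation: "(\<Sum>t\<in>box. sc (c t) * pbw t) = 0 ==> t : box ==> c t = 0"
proof -
 assume "(\<Sum>t\<in>box. sc (c t) * pbw t) = 0" "t : box"
 moreover have "(\<Sum>t\<in>box. sc (c t) * pbw t) = (\<Sum>i<p. \<Sum>j<p. \<Sum>l<p. sc (c (i, j, l)) * (Ef ^ i * Eh ^ j * Ee ^ l))"
  by (simp add: box_def pbw_def sum.cartesian_product case_prod_unfold)
 ultimately show ?thesis using PBW_independent[of "%i j l. c (i, j, l)"]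
  by (cases t) (auto simp: box_def)
qed

lemma mk_linear: "mk s j (x + y) = mk s j x + mk s j y" "mk s j (tvs a x) = sc a * mk s j x"
 by (auto intro!: te_eqI simp: ap_mk mkf_def mult.commute)

lemma mk_sum: "mk s j (\<Sum>i\<in>I. f i) = (\<Sum>i\<in>I. mk s j (f i))"
proof (induction I rule: infinite_finite_induct)
 case empty
 show ?case using mk_linear(2)[of s j 0 0] by simp
next
 case (infinite I)
 thus ?case using mk_linear(2)[of s j 0 0] by simp
qed (auto simp: mk_linear)

text \<open>A spanning set of component s: 2(p - s) vectors from its own generators and 2s from
  those of p - s, together 2p; for s = 0 just p.\<close>

definition gens :: "nat => 'k tv set"
 where "gens s = (if s = 0 then lb 0 ` {..<p} else lb s ` {..<p - s} \<union> (%j. ap eps (lb s j)) ` {..<p - s} \<union>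
  ((%j. ap alpha (lb (p - s) j)) ` {..<s} \<union> (%j. ap beta (lb (p - s) j)) ` {..<s}))"

lemma card_gens: "s < p ==> card (gens s) <= (if s = 0 then p else 2 * p)" and finite_gens: "finite (gens s)"
proof -
 show "finite (gens s)" by (simp add: gens_def)
 assume s: "s < p"
 show "card (gens s) <= (if s = 0 then p else 2 * p)"
 proof (cases "s = 0")
  case False
  have "card (gens s) <= card (lb s ` {..<p - s}) + card ((%j. ap eps (lb s j)) ` {..<p - s}) +
   (card ((%j. ap alpha (lb (p - s) j)) ` {..<s}) + card ((%j. ap beta (lb (p - s) j)) ` {..<s}))"
   using False unfolding gens_def
   by (simp) (intro order.trans[OF card_Un_le] add_mono card_Un_le)
  also have "... <= (p - s) + (p - s) + (s + s)"
   by (intro add_mono) (metis card_image_le card_lessThan finite_lessThan)+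
  finally show ?thesis using False s by simp
 qed (use card_image_le[of "{..<p}" "lb 0"] in \<open>simp add: gens_def\<close>)
qed

lemma mk_0 [simp]: "mk s j 0 = 0"
 using mk_linear(2)[of s j 0 0] by simp

text \<open>By \<open>KK_expansion\<close> an element of the commutant is determined by its values
  on the generators, and each value can be expanded in \<open>gens s\<close>.\<close>

lemma KK_subset_span:
 "KK \<subseteq> module.span (%c a. sc c * a) (\<Union>(s, j)\<in>Idx. mk s j ` gens s)"
proof
 interpret V: vector_space "%c (a :: 'k te). sc c * a" by (rule te_vector_space)
 let ?S = "\<Union>(s, j)\<in>Idx. mk s j ` gens s"
 have gen: "mk s j b : V.span ?S" if "(s, j) : Idx" "b : gens s" for s j b
  using that by (intro V.span_base) auto
 have off: "mk s j x = mk s j (ap (pr s) x)" for s j x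
  by (rule te_eqI) (simp add: ap_mk mkf_def flip: ap_ring(6) add: pr_mult)
 have mk: "mk s j q : V.span ?S" if sj: "(s, j) : Idx" for s j q
 proof -
  have 1: "mk s j (lb s' j') : V.span ?S" if "(s', j') : Idx" for s' j'
   using gen[OF sj, of "lb s' j'"] that sj off[of s j "lb s' j'"]
   by (cases "s' = s") (auto simp: gens_def lb_props Idx_iff V.span_zero)
  have 2: "mk s j (ap eps (lb s' j')) : V.span ?S" if i: "(s', j') : Idx" for s' j'
  proof (cases "s' = s & s ~= 0")
   case True
   thus ?thesis using gen[OF sj, of "ap eps (lb s' j')"] i by (auto simp: gens_def Idx_iff)
  next
   case False
   have pl: "ap (pr t) (lb s' j') = (if t = s' then lb s' j' else 0)" for t using i by (simp add: Idx_iff lb_props)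
   have "ap (pr s) (ap eps (lb s' j')) = 0"
   proof (cases "s' = s")
    case True
    hence "ap beta (lb s' j') = 0" using False ap_pr_alpha_beta(2)[of 0 "lb s' j'"] pl[of 0] by simp
    thus ?thesis by (simp flip: ap_alpha_beta(3))
   next
    case False
    thus ?thesis using ap_pr_alpha_beta(3)[of s "lb s' j'"] pl[of s] by simp
   qed
   thus ?thesis using off[of s j "ap eps (lb s' j')"] by (simp add: V.span_zero)
  qed
  have 3: "mk s j (ap alpha (lb s' j')) : V.span ?S & mk s j (ap beta (lb s' j')) : V.span ?S" if i: "(s', j') : Idx" for s' j'
  proof (cases "s' ~= 0 & s = p - s'")
   case True
   thus ?thesis using gen[OF sj, of "ap alpha (lb s' j')"] gen[OF sj, of "ap beta (lb s' j')"] i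
    by (auto simp: gens_def Idx_iff)
  next
   case False
   have "ap (pr s) (ap alpha (lb s' j')) = 0 & ap (pr s) (ap beta (lb s' j')) = 0"
    using False i sj arg_cong[OF pr_alpha, of "%a. ap a (lb s' j')" s] arg_cong[OF pr_beta, of "%a. ap a (lb s' j')" s]
    by (auto simp: Idx_iff lb_props split: if_splits)
   thus ?thesis using off[of s j "ap alpha (lb s' j')"] off[of s j "ap beta (lb s' j')"] by (simp add: V.span_zero)
  qed
  have "q = (\<Sum>(s', j')\<in>Idx. mkf s' j' (lb s' j') q)"
   using arg_cong[OF mk_lb_expansion, of "%a. ap a q"] by (simp add: ap_sum_left case_prod_unfold ap_mk)
  hence "mk s j q = (\<Sum>i\<in>Idx. mk s j (mkf (fst i) (snd i) (lb (fst i) (snd i)) q))"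
   by (metis (no_types, lifting) case_prod_unfold mk_sum sum.cong)
  also have "... : V.span ?S"
  proof (intro V.span_sum)
   fix i assume "i : Idx"
   then obtain s' j' where i: "i = (s', j')" "(s', j') : Idx" by (cases i) auto
   hence "ap (pr s') (lb s' j') = lb s' j'" by (simp add: Idx_iff lb_props)
   thus "mk s j (mkf (fst i) (snd i) (lb (fst i) (snd i)) q) : V.span ?S"
    using 1[OF i(2)] 2[OF i(2)] 3[OF i(2)]
    by (auto simp: i(1) mkf_def mk_linear intro!: V.span_add V.span_scale)
  qed
  finally show ?thesis .
 qed
 fix f assume "f : KK"
 hence "f = (\<Sum>i\<in>Idx. mk (fst i) (snd i) (ap f (lb (fst i) (snd i))))"
  using KK_expansion by (simp add: case_prod_unfold)
 also have "... : V.span ?S" using mk by (intro V.span_sum) auto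
 finally show "f : V.span ?S" .
qed

text \<open>There are p - s generators in component s, with 2p possible values each (p for s = 0): p
  * p + 2p * (1 + ... + (p - 1)) = p^3.\<close>

lemma card_KK_generators: "card (\<Union>(s, j)\<in>Idx. mk s j ` gens s) <= p ^ 3"
proof -
 have "card (\<Union>(s, j)\<in>Idx. mk s j ` gens s) <= (\<Sum>i\<in>Idx. card (mk (fst i) (snd i) ` gens (fst i)))"
  by (simp add: case_prod_unfold card_UN_le)
 also have "... <= (\<Sum>i\<in>Idx. if fst i = 0 then p else 2 * p)"
  by (intro sum_mono order.trans[OF card_image_le[OF finite_gens] card_gens]) (auto simp: Idx_def)
 also have "... = (\<Sum>s<p. \<Sum>j<p - s. if s = 0 then p else 2 * p)"
  unfolding Idx_def by (subst sum.Sigma) (auto simp: case_prod_unfold)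
 also have "... = (\<Sum>s<p. (p - s) * (if s = 0 then p else 2 * p))" by simp
 also have "... = p ^ 3"
 proof -
  have t: "2 * (\<Sum>s<n. n - s) = n * (n + 1)" for n :: nat
  proof (induction n)
   case (Suc n)
   have "(\<Sum>s<Suc n. Suc n - s) = Suc n + (\<Sum>s<n. n - s)" by (subst sum.lessThan_Suc_shift) simp
   thus ?case using Suc by (simp add: algebra_simps)
  qed simp
  have "p = Suc (p - 1)" using p3 by simp
  hence sh: "(\<Sum>s<p. f s) = f 0 + (\<Sum>s<p - 1. f (Suc s))" for f :: "nat => nat"
   by (metis sum.lessThan_Suc_shift)
  have "(\<Sum>s<p. (p - s) * (if s = 0 then p else 2 * p)) = p * p + (\<Sum>s<p - 1. p - 1 - s) * (2 * p)"
   unfolding sh by (simp add: sum_distrib_right)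
  also have "... = p * p + p * ((p - 1) * p)" using t[of "p - 1"] p3 by (simp add: mult_ac)
  also have "... = p * p * (1 + (p - 1))" by (simp only: distrib_left mult_1_right mult_ac)
  also have "... = p ^ 3" using p3 by (simp add: power3_eq_cube)
  finally show ?thesis .
 qed
 finally show ?thesis .
qed

lemma dist0_combination:
 assumes "finite I" "\<And>t. t : I ==> b t : dist0"
 shows "(\<lambda>u\<in>regular_funs. \<Sum>t\<in>I. c t * b t u) : dist0 \<and>
  pim (\<lambda>u\<in>regular_funs. \<Sum>t\<in>I. c t * b t u) = (\<Sum>t\<in>I. sc (c t) * pim (b t))"
proof -
 define f where "f I = (\<lambda>u\<in>regular_funs. \<Sum>t\<in>I. c t * b t u)" for I
 have "f I : dist0 & pim (f I) = (\<Sum>t\<in>I. sc (c t) * pim (b t))"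
  using assms
 proof (induction I rule: finite_induct)
  case empty
  have "f {} = dzero" "dzero = dscale 0 done1"
   by (auto simp: f_def dzero_def dscale_def done1_def intro!: restrict_ext)
  moreover have "pim (dscale 0 done1) = 0" using pim_dscale[OF done1_in, of 0] by simp
  ultimately show ?case using dzero_in by (metis sum.empty)
 next
  case (insert t I)
  have "f (insert t I) = dadd (dscale (c t) (b t)) (f I)"
   using insert(1,2) by (auto simp: f_def dadd_def dscale_def intro!: restrict_ext)
  thus ?case using insert dadd_in dscale_in pim_dadd pim_dscale by simp
 qed
 thus ?thesis by (simp add: f_def)
qed

lemma pbw_in_image: "pbw t : pim ` dist0"
proof -
 define I where "I = pim ` dist0"
 have m: "a * b : I" if "a : I" "b : I" for a b
  using that pim_dmul dmul_in by (auto simp: I_def image_iff) metis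
 have a: "a + b : I" if "a : I" "b : I" for a b
  using that pim_dadd dadd_in by (auto simp: I_def image_iff) metis
 have s: "sc x * a : I" if "a : I" for a x
  using that pim_dscale dscale_in by (auto simp: I_def image_iff) metis
 have one: "1 : I" unfolding I_def using pim_done1 done1_in by (metis imageI)
 have pw: "a ^ n : I" if "a : I" for a n using that by (induction n) (auto intro: m one)
 have g: "Ee : I" "Ef : I" by (auto simp: I_def Ee_def Ef_def intro: tang_01)
 have "Ee * Ef + sc (- 1) * (Ef * Ee) : I" by (intro a s m g)
 hence "Eh : I" by (simp add: Eh_def sc_uminus)
 thus ?thesis using g by (auto simp: pbw_def I_def[symmetric] split: prod.split intro: m pw)
qed

text \<open>The image contains p^3 independent PBW monomials and lies in the span of at most p^3
  elements.\<close>

lemma pim_surj: "pim ` dist0 = KK"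
proof
 interpret V: vector_space "%c (a :: 'k te). sc c * a" by (rule te_vector_space)
 show "pim ` dist0 \<subseteq> KK" using pim_in_KK by auto
 have fi: "inj_on pbw box" "V.independent (pbw ` box)"
 proof -
  have R: "\<forall>c t. (\<Sum>t\<in>box. sc (c t) * pbw t) = 0 --> t : box --> c t = 0" using pbw_relation by blast
  show "inj_on pbw box" by (rule V.family_independent(1)) (use R in auto)
  show "V.independent (pbw ` box)" by (rule V.family_independent(2)) (use R in auto)
 qed
 have B: "pbw ` box \<subseteq> V.span (\<Union>(s, j)\<in>Idx. mk s j ` gens s)"
 proof (rule image_subsetI)
  fix t
  have "pbw t : KK" using pbw_in_image[of t] pim_in_KK by auto
  thus "pbw t : V.span (\<Union>(s, j)\<in>Idx. mk s j ` gens s)" using KK_subset_span by (rule subsetD[rotated])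
 qed
 have fin: "finite (\<Union>(s, j)\<in>Idx. mk s j ` gens s)" by (auto simp: finite_gens)
 have "card (\<Union>(s, j)\<in>Idx. mk s j ` gens s) <= card (pbw ` box)"
  using card_KK_generators by (simp add: card_image[OF fi(1)] card_box)
 from V.span_subset_span_if_card_le[OF fi(2) fin B this] have "KK \<subseteq> V.span (pbw ` box)"
  by (rule order.trans[OF KK_subset_span])
 also have "... \<subseteq> pim ` dist0"
 proof
  fix x assume "x : V.span (pbw ` box)"
  then obtain u where "x = (\<Sum>v\<in>pbw ` box. sc (u v) * v)" by (auto simp: V.span_finite)
  hence x: "x = (\<Sum>t\<in>box. sc (u (pbw t)) * pbw t)" by (simp add: sum.reindex[OF fi(1)])
  have "\<forall>t. \<exists>b. b : dist0 & pim b = pbw t" using pbw_in_image by (auto simp: image_iff) metis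
  then obtain b where b: "\<And>t. b t : dist0" "\<And>t. pim (b t) = pbw t" by metis
  show "x : pim ` dist0"
   using dist0_combination[of box b "%t. u (pbw t)"] b by (auto simp: x image_iff intro!: bexI)
 qed
 finally show "KK \<subseteq> pim ` dist0" .
qed

subsection \<open>Injectivity\<close>

inductive_set polyreg :: "('k sl2 => 'k) set" where
 base: "(%x. c * ((sl2_mat x $ 1 $ 1) ^ i * (sl2_mat x $ 1 $ 2) ^ j * (sl2_mat x $ 2 $ 1) ^ l * (sl2_mat x $ 2 $ 2) ^ r)) : polyreg"
| add: "f : polyreg ==> g : polyreg ==> (%x. f x + g x) : polyreg"

lemma polyreg_mult: "f : polyreg ==> g : polyreg ==> (%x. f x * g x) : polyreg"
proof (induction rule: polyreg.induct)
 case 1: (base c i j l r)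
 from 1 show ?case
 proof (induction rule: polyreg.induct)
  case (base c' i' j' l' r')
  show ?case using polyreg.base[of "c * c'" "i + i'" "j + j'" "l + l'" "r + r'"]
   by (simp only: power_add mult_ac)
 next
  case (add f g) thus ?case by (simp add: distrib_left polyreg.add)
 qed
next
 case (add f f') thus ?case by (simp add: distrib_right polyreg.add)
qed

lemma regular_polyreg: "f : regular_funs ==> f : polyreg"
proof (induction rule: regular_funs.induct)
 case (const c) show ?case using polyreg.base[of c 0 0 0 0] by simp
next
 case (entry i j)
 show ?case using exhaust_2[of i] exhaust_2[of j] polyreg.base[of 1 1 0 0 0] polyreg.base[of 1 0 1 0 0]
  polyreg.base[of 1 0 0 1 0] polyreg.base[of 1 0 0 0 1] by auto
qed (auto intro: polyreg.add polyreg_mult)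

definition gmon :: "nat => nat => nat => nat => 'k sl2 => 'k"
 where "gmon i j l r x = (sl2_mat x $ 1 $ 1) ^ i * (sl2_mat x $ 1 $ 2) ^ j * (sl2_mat x $ 2 $ 1) ^ l * (sl2_mat x $ 2 $ 2) ^ r"

lemma gmon_regular: "gmon i j l r : regular_funs"
 unfolding gmon_def[abs_def] by (intro regular_funs.mult regular_power regular_funs.entry)

text \<open>On \<open>G_1\<close> the p-th powers of the entries a, b, c, d count as 1, 0, 0, 1, and
  d can be eliminated; so k[G_1] is spanned by the p^3 monomials in a, b, c with exponents below
  p.\<close>

lemma dist0_determined:
 assumes m: "m : dist0" and 0: "\<And>i j l. i < p ==> j < p ==> l < p ==> m (gmon i j l 0) = 0"
  and u: "u : regular_funs"
 shows "m u = 0"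
proof -
 have fr: "m (%x. gmon i j l r x * sl2_mat x $ a $ b ^ p) = sl2_mat 1 $ a $ b * m (gmon i j l r)" for i j l r a b
  using dist0_frob[OF m gmon_regular regular_funs.entry regular_frob[OF regular_funs.entry]]
  by (simp add: frob_entry)
 have shift: "m (gmon (i + p) j l r) = m (gmon i j l r)" "m (gmon i (j + p) l r) = 0" "m (gmon i j (l + p) r) = 0" for i j l r
  using fr[of i j l r 1 1] fr[of i j l r 1 2] fr[of i j l r 2 1]
  by (simp_all add: gmon_def[abs_def] power_add mat_def mult_ac)
 have abc: "m (gmon i j l 0) = 0" for i j l
 proof (induction i rule: less_induct)
  case (less i)
  consider "p <= i" | "p <= j" | "p <= l" | "i < p" "j < p" "l < p" by linarith
  thus ?case
  proof cases
   case 1 thus ?thesis using less[of "i - p"] shift(1)[of "i - p"] p3 by simp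
  next
   case 2 thus ?thesis using shift(2)[of i "j - p"] by simp
  next
   case 3 thus ?thesis using shift(3)[of i j "l - p"] by simp
  qed (use 0 in auto)
 qed
 have all: "m (gmon i j l r) = 0" for i j l r
 proof (induction r arbitrary: i j l)
  case (Suc r)
  obtain p' where p': "p = Suc p'" using p3 by (cases p) auto
  \<comment> \<open>Multiplying by a^p, which counts as 1, provides a factor a with which one d can
    be traded for 1 + b c.\<close>
  have "m (gmon i j l (Suc r)) = m (gmon (i + p) j l (Suc r))" by (simp add: shift)
  also have "gmon (i + p) j l (Suc r) = (%x. gmon (i + p') j l r x + gmon (i + p') (Suc j) (Suc l) r x)"
  proof
   fix x :: "'k sl2"
   have "sl2_mat x $ 1 $ 1 * sl2_mat x $ 2 $ 2 = 1 + sl2_mat x $ 1 $ 2 * sl2_mat x $ 2 $ 1"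
    using sl2_mat_entries_det[of x] by (simp add: algebra_simps)
   hence "gmon (i + p') j l r x * (sl2_mat x $ 1 $ 1 * sl2_mat x $ 2 $ 2)
    = gmon (i + p') j l r x * (1 + sl2_mat x $ 1 $ 2 * sl2_mat x $ 2 $ 1)" by simp
   thus "gmon (i + p) j l (Suc r) x = gmon (i + p') j l r x + gmon (i + p') (Suc j) (Suc l) r x"
    by (simp add: gmon_def p' distrib_left mult_ac)
  qed
  finally show ?case using Suc dist0_add[OF m gmon_regular gmon_regular] by simp
 qed (rule abc)
 have "polyreg \<subseteq> regular_funs"
 proof
  fix f assume "f : polyreg" thus "f : regular_funs"
   by (induction rule: polyreg.induct) (auto intro: regular_funs.add regular_cmult[OF gmon_regular[unfolded gmon_def[abs_def]]])
 qed
 moreover have "m f = 0" if "f : polyreg" for f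
  using that
 proof (induction rule: polyreg.induct)
  case (base c i j l r)
  show ?case using dist0_cmult[OF m gmon_regular, of c i j l r] all by (simp add: gmon_def)
 next
  case (add f g)
  thus ?case using dist0_add[OF m, of f g] \<open>polyreg \<subseteq> regular_funs\<close> by auto
 qed
 ultimately show ?thesis using regular_polyreg[OF u] by simp
qed

lemma fun_vector_space: "vector_space (%c (f :: 'x => 'k). (%t. c * f t))"
 by unfold_locales (simp_all add: fun_eq_iff fun_app algebra_simps)

text \<open>Values on the p^3 monomials embed \<open>dist0\<close> into a space of dimension p^3,
  which the preimages b of the PBW monomials already span. An element of the kernel is thus a
  combination of the b, and \<open>pim\<close> maps these to independent operators.\<close>

lemma pim_kernel:
 assumes m: "m : dist0" and 0: "pim m = 0" shows "q : regular_funs ==> m q = 0"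
proof -
 interpret V: vector_space "%c (f :: nat \<times> nat \<times> nat => 'k). (%t. c * f t)" by (rule fun_vector_space)
 define R where "R n = (%t. if t : box then n (case t of (i, j, l) => gmon i j l 0) else 0)" for n :: "'k dist"
 have R0: "n q = 0" if "n : dist0" "R n = 0" "q : regular_funs" for n q
 proof (rule dist0_determined[OF that(1) _ that(3)])
  fix i j l assume "i < p" "j < p" "l < p"
  thus "n (gmon i j l 0) = 0" using fun_cong[OF that(2), of "(i, j, l)"] by (simp add: R_def box_def fun_app)
 qed
 have "\<forall>t. \<exists>b. b : dist0 & pim b = pbw t" using pbw_in_image by (auto simp: image_iff) metis
 then obtain b where b: "\<And>t. b t : dist0" "\<And>t. pim (b t) = pbw t" by metis
 define cmb where "cmb c = (\<lambda>q\<in>regular_funs. \<Sum>t\<in>box. c t * b t q)" for c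
 have cmb: "cmb c : dist0" "pim (cmb c) = (\<Sum>t\<in>box. sc (c t) * pbw t)" for c
  using dist0_combination[of box b c] b by (auto simp: cmb_def)
 have Rc: "R (cmb c) = (\<Sum>t\<in>box. (%x. c t * R (b t) x))" for c
  by (auto simp: R_def cmb_def fun_eq_iff fun_app gmon_regular split: prod.splits)
 have z: "c t = 0" if zz: "R n = R (cmb c)" "pim n = 0" "n : dist0" "t : box" for c t n
 proof -
  have e: "n q = cmb c q" if q: "q : regular_funs" for q
  proof -
   define d where "d = dadd n (dscale (- 1) (cmb c))"
   have "R d = 0"
   proof (rule ext)
    fix t
    show "R d t = 0 t" using fun_cong[OF \<open>R n = R (cmb c)\<close>, of t]
     by (cases t; cases "t : box") (simp_all add: R_def d_def dadd_def dscale_def gmon_regular fun_app)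
   qed
   moreover have "d : dist0" unfolding d_def by (intro dadd_in dscale_in cmb zz)
   ultimately have "d q = 0" using R0 q by blast
   thus ?thesis using q by (simp add: d_def dadd_def dscale_def)
  qed
  have "n = cmb c" by (rule dist0_eqI[OF zz(3) cmb(1) e])
  thus ?thesis using cmb(2)[of c] zz(2) pbw_relation[OF _ zz(4), of c] by simp
 qed
 have dz: "pim dzero = 0" "R dzero = 0" using dist0_combination[of "{}" b] 
  by (simp_all add: dzero_def R_def fun_eq_iff fun_app gmon_regular split: prod.split)
 have fi: "inj_on (%t. R (b t)) box" "V.independent ((%t. R (b t)) ` box)"
 proof -
  have F: "\<forall>c t. (\<Sum>t\<in>box. (%x. c t * R (b t) x)) = 0 --> t : box --> c t = 0"
   using z[OF _ dz(1) dzero_in] by (simp add: dz(2) Rc)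
  show "inj_on (%t. R (b t)) box" by (rule V.family_independent(1)) (use F in auto)
  show "V.independent ((%t. R (b t)) ` box)" by (rule V.family_independent(2)) (use F in auto)
 qed
 define dl where "dl t = (%x. if x = t then 1 else (0 :: 'k))" for t :: "nat \<times> nat \<times> nat"
 have sp: "R n : V.span (dl ` box)" for n
 proof -
  have "R n = (\<Sum>t\<in>box. (%x. R n t * dl t x))"
   by (auto simp: fun_eq_iff fun_app dl_def R_def if_distrib sum.delta cong: if_cong)
  also have "... : V.span (dl ` box)" by (intro V.span_sum V.span_scale V.span_base) auto
  finally show ?thesis .
 qed
 have "card (dl ` box) <= card ((%t. R (b t)) ` box)" by (simp add: card_image[OF fi(1)] card_image_le)
 moreover have "(%t. R (b t)) ` box \<subseteq> V.span (dl ` box)" "finite (dl ` box)" using sp by auto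
 ultimately have "V.span (dl ` box) \<subseteq> V.span ((%t. R (b t)) ` box)"
  using fi(2) by (intro V.span_subset_span_if_card_le)
 hence "R m : V.span ((%t. R (b t)) ` box)" using sp by blast
 then obtain u where "R m = (\<Sum>v\<in>(%t. R (b t)) ` box. (%x. u v * v x))" by (auto simp: V.span_finite)
 hence Ru: "R m = (\<Sum>t\<in>box. (%x. u (R (b t)) * R (b t) x))" by (simp add: sum.reindex[OF fi(1)])
 hence "R m = R (cmb (%t. u (R (b t))))" by (simp add: Rc)
 hence "u (R (b t)) = 0" if "t : box" for t using z 0 m that by blast
 hence "R m = 0" unfolding Ru by (auto simp: fun_eq_iff fun_app)
 thus "q : regular_funs ==> m q = 0" using R0 m by blast
qed

lemma pim_bij: "bij_betw pim dist0 KK"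
proof (rule bij_betw_imageI[OF inj_onI pim_surj])
 fix u v assume m: "u : dist0" and n: "v : dist0" and e: "pim u = pim v"
 define d where "d = dadd u (dscale (- 1) v)"
 have "pim d = 0" using e by (simp add: d_def pim_dadd dscale_in m n pim_dscale sc_uminus)
 hence "d f = 0" if "f : regular_funs" for f
  using pim_kernel[OF _ _ that] m n by (simp add: d_def dadd_in dscale_in)
 thus "u = v" by (intro dist0_eqI[OF m n]) (auto simp: d_def dadd_def dscale_def)
qed

end

section \<open>Double complexes\<close>

text \<open>A first-quadrant complex with rows and columns exact except at their start. The two
  differentials commute without sign; \<open>dd\<close> carries its degree because the sign in the
  Koszul differential depends on it.\<close>

locale double_complex =
 fixes C :: "nat => nat => 'c::ab_group_add set" and del :: "'c => 'c" and dd :: "nat => 'c => 'c"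
 assumes C_0: "0 : C i j"
  and C_add: "x : C i j ==> y : C i j ==> x + y : C i j"
  and C_uminus: "x : C i j ==> - x : C i j"
  and del_in: "x : C i j ==> del x : C (Suc i) j"
  and dd_in: "x : C i j ==> dd j x : C i (Suc j)"
  and del_add: "del (x + y) = del x + del y"
  and dd_add: "dd j (x + y) = dd j x + dd j y"
  and del_del: "x : C i j ==> del (del x) = 0"
  and dd_dd: "x : C i j ==> dd (Suc j) (dd j x) = 0"
  and del_dd: "x : C i j ==> del (dd j x) = dd j (del x)"
  and row_exact: "x : C (Suc i) j ==> del x = 0 ==> \<exists>y\<in>C i j. del y = x"
  and col_exact: "x : C i (Suc j) ==> dd (Suc j) x = 0 ==> \<exists>y\<in>C i j. dd j y = x"
begin

lemma del_0 [simp]: "del 0 = 0" and dd_0 [simp]: "dd j 0 = 0"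
 using del_add[of 0 0] dd_add[of j 0 0] by simp_all

lemma del_uminus: "del (- x) = - del x" and dd_uminus: "dd j (- x) = - dd j x"
 using del_add[of x "- x"] dd_add[of j x "- x"] by (simp_all add: eq_neg_iff_add_eq_0 add.commute)

lemma del_diff: "del (x - y) = del x - del y" and dd_diff: "dd j (x - y) = dd j x - dd j y"
 using del_add[of x "- y"] dd_add[of j x "- y"] by (simp_all add: del_uminus dd_uminus)

lemma C_diff: "x : C i j ==> y : C i j ==> x - y : C i j"
 using C_add[of x i j "- y"] C_uminus[of y i j] by simp

definition ZZ :: "nat => nat => 'c set"
 where "ZZ i j = {x : C i j. del x = 0 & dd j x = 0}"

text \<open>Total boundaries inside \<open>ZZ i j\<close>, seen from the row or, for \<open>i = 0\<close>, from the column.\<close>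

fun BB :: "nat => nat => 'c set" where
 "BB 0 0 = {0}"
| "BB 0 (Suc j) = dd j ` {x : C 0 j. del x = 0}"
| "BB (Suc i) j = del ` {x : C i j. dd j x = 0}"

text \<open>A relation instead of a map, because the preimages b are arbitrary; that they do not
  affect the class of z follows from \<open>zigzag_BB\<close>. Linearity and equivariance are stated
  for related pairs.\<close>

fun zigzag :: "nat => nat => 'c => 'c => bool" where
 "zigzag 0 j f z \<longleftrightarrow> f = z"
| "zigzag (Suc i) j f z \<longleftrightarrow> (\<exists>b\<in>C i j. del b = f & zigzag i (Suc j) (dd j b) z)"

lemma zigzag_step_in: "b : C i j ==> del b : ZZ (Suc i) j ==> dd j b : ZZ i (Suc j)"
 by (auto simp: ZZ_def del_dd dd_dd dd_in)

lemma zigzag_in: "zigzag i j f z ==> f : ZZ i j ==> z : ZZ 0 (i + j)"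
proof (induction i arbitrary: j f)
 case (Suc i)
 then obtain b where b: "b : C i j" "del b = f" "zigzag i (Suc j) (dd j b) z" by auto
 hence "dd j b : ZZ i (Suc j)" using Suc.prems zigzag_step_in by blast
 thus ?case using Suc.IH[OF b(3)] by simp
qed simp

lemma zigzag_total: "f : ZZ i j ==> \<exists>z. zigzag i j f z"
proof (induction i arbitrary: j f)
 case (Suc i)
 hence "f : C (Suc i) j" "del f = 0" by (simp_all add: ZZ_def)
 then obtain b where b: "b : C i j" "del b = f" using row_exact by blast
 hence "dd j b : ZZ i (Suc j)" using Suc.prems zigzag_step_in by blast
 then obtain z where "zigzag i (Suc j) (dd j b) z" using Suc.IH by blast
 thus ?case using b by auto
next
 case 0 show ?case by (intro exI[of _ f]) simp
qed

lemma zigzag_surj: "z : ZZ 0 (i + j) ==> \<exists>f\<in>ZZ i j. zigzag i j f z"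
proof (induction i arbitrary: j)
 case (Suc i)
 hence "z : ZZ 0 (i + Suc j)" by simp
 then obtain f where f: "f : ZZ i (Suc j)" "zigzag i (Suc j) f z" using Suc.IH by blast
 hence "f : C i (Suc j)" "dd (Suc j) f = 0" by (simp_all add: ZZ_def)
 then obtain b where b: "b : C i j" "dd j b = f" using col_exact by blast
 have "dd j (del b) = 0" using f b del_dd[OF b(1)] by (simp add: ZZ_def)
 hence "del b : ZZ (Suc i) j" using b del_in del_del by (simp add: ZZ_def)
 thus ?case using b f by auto
qed auto

text \<open>Both conditions amount to x being \<open>del (dd j w)\<close>: exactness turns a closed
  preimage in one direction into a boundary from the other.\<close>

lemma BB_row_col:
 assumes "x : ZZ i (Suc j)"
 shows "x : BB i (Suc j) \<longleftrightarrow> x : dd j ` {y : C i j. del y = 0}"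
proof (cases i)
 case (Suc i')
 have "x : del ` {y : C i' (Suc j). dd (Suc j) y = 0} \<longleftrightarrow> (\<exists>w\<in>C i' j. x = del (dd j w))"
 proof
  assume "x : del ` {y : C i' (Suc j). dd (Suc j) y = 0}"
  then obtain y where "y : C i' (Suc j)" "dd (Suc j) y = 0" "x = del y" by auto
  thus "\<exists>w\<in>C i' j. x = del (dd j w)" using col_exact by metis
 next
  assume "\<exists>w\<in>C i' j. x = del (dd j w)"
  thus "x : del ` {y : C i' (Suc j). dd (Suc j) y = 0}" using dd_in dd_dd by blast
 qed
 moreover have "x : dd j ` {y : C i j. del y = 0} \<longleftrightarrow> (\<exists>w\<in>C i' j. x = del (dd j w))"
 proof
  assume "x : dd j ` {y : C i j. del y = 0}"
  then obtain y where y: "y : C (Suc i') j" "del y = 0" "x = dd j y" using Suc by auto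
  then obtain w where "w : C i' j" "del w = y" using row_exact by blast
  thus "\<exists>w\<in>C i' j. x = del (dd j w)" using y del_dd by metis
 next
  assume "\<exists>w\<in>C i' j. x = del (dd j w)"
  then obtain w where "w : C i' j" "x = dd j (del w)" using del_dd by metis
  thus "x : dd j ` {y : C i j. del y = 0}" using del_in del_del Suc by blast
 qed
 ultimately show ?thesis by (simp add: Suc)
qed simp

text \<open>One step preserves and reflects boundaries, since b may be changed by a preimage e of
  the same value: with \<open>dd j e = 0\<close> in one implication, with \<open>del e = 0\<close>
  in the other.\<close>

lemma zigzag_BB: "zigzag i j f z ==> f : ZZ i j ==> f : BB i j \<longleftrightarrow> z : BB 0 (i + j)"
proof (induction i arbitrary: j f)
 case (Suc i)
 then obtain b where b: "b : C i j" "del b = f" "zigzag i (Suc j) (dd j b) z" by auto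
 hence Z: "dd j b : ZZ i (Suc j)" using Suc.prems zigzag_step_in by blast
 have "f : BB (Suc i) j \<longleftrightarrow> dd j b : dd j ` {y : C i j. del y = 0}"
 proof
  assume "f : BB (Suc i) j"
  then obtain e where "e : C i j" "dd j e = 0" "del e = f" by auto
  hence "b - e : C i j" "del (b - e) = 0" "dd j (b - e) = dd j b" using b by (simp_all add: C_diff del_diff dd_diff)
  thus "dd j b : dd j ` {y : C i j. del y = 0}" by (metis (mono_tags, lifting) image_eqI mem_Collect_eq)
 next
  assume "dd j b : dd j ` {y : C i j. del y = 0}"
  then obtain e where "e : C i j" "del e = 0" "dd j e = dd j b" by auto
  hence "b - e : C i j" "dd j (b - e) = 0" "del (b - e) = f" using b by (simp_all add: C_diff del_diff dd_diff)
  thus "f : BB (Suc i) j" by (auto intro: image_eqI[of f del "b - e"])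
 qed
 also have "... \<longleftrightarrow> dd j b : BB i (Suc j)" using BB_row_col[OF Z] by simp
 also have "... \<longleftrightarrow> z : BB 0 (Suc i + j)" using Suc.IH[OF b(3) Z] by simp
 finally show ?case .
qed simp

lemma zigzag_add: "zigzag i j f z ==> zigzag i j f' z' ==> zigzag i j (f + f') (z + z')"
proof (induction i arbitrary: j f f')
 case (Suc i)
 then obtain b b' where b: "b : C i j" "del b = f" "zigzag i (Suc j) (dd j b) z"
  and b': "b' : C i j" "del b' = f'" "zigzag i (Suc j) (dd j b') z'" by auto
 thus ?case using Suc.IH[OF b(3) b'(3)]
  by (auto intro!: bexI[of _ "b + b'"] simp: C_add del_add dd_add)
qed simp

lemma zigzag_map:
 assumes "\<And>i j x. x : C i j ==> T x : C i j" "\<And>i j x. x : C i j ==> del (T x) = T (del x)"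
  "\<And>i j x. x : C i j ==> dd j (T x) = T (dd j x)"
 shows "zigzag i j f z ==> zigzag i j (T f) (T z)"
proof (induction i arbitrary: j f)
 case (Suc i)
 then obtain b where b: "b : C i j" "del b = f" "zigzag i (Suc j) (dd j b) z" by auto
 hence "del (T b) = T f" "zigzag i (Suc j) (dd j (T b)) (T z)"
  using assms(2,3)[OF b(1)] Suc.IH[OF b(3)] by auto
 thus ?case using assms(1)[OF b(1)] by auto
qed simp

end

subsection \<open>The Hochschild differential, by recursion on the argument list\<close>

text \<open>All terms of the differential but the first, with opposite sign.\<close>

fun hT :: "('r::ring_1 list => 'x => 'r) => 'r list => 'x => 'r" where
 "hT f [] = 0"
| "hT f [a] = f [] * (%_. a)"
| "hT f (a # b # as) = f (a * b # as) - hT (%l. f (a # l)) (b # as)"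

definition hdel :: "('r::ring_1 list => 'x => 'r) => 'r list => 'x => 'r"
 where "hdel f as = (case as of [] => 0 | a # as' => (%_. a) * f as' - hT f as)"

lemma hdel_simps [simp]: "hdel f [] = 0" "hdel f (a # as) = (%_. a) * f as - hT f (a # as)"
 by (simp_all add: hdel_def)

text \<open>The recursion evaluates f only at lists obtained by multiplying or dropping entries, so
  agreement over a multiplicatively closed set suffices.\<close>

lemma hT_cong:
 assumes "\<And>a b. a : S ==> b : S ==> a * b : S"
 shows "set as \<subseteq> S ==> (\<And>l. set l \<subseteq> S ==> Suc (length l) = length as ==> f l = g l) ==> hT f as = hT g as"
proof (induction as arbitrary: f g rule: induct_list012)
 case (3 a b as)
 have "hT (%l. f (a # l)) (b # as) = hT (%l. g (a # l)) (b # as)"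
  using 3(3,4) by (intro 3(2)) auto
 moreover have "f (a * b # as) = g (a * b # as)" using 3(3,4) assms by simp
 ultimately show ?case by simp
qed auto

lemma hT_add: "hT (%l. f l + g l) as = hT f as + hT g as"
 by (induction as arbitrary: f g rule: induct_list012) (simp_all add: algebra_simps)

lemma hT_diff: "hT (%l. f l - g l) as = hT f as - hT g as"
 by (induction as arbitrary: f g rule: induct_list012) (simp_all add: algebra_simps)

lemma hT_left_mult: "hT (%l. q * f l) as = q * hT f as"
 by (induction as arbitrary: f rule: induct_list012) (simp_all add: algebra_simps)

lemma const_fun_mult: "(%_. a * b) = (%_. a) * (%_. b)"
 by (simp add: fun_eq_iff fun_app)

text \<open>The sum of inner and last faces squares to zero. The auxiliary h collects the terms in
  which the first two entries are already multiplied; associativity cancels the double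
  products.\<close>

lemma hT_hT: "hT (hT f) (a # b # as) = 0"
proof (induction as arbitrary: f a b)
 case Nil
 show ?case unfolding hT.simps const_fun_mult by (simp only: mult.assoc diff_self)
next
 case (Cons c cs)
 define h where "h l = (case l of [] => 0 | b # l => f (a * b # l))" for l
 have "hT (%l. hT f (a # l)) (b # c # cs) = hT (%l. h l - hT (%l. f (a # l)) l) (b # c # cs)"
  by (rule hT_cong[of UNIV]) (auto simp: h_def neq_Nil_conv split: list.split)
 also have "... = hT h (b # c # cs)" by (simp only: hT_diff Cons diff_zero)
 also have "... = f (a * b * c # cs) - hT (%l. f (a * b # l)) (c # cs)" by (simp add: h_def mult.assoc)
 finally show ?case by simp
qed

lemma hdel_hdel: "hdel (hdel f) as = 0"
proof (cases as rule: remdups_adj.cases)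
 case (3 a b as')
 have "hT (hdel f) (a # b # as') = (%_. a * b) * f as' - hT f (a * b # as')
   - hT (%l. (%_. a) * f l - hT f (a # l)) (b # as')"
  by simp
 also have "... = (%_. a * b) * f as' - hT f (a * b # as') - (%_. a) * hT f (b # as') + hT (%l. hT f (a # l)) (b # as')"
  by (simp only: hT_diff hT_left_mult) (simp add: algebra_simps)
 also have "... = (%_. a * b) * f as' - (%_. a) * hT f (b # as')" using hT_hT[of f a b as'] by simp
 finally have "hT (hdel f) (a # b # as') = (%_. a) * (%_. b) * f as' - (%_. a) * hT f (b # as')"
  by (simp only: const_fun_mult)
 thus ?thesis unfolding 3 hdel_simps(2)[of "hdel f"] by (simp add: right_diff_distrib mult.assoc)
qed auto

context charp
begin

section \<open>Koszul cochains\<close>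

text \<open>Forms in x with operator coefficients, kept as functions on the plane; the coefficients
  are determined by the function (\<open>Hp_inject\<close>), which gives \<open>hc\<close> its
  meaning.\<close>

definition Hp :: "nat => (nat => 'k te) => 'k tef"
 where "Hp n c = (%x. \<Sum>i\<le>n. sc (x $ 1 ^ i * x $ 2 ^ (n - i)) * c i)"

definition hp :: "nat => ('k tef) set" where "hp n = range (Hp n)"

definition hc :: "nat => 'k tef => nat => 'k te" where "hc n f = (SOME c. f = Hp n c)"

abbreviation Rc :: "'k te => 'k tef" where "Rc a \<equiv> (%_. a)"

definition x1 :: "'k tef" where "x1 = (%x. sc (x $ 1))"
definition x2 :: "'k tef" where "x2 = (%x. sc (x $ 2))"

lemma D_eq: "D = x1 * Rc alpha + x2 * Rc beta"
 by (simp add: fun_eq_iff fun_app D_def x1_def x2_def)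

lemma x1_left_commute: "a * (x1 * b) = x1 * (a * b)" and x2_left_commute: "a * (x2 * b) = x2 * (a * b)"
 by (simp_all add: fun_eq_iff fun_app x1_def x2_def sc_commute sc_left_commute)


lemma te_polynomial_eq_0:
 assumes "\<And>t. (\<Sum>i\<le>n. sc (t ^ i) * c i) = (0 :: 'k te)" and "i <= n"
 shows "c i = 0"
proof (intro te_eqI tv_eqI)
 fix v s
 show "tv_fun (ap (c i) v) s = tv_fun (ap 0 v) s"
 proof (rule bh_eqI[of _ "p - 1" s])
  fix a b
  have "(\<Sum>i\<le>n. bc (tv_fun (ap (c i) v) s) a b * t ^ i) = 0" for t
  proof -
   have "bc (\<Sum>i\<le>n. Cst (t ^ i) * tv_fun (ap (c i) v) s) a b = bc (tv_fun (ap (\<Sum>i\<le>n. sc (t ^ i) * c i) v) s) a b"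
    by (simp add: ap_sum_left tv_fun_sum)
   also have "... = 0" by (simp add: assms(1))
   also have "bc (\<Sum>i\<le>n. Cst (t ^ i) * tv_fun (ap (c i) v) s) a b
    = (\<Sum>i\<le>n. bc (Cst (t ^ i) * tv_fun (ap (c i) v) s) a b)"
    by (intro bc_sum[of _ _ "p - 1" s] bh_cmult Tsp_in_bh) simp
   finally show ?thesis by (simp add: bc_cmult[OF Tsp_in_bh[OF tv_fun_in_Tsp]] mult.commute)
  qed
  hence "tcoeff (%t. \<Sum>i\<le>n. bc (tv_fun (ap (c i) v) s) a b * t ^ i) i = 0"
   by (simp add: tcoeff_const)
  thus "bc (tv_fun (ap (c i) v) s) a b = bc (tv_fun (ap 0 v) s) a b"
   using assms(2) by (simp add: tcoeff_sum_powers)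
 qed (rule Tsp_in_bh[OF tv_fun_in_Tsp])+
qed

lemma Hp_diff: "Hp n (%i. c i - d i) = Hp n c - Hp n d"
 and Hp_add: "Hp n (%i. c i + d i) = Hp n c + Hp n d"
 and Hp_lmult: "Hp n (%i. a * c i) = Rc a * Hp n c"
 and Hp_rmult: "Hp n (%i. c i * a) = Hp n c * Rc a"
 by (simp_all add: Hp_def fun_eq_iff fun_app sum_subtractf sum.distrib sum_distrib_left sum_distrib_right
  algebra_simps sc_left_commute)

lemma Hp_inject:
 assumes "Hp n c = Hp n d" "i <= n" shows "c i = d i"
proof -
 have "(\<Sum>i\<le>n. sc (t ^ i) * (c i - d i)) = 0" for t
  using fun_cong[OF assms(1), of "vec2 t 1"] by (simp add: Hp_def right_diff_distrib sum_subtractf)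
 thus ?thesis using te_polynomial_eq_0[where n = n and c = "%i. c i - d i" and i = i] assms(2) by simp
qed

lemma Hp_cong: "(\<And>i. i <= n ==> c i = d i) ==> Hp n c = Hp n d"
 by (auto simp: Hp_def fun_eq_iff intro!: sum.cong)

lemma Hp_in_hp [simp, intro]: "Hp n c : hp n" by (simp add: hp_def)

lemma Hp_hc: assumes "f : hp n" shows "Hp n (hc n f) = f"
proof -
 have "\<exists>c. f = Hp n c" using assms by (auto simp: hp_def)
 hence "f = Hp n (hc n f)" unfolding hc_def by (rule someI_ex)
 thus ?thesis by (rule sym)
qed

lemma hc_Hp: "i <= n ==> hc n (Hp n c) i = c i"
 using Hp_hc[OF Hp_in_hp, of n c] by (rule Hp_inject)

lemma hc_add: "f : hp n ==> h : hp n ==> i <= n ==> hc n (f + h) i = hc n f i + hc n h i"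
 by (metis (no_types, lifting) Hp_add Hp_hc hc_Hp)

lemma hc_lmult: "f : hp n ==> i <= n ==> hc n (Rc a * f) i = a * hc n f i"
 by (metis (no_types, lifting) Hp_lmult Hp_hc hc_Hp)

lemma hc_rmult: "f : hp n ==> i <= n ==> hc n (f * Rc a) i = hc n f i * a"
 by (metis (no_types, lifting) Hp_rmult Hp_hc hc_Hp)

lemma hp_add: "f : hp n ==> h : hp n ==> f + h : hp n" and hp_lmult: "f : hp n ==> Rc a * f : hp n"
 and hp_rmult: "f : hp n ==> f * Rc a : hp n" and hp_diff: "f : hp n ==> h : hp n ==> f - h : hp n"
 unfolding hp_def by (auto simp flip: Hp_add Hp_lmult Hp_rmult Hp_diff)

lemma hp_0: "0 : hp n"
proof -
 have "Hp n (%_. 0) = 0" by (simp add: Hp_def fun_eq_iff fun_app)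
 thus ?thesis by (metis Hp_in_hp)
qed

lemma hp_uminus: "f : hp n ==> - f : hp n"
 using hp_diff[OF hp_0, of f n] by simp

text \<open>Division by the coordinates: \<open>Q1\<close> takes the terms containing x1,
  \<open>Q2\<close> the remaining pure power of x2, and \<open>R2\<close> divides by x2 a form
  without pure power of x1. Prescribing coefficients makes all three linear.\<close>

definition Q1 :: "nat => 'k tef => 'k tef" where "Q1 n f = Hp n (%i. hc (Suc n) f (Suc i))"
definition Q2 :: "nat => 'k tef => 'k tef" where "Q2 n f = Hp n (%i. if i = 0 then hc (Suc n) f 0 else 0)"
definition R2 :: "nat => 'k tef => 'k tef" where "R2 n f = Hp n (hc (Suc n) f)"

lemma x1_Hp: "x1 * Hp n c = Hp (Suc n) (%i. case i of 0 => 0 | Suc i => c i)"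
proof
 fix x
 have m: "sc a * (sc b * y) = sc (a * b) * y" for a b y by (simp add: sc_mult mult.assoc)
 show "(x1 * Hp n c) x = Hp (Suc n) (%i. case i of 0 => 0 | Suc i => c i) x"
  unfolding Hp_def times_fun_apply x1_def sum.atMost_Suc_shift sum_distrib_left m by (simp add: mult.assoc)
qed

lemma x2_Hp: "x2 * Hp n c = Hp (Suc n) (%i. if i <= n then c i else 0)"
proof
 fix x
 have m: "sc a * (sc b * y) = sc (a * b) * y" for a b y by (simp add: sc_mult mult.assoc)
 show "(x2 * Hp n c) x = Hp (Suc n) (%i. if i <= n then c i else 0) x"
  unfolding Hp_def times_fun_apply x2_def sum.atMost_Suc sum_distrib_left m
  by (auto simp: Suc_diff_le mult.left_commute intro!: sum.cong)
qed

lemma hp_x1: "f : hp n ==> x1 * f : hp (Suc n)" and hp_x2: "f : hp n ==> x2 * f : hp (Suc n)"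
 unfolding hp_def by (auto simp: x1_Hp x2_Hp)

lemma hp_D: "f : hp n ==> D * f : hp (Suc n)" "f : hp n ==> f * D : hp (Suc n)"
proof -
 assume f: "f : hp n"
 show "D * f : hp (Suc n)" unfolding D_eq distrib_right mult.assoc using f
  by (intro hp_add hp_x1 hp_x2 hp_lmult)
 have "f * D = x1 * (f * Rc alpha) + x2 * (f * Rc beta)"
  unfolding D_eq by (simp add: distrib_left x1_left_commute x2_left_commute)
 thus "f * D : hp (Suc n)" using f by (simp add: hp_add hp_x1 hp_x2 hp_rmult)
qed

lemma Q_in_hp: "Q1 n f : hp n" "Q2 n f : hp n" "R2 n f : hp n"
 by (simp_all add: Q1_def Q2_def R2_def)

lemma Q1_Q2:
 assumes "f : hp (Suc n)" shows "x1 * Q1 n f + x2 * Q2 n f = f"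
proof -
 have "x1 * Q1 n f + x2 * Q2 n f = Hp (Suc n) (hc (Suc n) f)"
  unfolding Q1_def Q2_def x1_Hp x2_Hp Hp_add[symmetric] by (rule Hp_cong) (auto split: nat.split)
 thus ?thesis by (simp add: Hp_hc[OF assms])
qed

lemma x2_cancel: assumes "f : hp n" "x2 * f = 0" shows "f = 0"
proof -
 obtain c where c: "f = Hp n c" using assms(1) by (auto simp: hp_def)
 have z: "Hp m (%_. 0) = 0" for m by (simp add: Hp_def fun_eq_iff fun_app)
 have "c i = 0" if "i <= n" for i
  using Hp_inject[of "Suc n" "%i. if i <= n then c i else 0" "%_. 0" i] assms(2) that by (simp add: c x2_Hp z)
 hence "Hp n c = Hp n (%_. 0)" by (intro Hp_cong)
 thus ?thesis by (simp add: c z)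
qed

text \<open>The coefficient of x1^(n+2) shows that U has no pure power of x1, hence is divisible by
  x2; cancelling x2 in the relation then gives V.\<close>

lemma Koszul_syzygy:
 assumes U: "U : hp (Suc n)" and V: "V : hp (Suc n)" and eq: "x1 * U + x2 * V = 0"
 shows "U = x2 * R2 n U" "V = - (x1 * R2 n U)"
proof -
 have z: "Hp m (%_. 0) = 0" for m by (simp add: Hp_def fun_eq_iff fun_app)
 have "Hp (Suc (Suc n)) (%i. (case i of 0 => 0 | Suc i => hc (Suc n) U i) + (if i <= Suc n then hc (Suc n) V i else 0)) = 0"
  unfolding Hp_add x1_Hp[symmetric] x2_Hp[symmetric] Hp_hc[OF U] Hp_hc[OF V] by (rule eq)
 hence top: "hc (Suc n) U (Suc n) = 0"
  using Hp_inject[of "Suc (Suc n)" _ "%_. 0" "Suc (Suc n)"] by (fastforce simp: z)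
 have "x2 * R2 n U = Hp (Suc n) (hc (Suc n) U)"
  unfolding R2_def x2_Hp using top by (intro Hp_cong) (auto simp: le_Suc_eq)
 thus U': "U = x2 * R2 n U" by (simp add: Hp_hc[OF U])
 have "x2 * (V + x1 * R2 n U) = x1 * (x2 * R2 n U) + x2 * V" by (simp add: distrib_left x1_left_commute add.commute)
 also have "... = 0" unfolding U'[symmetric] by (rule eq)
 finally have "V + x1 * R2 n U = 0"
  using x2_cancel[of _ "Suc n"] hp_add[OF V hp_x1] Q_in_hp by blast
 thus "V = - (x1 * R2 n U)" by (simp add: eq_neg_iff_add_eq_0)
qed

subsection \<open>The complex\<close>

text \<open>The component that a form of degree n reaches from s: \<open>D\<close> exchanges s and p
  - s, so only the parity of n enters.\<close>

definition tau :: "nat => nat => nat" where "tau n s = (if even n then s else p - s)"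

text \<open>The degree n term of the resolution of \<open>KK\<close>. On the Steinberg component
  \<open>alpha\<close> and \<open>beta\<close> are zero and there is nothing to resolve, so forms of
  positive degree vanish there.\<close>

definition Iset :: "nat => ('k tef) set"
 where "Iset n = {f : hp n. (\<forall>s. 0 < s --> s < p --> f * Rc (pr s) = Rc (pr (tau n s)) * f) \<and>
  (if n = 0 then f * Rc (pr 0) = Rc (pr 0) * f else f * Rc (pr 0) = 0 & Rc (pr 0) * f = 0)}"

definition dI :: "nat => 'k tef => 'k tef"
 where "dI n f = D * f - (- 1) ^ n * f * D"

lemma Iset_hp: "f : Iset n ==> f : hp n" by (simp add: Iset_def)

lemma minus_one_power_commute: "(- 1) ^ n * a = a * ((- 1) ^ n :: 'r::ring_1)"
 by (cases "even n") auto

lemma Iset_0: "0 : Iset n" by (simp add: Iset_def hp_0)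

lemma Iset_add: "f : Iset n ==> h : Iset n ==> f + h : Iset n"
 by (auto simp: Iset_def hp_add distrib_left distrib_right)

lemma Iset_uminus: "f : Iset n ==> - f : Iset n"
 by (auto simp: Iset_def hp_uminus)

lemma Iset_lmult: assumes "f : Iset n" "\<forall>s. a * pr s = pr s * a" shows "Rc a * f : Iset n"
proof -
 have "Rc a * Rc (pr s) = Rc (pr s) * Rc a" for s using assms(2) by (simp add: fun_eq_iff fun_app)
 hence "Rc (pr s) * (Rc a * h) = Rc a * (Rc (pr s) * h)" for s h by (simp flip: mult.assoc)
 thus ?thesis using assms(1) by (auto simp: Iset_def hp_lmult mult.assoc)
qed

lemma Iset_rmult: assumes "f : Iset n" "\<forall>s. a * pr s = pr s * a" shows "f * Rc a : Iset n"
proof -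
 have "Rc a * Rc (pr s) = Rc (pr s) * Rc a" for s using assms(2) by (simp add: fun_eq_iff fun_app)
 hence "h * Rc a * Rc (pr s) = h * Rc (pr s) * Rc a" for s h by (simp add: mult.assoc)
 thus ?thesis using assms(1) by (auto simp: Iset_def hp_rmult mult.assoc[symmetric])
qed

lemma D_pr: "0 < s ==> s < p ==> D * Rc (pr s) = Rc (pr (p - s)) * D"
 and D_pr_0: "D * Rc (pr 0) = 0" "Rc (pr 0) * D = 0"
proof -
 show "D * Rc (pr s) = Rc (pr (p - s)) * D" if "0 < s" "s < p"
  by (rule ext, rule te_eqI) (use that in \<open>simp add: fun_app D_def ap_pr_alpha_beta\<close>)
 show "D * Rc (pr 0) = 0"
  by (rule ext, rule te_eqI) (simp add: fun_app D_def ap_pr_alpha_beta)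
 have "ap (pr 0) (ap alpha v) = 0 & ap (pr 0) (ap beta v) = 0" for v
  using arg_cong[OF pr_alpha, of "%a. ap a v" 0] arg_cong[OF pr_beta, of "%a. ap a v" 0] by simp
 thus "Rc (pr 0) * D = 0" by (intro ext te_eqI) (simp add: fun_app D_def)
qed

lemma D_D: "D * D = 0"
 by (rule ext, rule te_eqI) (simp add: fun_app D_def mult.commute)

lemma dI_in_Iset:
 assumes "f : Iset n" shows "dI n f : Iset (Suc n)"
proof -
 have h: "f : hp n" by (rule Iset_hp[OF assms])
 have hp: "dI n f : hp (Suc n)" unfolding dI_def using hp_D[OF h]
  by (cases "even n") (auto intro: hp_diff hp_add)
 have par: "dI n f * Rc (pr s) = Rc (pr (tau (Suc n) s)) * dI n f" if s: "0 < s" "s < p" for s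
 proof -
  have 1: "f * Rc (pr s) = Rc (pr (tau n s)) * f" "f * Rc (pr (p - s)) = Rc (pr (tau n (p - s))) * f"
   using assms s by (auto simp: Iset_def)
  have t: "0 < tau n s" "tau n s < p" "p - tau n s = tau (Suc n) s" "tau n (p - s) = tau (Suc n) s"
   using s by (auto simp: tau_def)
  have "D * f * Rc (pr s) = Rc (pr (tau (Suc n) s)) * (D * f)"
   using D_pr[OF t(1,2)] t(3) by (simp add: mult.assoc 1) (simp flip: mult.assoc)
  moreover have "f * D * Rc (pr s) = Rc (pr (tau (Suc n) s)) * (f * D)"
   using D_pr[OF s] 1(2) t(4) by (simp add: mult.assoc) (simp flip: mult.assoc)
  ultimately show ?thesis
   unfolding dI_def by (cases "even n") (simp_all add: left_diff_distrib right_diff_distrib distrib_left distrib_right)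
 qed
 have z: "D * (Rc (pr 0) * v) = 0" "v * Rc (pr 0) * D = 0" for v
  using D_pr_0 by (simp_all add: mult.assoc) (simp flip: mult.assoc)
 have "f * Rc (pr 0) = 0 & Rc (pr 0) * f = 0 | f * Rc (pr 0) = Rc (pr 0) * f"
  using assms by (auto simp: Iset_def split: if_splits)
 hence "D * (f * Rc (pr 0)) = 0" "Rc (pr 0) * f * D = 0" using z[of f] by auto
 hence "D * f * Rc (pr 0) = 0" "Rc (pr 0) * (f * D) = 0" by (simp_all only: mult.assoc)
 moreover have "f * D * Rc (pr 0) = 0" "Rc (pr 0) * (D * f) = 0"
  using D_pr_0 by (simp_all add: mult.assoc) (simp flip: mult.assoc)
 ultimately have "dI n f * Rc (pr 0) = 0" "Rc (pr 0) * dI n f = 0"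
  unfolding dI_def by (cases "even n"; simp add: left_diff_distrib right_diff_distrib distrib_left distrib_right)+
 thus ?thesis using hp par by (simp add: Iset_def)
qed

lemma dI_dI: "dI (Suc n) (dI n f) = 0"
proof -
 have "D * (f * D) = D * f * D" by (simp add: mult.assoc)
 moreover have "D * (D * f) = 0" "f * D * D = 0" using D_D by (simp_all add: mult.assoc) (simp flip: mult.assoc)
 ultimately show ?thesis
  unfolding dI_def by (cases "even n") (simp_all add: algebra_simps)
qed

lemma dI_add: "dI n (f + h) = dI n f + dI n h"
 by (simp add: dI_def algebra_simps)

lemma dI_lmult: assumes "a : KK" shows "dI n (Rc a * f) = Rc a * dI n f"
 and dI_rmult: "a : KK ==> dI n (f * Rc a) = dI n f * Rc a"
proof -
 have c: "D * Rc a = Rc a * D" if "a : KK" for a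
  using that by (simp add: KK_def fun_eq_iff fun_app D_def distrib_left distrib_right sc_left_commute mult.assoc)
 show "dI n (Rc a * f) = Rc a * dI n f"
  using c[OF assms] unfolding dI_def
  by (simp add: right_diff_distrib mult.assoc[symmetric] minus_one_power_commute) (simp add: mult.assoc minus_one_power_commute)
 show "dI n (f * Rc a) = dI n f * Rc a" if "a : KK"
  using c[OF that] unfolding dI_def by (simp add: left_diff_distrib mult.assoc)
qed

text \<open>A form of degree 0 is constant, and evaluating \<open>D\<close> at the two basis vectors
  turns the cocycle condition into commutation with \<open>alpha\<close> and
  \<open>beta\<close>.\<close>

lemma dI_0_kernel:
 "f : Iset 0 ==> dI 0 f = 0 \<longleftrightarrow> (\<exists>a\<in>KK. f = Rc a)"
proof
 assume f: "f : Iset 0" "dI 0 f = 0"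
 then obtain c where c: "f = Hp 0 c" by (auto simp: Iset_def hp_def)
 hence e: "f = Rc (c 0)" by (simp add: Hp_def fun_eq_iff)
 have "D x * c 0 = c 0 * D x" for x using fun_cong[OF f(2), of x] by (simp add: dI_def e fun_app)
 from this[of "vec2 1 0"] this[of "vec2 0 1"] have ab: "c 0 * alpha = alpha * c 0" "c 0 * beta = beta * c 0" by (simp_all add: D_def)
 have "c 0 * pr s = pr s * c 0" for s
 proof (cases "s < p")
  case True
  hence "f * Rc (pr s) = Rc (pr s) * f" using f(1) by (cases "s = 0") (auto simp: Iset_def tau_def)
  thus ?thesis using fun_cong[of _ _ 0] by (simp add: e fun_eq_iff fun_app)
 qed (simp add: pr_ge)
 thus "\<exists>a\<in>KK. f = Rc a" using ab e by (auto simp: KK_def)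
next
 assume "\<exists>a\<in>KK. f = Rc a"
 thus "dI 0 f = 0" using dI_lmult[of _ 0 1] by (auto simp: dI_def)
qed

lemma KK_Iset_0: "a : KK ==> Rc a : Iset 0"
proof -
 assume a: "a : KK"
 have "Rc a = Hp 0 (%_. a)" by (simp add: Hp_def fun_eq_iff)
 hence "Rc a : hp 0" by simp
 thus ?thesis using a by (auto simp: Iset_def KK_def tau_def fun_eq_iff fun_app)
qed

end

context charp
begin

subsection \<open>A linear section of the Koszul differential\<close>

text \<open>Since \<open>pr s = 0\<close> for s >= p, the parity rule may be imposed for every s; in
  odd degree \<open>tau n p = 0\<close> makes the rule at s = p say that
  \<open>Rc (pr 0) * f = 0\<close>.\<close>

lemma Iset_iff: "f : Iset n \<longleftrightarrow> f : hp n & (\<forall>s. f * Rc (pr s) = Rc (pr (tau n s)) * f) & (n > 0 --> f * Rc (pr 0) = 0)"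
proof (intro iffI conjI allI impI)
 assume f: "f : Iset n"
 thus "f : hp n" "n > 0 ==> f * Rc (pr 0) = 0" by (auto simp: Iset_def)
 fix s
 have z: "Rc 0 = (0 :: 'k tef)" by (simp add: fun_eq_iff fun_app)
 show "f * Rc (pr s) = Rc (pr (tau n s)) * f"
  using f pr_ge[of s] pr_ge[of "tau n s"] pr_ge[of p]
  by (cases "0 < s & s < p"; cases "s = 0"; cases "even n"; cases "n = 0") (auto simp: Iset_def tau_def z)
next
 assume *: "f : hp n & (\<forall>s. f * Rc (pr s) = Rc (pr (tau n s)) * f) & (n > 0 --> f * Rc (pr 0) = 0)"
 hence c: "f * Rc (pr s) = Rc (pr (tau n s)) * f" for s by blast
 have z: "Rc 0 = (0 :: 'k tef)" by (simp add: fun_eq_iff fun_app)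
 have "Rc (pr 0) * f = 0" if "n > 0"
 proof (cases "even n")
  case True
  hence "Rc (pr 0) * f = f * Rc (pr 0)" using c[of 0] by (simp add: tau_def)
  also have "... = 0" using * that by blast
  finally show ?thesis .
 next
  case False thus ?thesis using c[of p] pr_ge[of p] by (simp add: tau_def z)
 qed
 moreover have "f * Rc (pr 0) = Rc (pr 0) * f" if "n = 0" using c[of 0] that by (simp add: tau_def)
 ultimately show "f : Iset n"
  using * c by (cases "n = 0") (simp_all add: Iset_def)
qed

text \<open>For f a coordinate function this operator collects the coordinates of v along the
  generators; outside s = 0 a vector is PP c0 v + alpha PP c1 v + beta PP c2 v + eps PP c3 v, as
  \<open>PP_expansion\<close> records.\<close>

definition PP :: "(nat => nat => 'k tv => 'k) => 'k te"
 where "PP f = Abs_te (%v. \<Sum>i\<in>Idx. if fst i = 0 then 0 else tvs (f (fst i) (snd i) v) (lb (fst i) (snd i)))"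

lemma ap_PP:
 assumes "f : {c0, c1, c2, c3}"
 shows "ap (PP f) v = (\<Sum>i\<in>Idx. if fst i = 0 then 0 else tvs (f (fst i) (snd i) v) (lb (fst i) (snd i)))"
proof -
 have s: "tvs c (\<Sum>i\<in>I. h i) = (\<Sum>i\<in>I. tvs c (h i))" for c and I :: "(nat \<times> nat) set" and h
  by (induction I rule: infinite_finite_induct) auto
 show ?thesis
  unfolding PP_def using assms
  by (subst Abs_te_inverse) (auto simp: c_linear tvs_add_left s sum.distrib[symmetric] intro!: sum.cong)
qed

lemma PP_alpha_beta: "PP c1 * alpha = PP c0" "PP c2 * beta = PP c0" "PP c3 * alpha = PP c2" "PP c3 * beta = - PP c1"
 "PP c0 * alpha = 0" "PP c0 * beta = 0" "PP c2 * alpha = 0" "PP c1 * beta = 0"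
 by (auto intro!: te_eqI sum.cong sum.neutral simp: ap_PP c_alpha tvs_uminus_left sum_negf[symmetric])

lemma ap_pr_lb: "(s, j) : Idx ==> ap (pr t) (lb s j) = (if t = s then lb s j else 0)"
 by (simp add: Idx_iff lb_props)

lemma c_pr:
 assumes "0 < s" "s < p"
 shows "c0 s m (ap (pr t) v) = (if t = s then c0 s m v else 0)" "c3 s m (ap (pr t) v) = (if t = s then c3 s m v else 0)"
  "c1 s m (ap (pr t) v) = (if 0 < t & t < p & s = p - t then c1 s m v else 0)"
  "c2 s m (ap (pr t) v) = (if 0 < t & t < p & s = p - t then c2 s m v else 0)"
 using assms by (auto simp: c_defs ap_pr_alpha_beta tf_pr)

lemma PP_pr: "PP c0 * pr t = pr t * PP c0" "PP c3 * pr t = pr t * PP c3"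
 "0 < t ==> t < p ==> PP c1 * pr t = pr (p - t) * PP c1" "0 < t ==> t < p ==> PP c2 * pr t = pr (p - t) * PP c2"
 "PP c1 * pr 0 = 0" "PP c2 * pr 0 = 0" "PP c3 * pr 0 = 0"
proof -
 have I: "s < p" if "(s, j) : Idx" for s j using that by (simp add: Idx_iff)
 show "PP c0 * pr t = pr t * PP c0" "PP c3 * pr t = pr t * PP c3"
  "0 < t ==> t < p ==> PP c1 * pr t = pr (p - t) * PP c1" "0 < t ==> t < p ==> PP c2 * pr t = pr (p - t) * PP c2"
  by (auto intro!: te_eqI sum.cong simp: ap_PP ap_sum ap_pr_lb) (auto simp: c_pr dest!: I)
 show "PP c1 * pr 0 = 0" "PP c2 * pr 0 = 0" "PP c3 * pr 0 = 0"
  by (auto intro!: te_eqI sum.neutral simp: ap_PP c_pr dest!: I)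
qed

lemma PP_expansion:
 obtains e0 where "1 = pr 0 * e0 + PP c0 + alpha * PP c1 + beta * PP c2 + eps * PP c3"
proof -
 define e0 where "e0 = (\<Sum>i\<in>Idx. if fst i = 0 then mk (fst i) (snd i) (lb (fst i) (snd i)) else 0)"
 have "ap (pr 0 * e0 + PP c0 + alpha * PP c1 + beta * PP c2 + eps * PP c3) v = v" for v
 proof -
  have "ap (pr 0 * e0 + PP c0 + alpha * PP c1 + beta * PP c2 + eps * PP c3) v
   = (\<Sum>i\<in>Idx. ap (pr 0) (ap (if fst i = 0 then mk (fst i) (snd i) (lb (fst i) (snd i)) else 0) v)
   + (if fst i = 0 then 0 else tvs (c0 (fst i) (snd i) v) (lb (fst i) (snd i)))
   + ap alpha (if fst i = 0 then 0 else tvs (c1 (fst i) (snd i) v) (lb (fst i) (snd i)))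
   + ap beta (if fst i = 0 then 0 else tvs (c2 (fst i) (snd i) v) (lb (fst i) (snd i)))
   + ap eps (if fst i = 0 then 0 else tvs (c3 (fst i) (snd i) v) (lb (fst i) (snd i))))"
   by (simp add: e0_def ap_sum_left ap_PP ap_sum sum.distrib)
  also have "... = (\<Sum>i\<in>Idx. mkf (fst i) (snd i) (lb (fst i) (snd i)) v)"
   by (rule sum.cong) (auto simp: mkf_def ap_mk ap_pr_lb c_defs)
  also have "... = v" using arg_cong[OF mk_lb_expansion, of "%a. ap a v"]
   by (simp add: ap_sum_left case_prod_unfold ap_mk)
  finally show ?thesis .
 qed
 hence "1 = pr 0 * e0 + PP c0 + alpha * PP c1 + beta * PP c2 + eps * PP c3"
  by (intro te_eqI) simp
 thus ?thesis by (rule that)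
qed

lemma QR_linear:
 assumes "f : hp (Suc n)"
 shows "Q1 n (f * Rc a) = Q1 n f * Rc a" "Q1 n (Rc a * f) = Rc a * Q1 n f"
  "Q2 n (f * Rc a) = Q2 n f * Rc a" "Q2 n (Rc a * f) = Rc a * Q2 n f"
  "R2 n (f * Rc a) = R2 n f * Rc a" "R2 n (Rc a * f) = Rc a * R2 n f"
  "h : hp (Suc n) ==> Q1 n (f + h) = Q1 n f + Q1 n h" "h : hp (Suc n) ==> Q2 n (f + h) = Q2 n f + Q2 n h"
  "h : hp (Suc n) ==> R2 n (f + h) = R2 n f + R2 n h"
 unfolding Q1_def Q2_def R2_def using assms
 by (auto simp: hc_add hc_lmult hc_rmult intro!: Hp_cong simp flip: Hp_add Hp_lmult Hp_rmult)

definition eta :: "nat => 'k te" where "eta n = (- 1) ^ n"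
text \<open>Solves D h - eta h D = f with h = 0 on the generators. At \<open>lb\<close> the equation
  reads x1 h(alpha lb) + x2 h(beta lb) = - eta f(lb), solved by \<open>Q1\<close> and
  \<open>Q2\<close>; at \<open>alpha lb\<close> it reads x2 h(eps lb) = eta (f alpha - D sec1)(lb),
  solved by \<open>R2\<close>. All choices are linear, so \<open>sect\<close> can be applied to
  values of multilinear cochains.\<close>

definition sec1 where "sec1 n f = Rc (- eta n) * Q1 n f"
definition sec2 where "sec2 n f = Rc (- eta n) * Q2 n f"
definition sec3 where "sec3 n f = Rc (eta n) * R2 n (f * Rc alpha - D * sec1 n f)"
definition sect where "sect n f = sec1 n f * Rc (PP c1) + sec2 n f * Rc (PP c2) + sec3 n f * Rc (PP c3)"

lemma eta_square: "eta n * eta n = 1" and eta_commute: "a * eta n = eta n * a"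
 by (cases "even n"; simp add: eta_def)+

lemma Rc_simps: "Rc (a + b) = Rc a + Rc b" "Rc (a * b) = Rc a * Rc b" "Rc (- a) = - Rc a" "Rc 0 = 0" "Rc 1 = 1"
 by (simp_all add: fun_eq_iff fun_app)

lemma Rc_eta: "Rc (eta n) = (- 1) ^ n"
 by (cases "even n") (simp_all add: eta_def fun_eq_iff fun_app)

lemma sec_hp: assumes "f : hp (Suc n)"
 shows "sec1 n f : hp n" "sec2 n f : hp n" "f * Rc alpha - D * sec1 n f : hp (Suc n)" "sec3 n f : hp n"
 using assms by (auto simp: sec1_def sec2_def sec3_def intro!: hp_lmult Q_in_hp hp_diff hp_rmult hp_D)

lemma sect_linear:
 assumes f: "f : hp (Suc n)" and h: "h : hp (Suc n)"
 shows "sect n (Rc (sc a) * f + h) = Rc (sc a) * sect n f + sect n h"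
proof -
 have c: "Rc (sc a) * (\<upsilon> * \<zeta>) = \<upsilon> * (Rc (sc a) * \<zeta>)" for \<upsilon> \<zeta> :: "'k tef"
  by (simp add: fun_eq_iff fun_app sc_left_commute)
 have af: "Rc (sc a) * f : hp (Suc n)" using f by (rule hp_lmult)
 have 1: "sec1 n (Rc (sc a) * f + h) = Rc (sc a) * sec1 n f + sec1 n h"
  "sec2 n (Rc (sc a) * f + h) = Rc (sc a) * sec2 n f + sec2 n h"
  unfolding sec1_def sec2_def by (simp_all add: QR_linear[OF af] QR_linear[OF f] h distrib_left c)
 have "(Rc (sc a) * f + h) * Rc alpha - D * sec1 n (Rc (sc a) * f + h)
  = Rc (sc a) * (f * Rc alpha - D * sec1 n f) + (h * Rc alpha - D * sec1 n h)"
  unfolding 1 by (simp add: algebra_simps c)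
 hence 3: "sec3 n (Rc (sc a) * f + h) = Rc (sc a) * sec3 n f + sec3 n h"
  unfolding sec3_def using QR_linear[OF hp_lmult[OF sec_hp(3)[OF f], of "sc a"]] QR_linear[OF sec_hp(3)[OF f]] sec_hp(3)[OF h]
  by (simp add: distrib_left c)
 show ?thesis unfolding sect_def 1 3 by (simp add: algebra_simps)
qed

lemma sect_in_Iset:
 assumes f: "f : Iset (Suc n)" shows "sect n f : Iset n"
proof -
 have h: "f : hp (Suc n)" and par: "f * Rc (pr s) = Rc (pr (tau (Suc n) s)) * f" for s using f by (auto simp: Iset_iff)
 have e: "Rc a * Rc (- eta n) = Rc (- eta n) * Rc a" "Rc a * Rc (eta n) = Rc (eta n) * Rc a" for a
  by (simp_all add: fun_eq_iff fun_app eta_commute)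
 have q12: "sec1 n f * Rc (pr s) = Rc (pr (tau (Suc n) s)) * sec1 n f" "sec2 n f * Rc (pr s) = Rc (pr (tau (Suc n) s)) * sec2 n f" for s
  unfolding sec1_def sec2_def mult.assoc QR_linear(1,3)[OF h, symmetric] par QR_linear(2,4)[OF h]
  by (simp_all add: e flip: mult.assoc)
 have "(f * Rc alpha - D * sec1 n f) * Rc (pr s) = Rc (pr (tau n s)) * (f * Rc alpha - D * sec1 n f)" if s: "0 < s" "s < p" for s
 proof -
  have t: "tau (Suc n) (p - s) = tau n s" "0 < tau (Suc n) s" "tau (Suc n) s < p" "p - tau (Suc n) s = tau n s"
   using s by (auto simp: tau_def)
  have "Rc alpha * Rc (pr s) = Rc (pr (p - s)) * Rc alpha" using s by (simp add: fun_eq_iff fun_app alpha_pr)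
  hence "f * Rc alpha * Rc (pr s) = Rc (pr (tau n s)) * (f * Rc alpha)"
   using par[of "p - s"] t(1) by (simp add: mult.assoc) (simp flip: mult.assoc)
  moreover have "D * sec1 n f * Rc (pr s) = Rc (pr (tau n s)) * (D * sec1 n f)"
   using D_pr[OF t(2,3)] t(4) by (simp add: mult.assoc q12) (simp flip: mult.assoc)
  ultimately show ?thesis by (simp add: left_diff_distrib right_diff_distrib)
 qed
 hence q3: "sec3 n f * Rc (pr s) = Rc (pr (tau n s)) * sec3 n f" if "0 < s" "s < p" for s
  unfolding sec3_def mult.assoc QR_linear(5)[OF sec_hp(3)[OF h], symmetric] using that
  by (simp add: QR_linear(6)[OF sec_hp(3)[OF h]]) (simp add: e flip: mult.assoc)
 have PR: "0 < t ==> Rc (PP c3) * Rc (pr t) = Rc (pr t) * Rc (PP c3)"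
  "0 < t ==> t < p ==> Rc (PP c1) * Rc (pr t) = Rc (pr (p - t)) * Rc (PP c1)"
  "0 < t ==> t < p ==> Rc (PP c2) * Rc (pr t) = Rc (pr (p - t)) * Rc (PP c2)"
  "Rc (PP c1) * Rc (pr 0) = 0" "Rc (PP c2) * Rc (pr 0) = 0" "Rc (PP c3) * Rc (pr 0) = 0" for t
  using PP_pr by (simp_all flip: Rc_simps(2)) (simp_all add: Rc_simps)
 have z: "sect n f * Rc (pr 0) = 0" unfolding sect_def by (simp add: distrib_right mult.assoc PR)
 have c: "sect n f * Rc (pr s) = Rc (pr (tau n s)) * sect n f" if s: "0 < s" "s < p" for s
 proof -
  have t: "tau (Suc n) (p - s) = tau n s" using s by (auto simp: tau_def)
  show ?thesis
   unfolding sect_def using s by (simp add: distrib_right distrib_left mult.assoc PR)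
    (simp add: q12 q3[OF s] t flip: mult.assoc)
 qed
 have "sect n f * Rc (pr 0) = Rc (pr 0) * sect n f & Rc (pr 0) * sect n f = 0"
 proof -
  have "sect n f = sect n f * Rc (\<Sum>s<p. pr s)" by (simp add: pr_sum Rc_simps)
  also have "... = (\<Sum>s<p. sect n f * Rc (pr s))"
   by (simp add: fun_eq_iff fun_app sum_distrib_left)
  also have "... = (\<Sum>s\<in>{..<p} - {0}. Rc (pr (tau n s)) * sect n f)"
   using z c by (intro sum.mono_neutral_cong_right) auto
  finally have "Rc (pr 0) * sect n f = (\<Sum>s\<in>{..<p} - {0}. Rc (pr 0) * (Rc (pr (tau n s)) * sect n f))"
   by (metis sum_distrib_left)
  also have "... = 0"
  proof (intro sum.neutral ballI)
   fix s assume s: "s : {..<p} - {0}"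
   have "Rc (pr 0) * Rc (pr (tau n s)) = 0" using s by (auto simp: fun_eq_iff fun_app pr_mult tau_def)
   thus "Rc (pr 0) * (Rc (pr (tau n s)) * sect n f) = 0" by (simp flip: mult.assoc)
  qed
  finally show ?thesis using z by simp
 qed
 moreover have "sect n f : hp n"
  unfolding sect_def using sec_hp[OF h] by (intro hp_add hp_rmult)
 ultimately show ?thesis using c by (auto simp: Iset_def)
qed

text \<open>The equations left are those at \<open>beta lb\<close> and \<open>eps lb\<close>. The
  cocycle condition makes (U, V) a syzygy of (x1, x2); the Koszul relation gives the first equation,
  and the second after cancelling a factor x2.\<close>

lemma dI_sect:
 assumes f: "f : Iset (Suc n)" and 0: "dI (Suc n) f = 0" shows "dI n (sect n f) = f"
proof -
 have h: "f : hp (Suc n)" and k0: "f * Rc (pr 0) = 0" using f by (auto simp: Iset_iff)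
 define E where "E = Rc (eta n)"
 have EE: "E * E = 1" by (simp add: E_def fun_eq_iff fun_app eta_square)
 have Ec: "a * E = E * a" for a by (rule ext) (simp only: E_def times_fun_apply eta_commute)
 have Elc: "a * (E * b) = E * (a * b)" for a b by (simp only: mult.assoc[symmetric] Ec)
 have EE': "E * (E * a) = a" for a using EE by (simp flip: mult.assoc)
 have df: "D * f = - (E * (f * D))" using 0 by (simp add: dI_def E_def Rc_eta mult.assoc eq_neg_iff_add_eq_0)
 define a1 a2 a3 U V where "a1 = sec1 n f" and "a2 = sec2 n f" and "a3 = sec3 n f"
  and "U = f * Rc alpha - D * a1" and "V = f * Rc beta - D * a2"
 have s1: "x1 * a1 + x2 * a2 = - (E * f)"
 proof -
  have "x1 * a1 + x2 * a2 = - (E * (x1 * Q1 n f + x2 * Q2 n f))"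
   by (simp add: a1_def a2_def sec1_def sec2_def Rc_simps x1_left_commute[symmetric] x2_left_commute[symmetric] distrib_left flip: E_def)
  thus ?thesis by (simp only: Q1_Q2[OF h])
 qed
 have UV: "U : hp (Suc n)" "V : hp (Suc n)"
  using sec_hp[OF h] by (auto simp: U_def V_def a1_def a2_def intro!: hp_diff hp_rmult hp_D h)
 have fD: "f * D = x1 * (f * Rc alpha) + x2 * (f * Rc beta)"
  by (simp only: D_eq distrib_left x1_left_commute x2_left_commute)
 have UV': "x1 * U = x1 * (f * Rc alpha) - D * (x1 * a1)" "x2 * V = x2 * (f * Rc beta) - D * (x2 * a2)"
  by (simp_all only: U_def V_def right_diff_distrib x1_left_commute[of D] x2_left_commute[of D])
 have "x1 * U + x2 * V = f * D - D * (x1 * a1 + x2 * a2)"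
  by (simp only: fD distrib_left UV' add_diff_add)
 also have "... = 0" by (simp add: s1 df Elc[of D] EE')
 finally have syz: "U = x2 * R2 n U" "V = - (x1 * R2 n U)" using Koszul_syzygy[OF UV] by auto
 have a3: "a3 = E * R2 n U" by (simp add: a3_def sec3_def E_def U_def a1_def)
 have ER: "E * (x2 * a3) = U" "E * (x1 * a3) = - V"
  unfolding a3 x1_left_commute[of E] x2_left_commute[of E] EE' syz[symmetric] by (simp_all add: syz(2))
 hence al: "D * a1 + E * (x2 * a3) = f * Rc alpha" and be: "D * a2 - E * (x1 * a3) = f * Rc beta"
  by (simp_all add: U_def V_def)
 have "x2 * (D * a3) = D * (E * (x2 * R2 n U))" by (simp only: a3 x2_left_commute[of D] x2_left_commute[of E])
 also have "... = E * (D * f * Rc alpha)" using D_D unfolding syz(1)[symmetric] Elc[of D] by (simp add: U_def right_diff_distrib flip: mult.assoc)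
 also have "... = - (f * D * Rc alpha)" by (simp add: df mult.assoc EE')
 also have "D * Rc alpha = - (x2 * Rc eps)"
  by (simp add: fun_eq_iff fun_app D_def x2_def eps_def distrib_right mult.assoc beta_alpha)
 hence "- (f * D * Rc alpha) = x2 * (f * Rc eps)" by (simp add: mult.assoc x2_left_commute)
 finally have "x2 * (D * a3 - f * Rc eps) = 0" by (simp add: right_diff_distrib)
 moreover have "D * a3 - f * Rc eps : hp (Suc n)"
  unfolding a3_def using sec_hp[OF h] h by (intro hp_diff hp_D hp_rmult)
 ultimately have ep: "D * a3 = f * Rc eps" using x2_cancel by fastforce
 have PD: "Rc (PP c1) * D = x1 * Rc (PP c0)" "Rc (PP c2) * D = x2 * Rc (PP c0)"
  "Rc (PP c3) * D = x1 * Rc (PP c2) - x2 * Rc (PP c1)"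
  by (simp_all add: fun_eq_iff fun_app D_def x1_def x2_def distrib_left sc_left_commute PP_alpha_beta)
 obtain e0 where e: "1 = pr 0 * e0 + PP c0 + alpha * PP c1 + beta * PP c2 + eps * PP c3" by (rule PP_expansion)
 have "f = f * Rc (pr 0 * e0 + PP c0 + alpha * PP c1 + beta * PP c2 + eps * PP c3)" by (simp add: Rc_simps flip: e)
 also have "... = f * Rc (PP c0) + f * Rc alpha * Rc (PP c1) + f * Rc beta * Rc (PP c2) + f * Rc eps * Rc (PP c3)"
  by (simp add: Rc_simps distrib_left k0 flip: mult.assoc)
 also have "... = dI n (sect n f)"
 proof -
  have "f = - (E * (x1 * a1 + x2 * a2))" by (simp add: s1 EE')
  hence "f * Rc (PP c0) = - (E * (x1 * a1 + x2 * a2)) * Rc (PP c0)" by (rule arg_cong)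
  also have "... = - (E * (a1 * (x1 * Rc (PP c0)))) - E * (a2 * (x2 * Rc (PP c0)))"
   unfolding x1_left_commute[of a1] x2_left_commute[of a2] by (simp add: distrib_left distrib_right left_diff_distrib mult.assoc)
  finally have "f * Rc (PP c0) = - (E * (a1 * (x1 * Rc (PP c0)))) - E * (a2 * (x2 * Rc (PP c0)))" .
  moreover have "sect n f * D = a1 * (x1 * Rc (PP c0)) + a2 * (x2 * Rc (PP c0)) + a3 * (x1 * Rc (PP c2)) - a3 * (x2 * Rc (PP c1))"
   by (simp add: sect_def a1_def a2_def a3_def distrib_right mult.assoc PD right_diff_distrib)
  moreover have "D * sect n f = D * a1 * Rc (PP c1) + D * a2 * Rc (PP c2) + D * a3 * Rc (PP c3)"
   by (simp add: sect_def a1_def a2_def a3_def distrib_left mult.assoc)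
  moreover have "dI n (sect n f) = D * sect n f - E * (sect n f * D)" by (simp add: dI_def E_def Rc_eta mult.assoc)
  ultimately show ?thesis
   unfolding al[symmetric] be[symmetric] ep[symmetric] x1_left_commute[of a3] x2_left_commute[of a3]
   by (simp add: distrib_left distrib_right left_diff_distrib right_diff_distrib mult.assoc)
 qed
 finally show ?thesis by simp
qed

end

context charp
begin

section \<open>Cochains with values in the Koszul complex\<close>

lemma KK_mult: "a : KK ==> b : KK ==> a * b : KK" and KK_add: "a : KK ==> b : KK ==> a + b : KK"
proof -
 have "a * b * z = z * (a * b)" if "a * z = z * a" "b * z = z * b" for z
  by (metis mult.assoc that)
 thus "a : KK ==> b : KK ==> a * b : KK" by (simp add: KK_def)
qed (simp add: KK_def distrib_left distrib_right)

lemma KK_sc: "sc c : KK" by (simp add: KK_def sc_commute[symmetric])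

lemma KK_pr: "a : KK ==> \<forall>s. a * pr s = pr s * a" by (simp add: KK_def)

text \<open>Linearity is asked only for arguments in \<open>KK\<close>; additivity and homogeneity
  are merged so that a single law passes through the inductions.\<close>

definition multilin :: "('k te list => 'k tef) => bool"
 where "multilin f \<longleftrightarrow> (\<forall>l1 l2 x y c. set l1 \<subseteq> KK --> set l2 \<subseteq> KK --> x : KK --> y : KK -->
  f (l1 @ (sc c * x + y) # l2) = Rc (sc c) * f (l1 @ x # l2) + f (l1 @ y # l2))"

lemma multilinI:
 assumes "\<And>l1 l2 x y c. set l1 \<subseteq> KK ==> set l2 \<subseteq> KK ==> x : KK ==> y : KK ==>
  f (l1 @ (sc c * x + y) # l2) = Rc (sc c) * f (l1 @ x # l2) + f (l1 @ y # l2)"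
 shows "multilin f"
 unfolding multilin_def by (intro allI impI) (rule assms)

lemma multilinD:
 assumes "multilin f" "set l1 \<subseteq> KK" "set l2 \<subseteq> KK" "x : KK" "y : KK"
 shows "f (l1 @ (sc c * x + y) # l2) = Rc (sc c) * f (l1 @ x # l2) + f (l1 @ y # l2)"
 using assms unfolding multilin_def by meson

lemma multilin_Cons: "multilin f ==> a : KK ==> multilin (%l. f (a # l))"
 using multilinD[of f "a # _"] by (intro multilinI) simp

lemma hT_0: "hT (%l. 0) as = 0"
 using hT_diff[of "%l. 0" "%l. 0" as] by simp

lemma hT_multilin:
 assumes "multilin f" "set l1 \<subseteq> KK" "set l2 \<subseteq> KK" "x : KK" "y : KK"
 shows "hT f (l1 @ (sc c * x + y) # l2) = Rc (sc c) * hT f (l1 @ x # l2) + hT f (l1 @ y # l2)"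
 using assms
proof (induction l1 arbitrary: f)
 case Nil
 have z: "sc c * x + y : KK" using Nil by (intro KK_add KK_mult KK_sc)
 have S: "Rc (sc c * x + y) = Rc (sc c) * Rc x + Rc y" by (simp only: Rc_simps)
 have C: "g * Rc (sc c) = Rc (sc c) * g" for g by (simp add: fun_eq_iff fun_app sc_commute)
 have "hT f ([] @ (sc c * x + y) # l2) = Rc (sc c) * hT f ([] @ x # l2) + hT f ([] @ y # l2)"
 proof (cases l2)
  case l2: Nil
  show ?thesis by (simp only: l2 append_Nil hT.simps S distrib_left mult.assoc[symmetric] C)
 next
  case (Cons b l2')
  hence b: "b : KK" and l2': "set l2' \<subseteq> KK" using Nil by auto
  have "hT (%l. f ((sc c * x + y) # l)) (b # l2') = hT (%l. Rc (sc c) * f (x # l) + f (y # l)) (b # l2')"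
   by (rule hT_cong[where S = KK]) (use Nil(1,4,5) b l2' KK_mult multilinD[OF Nil(1), of "[]"] in auto)
  also have "... = Rc (sc c) * hT (%l. f (x # l)) (b # l2') + hT (%l. f (y # l)) (b # l2')"
   by (simp only: hT_add hT_left_mult)
  finally have 1: "hT (%l. f ((sc c * x + y) # l)) (b # l2')
   = Rc (sc c) * hT (%l. f (x # l)) (b # l2') + hT (%l. f (y # l)) (b # l2')" .
  have "(sc c * x + y) * b = sc c * (x * b) + y * b" by (simp add: distrib_right mult.assoc)
  hence 2: "f ((sc c * x + y) * b # l2') = Rc (sc c) * f (x * b # l2') + f (y * b # l2')"
   using multilinD[OF Nil(1), of "[]" l2' "x * b" "y * b" c] l2' KK_mult[OF _ b] Nil(4,5) by simp
  show ?thesis unfolding Cons append_Nil hT.simps 1 2 by (simp add: right_diff_distrib)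
 qed
 thus ?case .
next
 case (Cons a l1)
 have a: "a : KK" and l1: "set l1 \<subseteq> KK" using Cons by auto
 have 1: "hT (%l. f (a # l)) (l1 @ (sc c * x + y) # l2)
  = Rc (sc c) * hT (%l. f (a # l)) (l1 @ x # l2) + hT (%l. f (a # l)) (l1 @ y # l2)"
  using Cons(1)[OF multilin_Cons[OF Cons(2) a] l1] Cons.prems by blast
 have "hT f ((a # l1) @ (sc c * x + y) # l2) = Rc (sc c) * hT f ((a # l1) @ x # l2) + hT f ((a # l1) @ y # l2)"
 proof (cases l1)
  case Nil
  have "a * (sc c * x + y) = sc c * (a * x) + a * y" by (simp add: distrib_left sc_left_commute)
  hence "f (a * (sc c * x + y) # l2) = Rc (sc c) * f (a * x # l2) + f (a * y # l2)"
   using multilinD[OF Cons(2), of "[]" l2 "a * x" "a * y" c] KK_mult[OF a] Cons.prems by simp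
  thus ?thesis using 1 unfolding Nil append_Cons append_Nil hT.simps by (simp add: right_diff_distrib)
 next
  case l1': (Cons b l)
  hence "set (a * b # l) \<subseteq> KK" using KK_mult a l1 by auto
  hence "f (a * b # l @ (sc c * x + y) # l2) = Rc (sc c) * f (a * b # l @ x # l2) + f (a * b # l @ y # l2)"
   using multilinD[OF Cons(2), of "a * b # l" l2 x y c] Cons.prems by simp
  thus ?thesis using 1 unfolding l1' append_Cons hT.simps by (simp add: right_diff_distrib)
 qed
 thus ?case .
qed

lemma hT_in_Iset:
 "set as \<subseteq> KK ==> (\<And>l. f l : Iset j) ==> hT f as : Iset j"
proof (induction as arbitrary: f rule: induct_list012)
 case (3 a b as)
 have "hT (%l. f (a # l)) (b # as) : Iset j" using 3 by simp
 hence "hT f (a # b # as) : Iset j" using Iset_add[OF 3(4) Iset_uminus] by simp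
 thus ?case .
next
 case 1
 have "hT f [] : Iset j" by (simp add: Iset_0)
 thus ?case .
next
 case (2 a)
 hence "hT f [a] : Iset j" by (auto intro!: Iset_rmult KK_pr)
 thus ?case .
qed

lemma hT_dI: "set as \<subseteq> KK ==> hT (%l. dI j (f l)) as = dI j (hT f as)"
proof (induction as arbitrary: f rule: induct_list012)
 case (3 a b as)
 have "dI j (u - h) = dI j u - dI j h" for u h by (simp add: dI_def algebra_simps)
 hence "hT (%l. dI j (f l)) (a # b # as) = dI j (hT f (a # b # as))" using 3 by simp
 thus ?case .
next
 case 1
 have "hT (%l. dI j (f l)) [] = dI j (hT f [])" by (simp add: dI_def)
 thus ?case .
next
 case (2 a)
 hence "hT (%l. dI j (f l)) [a] = dI j (hT f [a])" by (simp add: dI_rmult)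
 thus ?case .
qed

text \<open>Here i is the Hochschild degree and j the Koszul degree. Values off the domain are fixed
  to 0, so that equality of cochains is equality of functions.\<close>

definition CI :: "nat => nat => ('k te list => 'k tef) set"
 where "CI i j = {f. multilin f & (\<forall>as. f as : Iset j) & (\<forall>as. ~ (length as = i & set as \<subseteq> KK) --> f as = 0)}"

definition delC :: "('k te list => 'k tef) => 'k te list => 'k tef"
 where "delC f = (%as. if set as \<subseteq> KK then hdel f as else 0)"

definition ddC :: "nat => ('k te list => 'k tef) => 'k te list => 'k tef"
 where "ddC j f = (%as. dI j (f as))"

lemma CI_D: "f : CI i j ==> multilin f" "f : CI i j ==> f as : Iset j" "f : CI i j ==> length as ~= i ==> f as = 0"
 "f : CI i j ==> ~ set as \<subseteq> KK ==> f as = 0"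
 by (auto simp: CI_def)

lemma CI_I: "multilin f ==> (\<And>as. f as : Iset j) ==> (\<And>as. length as ~= i ==> f as = 0) ==> (\<And>as. ~ set as \<subseteq> KK ==> f as = 0)
 ==> f : CI i j"
 by (auto simp: CI_def)

lemma hdel_multilin:
 assumes f: "multilin f" and l: "set l1 \<subseteq> KK" "set l2 \<subseteq> KK" "x : KK" "y : KK"
 shows "hdel f (l1 @ (sc c * x + y) # l2) = Rc (sc c) * hdel f (l1 @ x # l2) + hdel f (l1 @ y # l2)"
proof (cases l1)
 case Nil
 thus ?thesis using hT_multilin[OF f l, of c] by (simp add: Rc_simps algebra_simps)
next
 case (Cons a l1')
 have C: "Rc a * (Rc (sc c) * g) = Rc (sc c) * (Rc a * g)" for g by (simp add: fun_eq_iff fun_app sc_left_commute)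
 have "f (l1' @ (sc c * x + y) # l2) = Rc (sc c) * f (l1' @ x # l2) + f (l1' @ y # l2)"
  using multilinD[OF f, of l1' l2 x y c] l Cons by simp
 thus ?thesis using hT_multilin[OF f l, of c] by (simp add: Cons C right_diff_distrib distrib_left)
qed

lemma delC_in:
 assumes f: "f : CI i j" shows "delC f : CI (Suc i) j"
proof (rule CI_I)
 show "multilin (delC f)"
 proof (rule multilinI)
  fix l1 l2 x y c assume l: "set l1 \<subseteq> KK" "set l2 \<subseteq> KK" "x : KK" "y : KK"
  moreover have "sc c * x + y : KK" using l by (intro KK_add KK_mult KK_sc)
  ultimately show "delC f (l1 @ (sc c * x + y) # l2) = Rc (sc c) * delC f (l1 @ x # l2) + delC f (l1 @ y # l2)"
   using hdel_multilin[OF CI_D(1)[OF f] l, of c] by (simp add: delC_def)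
 qed
 show "delC f as : Iset j" for as
 proof (cases as)
  case (Cons a l)
  show ?thesis
  proof (cases "set as \<subseteq> KK")
   case True
   hence "Rc a * f l : Iset j" "hT f as : Iset j"
    using Cons CI_D(2)[OF f] by (auto intro!: Iset_lmult KK_pr hT_in_Iset)
   thus ?thesis using Iset_add[OF _ Iset_uminus] True by (fastforce simp: delC_def Cons)
  qed (simp add: delC_def Iset_0)
 qed (simp add: delC_def Iset_0)
 show "delC f as = 0" if as: "length as ~= Suc i" for as
 proof (cases as)
  case (Cons a l)
  have "hT f as = 0" if "set as \<subseteq> KK"
   using hT_cong[of KK as f "%l. 0", OF KK_mult that] CI_D(3)[OF f] as by (simp add: hT_0)
  thus ?thesis using CI_D(3)[OF f, of l] as by (simp add: delC_def Cons)
 qed (simp add: delC_def)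
qed (simp add: delC_def)

lemma dI_linear: "dI j (Rc (sc c) * f + h) = Rc (sc c) * dI j f + dI j h"
 by (simp add: dI_add dI_lmult KK_sc)

lemma dI_of_0: "dI j 0 = 0" by (simp add: dI_def)

lemma ddC_in: "f : CI i j ==> ddC j f : CI i (Suc j)"
proof (rule CI_I)
 assume f: "f : CI i j"
 show "multilin (ddC j f)"
  using multilinD[OF CI_D(1)[OF f]] by (intro multilinI) (simp add: ddC_def dI_linear)
qed (auto simp: ddC_def dI_of_0 CI_D intro!: dI_in_Iset)

lemma delC_add: "delC (f + g) = delC f + delC g"
proof
 fix as
 have "hT (f + g) as = hT f as + hT g as"
  using hT_add[of f g as] by (simp add: plus_fun_def)
 thus "delC (f + g) as = (delC f + delC g) as"
  by (cases as) (simp_all add: delC_def plus_fun_apply distrib_left)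
qed

lemma delC_delC: "delC (delC f) as = 0"
proof (cases "set as \<subseteq> KK")
 case True
 have "hT (delC f) as = hT (hdel f) as"
  by (rule hT_cong[where S = KK, OF KK_mult True]) (auto simp: delC_def)
 moreover have "set (tl as) \<subseteq> KK" using True by (cases as) auto
 ultimately have "hdel (delC f) as = hdel (hdel f) as"
  by (cases as) (simp_all add: delC_def)
 thus ?thesis by (simp add: delC_def hdel_hdel)
qed (simp add: delC_def)

lemma delC_ddC: "delC (ddC j f) as = ddC j (delC f) as"
proof (cases "set as \<subseteq> KK")
 case True
 have s: "dI j (u - h) = dI j u - dI j h" for u h by (simp add: dI_def algebra_simps)
 show ?thesis
 proof (cases as)
  case (Cons a l)
  hence "dI j (Rc a * f l) = Rc a * dI j (f l)" using True by (intro dI_lmult) auto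
  thus ?thesis using hT_dI[OF True, of j f] True by (simp add: Cons delC_def ddC_def s)
 qed (simp add: delC_def ddC_def dI_of_0)
qed (simp add: delC_def ddC_def dI_of_0)

lemma sect_0: "sect n 0 = 0"
 using sect_linear[OF hp_0 hp_0, of n "- 1"] by (simp add: sc_uminus Rc_simps)

text \<open>The section of the Koszul differential is applied value by value; its linearity keeps
  the cochain multilinear.\<close>

lemma CI_column_exact:
 assumes f: "f : CI i (Suc j)" and 0: "ddC (Suc j) f = 0"
 shows "\<exists>b\<in>CI i j. ddC j b = f"
proof (intro bexI[of _ "%as. sect j (f as)"])
 show "ddC j (%as. sect j (f as)) = f"
 proof
  fix as
  have "dI (Suc j) (f as) = 0" using fun_cong[OF 0, of as] by (simp add: ddC_def zero_fun_apply)
  thus "ddC j (%as. sect j (f as)) as = f as" unfolding ddC_def by (rule dI_sect[OF CI_D(2)[OF f]])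
 qed
 show "(%as. sect j (f as)) : CI i j"
 proof (rule CI_I)
  show "multilin (%as. sect j (f as))"
   using multilinD[OF CI_D(1)[OF f]] CI_D(2)[OF f] by (intro multilinI) (simp add: sect_linear Iset_hp)
 qed (auto simp: CI_D[OF f] sect_0 intro!: sect_in_Iset)
qed

text \<open>A contracting homotopy: \<open>1 = \<Sum> mk s j (lb s j)\<close> makes the tautological module projective over \<open>KK\<close>.\<close>

definition hom_val :: "nat => ('k te list => 'k tef) => 'k te list => nat => 'k te"
 where "hom_val j f as i = Abs_te (%q. \<Sum>s<p. ap (hc j (f (as @ [mk s 0 q])) i) (lb s 0))"

definition HOM :: "nat => ('k te list => 'k tef) => 'k te list => 'k tef"
 where "HOM j f as = (if set as \<subseteq> KK then Hp j (hom_val j f as) else 0)"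

lemma mk_combination: "mk s m (tvs c q + q') = sc c * mk s m q + mk s m q'"
 by (rule te_eqI) (simp add: ap_mk mkf_def algebra_simps)

lemma mk_pr: "mk s m (ap (pr t) q) = (if s = t then mk s m q else 0)"
proof -
 have "ap (pr s) (ap (pr t) q) = (if s = t then ap (pr s) q else 0)"
  using arg_cong[OF pr_mult[of s t], of "%a. ap a q"] by simp
 thus ?thesis by (intro te_eqI) (simp add: ap_mk mkf_def)
qed

lemma multilin_last_0: "multilin f ==> set l \<subseteq> KK ==> f (l @ [0]) = 0"
 using multilinD[of f l "[]" 0 0 1] KK_sc[of 0] by (simp add: Rc_simps)

text \<open>Every q is the sum over s of \<open>mk s 0 q\<close> applied to \<open>lb s 0\<close>,
  and q -> \<open>mk s 0 q\<close> is linear over \<open>KK\<close>. The homotopy therefore feeds q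
  to the cochain as a last argument and evaluates at \<open>lb s 0\<close>.\<close>

lemma HOM_eval:
 assumes f: "multilin f" "\<And>l. f l : hp j" and as: "set as \<subseteq> KK"
 shows "ap (HOM j f as x) q = (\<Sum>s<p. ap (f (as @ [mk s 0 q]) x) (lb s 0))"
proof -
 have "f (as @ [mk s 0 (tvs c q + q')]) = Rc (sc c) * f (as @ [mk s 0 q]) + f (as @ [mk s 0 q'])" for s c q q'
  using multilinD[OF f(1) as, of "[]" "mk s 0 q" "mk s 0 q'" c] by (simp add: mk_combination mk_in_KK)
 hence h: "hc j (f (as @ [mk s 0 (tvs c q + q')])) i = sc c * hc j (f (as @ [mk s 0 q])) i + hc j (f (as @ [mk s 0 q'])) i"
  if "i <= j" for s c q q' i
  using that by (simp add: hc_add[OF hp_lmult[OF f(2)] f(2)] hc_lmult[OF f(2)])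
 have h1: "hc j (f (as @ [mk s 0 (q + q')])) i = hc j (f (as @ [mk s 0 q])) i + hc j (f (as @ [mk s 0 q'])) i"
  if "i <= j" for s q q' i using h[OF that, of s 1] by simp
 have z: "hc j (f (as @ [mk s 0 0])) i = 0" if "i <= j" for s i
  using h1[OF that, of s 0 0] by simp
 have h2: "hc j (f (as @ [mk s 0 (tvs c q)])) i = sc c * hc j (f (as @ [mk s 0 q])) i"
  if "i <= j" for s c q i using h[OF that, of s c q 0] z[OF that] by simp
 have "ap (hom_val j f as i) q = (\<Sum>s<p. ap (hc j (f (as @ [mk s 0 q])) i) (lb s 0))" if i: "i <= j" for i
 proof -
  have s: "tvs c (\<Sum>s<p. g s) = (\<Sum>s<p. tvs c (g s))" for c and g :: "nat => 'k tv"
   using ap_sum[of "sc c" g "{..<p}"] by simp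
  show ?thesis unfolding hom_val_def
   by (subst Abs_te_inverse) (simp_all add: h1[OF i] h2[OF i] sum.distrib s)
 qed
 hence "ap (Hp j (hom_val j f as) x) q
  = (\<Sum>i\<le>j. tvs (x $ 1 ^ i * x $ 2 ^ (j - i)) (\<Sum>s<p. ap (hc j (f (as @ [mk s 0 q])) i) (lb s 0)))"
  by (simp add: Hp_def ap_sum_left)
 also have "... = (\<Sum>i\<le>j. \<Sum>s<p. tvs (x $ 1 ^ i * x $ 2 ^ (j - i)) (ap (hc j (f (as @ [mk s 0 q])) i) (lb s 0)))"
  by (simp add: ap_sum[where a = "sc _", unfolded ap_sc])
 also have "... = (\<Sum>s<p. ap (Hp j (hc j (f (as @ [mk s 0 q]))) x) (lb s 0))"
  by (subst sum.swap) (simp add: Hp_def ap_sum_left)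
 finally show ?thesis by (simp add: HOM_def as Hp_hc[OF f(2)])
qed

lemma HOM_in_hp: "HOM j f as : hp j" by (simp add: HOM_def hp_0)

lemma HOM_in_Iset:
 assumes f: "multilin f" "\<And>l. f l : Iset j" shows "HOM j f as : Iset j"
proof (cases "set as \<subseteq> KK")
 case as: True
 note ev = HOM_eval[OF f(1) Iset_hp[OF f(2)] as]
 have lb: "ap (pr t) (lb s 0) = (if t = s then lb s 0 else 0)" if "s < p" for s t
  using that by (simp add: lb_props)
 have c: "f l * Rc (pr s) = Rc (pr (tau j s)) * f l" "j > 0 ==> f l * Rc (pr 0) = 0" for l s
  using f(2)[of l] unfolding Iset_iff by blast+
 have c': "ap (f l x) (ap (pr s) v) = ap (pr (tau j s)) (ap (f l x) v)" for l s x v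
  using fun_cong[OF c(1)[of l s], of x] by (metis ap_ring(6) times_fun_apply)
 have c0: "ap (f l x) (ap (pr 0) v) = 0" if "j > 0" for l x v
  using fun_cong[OF c(2)[OF that, of l], of x] by (metis ap_ring(1,6) times_fun_apply zero_fun_apply)
 have e: "ap (HOM j f as x) (ap (pr t) q) = (if t < p then ap (f (as @ [mk t 0 q]) x) (lb t 0) else 0)" for x t q
 proof -
  have "ap (HOM j f as x) (ap (pr t) q) = (\<Sum>s<p. if s = t then ap (f (as @ [mk t 0 q]) x) (lb t 0) else 0)"
   unfolding ev by (rule sum.cong) (auto simp: mk_pr multilin_last_0[OF f(1) as] zero_fun_apply)
  thus ?thesis by simp
 qed
 have "HOM j f as * Rc (pr t) = Rc (pr (tau j t)) * HOM j f as" for t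
 proof (intro ext te_eqI)
  fix x q
  have "ap (pr (tau j t)) (ap (HOM j f as x) q) = (\<Sum>s<p. ap (f (as @ [mk s 0 q]) x) (ap (pr t) (lb s 0)))"
   by (simp add: ev ap_sum c')
  also have "... = (\<Sum>s<p. if s = t then ap (f (as @ [mk t 0 q]) x) (lb t 0) else 0)"
   by (rule sum.cong) (auto simp: lb)
  finally show "ap ((HOM j f as * Rc (pr t)) x) q = ap ((Rc (pr (tau j t)) * HOM j f as) x) q"
   by (simp add: e times_fun_apply)
 qed
 moreover have "HOM j f as * Rc (pr 0) = 0" if "j > 0"
 proof (intro ext te_eqI)
  fix x q
  show "ap ((HOM j f as * Rc (pr 0)) x) q = ap ((0 :: 'k tef) x) q"
   using c0[OF that, of "as @ [mk 0 0 q]" x "lb 0 0"] lb[of 0 0] p3 by (simp add: e times_fun_apply zero_fun_apply)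
 qed
 ultimately show ?thesis using HOM_in_hp by (simp add: Iset_iff)
qed (simp add: HOM_def Iset_0)

text \<open>When the last argument a is multiplied with \<open>mk s 0 q\<close>, the product is
  \<open>mk s 0 (ap a q)\<close>, so this face belongs to \<open>HOM\<close>; the final face, right
  multiplication by \<open>mk s 0 q\<close>, returns f(as) applied to q, with a sign.\<close>

lemma hT_HOM:
 assumes "multilin f" "\<And>l. f l : hp j" "as ~= []" "set as \<subseteq> KK"
 shows "(\<Sum>s<p. ap (hT f (as @ [mk s 0 q]) x) (lb s 0))
  = ap (hT (HOM j f) as x) q + ap ((- 1) ^ length as * f as x) q"
 using assms
proof (induction as arbitrary: f rule: induct_list012)
 case (2 a)
 have a: "a : KK" using 2 by simp
 have "(\<Sum>s<p. ap (hT f ([a] @ [mk s 0 q]) x) (lb s 0))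
  = (\<Sum>s<p. ap (f [mk s 0 (ap a q)] x) (lb s 0)) - (\<Sum>s<p. ap (f [a] x) (ap (pr s) q))"
  using mk_lb[of _ 0 _ 0] by (simp add: KK_mult_mk[OF a] Idx_iff sum_subtractf times_fun_apply)
 also have "(\<Sum>s<p. ap (f [a] x) (ap (pr s) q)) = ap (f [a] x) q"
  using arg_cong[OF pr_sum, of "%a. ap a q"] by (simp add: ap_sum_left ap_sum[symmetric])
 finally show ?case by (simp add: HOM_eval[OF 2(1,2)] sum_subtractf times_fun_apply)
next
 case (3 a b as)
 have ab: "a : KK" "b : KK" "set as \<subseteq> KK" using 3 by auto
 have hv: "hom_val j (%l. f (a # l)) l = hom_val j f (a # l)" for l by (simp add: hom_val_def fun_eq_iff)
 have H: "hT (HOM j (%l. f (a # l))) (b # as) = hT (%l. HOM j f (a # l)) (b # as)"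
  by (rule hT_cong[where S = KK]) (use ab KK_mult in \<open>auto simp: HOM_def hv\<close>)
 have "(\<Sum>s<p. ap (hT (%l. f (a # l)) ((b # as) @ [mk s 0 q]) x) (lb s 0))
  = ap (hT (HOM j (%l. f (a # l))) (b # as) x) q + ap ((- 1) ^ length (b # as) * f (a # b # as) x) q"
  by (rule 3(2)) (use 3 ab in \<open>auto intro: multilin_Cons\<close>)
 moreover have "(\<Sum>s<p. ap (f ((a * b # as) @ [mk s 0 q]) x) (lb s 0)) = ap (HOM j f (a * b # as) x) q"
  using ab KK_mult by (intro HOM_eval[OF 3(3,4), symmetric]) auto
 ultimately show ?case unfolding H by (simp add: sum_subtractf)
qed simp

lemma CI_row_exact:
 assumes f: "f : CI (Suc i) j" and 0: "delC f = 0"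
 shows "\<exists>b\<in>CI i j. delC b = f"
proof -
 \<comment> \<open>The identity \<open>hT_HOM\<close> produces the sign of the length of the list,
   here Suc i; E cancels it.\<close>
 define E where "E = Rc (sc ((- 1) ^ Suc i))"
 have EE: "E * (E * g) = g" for g
  by (simp add: E_def fun_eq_iff fun_app flip: mult.assoc sc_mult power_mult_distrib)
 have Ec: "E * g = g * E" for g by (simp add: E_def fun_eq_iff fun_app sc_commute)
 define b where "b = (%as. E * HOM j f as)"
 note ml = CI_D(1)[OF f] and val = CI_D(2)[OF f]
 note ev = HOM_eval[OF ml Iset_hp[OF val]]
 have bI: "b : CI i j"
 proof (rule CI_I)
  show "multilin b"
  proof (rule multilinI)
   fix l1 l2 x y c assume l: "set l1 \<subseteq> KK" "set l2 \<subseteq> KK" "x : KK" "y : KK"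
   moreover have z: "sc c * x + y : KK" using l by (intro KK_add KK_mult KK_sc)
   ultimately have "HOM j f (l1 @ (sc c * x + y) # l2) = Rc (sc c) * HOM j f (l1 @ x # l2) + HOM j f (l1 @ y # l2)"
    using multilinD[OF ml, of l1 "l2 @ [_]" x y c]
    by (intro ext te_eqI) (simp add: ev mk_in_KK sum.distrib plus_fun_apply times_fun_apply ap_sum[where a = "sc _", unfolded ap_sc])
   thus "b (l1 @ (sc c * x + y) # l2) = Rc (sc c) * b (l1 @ x # l2) + b (l1 @ y # l2)"
    unfolding b_def by (simp add: distrib_left mult.assoc Ec)
  qed
  show "b as : Iset j" for as unfolding b_def E_def
   by (intro Iset_lmult HOM_in_Iset ml val) (simp add: sc_commute)
  show "b as = 0" if "length as ~= i" for as
  proof (cases "set as \<subseteq> KK")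
   case True
   have "HOM j f as = 0" by (intro ext te_eqI) (simp add: ev[OF True] CI_D(3)[OF f] that zero_fun_apply)
   thus ?thesis by (simp add: b_def)
  qed (simp add: b_def HOM_def)
  show "b as = 0" if "~ set as \<subseteq> KK" for as using that by (auto simp: b_def HOM_def)
 qed
 have "delC b as = f as" for as
 proof (cases "length as = Suc i & set as \<subseteq> KK")
  case False
  hence "f as = 0" "delC b as = 0" using f delC_in[OF bI] unfolding CI_def by blast+
  thus ?thesis by simp
 next
  case True
  then obtain a l where as: "as = a # l" by (cases as) auto
  have "Rc a * HOM j f l - hT (HOM j f) as = E * f as"
  proof (intro ext te_eqI)
   fix t q
   have "hdel f (as @ [mk s 0 q]) = 0" for s
    using fun_cong[OF 0, of "as @ [mk s 0 q]"] True by (simp add: delC_def mk_in_KK zero_fun_apply)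
   hence "hT f (as @ [mk s 0 q]) t = a * f (l @ [mk s 0 q]) t" for s
    by (simp add: as fun_eq_iff times_fun_apply zero_fun_apply)
   hence "(\<Sum>s<p. ap (hT f (as @ [mk s 0 q]) t) (lb s 0)) = ap a (ap (HOM j f l t) q)"
    using True as by (simp add: ev ap_sum)
   moreover have "(- 1) ^ length as * f as t = E t * f as t"
    using True by (cases "even i") (auto simp: E_def sc_uminus)
   moreover have "(\<Sum>s<p. ap (hT f (as @ [mk s 0 q]) t) (lb s 0))
    = ap (hT (HOM j f) as t) q + ap ((- 1) ^ length as * f as t) q"
    using True as by (intro hT_HOM ml Iset_hp val) auto
   ultimately show "ap ((Rc a * HOM j f l - hT (HOM j f) as) t) q = ap ((E * f as) t) q"
    by (simp add: fun_app diff_eq_eq add.commute)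
  qed
  moreover have "delC b as = E * (Rc a * HOM j f l - hT (HOM j f) as)"
   using True hT_left_mult[of E "HOM j f" as] unfolding delC_def as hdel_simps
   by (simp add: b_def right_diff_distrib) (metis Ec mult.assoc)
  ultimately show ?thesis by (simp add: EE)
 qed
 hence "delC b = f" by (rule ext)
 thus ?thesis using bI by blast
qed

lemma multilin_0: "multilin 0" by (rule multilinI) (simp add: zero_fun_apply)

text \<open>The kernel of the Koszul differential at j = 0 is the Hochschild complex of
  \<open>KK\<close>, the kernel of the Hochschild differential at i = 0 is the complex of
  invariants; the zigzags compare these two.\<close>

sublocale CI: double_complex CI delC ddC
proof
 fix i j and f g :: "'k te list => 'k tef"
 show "0 : CI i j" by (simp add: CI_def Iset_0 multilin_0 zero_fun_apply)
 show "f + g : CI i j" if "f : CI i j" "g : CI i j"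
 proof (rule CI_I)
  show "multilin (f + g)"
   using that[THEN CI_D(1), THEN multilinD] by (intro multilinI) (simp add: plus_fun_apply distrib_left)
 qed (simp_all add: plus_fun_apply CI_D[OF that(1)] CI_D[OF that(2)] Iset_add)
 show "- f : CI i j" if "f : CI i j"
 proof (rule CI_I)
  show "multilin (- f)"
   using that[THEN CI_D(1), THEN multilinD] by (intro multilinI) (simp)
 qed (simp_all add: CI_D[OF that] Iset_uminus)
 show "delC (f + g) = delC f + delC g" by (rule delC_add)
 show "ddC j (f + g) = ddC j f + ddC j g" by (rule ext) (simp add: ddC_def plus_fun_apply dI_add)
 show "delC (delC f) = 0" by (rule ext) (simp add: delC_delC zero_fun_apply)
 show "ddC (Suc j) (ddC j f) = 0" by (rule ext) (simp add: ddC_def dI_dI zero_fun_apply)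
 show "delC (ddC j f) = ddC j (delC f)" by (rule ext) (rule delC_ddC)
qed (use delC_in ddC_in CI_row_exact CI_column_exact in auto)

end

section \<open>Homogeneous functions on the plane\<close>

definition SP :: "nat => ('k::alg_closed_field ^ 2 => 'k) set"
 where "SP n = range (%c x. \<Sum>i\<le>n. c i * (x $ 1 ^ i * x $ 2 ^ (n - i)))"

definition SP2 :: "nat => ('k::alg_closed_field ^ 2 => 'k ^ 2) set"
 where "SP2 n = {w. (%x. w x $ 1) : SP n & (%x. w x $ 2) : SP n}"

lemma SP_I: "(\<And>x. h x = (\<Sum>i\<le>n. c i * (x $ 1 ^ i * x $ 2 ^ (n - i)))) ==> h : SP n"
 unfolding SP_def by (auto simp: fun_eq_iff)

lemma SP_E:
 assumes "h : SP n" obtains c where "h = (%x. \<Sum>i\<le>n. c i * (x $ 1 ^ i * x $ 2 ^ (n - i)))"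
 using assms by (auto simp: SP_def)

lemma SP_add: "f : SP n ==> g : SP n ==> (%x. f x + g x) : SP n"
 by (elim SP_E, rule_tac c = "%i. c i + ca i" in SP_I) (simp add: sum.distrib distrib_right)

lemma SP_cmult: "f : SP n ==> (%x. a * f x) : SP n"
 by (elim SP_E, rule_tac c = "%i. a * c i" in SP_I) (simp add: sum_distrib_left mult.assoc)

lemma SP_0: "(%x. 0) : SP n" by (rule SP_I[where c = "%_. 0"]) simp

lemma SP_diff: "f : SP n ==> g : SP n ==> (%x. f x - g x) : SP n"
 using SP_add[OF _ SP_cmult[of g n "- 1"]] by simp

lemma SP_sum: "(\<And>i. i : I ==> f i : SP n) ==> (%x. \<Sum>i\<in>I. f i x) : SP n"
 by (induction I rule: infinite_finite_induct) (auto intro: SP_0 SP_add)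

lemma SP_mon: "i <= n ==> (%z :: 'k::alg_closed_field ^ 2. z $ 1 ^ i * z $ 2 ^ (n - i)) : SP n"
proof (rule SP_I[where c = "%j. if j = i then 1 else 0"])
 fix z :: "'k ^ 2" assume "i <= n"
 thus "z $ 1 ^ i * z $ 2 ^ (n - i) = (\<Sum>j\<le>n. (if j = i then 1 else 0) * (z $ 1 ^ j * z $ 2 ^ (n - j)))"
  by (simp add: if_distrib[of "%x. x * _"] cong: if_cong)
qed

lemma SP_mult:
 fixes f g :: "'k::alg_closed_field ^ 2 => 'k"
 assumes "f : SP m" "g : SP n" shows "(%x. f x * g x) : SP (m + n)"
proof -
 obtain c where f: "f = (%x. \<Sum>i\<le>m. c i * (x $ 1 ^ i * x $ 2 ^ (m - i)))" using assms(1) by (rule SP_E)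
 obtain d where g: "g = (%x. \<Sum>i\<le>n. d i * (x $ 1 ^ i * x $ 2 ^ (n - i)))" using assms(2) by (rule SP_E)
 have "(%x. f x * g x) = (%x. \<Sum>i\<le>m. \<Sum>j\<le>n. c i * d j * (x $ 1 ^ (i + j) * x $ 2 ^ (m + n - (i + j))))"
 proof
  fix x :: "'k ^ 2"
  have e: "x $ 2 ^ (m + n - (i + j)) = x $ 2 ^ (m - i) * x $ 2 ^ (n - j)" if "i <= m" "j <= n" for i j
   using that by (simp flip: power_add)
  show "f x * g x = (\<Sum>i\<le>m. \<Sum>j\<le>n. c i * d j * (x $ 1 ^ (i + j) * x $ 2 ^ (m + n - (i + j))))"
   unfolding f g sum_product by (intro sum.cong refl) (simp add: power_add e)
 qed
 thus ?thesis by (auto intro!: SP_sum SP_cmult SP_mon)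
qed

lemma SP_const: "(%x. c) : SP 0" by (rule SP_I[where c = "%_. c"]) simp

lemma SP_0_eq: "f : SP 0 ==> f = (%x. f 0)" by (auto elim!: SP_E)

lemma SP_coord: "(%x. x $ i) : SP (Suc 0)"
 using SP_mon[of 1 1] SP_mon[of 0 1] exhaust_2[of i] by auto

lemma SP_power: "f : SP (Suc 0) ==> (%x. f x ^ n) : SP n"
 by (induction n) (auto intro: SP_const dest: SP_mult)

lemma SP_subst: assumes "f : SP n" shows "(%x. f (A *v x)) : SP n"
proof -
 obtain c where f: "f = (%x. \<Sum>i\<le>n. c i * (x $ 1 ^ i * x $ 2 ^ (n - i)))" using assms by (rule SP_E)
 have l: "(%x. (A *v x) $ i) : SP (Suc 0)" for i
  unfolding matrix_vector_mult_def by (auto intro!: SP_sum SP_cmult SP_coord)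
 have "(%x. (A *v x) $ 1 ^ i * (A *v x) $ 2 ^ (n - i)) : SP n" if "i <= n" for i
  using SP_mult[OF SP_power[OF l] SP_power[OF l], of 1 i 2 "n - i"] that by simp
 thus ?thesis unfolding f by (intro SP_sum SP_cmult) auto
qed

lemma SP_split:
 assumes "f : SP (Suc n)"
 obtains a b where "a : SP n" "b : SP n" "f = (%x. x $ 1 * a x + x $ 2 * b x)"
proof -
 obtain c where f: "f = (%x. \<Sum>i\<le>Suc n. c i * (x $ 1 ^ i * x $ 2 ^ (Suc n - i)))" using assms by (rule SP_E)
 have 1: "f = (%x. x $ 1 * (\<Sum>i\<le>n. c (Suc i) * (x $ 1 ^ i * x $ 2 ^ (n - i))) + x $ 2 * (c 0 * (x $ 1 ^ 0 * x $ 2 ^ (n - 0))))"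
  unfolding f sum.atMost_Suc_shift by (simp add: sum_distrib_left mult_ac fun_eq_iff)
 have 2: "(%x. c 0 * (x $ 1 ^ 0 * x $ 2 ^ (n - 0))) : SP n" by (intro SP_cmult SP_mon) simp
 have 3: "(%x. \<Sum>i\<le>n. c (Suc i) * (x $ 1 ^ i * x $ 2 ^ (n - i))) : SP n" by (rule SP_I) simp
 show ?thesis by (rule that[OF 3 2 1])
qed

context charp
begin

section \<open>Invariants\<close>

lemma odd_p: "odd p" using prime_p p3 prime_odd_nat[of p] by auto

lemma sc_inject: "sc a = (sc b :: 'k te) ==> a = b"
proof -
 assume "sc a = (sc b :: 'k te)"
 hence "tf 0 0 (ap (sc a) (lb 0 0)) = tf 0 0 (ap (sc b) (lb 0 0))" by simp
 thus "a = b" using p3 by (simp add: tf_0_lb Idx_iff)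
qed

lemma Hp_sc: "Hp n (%i. sc (c i)) = (%x. sc (\<Sum>i\<le>n. c i * (x $ 1 ^ i * x $ 2 ^ (n - i))))"
 by (simp add: Hp_def sc_sum fun_eq_iff mult.commute flip: sc_mult)

lemma hp_sc: "h : SP n ==> (%x. sc (h x)) : hp n"
 by (elim SP_E) (auto simp flip: Hp_sc)

lemma SP_functional:
 assumes u: "u : hp n" and L: "\<And>a b. L (a + b) = L a + L b" "\<And>c a. L (sc c * a) = c * (L a :: 'k)"
 shows "(%x. L (u x)) : SP n"
proof -
 obtain c where c: "u = Hp n c" using u by (auto simp: hp_def)
 have "L 0 = 0" using L(2)[of 0 0] by simp
 hence s: "L (\<Sum>i\<in>I. f i) = (\<Sum>i\<in>I. L (f i))" for I :: "nat set" and f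
  by (induction I rule: infinite_finite_induct) (auto simp: L(1))
 show ?thesis by (rule SP_I[where c = "%i. L (c i)"]) (simp add: c Hp_def s L(2) mult.commute)
qed

text \<open>The scalar case of \<open>Koszul_syzygy\<close>, obtained by viewing scalars as
  operators, since \<open>sc\<close> is injective.\<close>

lemma SP_syzygy:
 fixes u v :: "'k ^ 2 => 'k"
 assumes u: "u : SP (Suc n)" and v: "v : SP (Suc n)" and eq: "\<And>x. x $ 1 * u x = x $ 2 * v x"
 obtains h where "h : SP n" "u = (%x. x $ 2 * h x)" "v = (%x. x $ 1 * h x)"
proof -
 obtain c where c: "u = (%x. \<Sum>i\<le>Suc n. c i * (x $ 1 ^ i * x $ 2 ^ (Suc n - i)))" using u by (rule SP_E)
 define h where "h x = (\<Sum>i\<le>n. c i * (x $ 1 ^ i * x $ 2 ^ (n - i)))" for x :: "'k ^ 2"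
 define U V where "U = (%x. sc (u x) :: 'k te)" and "V = (%x. sc (- v x) :: 'k te)"
 have UV: "U : hp (Suc n)" "V : hp (Suc n)"
  using u SP_cmult[OF v, of "- 1"] by (simp_all add: U_def V_def hp_sc)
 have "x1 * U + x2 * V = 0"
  by (simp add: fun_eq_iff fun_app x1_def x2_def U_def V_def eq flip: sc_mult sc_add)
 note K = Koszul_syzygy[OF UV this]
 have "U = Hp (Suc n) (%i. sc (c i))" unfolding U_def c Hp_sc ..
 hence "R2 n U = Hp n (%i. sc (c i))" unfolding R2_def by (intro Hp_cong) (simp add: hc_Hp)
 hence R: "R2 n U = (%x. sc (h x))" by (simp add: Hp_sc h_def)
 have "sc (u x) = (sc (x $ 2 * h x) :: 'k te)" "sc (v x) = (sc (x $ 1 * h x) :: 'k te)" for x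
  using fun_cong[OF K(1), of x] fun_cong[OF K(2), of x] unfolding R
  by (simp_all add: fun_app x1_def x2_def U_def V_def sc_mult sc_uminus)
 hence "u = (%x. x $ 2 * h x)" "v = (%x. x $ 1 * h x)" using sc_inject by blast+
 moreover have "h : SP n" using SP_I[OF h_def] .
 ultimately show ?thesis using that by blast
qed

text \<open>The Hochschild cohomology of degree 0 with coefficients in the bimodule
  \<open>Iset n\<close>.\<close>

definition JJ :: "nat => ('k tef) set"
 where "JJ n = {f : Iset n. \<forall>a\<in>KK. \<forall>x. a * f x = f x * a}"

text \<open>The shape of the invariants: in even degree a scalar form and a form times
  \<open>eps\<close> on each component, in odd degree a vector-valued form w acting through
  \<open>D\<close>. \<open>G0\<close>, \<open>G3\<close> and \<open>GW\<close> recover these forms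
  from the value at one generator.\<close>

definition zE where "zE a b = (%x. \<Sum>s<p. (sc (a s x) + sc (b s x) * eps) * pr s)"
definition zO where "zO w = (%x. \<Sum>s<p. D (w s x) * pr s)"

definition G0 where "G0 f s x = c0 s 0 (ap (f x) (lb s 0))"
definition G3 where "G3 f s x = c3 s 0 (ap (f x) (lb s 0))"
definition GW where "GW f s x = vec2 (c1 s 0 (ap (f x) (lb s 0))) (c2 s 0 (ap (f x) (lb s 0)))"

definition wedge :: "'k ^ 2 => 'k ^ 2 => 'k" where "wedge x y = x $ 1 * y $ 2 - x $ 2 * y $ 1"

lemma D_mult: "D x * D y = sc (wedge x y) * eps"
 by (rule te_eqI) (simp add: D_def wedge_def tvs_diff_left mult.commute)

lemma D_eps: "D x * eps = 0" "eps * D x = 0"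
 by (simp_all add: D_def distrib_left distrib_right mult.assoc sc_left_commute)

lemma D_prp: "D y * pr s = (if 0 < s & s < p then pr (p - s) * D y else 0)"
 by (simp add: D_def distrib_left distrib_right mult.assoc alpha_pr beta_pr sc_left_commute)

lemma pr_D: "pr s * D y = (if 0 < s & s < p then D y * pr (p - s) else 0)"
 by (simp add: D_def distrib_left distrib_right mult.assoc pr_alpha pr_beta sc_left_commute)

lemma te_pr_eqI: fixes a b :: "'k te" assumes "\<And>s. s < p ==> a * pr s = b * pr s" shows "a = b"
proof -
 have "a * (\<Sum>s<p. pr s) = b * (\<Sum>s<p. pr s)" unfolding sum_distrib_left using assms by (intro sum.cong) auto
 thus ?thesis by (simp add: pr_sum)
qed

lemma sum_pr: "(\<Sum>s<p. h s * pr s) * pr t = (if t < p then h t * pr t else 0)"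
 by (simp add: sum_distrib_right mult.assoc pr_mult if_distrib[of "%x. _ * x"] cong: if_cong)

lemma zE_pr: "s < p ==> zE a b x * pr s = (sc (a s x) + sc (b s x) * eps) * pr s"
 and zO_pr: "s < p ==> zO w x * pr s = D (w s x) * pr s"
 by (simp_all add: zE_def zO_def sum_pr)

lemma eps_pr_0: "eps * pr 0 = 0" by (simp add: eps_def mult.assoc beta_pr)

text \<open>A vector q of component s is \<open>mk s 0 q\<close> applied to \<open>lb s 0\<close>,
  so h is known there once its value at that one generator is; the coordinates of this value exhibit
  h as an element of the exterior algebra.\<close>

lemma double_commutant:
 assumes "\<forall>a\<in>KK. a * h = h * a" "s < p"
 shows "h * pr s = (sc (c0 s 0 (ap h (lb s 0))) + sc (c1 s 0 (ap h (lb s 0))) * alpha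
  + sc (c2 s 0 (ap h (lb s 0))) * beta + sc (c3 s 0 (ap h (lb s 0))) * eps) * pr s"
proof (rule te_eqI)
 fix q
 have "ap h (ap (pr s) q) = ap (h * mk s 0 q) (lb s 0)" using mk_lb[of s 0 s 0 q] assms(2) by (simp add: Idx_iff)
 also have "h * mk s 0 q = mk s 0 q * h" using assms(1) mk_in_KK by simp
 finally show "ap (h * pr s) q = ap ((sc (c0 s 0 (ap h (lb s 0))) + sc (c1 s 0 (ap h (lb s 0))) * alpha
  + sc (c2 s 0 (ap h (lb s 0))) * beta + sc (c3 s 0 (ap h (lb s 0))) * eps) * pr s) q"
  by (simp add: ap_mk mkf_def)
qed

lemma ap_lb_pr: "s < p ==> ap (pr t) (lb s 0) = (if t = s then lb s 0 else 0)"
 by (simp add: lb_props)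

lemma JJ_pr: assumes "f : JJ n" shows "f x * pr s = pr (tau n s) * f x" "n > 0 ==> f x * pr 0 = 0"
proof -
 have i: "f * Rc (pr s) = Rc (pr (tau n s)) * f" "n > 0 ==> f * Rc (pr 0) = 0"
  using assms unfolding JJ_def Iset_iff by blast+
 show "f x * pr s = pr (tau n s) * f x" using fun_cong[OF i(1), of x] by (simp add: fun_app)
 show "f x * pr 0 = 0" if "n > 0" using fun_cong[OF i(2)[OF that], of x] by (simp add: fun_app)
qed

lemma JJ_even:
 assumes f: "f : JJ n" and n: "even n" shows "f = zE (G0 f) (G3 f)"
proof (rule ext, rule te_pr_eqI)
 fix x s assume s: "s < p"
 have "ap (f x) (lb s 0) = ap (f x * pr s) (lb s 0)" using s by (simp add: ap_lb_pr)
 also have "... = ap (pr s) (ap (f x) (lb s 0))" using JJ_pr(1)[OF f] n by (simp add: tau_def)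
 finally have v: "ap (f x) (lb s 0) = ap (pr s) (ap (f x) (lb s 0))" .
 \<comment> \<open>As p is odd, s and p - s are different components for s > 0, and a vector of
   component s has no coordinates along \<open>alpha lb\<close> or \<open>beta lb\<close> with index
   s.\<close>
 have "s ~= p - s | s = 0" using odd_p s by (metis even_add le_add_diff_inverse2 less_imp_le)
 hence "c1 s 0 (ap (f x) (lb s 0)) = 0" "c2 s 0 (ap (f x) (lb s 0)) = 0"
  using c_pr(3,4)[of s 0 s "ap (f x) (lb s 0)"] s v by (cases "s = 0"; simp add: c1_def c2_def)+
 thus "f x * pr s = zE (G0 f) (G3 f) x * pr s"
  using double_commutant[of "f x" s] f s by (simp add: zE_pr G0_def G3_def JJ_def)
qed

lemma JJ_odd:
 assumes f: "f : JJ n" and n: "odd n" shows "f = zO (GW f)"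
proof (rule ext, rule te_pr_eqI)
 fix x s assume s: "s < p"
 show "f x * pr s = zO (GW f) x * pr s"
 proof (cases "s = 0")
  case True
  have "n > 0" using n by (cases n) auto
  thus ?thesis using JJ_pr(2)[OF f] s by (simp add: True zO_pr D_prp)
 next
  case False
  have "ap (f x) (lb s 0) = ap (f x * pr s) (lb s 0)" using s by (simp add: ap_lb_pr)
  also have "... = ap (pr (p - s)) (ap (f x) (lb s 0))" using JJ_pr(1)[OF f] n by (simp add: tau_def)
  finally have v: "ap (f x) (lb s 0) = ap (pr (p - s)) (ap (f x) (lb s 0))" .
  have "s ~= p - s" using odd_p s by (metis even_add le_add_diff_inverse2 less_imp_le)
  hence "c0 s 0 (ap (f x) (lb s 0)) = 0" "c3 s 0 (ap (f x) (lb s 0)) = 0"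
   using c_pr(1,2)[of s 0 "p - s" "ap (f x) (lb s 0)"] s False v by auto
  thus ?thesis
   using double_commutant[of "f x" s] f s by (simp add: zO_pr GW_def JJ_def D_def)
 qed
qed

lemma c_lb: "s < p ==> c0 s 0 (lb s 0) = 1" "s < p ==> c0 s 0 (ap eps (lb s 0)) = 0"
  "0 < s ==> s < p ==> c3 s 0 (lb s 0) = 0" "0 < s ==> s < p ==> c3 s 0 (ap eps (lb s 0)) = 1"
  "0 < s ==> s < p ==> c1 s 0 (ap alpha (lb s 0)) = 1" "0 < s ==> s < p ==> c1 s 0 (ap beta (lb s 0)) = 0"
  "0 < s ==> s < p ==> c2 s 0 (ap alpha (lb s 0)) = 0" "0 < s ==> s < p ==> c2 s 0 (ap beta (lb s 0)) = 1"
 by (auto simp: c_defs tf_lb tf_0_lb Idx_iff)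

lemma zE_lb: assumes "s < p"
 shows "ap (zE a b z) (lb s 0) = tvs (a s z) (lb s 0) + tvs (b s z) (ap eps (lb s 0))"
 using arg_cong[OF zE_pr[OF assms, of a b z], of "%x. ap x (lb s 0)"] assms by (simp add: ap_lb_pr)

lemma zO_lb: assumes "s < p"
 shows "ap (zO w z) (lb s 0) = tvs (w s z $ 1) (ap alpha (lb s 0)) + tvs (w s z $ 2) (ap beta (lb s 0))"
 using arg_cong[OF zO_pr[OF assms, of w z], of "%x. ap x (lb s 0)"] assms by (simp add: ap_lb_pr D_def)

lemma G0_zE: "s < p ==> G0 (zE a b) s = a s" and G3_zE: "0 < s ==> s < p ==> G3 (zE a b) s = b s"
 and GW_zO: "0 < s ==> s < p ==> GW (zO w) s = w s"
 by (simp_all add: fun_eq_iff G0_def G3_def GW_def zE_lb zO_lb c_linear c_lb)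
  (metis vec2_eqI)

lemma G_SP:
 assumes "f : hp n" shows "G0 f s : SP n" "G3 f s : SP n" "GW f s : SP2 n"
 using SP_functional[OF assms, of "%a. c0 s 0 (ap a (lb s 0))"] SP_functional[OF assms, of "%a. c1 s 0 (ap a (lb s 0))"]
  SP_functional[OF assms, of "%a. c2 s 0 (ap a (lb s 0))"] SP_functional[OF assms, of "%a. c3 s 0 (ap a (lb s 0))"]
 unfolding SP2_def by (simp_all add: G0_def[abs_def] G3_def[abs_def] GW_def c_linear)

lemma G_linear:
 "G0 (f + h) s x = G0 f s x + G0 h s x" "G3 (f + h) s x = G3 f s x + G3 h s x"
 "GW (f + h) s x = GW f s x + GW h s x" "G0 (Rc (sc c) * f) s x = c * G0 f s x"
 "G3 (Rc (sc c) * f) s x = c * G3 f s x" "GW (Rc (sc c) * f) s x = c *s GW f s x"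
 by (simp_all add: G0_def G3_def GW_def fun_app c_linear vec_eq_iff forall_2)

lemma G0_0: assumes "f : JJ n" "n > 0" shows "G0 f 0 x = 0"
proof -
 have "ap (f x * pr 0) (lb 0 0) = 0" using JJ_pr(2)[OF assms] by simp
 thus ?thesis using p3 by (simp add: G0_def ap_lb_pr c0_def)
qed

lemma hp_sum: "(\<And>i. i : I ==> f i : hp n) ==> (%x. \<Sum>i\<in>I. f i x) : hp n"
proof (induction I rule: infinite_finite_induct)
 case (insert i I)
 have "(%x. \<Sum>i\<in>insert i I. f i x) = f i + (%x. \<Sum>i\<in>I. f i x)" using insert by (simp add: fun_eq_iff fun_app)
 thus ?case using insert by (auto intro: hp_add)
qed (use hp_0[unfolded zero_fun_def] in auto)

lemma JJ_I:
 assumes "f : hp n" "\<And>x s. f x * pr s = pr (tau n s) * f x" "\<And>x. n > 0 ==> f x * pr 0 = 0"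
  "\<And>x a. a : KK ==> a * f x = f x * a"
 shows "f : JJ n"
 using assms unfolding JJ_def Iset_iff by (auto simp: fun_eq_iff fun_app)

lemma hp_sc_mult: "h : SP n ==> (%x. sc (h x) * a) : hp n"
 using hp_rmult[OF hp_sc] by (simp add: times_fun_def)

lemma KK_eps: "a : KK ==> a * eps = eps * a" and KK_D: "a : KK ==> a * D x = D x * a"
proof -
 assume a: "a : KK"
 hence ab: "a * alpha = alpha * a" "a * beta = beta * a" by (auto simp: KK_def)
 show "a * D x = D x * a" by (simp add: D_def distrib_left distrib_right sc_left_commute ab mult.assoc)
 show "a * eps = eps * a" by (metis ab eps_def mult.assoc)
qed

lemma zE_in_JJ:
 assumes "\<And>s. s < p ==> a s : SP n" "\<And>s. s < p ==> b s : SP n" "n > 0 ==> a 0 = (%z. 0)" "even n"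
 shows "zE a b : JJ n"
proof (rule JJ_I)
 have "(%z. (sc (a s z) + sc (b s z) * eps) * pr s) : hp n" if "s < p" for s
  using hp_add[OF hp_sc_mult[OF assms(1)[OF that], of "pr s"] hp_sc_mult[OF assms(2)[OF that], of "eps * pr s"]]
  by (simp add: plus_fun_def distrib_right mult.assoc)
 thus "zE a b : hp n" unfolding zE_def by (intro hp_sum) auto
 have c: "pr t * ((sc x + sc y * eps) * pr s) = (sc x + sc y * eps) * (pr t * pr s)" for x y s t
  by (simp add: distrib_left distrib_right mult.assoc sc_left_commute) (metis eps_pr mult.assoc)
 show "zE a b z * pr s = pr (tau n s) * zE a b z" for z s
  using assms(4) pr_ge[of s] unfolding zE_def sum_pr sum_distrib_left c
  by (simp add: tau_def pr_mult if_distrib[of "%x. _ * x"] cong: if_cong)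
 show "zE a b z * pr 0 = 0" if "n > 0" for z
  using zE_pr[of 0 a b z] p3 by (simp add: assms(3)[OF that] mult.assoc eps_pr_0)
 show "x * zE a b z = zE a b z * x" if "x : KK" for x z
  using KK_eps[OF that] that unfolding zE_def sum_distrib_left sum_distrib_right
  by (intro sum.cong refl)
   (simp add: KK_def distrib_left distrib_right mult.assoc sc_left_commute, metis mult.assoc)
qed

lemma zO_in_JJ:
 assumes "\<And>s. s < p ==> w s : SP2 n" "odd n"
 shows "zO w : JJ n"
proof (rule JJ_I)
 have "(%z. D (w s z) * pr s) : hp n" if "s < p" for s
  using hp_add[OF hp_sc_mult[of "%z. w s z $ 1" n "alpha * pr s"] hp_sc_mult[of "%z. w s z $ 2" n "beta * pr s"]] assms(1)[OF that]
  by (simp add: SP2_def D_def plus_fun_def distrib_right mult.assoc)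
 thus "zO w : hp n" unfolding zO_def by (intro hp_sum) auto
 show "zO w z * pr s = pr (tau n s) * zO w z" for z s
 proof -
  have "pr (p - s) * zO w z = (if 0 < s & s < p then D (w s z) * pr s else 0)"
   unfolding zO_def sum_distrib_left mult.assoc[symmetric] pr_D
   by (auto simp: mult.assoc pr_mult if_distrib[of "%x. _ * x"] cong: if_cong)
  thus ?thesis using assms(2) zO_pr[of s w z] pr_ge[of s] D_prp[of "w 0 z" 0] p3 by (auto simp: tau_def)
 qed
 show "zO w z * pr 0 = 0" for z using zO_pr[of 0] p3 by (simp add: D_prp)
 show "x * zO w z = zO w z * x" if "x : KK" for x z
 proof -
  have "x * pr s = pr s * x" for s using that by (simp add: KK_def)
  thus ?thesis
   unfolding zO_def sum_distrib_left sum_distrib_right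
   by (intro sum.cong refl) (metis KK_D[OF that] mult.assoc)
 qed
qed

text \<open>\<open>D\<close> carries component s to p - s, so the commutator compares the scalars at
  the two indices; the \<open>eps\<close> part dies against \<open>D\<close>.\<close>

lemma dI_zE:
 assumes "even n"
 shows "dI n (zE a b) = zO (%s z. (a s z - a (p - s) z) *s z)"
proof (rule ext, rule te_pr_eqI)
 fix z s assume s: "s < p"
 have D: "D (c *s x) = sc c * D x" for c x by (simp add: D_def sc_mult distrib_left mult.assoc)
 have 1: "D z * zE a b z * pr s = sc (a s z) * (D z * pr s)"
  using zE_pr[OF s, of a b z]
  by (simp add: mult.assoc distrib_left distrib_right sc_left_commute) (simp add: D_eps flip: mult.assoc)
 have 2: "zE a b z * D z * pr s = sc (a (p - s) z) * (D z * pr s)"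
 proof (cases "s = 0")
  case False
  hence "zE a b z * D z * pr s = zE a b z * pr (p - s) * D z" using s by (simp add: D_prp mult.assoc)
  also have "... = (sc (a (p - s) z) + sc (b (p - s) z) * eps) * (pr (p - s) * D z)"
   using s False by (simp add: zE_pr mult.assoc)
  also have "pr (p - s) * D z = D z * pr s" using s False by (simp add: D_prp)
  also have "(sc (a (p - s) z) + sc (b (p - s) z) * eps) * (D z * pr s) = sc (a (p - s) z) * (D z * pr s)"
   by (simp add: distrib_right mult.assoc) (simp add: D_eps flip: mult.assoc)
  finally show ?thesis .
 qed (simp add: D_prp mult.assoc)
 show "dI n (zE a b) z * pr s = zO (%s z. (a s z - a (p - s) z) *s z) z * pr s"
  using assms 1 2 s by (simp add: dI_def fun_app left_diff_distrib zO_pr D sc_diff mult.assoc)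
qed

text \<open>By \<open>D_mult\<close> a product of two values of \<open>D\<close> is their
  determinant times \<open>eps\<close>, and reversing the order changes the sign; the anticommutator
  thus becomes a difference of determinants.\<close>

lemma dI_zO:
 assumes "odd n"
 shows "dI n (zO w) = zE (%s x. 0) (%s x. wedge x (w s x) - wedge x (w (p - s) x))"
proof (rule ext, rule te_pr_eqI)
 fix x s assume s: "s < p"
 have 1: "D x * zO w x * pr s = sc (wedge x (w s x)) * (eps * pr s)"
  using s by (simp add: mult.assoc zO_pr) (simp add: D_mult flip: mult.assoc)
 have 2: "zO w x * D x * pr s = - (sc (wedge x (w (p - s) x)) * (eps * pr s))"
 proof (cases "s = 0")
  case False
  hence "zO w x * D x * pr s = zO w x * pr (p - s) * D x" using s by (simp add: D_prp mult.assoc)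
  also have "... = D (w (p - s) x) * (pr (p - s) * D x)" using s False by (simp add: zO_pr mult.assoc)
  also have "pr (p - s) * D x = D x * pr s" using s False by (simp add: D_prp)
  also have "D (w (p - s) x) * (D x * pr s) = - (sc (wedge x (w (p - s) x)) * (eps * pr s))"
   by (simp add: D_mult wedge_def sc_diff left_diff_distrib mult.commute[of "_ $ 1"] flip: mult.assoc)
  finally show ?thesis .
 qed (simp add: D_prp mult.assoc eps_pr_0)
 show "dI n (zO w) x * pr s = zE (%s x. 0) (%s x. wedge x (w s x) - wedge x (w (p - s) x)) x * pr s"
  using assms 1 2 s by (simp add: dI_def fun_app distrib_right zE_pr sc_diff left_diff_distrib mult.assoc)
qed

text \<open>Conjugation of the values together with a Frobenius-twisted substitution of x; this is
  the action under which \<open>D\<close> is invariant (\<open>gI_D\<close>).\<close>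

definition gI :: "'k sl2 => 'k tef => 'k tef"
 where "gI g f = (%x. rho g * f (sl2_mat (frob (inverse g)) *v x) * rho (inverse g))"

lemma D_conj: "rho g * (D y * rho (inverse g)) = D (sl2_mat (frob g) *v y)"
 by (simp add: D_rho)

text \<open>\<open>eps\<close> is the product of \<open>D\<close> at the two basis vectors, so
  conjugation multiplies it by the determinant of a matrix in SL2.\<close>

lemma eps_conj: "rho g * (eps * rho (inverse g)) = eps"
proof -
 define B where "B = sl2_mat (frob g)"
 have e: "eps = D (vec2 1 0) * D (vec2 0 1)" by (simp add: D_def eps_def)
 have "rho g * (eps * rho (inverse g)) = rho g * (D (vec2 1 0) * rho (inverse g)) * (rho g * (D (vec2 0 1) * rho (inverse g)))"
  by (simp add: e mult.assoc)
 also have "... = sc (det B) * eps"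
  unfolding D_conj B_def[symmetric] D_mult by (simp add: wedge_def matvec_2 det_2 mult.commute[of "B $ 1 $ 2"])
 finally show ?thesis by (simp add: B_def)
qed

lemma gI_zE: "gI g (zE a b) = zE (%s z. a s (sl2_mat (frob (inverse g)) *v z)) (%s z. b s (sl2_mat (frob (inverse g)) *v z))"
 and gI_zO: "gI g (zO w) = zO (%s z. sl2_mat (frob g) *v w s (sl2_mat (frob (inverse g)) *v z))"
proof -
 have r: "rho (inverse g) * pr s = pr s * rho (inverse g)" for s by (rule rho_pr)
 have e: "rho g * (sc x * (eps * (pr s * rho (inverse g)))) = sc x * (eps * pr s)" for x s
  unfolding sc_left_commute[of "rho g"] r[symmetric] using eps_conj[of g] by (simp add: mult.assoc[symmetric])
 show "gI g (zE a b) = zE (%s z. a s (sl2_mat (frob (inverse g)) *v z)) (%s z. b s (sl2_mat (frob (inverse g)) *v z))"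
 proof (rule ext, rule te_pr_eqI)
  fix z s assume s: "s < p"
  define zz where "zz = sl2_mat (frob (inverse g)) *v z"
  have "gI g (zE a b) z * pr s = rho g * (zE a b zz * pr s * rho (inverse g))"
   by (simp add: gI_def zz_def mult.assoc r)
  also have "... = (sc (a s zz) + sc (b s zz) * eps) * pr s"
   using s by (simp add: zE_pr distrib_left distrib_right mult.assoc e)
    (simp add: sc_left_commute flip: r)
  finally show "gI g (zE a b) z * pr s = zE (%s z. a s (sl2_mat (frob (inverse g)) *v z)) (%s z. b s (sl2_mat (frob (inverse g)) *v z)) z * pr s"
   using s by (simp add: zE_pr zz_def)
 qed
 show "gI g (zO w) = zO (%s z. sl2_mat (frob g) *v w s (sl2_mat (frob (inverse g)) *v z))"
 proof (rule ext, rule te_pr_eqI)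
  fix z s assume s: "s < p"
  define zz where "zz = sl2_mat (frob (inverse g)) *v z"
  have "gI g (zO w) z * pr s = rho g * (zO w zz * pr s * rho (inverse g))"
   by (simp add: gI_def zz_def mult.assoc r)
  also have "... = rho g * (D (w s zz) * rho (inverse g)) * pr s" using s by (simp add: zO_pr mult.assoc r)
  finally show "gI g (zO w) z * pr s = zO (%s z. sl2_mat (frob g) *v w s (sl2_mat (frob (inverse g)) *v z)) z * pr s"
   using s by (simp add: zO_pr zz_def D_conj)
 qed
qed

end

section \<open>Isomorphisms of modules\<close>

text \<open>Equivariance on a subset B accommodates modules whose action is meaningful only on the
  Borel subgroup. Closure of the source is included so that such maps can be inverted and fed into
  further constructions.\<close>

definition gmod_iso_on :: "'g set => ('k, 'v, 'g) gmodule => ('k, 'w, 'g) gmodule => ('v => 'w) => bool"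
 where "gmod_iso_on B M N j \<longleftrightarrow> bij_betw j (carrier M) (carrier N) \<and>
  (\<forall>x\<in>carrier M. \<forall>y\<in>carrier M. x +[M] y : carrier M & j (x +[M] y) = j x +[N] j y) \<and>
  (\<forall>c. \<forall>x\<in>carrier M. c *[M] x : carrier M & j (c *[M] x) = c *[N] j x) \<and>
  (\<forall>g\<in>B. \<forall>x\<in>carrier M. act M g x : carrier M & j (act M g x) = act N g (j x))"

lemma gmod_iso_on_UNIV: "gmod_iso_on UNIV M N j ==> M \<cong>\<^sub>G N"
 by (auto simp: gmod_iso_on_def gmod_iso_def)

text \<open>A quotient is identified through a relation R whose fibres are the cosets, which suits
  zigzags. The reparametrisation \<tau> of the group accounts for the Frobenius untwist.\<close>

lemma quot_gmod_iso:
 fixes M :: "('k, 'v, 'g) gmodule" and N :: "('k, 'w, 'g) gmodule"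
 assumes dom: "\<And>x y. R x y ==> x : carrier M & y : carrier N"
  and tot: "\<And>x. x : carrier M ==> \<exists>y. R x y" and surj: "\<And>y. y : carrier N ==> \<exists>x. R x y"
  and uniq: "\<And>x y y'. R x y ==> R x y' ==> y = y'"
  and add: "\<And>x y x' y'. R x y ==> R x' y' ==> R (x +[M] x') (y +[N] y')"
  and sm: "\<And>c x y. R x y ==> R (c *[M] x) (c *[N] y)"
  and ac: "\<And>g x y. g : B ==> R x y ==> R (act M (\<tau> g) x) (act N g y)"
  and cos: "\<And>x y. R x y ==> H +>\<^bsub>M\<^esub> x = {x'. R x' y}"
  and assoc: "\<And>h x y. h : H ==> x : carrier M ==> y : carrier M ==> (h +[M] x) +[M] y = h +[M] (x +[M] y)"
 obtains j where "gmod_iso_on B ((quot_gmod M H)\<lparr>act := %g. act (quot_gmod M H) (\<tau> g)\<rparr>) N j"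
  "\<And>y. y : carrier N ==> j {x. R x y} = y"
proof -
 define K where "K y = {x. R x y}" for y
 have car: "a_rcosets\<^bsub>M\<^esub> H = K ` carrier N"
 proof -
  have "a_rcosets\<^bsub>M\<^esub> H = (%x. H +>\<^bsub>M\<^esub> x) ` carrier M" by (auto simp: A_RCOSETS_def')
  also have "... = K ` carrier N" using tot surj dom cos unfolding K_def by (auto simp: image_iff) metis+
  finally show ?thesis .
 qed
 have inj: "inj_on K (carrier N)"
  unfolding K_def by (rule inj_onI) (use surj uniq in blast)
 have union: "(\<Union>x\<in>K y. H +>\<^bsub>M\<^esub> f x) = K (h y)" if "y : carrier N" "\<And>x. R x y ==> R (f x) (h y)" for y f h
  using surj[OF that(1)] that(2) cos unfolding K_def by fastforce
 have Kadd: "K y <+>\<^bsub>M\<^esub> K y' = K (y +[N] y')" if y: "y : carrier N" and y': "y' : carrier N" for y y'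
 proof
  show "K y <+>\<^bsub>M\<^esub> K y' \<subseteq> K (y +[N] y')" using add by (auto simp: set_add_def' K_def)
  obtain x x' where x: "R x y" "R x' y'" using surj[OF y] surj[OF y'] by blast
  show "K (y +[N] y') \<subseteq> K y <+>\<^bsub>M\<^esub> K y'"
  proof
   fix u assume "u : K (y +[N] y')"
   hence "u : H +>\<^bsub>M\<^esub> (x +[M] x')" using cos[OF add[OF x]] by (simp add: K_def)
   then obtain h where h: "h : H" "u = h +[M] (x +[M] x')" by (auto simp: a_r_coset_def')
   hence "u = (h +[M] x) +[M] x'" using assoc dom x by metis
   moreover have "h +[M] x : K y" using h cos[OF x(1)] by (auto simp: a_r_coset_def' K_def)
   ultimately show "u : K y <+>\<^bsub>M\<^esub> K y'" using x by (auto simp: set_add_def' K_def)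
  qed
 qed
 define q where "q = inv_into (carrier N) K"
 have q: "q (K y) = y" if "y : carrier N" for y using that inj by (simp add: q_def)
 have cl: "y +[N] y' : carrier N" "c *[N] y : carrier N" "g : B ==> act N g y : carrier N"
  if "y : carrier N" "y' : carrier N" for y y' c g
  using surj[OF that(1)] surj[OF that(2)] add sm ac dom by meson+
 have usm: "(\<Union>x\<in>K y. H +>\<^bsub>M\<^esub> (c *[M] x)) = K (c *[N] y)" if "y : carrier N" for c y
  using that by (rule union) (rule sm)
 have uac: "(\<Union>x\<in>K y. H +>\<^bsub>M\<^esub> act M (\<tau> g) x) = K (act N g y)" if "y : carrier N" "g : B" for g y
  using that(1) by (rule union) (rule ac[OF that(2)])
 have "gmod_iso_on B ((quot_gmod M H)\<lparr>act := %g. act (quot_gmod M H) (\<tau> g)\<rparr>) N q"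
  unfolding gmod_iso_on_def
 proof (intro conjI ballI allI)
  show "bij_betw q (carrier ((quot_gmod M H)\<lparr>act := %g. act (quot_gmod M H) (\<tau> g)\<rparr>)) (carrier N)"
   unfolding q_def using inj by (simp add: car quot_gmod_def gmod_def bij_betw_inv_into inj_on_imp_bij_betw)
 qed (auto simp: car q cl quot_gmod_def gmod_def Kadd usm uac)
 thus ?thesis using q by (rule that[unfolded K_def[symmetric]])
qed

section \<open>Comparison of Hochschild cohomology with the Koszul complex\<close>

lemma list_update_split:
 "i < length as ==> as[i := x] = take i as @ x # drop (Suc i) as"
 by (rule upd_conv_take_nth_drop)

text \<open>The bridge from the recursive differential to the closed formula in
  \<open>hoch_diff\<close>.\<close>

lemma hT_formula:
 "length as = Suc n ==> hT f as = (\<Sum>i<n. (- 1) ^ i * f (take i as @ (as ! i * as ! Suc i) # drop (i + 2) as))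
  + (- 1) ^ n * f (butlast as) * (%_. last as)"
proof (induction as arbitrary: f n rule: induct_list012)
 case (3 a b as)
 then obtain m where n: "n = Suc m" "length (b # as) = Suc m" by (cases n) auto
 have "hT f (a # b # as) = (\<Sum>i<n. (- 1) ^ i * f (take i (a # b # as) @ ((a # b # as) ! i * (a # b # as) ! Suc i) # drop (i + 2) (a # b # as)))
  + (- 1) ^ n * f (butlast (a # b # as)) * (%_. last (a # b # as))"
  unfolding n(1) sum.lessThan_Suc_shift hT.simps 3(2)[OF n(2), of "%l. f (a # l)"] by (simp add: sum_negf)
 thus ?case .
next
 case (2 a)
 hence "n = 0" by simp
 hence "hT f [a] = (\<Sum>i<n. (- 1) ^ i * f (take i [a] @ ([a] ! i * [a] ! Suc i) # drop (i + 2) [a]))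
  + (- 1) ^ n * f (butlast [a]) * (%_. last [a])" by simp
 thus ?case .
qed simp

context charp
begin

abbreviation DA :: "('k, 'k dist, 'k sl2) gmodule" where "DA \<equiv> Dist_G1"

lemma DA_simps: "carrier DA = dist0" "m +[DA] n = dadd m n" "c *[DA] m = dscale c m" "m \<otimes>\<^bsub>DA\<^esub> n = dmul m n"
 "act DA g m = dact g m" "\<zero>\<^bsub>DA\<^esub> = dzero"
 by (simp_all add: Dist_G1_def fun_gmod_def gmod_def triv_gmod_def distributions_G1_eq
  dadd_def dscale_def dmul_def dact_def dzero_def)

lemma pim_dzero: "pim dzero = 0"
 by (intro te_eqI tv_eqI) (simp add: tv_fun_pim dzero_in,
  simp add: conv_def dzero_def fun_eq_iff subm_regular[OF Tsp_in_bh[OF tv_fun_in_Tsp]] zero_fun_apply)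

lemma pim_eqI: "m : dist0 ==> n : dist0 ==> pim m = pim n ==> m = n"
 using bij_betw_imp_inj_on[OF pim_bij] by (rule inj_onD)

definition pin :: "'k te => ('k sl2 => 'k) => 'k" where "pin = inv_into dist0 pim"

lemma pin: "a : KK ==> pin a : dist0" "a : KK ==> pim (pin a) = a" "m : dist0 ==> pin (pim m) = m"
 using pim_bij unfolding pin_def
 by (auto simp: bij_betw_def inv_into_into f_inv_into_f)

lemma DA_abelian_monoid: "abelian_monoid DA"
proof (rule abelian_monoidI; unfold DA_simps)
 fix u v r :: "'k dist" assume m: "u : dist0"
 show "dadd dzero u = u" by (rule pim_eqI) (simp_all add: m pim_dadd dadd_in dzero_in pim_dzero)
 assume n: "v : dist0"
 show "dadd u v : dist0" by (rule dadd_in[OF m n])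
 show "dadd u v = dadd v u" by (rule pim_eqI) (simp_all add: m n pim_dadd dadd_in add.commute)
 assume "r : dist0"
 thus "dadd (dadd u v) r = dadd u (dadd v r)"
  using m n by (intro pim_eqI) (simp_all add: pim_dadd dadd_in add.assoc)
qed (rule dzero_in)

lemma pim_finsum:
 "(\<And>i. i : I ==> h i : dist0) ==> finite I ==> (\<Oplus>\<^bsub>DA\<^esub>i\<in>I. h i) : dist0 & pim (\<Oplus>\<^bsub>DA\<^esub>i\<in>I. h i) = (\<Sum>i\<in>I. pim (h i))"
proof -
 interpret DA: abelian_monoid DA by (rule DA_abelian_monoid)
 assume h: "\<And>i. i : I ==> h i : dist0" and "finite I"
 from this(2,1) show ?thesis
 proof (induction I rule: finite_induct)
  case (insert i I)
  hence "(\<Oplus>\<^bsub>DA\<^esub>i\<in>insert i I. h i) = dadd (h i) (\<Oplus>\<^bsub>DA\<^esub>i\<in>I. h i)"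
   by (subst DA.finsum_insert) (auto simp: DA_simps)
  thus ?case using insert by (simp add: dadd_in pim_dadd)
 qed (simp add: DA_simps dzero_in pim_dzero)
qed

text \<open>Transport along \<open>pim\<close>: Hochschild cochains of Dist(G_1) become the cochains
  of bidegree (n, 0) killed by the Koszul differential (\<open>enc_in\<close>,
  \<open>enc_surj\<close>).\<close>

definition enc :: "nat => ('k dist list => ('k sl2 => 'k) => 'k) => 'k te list => 'k tef"
 where "enc n F = (%as. if length as = n & set as \<subseteq> KK then Rc (pim (F (map pin as))) else 0)"

lemma enc_out: "(length as = n --> ~ set as \<subseteq> KK) ==> enc n F as = 0"
 by (auto simp: enc_def)

lemma tuples_DA: "ms : tuples DA n \<longleftrightarrow> length ms = n & set ms \<subseteq> dist0"
 by (simp add: tuples_def DA_simps)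

lemma map_pim_pin: "set as \<subseteq> KK ==> map pim (map pin as) = as" "set ms \<subseteq> dist0 ==> map pin (map pim ms) = ms"
 by (auto simp: pin intro!: map_idI)

lemma enc_map: "ms : tuples DA n ==> enc n F (map pim ms) = Rc (pim (F ms))"
 using pim_in_KK by (auto simp: enc_def tuples_DA map_pim_pin(2) simp del: map_map)

lemma enc_eqI:
 assumes "\<And>ms. ms : tuples DA n ==> f (map pim ms) = Rc (pim (F ms))"
  "\<And>as. ~ (length as = n & set as \<subseteq> KK) ==> f as = 0"
 shows "enc n F = f"
proof
 fix as
 show "enc n F as = f as"
 proof (cases "length as = n & set as \<subseteq> KK")
  case True
  hence "map pin as : tuples DA n" by (auto simp: tuples_DA pin)
  thus ?thesis using assms(1)[of "map pin as"] True enc_map[of "map pin as" n F] map_pim_pin(1) by metis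
 qed (use assms(2) in \<open>auto simp: enc_def\<close>)
qed

lemma enc_inject:
 assumes "F : tuples DA n \<rightarrow>\<^sub>E dist0" "F' : tuples DA n \<rightarrow>\<^sub>E dist0" "enc n F = enc n F'"
 shows "F = F'"
proof (rule PiE_ext[OF assms(1,2)])
 fix ms assume m: "ms : tuples DA n"
 have "Rc (pim (F ms)) = Rc (pim (F' ms))" using assms(3) enc_map[OF m] by metis
 thus "F ms = F' ms" using m assms(1,2) by (intro pim_eqI) (auto simp: fun_eq_iff)
qed

abbreviation HC :: "nat => ('k, 'k dist list => 'k dist, 'k sl2) gmodule"
 where "HC \<equiv> hoch_cochains DA"

lemma hoch_cochains_simps:
 "x +[HC n] y = (\<lambda>as\<in>tuples DA n. dadd (x as) (y as))"
 "c *[HC n] x = (\<lambda>as\<in>tuples DA n. dscale c (x as))"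
 "act (HC n) g x = (\<lambda>as\<in>tuples DA n. dact g (x (map (dact (inverse g)) as)))"
 "\<zero>\<^bsub>HC n\<^esub> = (\<lambda>as\<in>tuples DA n. dzero)"
 by (simp_all add: hoch_cochains_def fun_gmod_def gmod_def DA_simps(2-6) DA_simps(5)[abs_def] cong: restrict_cong)

lemma hoch_cochains_PiE: "F : carrier (HC n) ==> F : tuples DA n \<rightarrow>\<^sub>E dist0"
 by (simp add: hoch_cochains_def fun_gmod_def gmod_def DA_simps)

lemma enc_in:
 assumes F: "F : carrier (HC n)" shows "enc n F : CI n 0" "ddC 0 (enc n F) = 0"
proof -
 have FE: "F : tuples DA n \<rightarrow>\<^sub>E dist0" by (rule hoch_cochains_PiE[OF F])
 have ml: "F (as[i := dadd x y]) = dadd (F (as[i := x])) (F (as[i := y]))" "F (as[i := dscale c x]) = dscale c (F (as[i := x]))"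
  if "as : tuples DA n" "i < n" "x : dist0" "y : dist0" for as i x y c
  using F that by (simp_all add: hoch_cochains_def fun_gmod_def gmod_def DA_simps)
 have val: "\<exists>a\<in>KK. enc n F as = Rc a" if "length as = n" "set as \<subseteq> KK" for as
 proof -
  have "map pin as : tuples DA n" using that by (auto simp: tuples_DA pin)
  hence "F (map pin as) : dist0" using FE by auto
  thus ?thesis using that pim_in_KK by (auto simp: enc_def)
 qed
 show "enc n F : CI n 0"
 proof (rule CI_I)
  show "enc n F as : Iset 0" for as
   using val[of as] KK_Iset_0 Iset_0 by (cases "length as = n & set as \<subseteq> KK") (auto simp: enc_def)
  show "multilin (enc n F)"
  proof (rule multilinI)
   fix l1 l2 x y c assume l: "set l1 \<subseteq> KK" "set l2 \<subseteq> KK" "x : KK" "y : KK"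
   have z: "sc c * x + y : KK" using l by (intro KK_add KK_mult KK_sc)
   define as where "as = map pin (l1 @ x # l2)"
   have up: "as[length l1 := w] = map pin l1 @ w # map pin l2" for w
    unfolding as_def map_append list.map by (metis length_map list_update_length)
   have pz: "pin (sc c * x + y) = dadd (dscale c (pin x)) (pin y)"
    by (rule pim_eqI) (simp_all add: pin l z dadd_in dscale_in pim_dadd pim_dscale)
   show "enc n F (l1 @ (sc c * x + y) # l2) = Rc (sc c) * enc n F (l1 @ x # l2) + enc n F (l1 @ y # l2)"
   proof (cases "Suc (length l1 + length l2) = n")
    case True
    hence as: "as : tuples DA n" and i: "length l1 < n" using l by (auto simp: as_def tuples_DA pin)
    have t: "map pin l1 @ w # map pin l2 : tuples DA n" if "w : dist0" for w
     using True l that by (auto simp: tuples_DA pin)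
    have "F (map pin l1 @ dadd (dscale c (pin x)) (pin y) # map pin l2)
     = dadd (dscale c (F (map pin l1 @ pin x # map pin l2))) (F (map pin l1 @ pin y # map pin l2))"
     using ml(1)[OF as i, of "dscale c (pin x)" "pin y"] ml(2)[OF as i, of "pin x" "pin x" c] l pin dscale_in
     unfolding up by simp
    moreover have "F (map pin l1 @ pin w # map pin l2) : dist0" if "w : KK" for w
     using FE t[OF pin(1)[OF that]] by auto
    ultimately show ?thesis
     using True l z by (simp add: enc_def pz pim_dadd pim_dscale dscale_in Rc_simps)
   qed (auto simp: enc_def)
  qed
 qed (auto simp: enc_def)
 show "ddC 0 (enc n F) = 0"
 proof
  fix as
  show "ddC 0 (enc n F) as = 0 as"
   using val[of as] dI_0_kernel KK_Iset_0 dI_of_0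
   by (cases "length as = n & set as \<subseteq> KK") (auto simp: ddC_def zero_fun_apply enc_def)
 qed
qed

lemma multilin_0_arg: "multilin f ==> set l1 \<subseteq> KK ==> set l2 \<subseteq> KK ==> f (l1 @ 0 # l2) = 0"
 using multilinD[of f l1 l2 0 0 1] KK_sc[of 0] by (simp add: Rc_simps)

lemma enc_surj:
 assumes f: "f : CI n 0" "ddC 0 f = 0"
 shows "\<exists>F\<in>carrier (HC n). enc n F = f"
proof -
 have "dI 0 (f as) = 0" for as using fun_cong[OF f(2), of as] by (simp add: ddC_def zero_fun_apply)
 hence k: "f as 0 : KK" "f as = Rc (f as 0)" for as
  using dI_0_kernel[OF CI_D(2)[OF f(1)], of as] by auto
 define F where "F = (\<lambda>ms\<in>tuples DA n. pin (f (map pim ms) 0))"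
 have pF: "pim (F ms) = f (map pim ms) 0" "F ms : dist0" if "ms : tuples DA n" for ms
  using that by (simp_all add: F_def pin k(1))
 have t: "ms[i := r] : tuples DA n" if "ms : tuples DA n" "r : dist0" for ms i r
  using that set_update_subset_insert[of ms i r] by (auto simp: tuples_DA)
 have s: "set (map pim (take i ms)) \<subseteq> KK" "set (map pim (drop (Suc i) ms)) \<subseteq> KK" if "ms : tuples DA n" for ms i
  using that pim_in_KK by (auto simp: tuples_DA dest!: in_set_takeD in_set_dropD)
 have ms: "map pim (ms[i := r]) = map pim (take i ms) @ pim r # map pim (drop (Suc i) ms)"
  if "ms : tuples DA n" "i < n" for ms i r
  using that by (simp add: tuples_DA list_update_split)
 have "F : carrier (HC n)"
  unfolding hoch_cochains_def fun_gmod_def gmod_def partial_object.select_convs DA_simps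
 proof (intro CollectI conjI ballI allI impI)
  show "F : tuples DA n \<rightarrow>\<^sub>E dist0" by (auto simp: F_def pin k(1))
 next
  fix ms i and u v :: "'k dist" assume m: "ms : tuples DA n" "i < n" "u : dist0" "v : dist0"
  show "F (ms[i := dadd u v]) = dadd (F (ms[i := u])) (F (ms[i := v]))"
  proof (rule pim_eqI)
   show "pim (F (ms[i := dadd u v])) = pim (dadd (F (ms[i := u])) (F (ms[i := v])))"
    using multilinD[OF CI_D(1)[OF f(1)] s[OF m(1), of i], of "pim u" "pim v" 1] m pim_in_KK
    by (simp add: pF t[OF m(1)] pim_dadd dadd_in ms[OF m(1,2)] Rc_simps plus_fun_apply)
  qed (simp_all add: pF t[OF m(1)] m dadd_in)
 next
  fix ms i c and u :: "'k dist" assume m: "ms : tuples DA n" "i < n" "u : dist0"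
  show "F (ms[i := dscale c u]) = dscale c (F (ms[i := u]))"
  proof (rule pim_eqI)
   show "pim (F (ms[i := dscale c u])) = pim (dscale c (F (ms[i := u])))"
    using multilinD[OF CI_D(1)[OF f(1)] s[OF m(1), of i], of "pim u" 0 c] m pim_in_KK KK_sc[of 0] multilin_0_arg[OF CI_D(1)[OF f(1)] s[OF m(1), of i]]
    by (simp add: pF t[OF m(1)] pim_dscale dscale_in ms[OF m(1,2)] times_fun_apply)
  qed (simp_all add: pF t[OF m(1)] m dscale_in)
 qed
 moreover have "enc n F = f"
 proof (rule enc_eqI)
  show "f as = 0" if "~ (length as = n & set as \<subseteq> KK)" for as using that CI_D(3,4)[OF f(1)] by blast
 qed (use pF k(2) in auto)
 ultimately show ?thesis by blast
qed

lemma hoch_diff_pim: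
 assumes F: "F : tuples DA n \<rightarrow>\<^sub>E dist0" and ms: "ms : tuples DA (Suc n)"
 shows "hoch_diff DA n F ms : dist0" "hdel (enc n F) (map pim ms) = Rc (pim (hoch_diff DA n F ms))"
proof -
 obtain m l where m: "ms = m # l" using ms by (cases ms) (auto simp: tuples_DA)
 have FI: "F l : dist0" if "l : tuples DA n" for l using that F by auto
 define T where "T i = take i ms @ dmul (ms ! i) (ms ! Suc i) # drop (i + 2) ms" for i
 have l: "length ms = Suc n" "set ms \<subseteq> dist0" and ne: "ms ~= []" using ms by (auto simp: tuples_DA)
 have nth: "ms ! i : dist0" if "i <= n" for i using l that nth_mem[of i ms] by auto
 have T: "T i : tuples DA n" if "i < n" for i
  using l that nth[of i] nth[of "Suc i"] by (auto simp: T_def tuples_DA dmul_in dest!: in_set_takeD in_set_dropD)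
 have b: "butlast ms : tuples DA n" "tl ms : tuples DA n" and la: "last ms : dist0" "hd ms : dist0"
  using l by (auto simp: tuples_DA m dest: in_set_butlastD)
 have e: "hoch_diff DA n F ms = dadd (dadd (dmul (hd ms) (F (tl ms))) (\<Oplus>\<^bsub>DA\<^esub>i\<in>{..<n}. dscale ((- 1) ^ Suc i) (F (T i))))
  (dscale ((- 1) ^ Suc n) (dmul (F (butlast ms)) (last ms)))"
  unfolding hoch_diff_def DA_simps T_def using ms by simp
 have S: "(\<Oplus>\<^bsub>DA\<^esub>i\<in>{..<n}. dscale ((- 1) ^ Suc i) (F (T i))) : dist0 \<and>
  pim (\<Oplus>\<^bsub>DA\<^esub>i\<in>{..<n}. dscale ((- 1) ^ Suc i) (F (T i))) = (\<Sum>i<n. pim (dscale ((- 1) ^ Suc i) (F (T i))))"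
  by (rule pim_finsum) (auto intro: dscale_in FI T)
 show "hoch_diff DA n F ms : dist0"
  unfolding e using S by (intro dadd_in dmul_in dscale_in la FI b) auto
 have sg: "sc ((- 1) ^ i) = (- 1 :: 'k te) ^ i" for i by (cases "even i") (simp_all add: sc_uminus)
 have "enc n F (take i (map pim ms) @ (pim (ms ! i) * pim (ms ! Suc i)) # drop (Suc (Suc i)) (map pim ms)) = Rc (pim (F (T i)))"
  if i: "i < n" for i
 proof -
  have "take i (map pim ms) @ (pim (ms ! i) * pim (ms ! Suc i)) # drop (Suc (Suc i)) (map pim ms) = map pim (T i)"
   using i nth[of i] nth[of "Suc i"] by (simp add: T_def pim_dmul take_map drop_map)
  thus ?thesis by (simp only: enc_map[OF T[OF i]])
 qed
 hence "hT (enc n F) (map pim ms) = (\<Sum>i<n. (- 1) ^ i * Rc (pim (F (T i)))) + (- 1) ^ n * Rc (pim (F (butlast ms))) * Rc (pim (last ms))"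
  using l(1) hT_formula[of "map pim ms" n "enc n F"]
  by (simp add: map_butlast[symmetric] last_map[OF ne] enc_map[OF b(1)])
 moreover have "Rc (pim (hoch_diff DA n F ms)) = Rc (pim (hd ms)) * Rc (pim (F (tl ms)))
  - ((\<Sum>i<n. (- 1) ^ i * Rc (pim (F (T i)))) + (- 1) ^ n * Rc (pim (F (butlast ms))) * Rc (pim (last ms)))"
 proof -
  have "pim (hoch_diff DA n F ms) = pim (hd ms) * pim (F (tl ms))
   - ((\<Sum>i<n. (- 1) ^ i * pim (F (T i))) + (- 1) ^ n * (pim (F (butlast ms)) * pim (last ms)))"
   unfolding e using S T b la FI
   by (simp add: pim_dadd pim_dscale pim_dmul dadd_in dscale_in dmul_in sg sc_uminus sum_negf)
  moreover have "Rc (\<Sum>i<n. (- 1) ^ i * pim (F (T i))) = (\<Sum>i<n. (- 1) ^ i * Rc (pim (F (T i))))"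
   by (simp add: fun_eq_iff fun_app)
  ultimately show ?thesis
   by (simp add: fun_eq_iff fun_app mult.assoc)
 qed
 moreover have "enc n F (map pim l) = Rc (pim (F l))" using b(2) by (simp add: enc_map m)
 ultimately show "hdel (enc n F) (map pim ms) = Rc (pim (hoch_diff DA n F ms))"
  unfolding m list.map hdel_simps by (simp add: m)
qed

lemma hoch_diff_PiE: "F : tuples DA n \<rightarrow>\<^sub>E dist0 ==> hoch_diff DA n F : tuples DA (Suc n) \<rightarrow>\<^sub>E dist0"
 using hoch_diff_pim(1) by (auto simp: hoch_diff_def)

lemma enc_hoch_diff:
 assumes F: "F : carrier (HC n)"
 shows "enc (Suc n) (hoch_diff DA n F) = delC (enc n F)"
proof (rule enc_eqI)
 fix ms assume m: "ms : tuples DA (Suc n)"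
 hence "set (map pim ms) \<subseteq> KK" using pim_in_KK by (auto simp: tuples_DA)
 thus "delC (enc n F) (map pim ms) = Rc (pim (hoch_diff DA n F ms))"
  using hoch_diff_pim(2)[OF hoch_cochains_PiE[OF F] m] by (simp add: delC_def)
qed (use CI_D(3,4)[OF delC_in[OF enc_in(1)[OF F]]] in blast)

text \<open>Instead of checking multilinearity of the closed formula, the encoded differential is
  decoded and identified by injectivity of \<open>enc\<close>.\<close>

lemma hoch_diff_in: "F : carrier (HC n) ==> hoch_diff DA n F : carrier (HC (Suc n))"
proof -
 assume F: "F : carrier (HC n)"
 have "ddC 0 (delC (enc n F)) = delC (ddC 0 (enc n F))" by (rule ext) (simp add: delC_ddC)
 hence "ddC 0 (delC (enc n F)) = 0" by (simp add: enc_in(2)[OF F] CI.del_0)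
 then obtain F' where F': "F' : carrier (HC (Suc n))" "enc (Suc n) F' = delC (enc n F)"
  using enc_surj[OF delC_in[OF enc_in(1)[OF F]]] by blast
 hence "F' = hoch_diff DA n F"
  using enc_hoch_diff[OF F] hoch_diff_PiE[OF hoch_cochains_PiE[OF F]] hoch_cochains_PiE
  by (intro enc_inject[of _ "Suc n"]) auto
 thus ?thesis using F' by simp
qed

lemma enc_zero: "enc n (\<lambda>as\<in>tuples DA n. dzero) = 0"
 by (rule enc_eqI) (auto simp: zero_fun_apply pim_dzero Rc_simps)

lemma hoch_cocycles_eq:
 "hoch_cocycles DA n = {F : carrier (HC n). enc n F : CI.ZZ n 0}"
proof -
 have "hoch_diff DA n F = \<zero>\<^bsub>HC (Suc n)\<^esub> \<longleftrightarrow> enc n F : CI.ZZ n 0" if F: "F : carrier (HC n)" for F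
 proof -
  have "(\<lambda>as\<in>tuples DA (Suc n). dzero) : tuples DA (Suc n) \<rightarrow>\<^sub>E (dist0 :: 'k dist set)" by (auto simp: dzero_in)
  hence "hoch_diff DA n F = \<zero>\<^bsub>HC (Suc n)\<^esub> \<longleftrightarrow> delC (enc n F) = 0"
   using enc_inject[OF hoch_diff_PiE[OF hoch_cochains_PiE[OF F]]]
   unfolding hoch_cochains_simps enc_hoch_diff[OF F, symmetric] by (metis enc_zero)
  thus ?thesis using enc_in[OF F] by (simp add: CI.ZZ_def)
 qed
 thus ?thesis by (auto simp: hoch_cocycles_def)
qed

lemma hoch_coboundaries_eq:
 "hoch_coboundaries DA n \<subseteq> carrier (HC n)" "enc n ` hoch_coboundaries DA n = CI.BB n 0"
proof -
 have z: "\<zero>\<^bsub>HC 0\<^esub> : carrier (HC 0)"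
 proof -
  obtain F where F: "F : carrier (HC 0)" "enc 0 F = 0"
   using enc_surj[OF CI.C_0] CI.dd_0 by blast
  have "(\<lambda>as\<in>tuples DA 0. dzero) : tuples DA 0 \<rightarrow>\<^sub>E (dist0 :: 'k dist set)" by (auto simp: dzero_in)
  hence "(\<lambda>as\<in>tuples DA 0. dzero) = F"
   using F hoch_cochains_PiE enc_zero by (intro enc_inject[of _ 0]) auto
  thus ?thesis using F by (simp add: hoch_cochains_simps)
 qed
 show "hoch_coboundaries DA n \<subseteq> carrier (HC n)"
  using z hoch_diff_in by (auto simp: hoch_coboundaries_def split: nat.splits)
 show "enc n ` hoch_coboundaries DA n = CI.BB n 0"
 proof (cases n)
  case 0
  thus ?thesis by (simp add: hoch_coboundaries_def hoch_cochains_simps enc_zero)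
 next
  case (Suc m)
  have "{x : CI m 0. ddC 0 x = 0} = enc m ` carrier (HC m)"
   using enc_in enc_surj by blast
  thus ?thesis by (simp add: Suc hoch_coboundaries_def image_image enc_hoch_diff)
 qed
qed

lemma enc_linear:
 assumes "F : carrier (HC n)" "F' : carrier (HC n)"
 shows "enc n (F +[HC n] F') = enc n F + enc n F'"
  and "enc n (c *[HC n] F) = (%as. Rc (sc c) * enc n F as)"
proof -
 have FI: "F l : dist0" "F' l : dist0" if "l : tuples DA n" for l
  using that assms[THEN hoch_cochains_PiE] by auto
 show "enc n (F +[HC n] F') = enc n F + enc n F'"
  by (rule enc_eqI) (auto simp: hoch_cochains_simps plus_fun_apply enc_map pim_dadd FI Rc_simps enc_out)
 show "enc n (c *[HC n] F) = (%as. Rc (sc c) * enc n F as)"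
  by (rule enc_eqI) (auto simp: hoch_cochains_simps enc_map pim_dscale FI Rc_simps enc_out)
qed

lemma hoch_add_in:
 assumes "F : carrier (HC n)" "F' : carrier (HC n)"
 shows "F +[HC n] F' : carrier (HC n)"
proof -
 have "enc n F + enc n F' : CI n 0" "ddC 0 (enc n F + enc n F') = 0"
  using assms enc_in by (simp_all add: CI.C_add CI.dd_add)
 then obtain G where G: "G : carrier (HC n)" "enc n G = enc n F + enc n F'" using enc_surj by blast
 have "F +[HC n] F' : tuples DA n \<rightarrow>\<^sub>E dist0"
  unfolding hoch_cochains_simps using assms[THEN hoch_cochains_PiE] by (auto intro!: dadd_in)
 hence "G = F +[HC n] F'"
  using G enc_linear(1)[OF assms] by (intro enc_inject[OF hoch_cochains_PiE]) auto
 thus ?thesis using G by simp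
qed

end

context charp
begin

subsection \<open>The group action\<close>

definition conj :: "'k sl2 => 'k te => 'k te" where "conj g a = rho g * a * rho (inverse g)"

lemma conj_simps [simp]: "conj g (a * b) = conj g a * conj g b" "conj g (a + b) = conj g a + conj g b"
 "conj g (sc c) = sc c" "conj g (conj (inverse g) a) = a" "conj (inverse g) (conj g a) = a"
 by (simp_all add: conj_def distrib_left distrib_right mult.assoc sc_commute)

lemma conj_pim: "m : dist0 ==> conj g (pim m) = pim (dact g m)"
 by (simp add: conj_def pim_dact)

lemma conj_KK: "a : KK ==> conj g a : KK"
 using conj_pim[of "pin a" g] pim_in_KK[OF dact_in] pin by metis

lemma conj_KK_iff: "set (map (conj g) as) \<subseteq> KK \<longleftrightarrow> set as \<subseteq> KK"
proof
 assume *: "set (map (conj g) as) \<subseteq> KK"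
 show "set as \<subseteq> KK"
 proof
  fix a assume "a : set as"
  hence "conj (inverse g) (conj g a) : KK" using * by (rule_tac conj_KK) auto
  thus "a : KK" by simp
 qed
qed (auto intro: conj_KK)

lemma gI_simps: "gI g (f * h) = gI g f * gI g h" "gI g (f + h) = gI g f + gI g h" "gI g (f - h) = gI g f - gI g h"
 "gI g (Rc a) = Rc (conj g a)" "gI g 0 = 0" "gI g (- f) = - gI g f"
 by (simp_all add: gI_def conj_def fun_eq_iff fun_app algebra_simps)

lemma gI_D: "gI g D = D"
proof
 fix x
 have "sl2_mat (frob g) ** sl2_mat (frob (inverse g)) = mat 1" by (simp add: frob_inverse flip: sl2_mat_mult)
 thus "gI g D x = D x" by (simp add: gI_def mult.assoc D_conj matrix_vector_mul_assoc)
qed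

lemma gI_dI: "gI g (dI n f) = dI n (gI g f)"
 by (cases "even n") (simp_all add: dI_def gI_simps gI_D)

lemma hp_subst: assumes "u : hp n" shows "(%x. u (A *v x)) : hp n"
proof -
 obtain c where c: "u = Hp n c" using assms by (auto simp: hp_def)
 show ?thesis unfolding c Hp_def
  by (intro hp_sum hp_sc_mult SP_subst[where f = "%x. x $ 1 ^ _ * x $ 2 ^ _"] SP_mon) simp
qed

lemma gI_Iset: assumes "f : Iset n" shows "gI g f : Iset n"
proof -
 have "gI g f = Rc (rho g) * (%x. f (sl2_mat (frob (inverse g)) *v x)) * Rc (rho (inverse g))"
  by (simp add: gI_def fun_eq_iff fun_app)
 hence h: "gI g f : hp n" using Iset_hp[OF assms] by (simp add: hp_lmult hp_rmult hp_subst)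
 have R: "gI g (Rc (pr s)) = Rc (pr s)" for s
  by (simp add: gI_simps conj_def rho_pr mult.assoc)
 have "gI g (f * Rc (pr s)) = gI g (Rc (pr (tau n s)) * f)" "n > 0 ==> gI g (f * Rc (pr 0)) = gI g 0" for s
  using assms unfolding Iset_iff by auto
 thus ?thesis unfolding Iset_iff gI_simps(1,5) R using h by blast
qed

definition gC where "gC g f = (%as. gI g (f (map (conj (inverse g)) as)))"

lemma hT_gC: "hT (gC g f) as = gI g (hT f (map (conj (inverse g)) as))"
proof (induction as arbitrary: f rule: induct_list012)
 case (3 a b as)
 have "hT (%l. gC g f (a # l)) (b # as) = hT (gC g (%l. f (conj (inverse g) a # l))) (b # as)"
  by (simp add: gC_def[abs_def])
 hence "hT (gC g f) (a # b # as) = gI g (hT f (map (conj (inverse g)) (a # b # as)))"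
  using 3(2)[of "%l. f (conj (inverse g) a # l)"] by (simp add: gI_simps) (simp add: gC_def)
 thus ?case .
next
 case 1
 have "hT (gC g f) [] = gI g (hT f (map (conj (inverse g)) []))" by (simp add: gI_simps)
 thus ?case .
next
 case (2 a)
 have "hT (gC g f) [a] = gI g (hT f (map (conj (inverse g)) [a]))" by (simp add: gC_def gI_simps)
 thus ?case .
qed

lemma gC_in: assumes f: "f : CI i j" shows "gC g f : CI i j"
proof (rule CI_I)
 show "multilin (gC g f)"
  using multilinD[OF CI_D(1)[OF f], of "map (conj (inverse g)) _" "map (conj (inverse g)) _" "conj (inverse g) _" "conj (inverse g) _"]
  by (intro multilinI) (simp add: gC_def gI_simps conj_KK conj_KK_iff[simplified])
 show "gC g f as = 0" if "~ set as \<subseteq> KK" for as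
  using that conj_KK_iff[of "inverse g" as] CI_D(4)[OF f] by (metis gC_def gI_simps(5))
qed (simp_all add: gC_def gI_Iset CI_D[OF f] gI_simps)

lemma delC_gC: "delC (gC g f) = gC g (delC f)"
proof
 fix as
 have "hdel (gC g f) as = gI g (hdel f (map (conj (inverse g)) as))"
  using hT_gC[of g f as] by (cases as) (simp_all add: gI_simps gC_def)
 thus "delC (gC g f) as = gC g (delC f) as"
  using conj_KK_iff[of "inverse g" as] by (simp add: delC_def gC_def[of g "%as. if _ as then _ as else _"] gI_simps)
qed

lemma ddC_gC: "ddC j (gC g f) = gC g (ddC j f)"
 by (simp add: ddC_def gC_def gI_dI)

definition cmC where "cmC c f = (%as :: 'k te list. Rc (sc c) * f as)"

lemma cmC_in: assumes f: "f : CI i j" shows "cmC c f : CI i j"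
proof (rule CI_I)
 show "multilin (cmC c f)"
 proof (rule multilinI)
  fix l1 l2 x y a assume l: "set l1 \<subseteq> KK" "set l2 \<subseteq> KK" "x : KK" "y : KK"
  have "Rc (sc c) * (Rc (sc a) * h) = Rc (sc a) * (Rc (sc c) * h)" for h
   by (rule ext) (simp only: times_fun_apply sc_left_commute[of "sc c" a])
  thus "cmC c f (l1 @ (sc a * x + y) # l2) = Rc (sc a) * cmC c f (l1 @ x # l2) + cmC c f (l1 @ y # l2)"
   using multilinD[OF CI_D(1)[OF f] l, of a] by (simp add: cmC_def distrib_left)
 qed
qed (simp_all add: cmC_def CI_D[OF f] Iset_lmult sc_commute)

lemma delC_cmC: "delC (cmC c f) = cmC c (delC f)"
proof
 fix as
 have "Rc a * (Rc (sc c) * h) = Rc (sc c) * (Rc a * h)" for a h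
  by (rule ext) (simp only: times_fun_apply sc_left_commute[of a c])
 hence "hdel (cmC c f) as = Rc (sc c) * hdel f as"
  unfolding cmC_def by (cases as) (simp_all add: hT_left_mult right_diff_distrib)
 thus "delC (cmC c f) as = cmC c (delC f) as" by (simp add: delC_def cmC_def)
qed

lemma ddC_cmC: "ddC j (cmC c f) = cmC c (ddC j f)"
 by (simp add: ddC_def cmC_def dI_lmult KK_sc)

lemma enc_act:
 assumes F: "F : carrier (HC n)"
 shows "enc n (act (HC n) g F) = gC g (enc n F)"
proof (rule enc_eqI)
 fix ms assume m: "ms : tuples DA n"
 hence t: "map (dact (inverse g)) ms : tuples DA n" by (auto simp: tuples_DA dact_in)
 have "map (conj (inverse g)) (map pim ms) = map pim (map (dact (inverse g)) ms)"
  using m by (auto simp: tuples_DA conj_pim)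
 hence "gC g (enc n F) (map pim ms) = Rc (conj g (pim (F (map (dact (inverse g)) ms))))"
  by (simp only: gC_def enc_map[OF t] gI_simps)
 also have "... = Rc (pim (dact g (F (map (dact (inverse g)) ms))))"
  using hoch_cochains_PiE[OF F] t by (subst conj_pim) auto
 finally show "gC g (enc n F) (map pim ms) = Rc (pim (act (HC n) g F ms))"
  using m by (simp add: hoch_cochains_simps)
qed (use CI_D(3,4)[OF gC_in[OF enc_in(1)[OF F]]] in blast)

subsection \<open>Cohomology from invariants\<close>

definition JZ where "JZ n = {f : JJ n. dI n f = 0}"
definition JB where "JB n = (case n of 0 => {0} | Suc m => dI m ` JJ m)"

lemma CI_0_D: assumes "f : CI 0 n" "delC f = 0" shows "f [] : JJ n"
proof -
 have "a * f [] x = f [] x * a" if "a : KK" for a x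
  using fun_cong[OF fun_cong[OF assms(2), of "[a]"], of x] that by (simp add: delC_def fun_app)
 thus ?thesis using CI_D(2)[OF assms(1)] by (simp add: JJ_def)
qed

text \<open>A form as a cochain without arguments; its Hochschild differential is the commutator
  with \<open>KK\<close>, so invariants give cocycles.\<close>

definition sing :: "'k tef => 'k te list => 'k tef" where "sing f = (%as. if as = [] then f else 0)"

lemma sing: assumes "f : JJ n" shows "sing f : CI 0 n" "delC (sing f) = 0"
proof -
 show s: "sing f : CI 0 n"
  using assms by (intro CI_I multilinI) (auto simp: sing_def JJ_def Iset_0)
 show "delC (sing f) = 0"
 proof
  fix as
  show "delC (sing f) as = 0 as"
  proof (cases "length as = 1 & set as \<subseteq> KK")
   case True
   then obtain a where "as = [a]" "a : KK" by (cases as) auto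
   thus ?thesis using assms by (simp add: delC_def sing_def JJ_def fun_eq_iff fun_app)
  next
   case False
   hence "delC (sing f) as = 0" using CI_D(3,4)[OF delC_in[OF s], of as] by auto
   thus ?thesis by (simp add: zero_fun_apply)
  qed
 qed
qed

lemma CI_0_sing: "f : CI 0 n ==> f = sing (f [])"
 using CI_D(3) by (fastforce simp: sing_def fun_eq_iff[of f])

lemma ZZ_0: "z : CI.ZZ 0 n ==> z [] : JZ n" "f : JZ n ==> sing f : CI.ZZ 0 n"
 "z : CI.ZZ 0 n ==> z : CI.BB 0 n \<longleftrightarrow> z [] : JB n"
proof -
 have d: "ddC m (sing f) = sing (dI m f)" for m f by (auto simp: ddC_def sing_def dI_of_0)
 have s0: "sing 0 = 0" by (auto simp: sing_def zero_fun_apply)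
 have si: "sing f [] = f" for f by (simp add: sing_def)
 show "z [] : JZ n" if z: "z : CI.ZZ 0 n"
 proof -
  have "ddC n z [] = 0" using z by (simp add: CI.ZZ_def zero_fun_apply)
  thus ?thesis using z CI_0_D[of z n] by (simp add: JZ_def CI.ZZ_def ddC_def)
 qed
 show "sing f : CI.ZZ 0 n" if "f : JZ n" using that sing[of f n] by (simp add: JZ_def CI.ZZ_def d s0)
 assume "z : CI.ZZ 0 n"
 hence "z : CI 0 n" by (simp add: CI.ZZ_def)
 hence z: "z = sing (z [])" by (rule CI_0_sing)
 show "z : CI.BB 0 n \<longleftrightarrow> z [] : JB n"
 proof (cases n)
  case 0
  thus ?thesis using z s0 by (auto simp: JB_def zero_fun_apply)
 next
  case (Suc m)
  have "z : ddC m ` {x : CI 0 m. delC x = 0} \<longleftrightarrow> z [] : dI m ` JJ m"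
  proof
   assume "z : ddC m ` {x : CI 0 m. delC x = 0}"
   thus "z [] : dI m ` JJ m" using CI_0_D by (auto simp: ddC_def)
  next
   assume "z [] : dI m ` JJ m"
   then obtain f where f: "f : JJ m" "z = sing (dI m f)" using z by (metis imageE)
   thus "z : ddC m ` {x : CI 0 m. delC x = 0}"
    using sing[OF f(1)] by (intro image_eqI[of _ _ "sing f"]) (simp_all add: d)
  qed
  thus ?thesis by (simp add: Suc JB_def)
 qed
qed

lemma BB_ZZ: "x : CI.BB n 0 ==> x : CI.ZZ n 0"
 by (cases n) (auto simp: CI.ZZ_def CI.C_0 CI.del_in CI.del_del CI.del_dd[symmetric])

text \<open>Here the cochains of Dist(G_1) disappear: a linear equivariant surjection Psi from the
  cocycles of invariants, with the boundaries as kernel, determines the cohomology. The action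
  hypothesis has \<open>frob g\<close> because x moves through Frobenius; the untwist absorbs
  it.\<close>

theorem HH_iso:
 fixes N :: "('k, 'w, 'k sl2) gmodule" and Psi :: "'k tef => 'w"
 assumes car: "\<And>u. u : JZ n ==> Psi u : carrier N" and surj: "\<And>y. y : carrier N ==> \<exists>u\<in>JZ n. Psi u = y"
  and ker: "\<And>u v. u : JZ n ==> v : JZ n ==> Psi u = Psi v \<longleftrightarrow> u - v : JB n"
  and add: "\<And>u v. u : JZ n ==> v : JZ n ==> Psi (u + v) = Psi u +[N] Psi v"
  and sm: "\<And>c u. u : JZ n ==> Psi (Rc (sc c) * u) = c *[N] Psi u"
  and act: "\<And>g u. u : JZ n ==> Psi (gI g u) = act N (frob g) (Psi u)"
 shows "frob_untwist (HH n DA) \<cong>\<^sub>G N"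
proof -
 define M where "M = (HC n)\<lparr>carrier := hoch_cocycles DA n\<rparr>"
 define Z where "Z = hoch_cocycles DA n"
 define H where "H = hoch_coboundaries DA n"
 have Mops: "carrier M = Z" "x +[M] y = x +[HC n] y" "c *[M] x = c *[HC n] x"
  "act M g x = act (HC n) g x" for x y c g by (simp_all add: M_def Z_def)
 have ZC: "F : carrier (HC n)" "enc n F : CI.ZZ n 0" if "F : Z" for F
  using that by (simp_all add: Z_def hoch_cocycles_eq)
 have ZI: "F : Z" if F: "F : tuples DA n \<rightarrow>\<^sub>E dist0" "enc n F = f" "f : CI.ZZ n 0" for F f
 proof -
  obtain G where "G : carrier (HC n)" "enc n G = f"
   using enc_surj[of f n] F(3) by (auto simp: CI.ZZ_def)
  thus ?thesis using enc_inject[of G n F] F hoch_cochains_PiE by (auto simp: Z_def hoch_cocycles_eq)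
 qed
 have HC: "H \<subseteq> carrier (HC n)" "enc n ` H = CI.BB n 0"
  by (simp_all add: H_def hoch_coboundaries_eq)
 have HZ: "h : Z" if "h : H" for h using that HC BB_ZZ by (auto simp: Z_def hoch_cocycles_eq)
 have zin: "z : CI.ZZ 0 n" if "CI.zigzag n 0 f z" "f : CI.ZZ n 0" for f z using CI.zigzag_in[OF that] by simp
 have Zdiff: "f - f' : CI.ZZ n 0" if "f : CI.ZZ n 0" "f' : CI.ZZ n 0" for f f'
  using that by (simp add: CI.ZZ_def CI.C_diff CI.del_diff CI.dd_diff)
 \<comment> \<open>The zigzag of a difference connects the two notions of boundary, so classes agree
   at one end exactly when they agree at the other.\<close>
 have core: "Psi (z []) = Psi (z' []) \<longleftrightarrow> f - f' : CI.BB n 0"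
  if "CI.zigzag n 0 f z" "CI.zigzag n 0 f' z'" "f : CI.ZZ n 0" "f' : CI.ZZ n 0" for f f' z z'
 proof -
  have "CI.zigzag n 0 (- f') (- z')"
   using that(2) by (rule CI.zigzag_map[where T = uminus, rotated 3]) (auto simp: CI.C_uminus CI.del_uminus CI.dd_uminus)
  hence d: "CI.zigzag n 0 (f - f') (z - z')" using CI.zigzag_add[OF that(1)] by fastforce
  have "(z - z') [] = z [] - z' []" by (simp add: fun_app)
  thus ?thesis
   using CI.zigzag_BB[OF d Zdiff] ZZ_0(3)[OF zin[OF d Zdiff]] ker[OF ZZ_0(1)[OF zin] ZZ_0(1)[OF zin]] that by simp
 qed
 define R where "R F y \<longleftrightarrow> F : Z & (\<exists>z. CI.zigzag n 0 (enc n F) z & Psi (z []) = y)" for F y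
 have "(quot_gmod M H)\<lparr>act := %g. act (quot_gmod M H) (inv_into UNIV frob g)\<rparr> \<cong>\<^sub>G N"
 proof (rule quot_gmod_iso[where R = R and B = UNIV and \<tau> = "inv_into UNIV frob", OF _ _ _ _ _ _ _ _ _ gmod_iso_on_UNIV])
  show "x : carrier M & y : carrier N" if "R x y" for x y
   using that car ZZ_0(1) zin ZC unfolding R_def Mops by blast
  show "\<exists>y. R x y" if "x : carrier M" for x
   using that CI.zigzag_total ZC(2) unfolding R_def Mops by blast
  show "\<exists>x. R x y" if y: "y : carrier N" for y
  proof -
   obtain u where u: "u : JZ n" "Psi u = y" using surj[OF y] by blast
   hence "sing u : CI.ZZ 0 (n + 0)" using ZZ_0(2) by simp
   then obtain f where f: "f : CI.ZZ n 0" "CI.zigzag n 0 f (sing u)" using CI.zigzag_surj by blast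
   obtain F where "F : carrier (HC n)" "enc n F = f"
    using enc_surj[of f n] f(1) by (auto simp: CI.ZZ_def)
   hence "R F y" using f u by (auto simp: R_def Z_def hoch_cocycles_eq sing_def)
   thus ?thesis by (rule exI[of "%x. R x y"])
  qed
  show "y = y'" if R: "R x y" "R x y'" for x y y'
  proof -
   obtain z z' where z: "CI.zigzag n 0 (enc n x) z" "Psi (z []) = y" "CI.zigzag n 0 (enc n x) z'" "Psi (z' []) = y'"
    and x: "x : Z" using R unfolding R_def by blast
   have "0 : CI.BB n 0"
    by (cases n) (auto intro!: image_eqI[of _ _ 0] simp: CI.C_0)
   thus ?thesis using core[OF z(1,3) ZC(2)[OF x] ZC(2)[OF x]] z by simp
  qed
  show "R (x +[M] x') (y +[N] y')" if R: "R x y" "R x' y'" for x y x' y'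
  proof -
   obtain z z' where z: "CI.zigzag n 0 (enc n x) z" "Psi (z []) = y" "CI.zigzag n 0 (enc n x') z'" "Psi (z' []) = y'"
    and x: "x : Z" "x' : Z" using R unfolding R_def by blast
   have e: "enc n (x +[HC n] x') = enc n x + enc n x'" by (rule enc_linear(1)) (use ZC x in auto)
   have "enc n x + enc n x' : CI.ZZ n 0"
    using ZC(2)[OF x(1)] ZC(2)[OF x(2)] by (simp add: CI.ZZ_def CI.C_add CI.del_add CI.dd_add)
   hence "x +[M] x' : Z" using hoch_add_in[OF ZC(1)[OF x(1)] ZC(1)[OF x(2)]]
    by (simp add: Mops Z_def hoch_cocycles_eq e)
   moreover have "Psi ((z + z') []) = y +[N] y'"
    using add[OF ZZ_0(1)[OF zin] ZZ_0(1)[OF zin], OF z(1) _ z(3)] ZC(2) x z(2,4) by (simp add: plus_fun_apply)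
   ultimately show ?thesis using CI.zigzag_add[OF z(1,3)] unfolding R_def Mops e by blast
  qed
  show "R (c *[M] x) (c *[N] y)" if R: "R x y" for c x y
  proof -
   obtain z where z: "CI.zigzag n 0 (enc n x) z" "Psi (z []) = y" and x: "x : Z" using R unfolding R_def by blast
   have e: "enc n (c *[HC n] x) = cmC c (enc n x)"
    unfolding cmC_def by (rule enc_linear(2)[OF ZC(1) ZC(1)]) (rule x)+
   have 0: "cmC c 0 = 0" by (simp add: cmC_def fun_eq_iff fun_app)
   have "cmC c (enc n x) : CI.ZZ n 0"
    using ZC(2)[OF x] by (simp add: CI.ZZ_def cmC_in delC_cmC ddC_cmC 0)
   hence "c *[M] x : Z" unfolding Mops
    using hoch_cochains_PiE[OF ZC(1)[OF x]] by (intro ZI[OF _ e]) (auto simp: hoch_cochains_simps intro!: dscale_in)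
   moreover have "CI.zigzag n 0 (cmC c (enc n x)) (cmC c z)"
    using z(1) by (rule CI.zigzag_map[rotated 3]) (auto simp: cmC_in delC_cmC ddC_cmC)
   moreover have "Psi (cmC c z []) = c *[N] y"
    using sm[OF ZZ_0(1)[OF zin[OF z(1) ZC(2)[OF x]]]] z(2) by (simp add: cmC_def)
   ultimately show ?thesis unfolding R_def Mops e by blast
  qed
  show "R (act M (inv_into UNIV frob g) x) (act N g y)" if R: "R x y" for g x y
  proof -
   define h where "h = inv_into UNIV frob g"
   have h: "frob h = g" using bij_frob[where 'k = 'k] CHAR p3 by (simp add: h_def bij_is_surj f_inv_into_f)
   obtain z where z: "CI.zigzag n 0 (enc n x) z" "Psi (z []) = y" and x: "x : Z" using R unfolding R_def by blast
   have e: "enc n (act (HC n) h x) = gC h (enc n x)" by (rule enc_act[OF ZC(1)[OF x]])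
   have 0: "gC h 0 = 0" by (simp add: gC_def zero_fun_apply gI_simps fun_eq_iff[of "%as. 0"])
   have "gC h (enc n x) : CI.ZZ n 0"
    using ZC(2)[OF x] by (simp add: CI.ZZ_def gC_in delC_gC ddC_gC 0)
   moreover have "act (HC n) h x : tuples DA n \<rightarrow>\<^sub>E dist0"
   proof -
    have "map (dact (inverse h)) ms : tuples DA n" if "ms : tuples DA n" for ms
     using that by (auto simp: tuples_DA dact_in)
    thus ?thesis
     using hoch_cochains_PiE[OF ZC(1)[OF x]] by (auto simp: hoch_cochains_simps intro!: dact_in)
   qed
   ultimately have "act M h x : Z" unfolding Mops by (intro ZI[OF _ e])
   moreover have "CI.zigzag n 0 (gC h (enc n x)) (gC h z)"
    using z(1) by (rule CI.zigzag_map[rotated 3]) (auto simp: gC_in delC_gC ddC_gC)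
   moreover have "Psi (gC h z []) = act N g y"
    using act[OF ZZ_0(1)[OF zin[OF z(1) ZC(2)[OF x]]], of h] z(2) by (simp add: gC_def h)
   ultimately show ?thesis unfolding R_def Mops e h_def[symmetric] by blast
  qed
  show "H +>\<^bsub>M\<^esub> x = {x'. R x' y}" if R: "R x y" for x y
  proof -
   obtain z where z: "CI.zigzag n 0 (enc n x) z" "Psi (z []) = y" and x: "x : Z" using R unfolding R_def by blast
   have e: "enc n (h +[HC n] x) = enc n h + enc n x" if "h : H" for h
    by (rule enc_linear(1)) (use ZC x HC(1) that in auto)
   have 1: "R (h +[M] x) y" if h: "h : H" for h
   proof -
    have B: "enc n h : CI.BB n 0" using h HC(2) by auto
    hence Z': "enc n h + enc n x : CI.ZZ n 0"
     using ZC(2)[OF x] BB_ZZ[OF B] by (simp add: CI.ZZ_def CI.C_add CI.del_add CI.dd_add)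
    hence hx: "h +[M] x : Z" using hoch_add_in[OF _ ZC(1)[OF x], of h] h HC(1)
     by (auto simp: Mops Z_def hoch_cocycles_eq e[OF h])
    obtain z' where z': "CI.zigzag n 0 (enc n h + enc n x) z'" using CI.zigzag_total[OF Z'] by blast
    have "Psi (z' []) = Psi (z [])" using core[OF z' z(1) Z' ZC(2)[OF x]] B by simp
    thus ?thesis using hx z' z(2) unfolding R_def Mops e[OF h] by blast
   qed
   have 2: "\<exists>h\<in>H. x' = h +[M] x" if R': "R x' y" for x'
   proof -
    obtain z' where z': "CI.zigzag n 0 (enc n x') z'" "Psi (z' []) = y" and x': "x' : Z" using R' unfolding R_def by blast
    hence "enc n x' - enc n x : enc n ` H" using core[OF z'(1) z(1) ZC(2)[OF x'] ZC(2)[OF x]] z HC(2) by simp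
    then obtain h where h: "h : H" "enc n x' = enc n h + enc n x" by (auto simp: diff_eq_eq)
    have "x' = h +[HC n] x"
    proof (rule enc_inject)
     show "x' : tuples DA n \<rightarrow>\<^sub>E dist0" by (rule hoch_cochains_PiE[OF ZC(1)[OF x']])
     have "h : carrier (HC n)" using h(1) HC(1) by blast
     from hoch_cochains_PiE[OF hoch_add_in[OF this ZC(1)[OF x]]]
     show "h +[HC n] x : tuples DA n \<rightarrow>\<^sub>E dist0" .
     show "enc n x' = enc n (h +[HC n] x)" using h(2) e[OF h(1)] by simp
    qed
    thus ?thesis using h by (auto simp: Mops)
   qed
   show ?thesis using 1 2 unfolding a_r_coset_def' by blast
  qed
  show "(h +[M] x) +[M] y = h +[M] (x +[M] y)" for h x y
   by (auto simp: Mops hoch_cochains_simps dadd_def add.assoc restrict_def fun_eq_iff)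
 qed
 thus ?thesis by (simp add: HH_def frob_untwist_def M_def H_def)
qed

end

section \<open>Cohomology of the invariants in terms of binary forms\<close>

definition Smod :: "nat => ('k::alg_closed_field, 'k ^ 2 => 'k, 'k sl2) gmodule"
 where "Smod n = gmod (SP n) (%f h x. f x + h x) (%x. 0) (%c f x. c * f x) (%g f x. f (sl2_mat (inverse g) *v x))"

text \<open>Pairs of forms: a model of the forms of degree n tensored with L(1).\<close>

definition Pmod :: "nat => ('k::alg_closed_field, 'k ^ 2 => 'k ^ 2, 'k sl2) gmodule"
 where "Pmod n = gmod (SP2 n) (%f h x. f x + h x) (%x. 0) (%c f x. c *s f x)
  (%g f x. sl2_mat g *v f (sl2_mat (inverse g) *v x))"

lemma power_gmod_simps:
 "carrier (power_gmod n M) = {..<n} \<rightarrow>\<^sub>E carrier M" "x +[power_gmod n M] y = (\<lambda>i\<in>{..<n}. x i +[M] y i)"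
 "c *[power_gmod n M] x = (\<lambda>i\<in>{..<n}. c *[M] x i)" "act (power_gmod n M) g x = (\<lambda>i\<in>{..<n}. act M g (x i))"
 by (simp_all add: power_gmod_def fun_gmod_def gmod_def)

text \<open>At the origin a form of positive degree vanishes anyway, and a form of degree 0 is
  constant.\<close>

lemma SP_eq_0:
 fixes f :: "'k::alg_closed_field ^ 2 => 'k"
 assumes f: "f : SP n" and 0: "\<And>x. x ~= 0 ==> f x = 0" shows "f x = 0"
proof (cases "x = 0")
 case True
 show ?thesis
 proof (cases n)
  case 0
  hence "f 0 = f (vec2 1 0)" using SP_0_eq f by metis
  moreover have "vec2 1 0 ~= (0 :: 'k ^ 2)" by (metis vec2_nth(1) zero_index zero_neq_one)
  ultimately show ?thesis using assms(2) True by simp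
 next
  case (Suc m)
  thus ?thesis using f True by (auto simp: SP_def power_0_left intro!: sum.neutral)
 qed
qed (rule 0)

context charp
begin

lemma JZ_power_iso:
 fixes M :: "('k, 'w, 'k sl2) gmodule" and P :: "'k tef => nat => 'w"
 assumes "\<And>f i. f : JZ n ==> i < N ==> P f i : carrier M"
  and "\<And>y. (\<And>i. i < N ==> y i : carrier M) ==> \<exists>f\<in>JZ n. \<forall>i<N. P f i = y i"
  and "\<And>f h. f : JZ n ==> h : JZ n ==> (\<forall>i<N. P f i = P h i) \<longleftrightarrow> f - h : JB n"
  and "\<And>f h i. f : JZ n ==> h : JZ n ==> i < N ==> P (f + h) i = P f i +[M] P h i"
  and "\<And>c f i. f : JZ n ==> i < N ==> P (Rc (sc c) * f) i = c *[M] P f i"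
  and "\<And>g f i. f : JZ n ==> i < N ==> P (gI g f) i = act M (frob g) (P f i)"
 shows "frob_untwist (HH n DA) \<cong>\<^sub>G power_gmod N M"
proof (rule HH_iso[where Psi = "%f. \<lambda>i\<in>{..<N}. P f i"])
 show "\<exists>f\<in>JZ n. (\<lambda>i\<in>{..<N}. P f i) = y" if y: "y : carrier (power_gmod N M)" for y
 proof -
  have y': "y : {..<N} \<rightarrow>\<^sub>E carrier M" using y by (simp add: power_gmod_simps)
  then obtain f where f: "f : JZ n" "\<forall>i<N. P f i = y i" using assms(2)[of y] by auto
  have "(\<lambda>i\<in>{..<N}. P f i) = y" using y' f(2) by (auto simp: fun_eq_iff restrict_def PiE_def extensional_def)
  thus ?thesis using f(1) by blast
 qed
 show "(\<lambda>i\<in>{..<N}. P f i) = (\<lambda>i\<in>{..<N}. P h i) \<longleftrightarrow> f - h : JB n" if "f : JZ n" "h : JZ n" for f h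
  unfolding assms(3)[OF that, symmetric] by (auto simp: fun_eq_iff restrict_def)
qed (auto simp: power_gmod_simps assms cong: restrict_cong)

lemma JJ_diff: "f : JJ n ==> h : JJ n ==> f - h : JJ n"
 using Iset_add[OF _ Iset_uminus, of f n h] by (simp add: JJ_def fun_app algebra_simps)

lemma JZ_diff: fixes f h :: "'k tef" shows "f : JZ n ==> h : JZ n ==> f - h : JZ n"
proof -
 have "dI n (f - h) = dI n f - dI n h" by (simp add: dI_def algebra_simps)
 thus "f : JZ n ==> h : JZ n ==> f - h : JZ n" by (simp add: JZ_def JJ_diff)
qed

lemma G_diff:
 fixes f h :: "'k tef"
 shows "G0 (f - h) s x = G0 f s x - G0 h s x" "G3 (f - h) s x = G3 f s x - G3 h s x"
 "GW (f - h) s x = GW f s x - GW h s x"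
 using G_linear(1)[of "f - h" h s x] G_linear(2)[of "f - h" h s x] G_linear(3)[of "f - h" h s x] by simp_all

lemma JJ_SP: assumes "f : JJ n" shows "G0 f s : SP n" "G3 f s : SP n" "GW f s : SP2 n"
 using assms G_SP Iset_hp by (auto simp: JJ_def)

lemma zE_eqI:
 assumes "f : JJ n" "even n" "\<And>s. s < p ==> G0 f s = a s" "\<And>s. 0 < s ==> s < p ==> G3 f s = b s"
 shows "f = zE a b"
proof (rule ext, rule te_pr_eqI)
 fix x s assume s: "s < p"
 have "f x * pr s = zE (G0 f) (G3 f) x * pr s" using JJ_even[OF assms(1,2)] by simp
 also have "... = zE a b x * pr s"
  using assms(3)[OF s] assms(4)[OF _ s] s
  by (cases "s = 0") (simp_all add: zE_pr distrib_right mult.assoc eps_pr_0)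
 finally show "f x * pr s = zE a b x * pr s" .
qed

lemma zO_eqI:
 assumes "f : JJ n" "odd n" "\<And>s. 0 < s ==> s < p ==> GW f s = w s"
 shows "f = zO w"
proof (rule ext, rule te_pr_eqI)
 fix x s assume s: "s < p"
 have "f x * pr s = zO (GW f) x * pr s" using JJ_odd[OF assms(1,2)] by simp
 also have "... = zO w x * pr s"
  using assms(3)[OF _ s] s by (cases "s = 0") (simp_all add: zO_pr D_prp)
 finally show "f x * pr s = zO w x * pr s" .
qed

text \<open>The differential is the scalar difference times the vector x; it can vanish at x nonzero
  only if the difference does, and \<open>SP_eq_0\<close> extends this to the origin.\<close>

lemma JZ_even: assumes f: "f : JJ n" and n: "even n"
 shows "f : JZ n \<longleftrightarrow> (\<forall>s. 0 < s --> s < p --> G0 f s = G0 f (p - s))"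
proof
 define w where "w s x = (G0 f s x - G0 f (p - s) x) *s x" for s x
 have e: "dI n f = zO w" using dI_zE[OF n, of "G0 f" "G3 f"] JJ_even[OF f n] by (simp add: w_def[abs_def])
 show "\<forall>s. 0 < s --> s < p --> G0 f s = G0 f (p - s)" if "f : JZ n"
 proof (intro allI impI ext)
  fix s x assume s: "0 < s" "s < p"
  have "zO w = 0" using that e by (simp add: JZ_def)
  hence w0: "w s x = 0" for x
   using GW_zO[OF s, of w] by (simp add: GW_def fun_eq_iff fun_app c_defs vec2_eqI[of 0 0 0, symmetric])
  have "G0 f s x - G0 f (p - s) x = 0" if "x ~= 0" for x
   using w0[of x] that by (simp add: w_def vec_eq_iff) (metis eq_iff_diff_eq_0)
  hence "G0 f s x - G0 f (p - s) x = 0"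
   using SP_eq_0[OF SP_diff[OF JJ_SP(1)[OF f] JJ_SP(1)[OF f]]] by blast
  thus "G0 f s x = G0 f (p - s) x" by simp
 qed
 show "f : JZ n" if a: "\<forall>s. 0 < s --> s < p --> G0 f s = G0 f (p - s)"
 proof -
  have wz: "w s x = 0" if "0 < s" "s < p" for s x
   using fun_cong[OF a[rule_format, OF that], of x] by (simp add: w_def)
  have "zO w = 0"
  proof (rule ext, rule te_pr_eqI)
   fix x s assume s: "s < p"
   show "zO w x * pr s = 0 x * pr s"
    using s by (cases "s = 0") (simp_all add: zO_pr D_prp wz zero_fun_apply, simp add: D_def)
  qed
  thus ?thesis using e f by (simp add: JZ_def)
 qed
qed

lemma JZ_odd: assumes f: "f : JZ n" and n: "odd n" and s: "0 < s" "s < p"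
 shows "wedge x (GW f s x) = wedge x (GW f (p - s) x)"
proof -
 have "zE (%s x. 0) (%s x. wedge x (GW f s x) - wedge x (GW f (p - s) x)) = 0"
  using f dI_zO[OF n, of "GW f"] JJ_odd[OF _ n, of f] by (simp add: JZ_def)
 thus ?thesis
  using G3_zE[OF s, of "%s x. 0" "%s x. wedge x (GW f s x) - wedge x (GW f (p - s) x)"] s
  by (simp add: G3_def fun_eq_iff fun_app c_defs)
qed

text \<open>By \<open>dI_zO\<close> boundaries are antisymmetric under s <-> p - s. Conversely every
  form of positive degree is det(x, w) for some w, and placing w on one member of each pair realises
  a given antisymmetric family.\<close>

lemma JB_even: assumes f: "f : JJ n" and n: "even n" "n > 0"
 shows "f : JB n \<longleftrightarrow> (\<forall>s. 0 < s --> s < p --> (\<forall>x. G0 f s x = 0 & G3 f s x + G3 f (p - s) x = 0))"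
proof -
 obtain m where m: "n = Suc m" "odd m" using n by (cases n) auto
 show ?thesis
 proof
  assume "f : JB n"
  then obtain h where h: "h : JJ m" "f = dI m h" by (auto simp: JB_def m)
  hence e: "f = zE (%s x. 0) (%s x. wedge x (GW h s x) - wedge x (GW h (p - s) x))"
   using dI_zO[OF m(2), of "GW h"] JJ_odd[OF h(1) m(2)] by simp
  show "\<forall>s. 0 < s --> s < p --> (\<forall>x. G0 f s x = 0 & G3 f s x + G3 f (p - s) x = 0)"
   unfolding e by (simp add: G0_zE G3_zE)
 next
  assume a: "\<forall>s. 0 < s --> s < p --> (\<forall>x. G0 f s x = 0 & G3 f s x + G3 f (p - s) x = 0)"
  have "\<exists>w\<in>SP2 m. \<forall>x. wedge x (w x) = G3 f s x" for s
  proof -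
   obtain u v where uv: "u : SP m" "v : SP m" "G3 f s = (%x. x $ 1 * u x + x $ 2 * v x)"
    using JJ_SP(2)[OF f, of s, unfolded m(1)] by (rule SP_split)
   have "(%x. - v x) : SP m" using SP_cmult[OF uv(2), of "- 1"] by simp
   thus ?thesis using uv
    by (intro bexI[of _ "%x. vec2 (- v x) (u x)"]) (simp_all add: wedge_def SP2_def)
  qed
  then obtain w where w: "\<And>s. w s : SP2 m" "\<And>s x. wedge x (w s x) = G3 f s x" by metis
  define w' where "w' s = (if 2 * s < p then w s else (%x. 0))" for s
  have w': "w' s : SP2 m" for s using w(1) by (auto simp: w'_def SP2_def SP_0)
  have w0: "wedge x 0 = 0" for x by (simp add: wedge_def)
  have "f = zE (%s x. 0) (%s x. wedge x (w' s x) - wedge x (w' (p - s) x))"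
  proof (rule zE_eqI[OF f n(1)])
   show "G0 f s = (%x. 0)" if "s < p" for s
    using a that G0_0[OF f n(2)] by (cases "s = 0") auto
   show "G3 f s = (%x. wedge x (w' s x) - wedge x (w' (p - s) x))" if s: "0 < s" "s < p" for s
   proof
    fix x
    have "G3 f s x + G3 f (p - s) x = 0" using a s by blast
    moreover have "2 * s < p & ~ 2 * (p - s) < p | ~ 2 * s < p & 2 * (p - s) < p"
     using s odd_p by (cases "2 * s = p") auto
    ultimately show "G3 f s x = wedge x (w' s x) - wedge x (w' (p - s) x)"
     by (auto simp: w'_def w w0 eq_neg_iff_add_eq_0)
   qed
  qed
  hence "f = dI m (zO w')" by (simp add: dI_zO[OF m(2)])
  thus "f : JB n" using zO_in_JJ[OF w' m(2)] by (simp add: JB_def m)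
 qed
qed

text \<open>If a closed f takes opposite values at s and p - s, then det(x, w_s) equals its own
  negative and vanishes because p is odd; by the syzygy lemma w_s is a form times x, which is the
  shape of a boundary.\<close>

lemma JB_odd: assumes f: "f : JZ n" and n: "odd n"
 shows "f : JB n \<longleftrightarrow> (\<forall>s. 0 < s --> s < p --> (\<forall>x. GW f s x + GW f (p - s) x = 0))"
proof -
 have fJ: "f : JJ n" using f by (simp add: JZ_def)
 obtain m where m: "n = Suc m" "even m" using n by (cases n) auto
 show ?thesis
 proof
  assume "f : JB n"
  then obtain v where v: "v : JJ m" "f = dI m v" by (auto simp: JB_def m)
  hence e: "f = zO (%s x. (G0 v s x - G0 v (p - s) x) *s x)"
   using dI_zE[OF m(2), of "G0 v" "G3 v"] JJ_even[OF v(1) m(2)] by simp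
  show "\<forall>s. 0 < s --> s < p --> (\<forall>x. GW f s x + GW f (p - s) x = 0)"
   unfolding e by (simp add: GW_zO vec_eq_iff left_diff_distrib)
 next
  assume a: "\<forall>s. 0 < s --> s < p --> (\<forall>x. GW f s x + GW f (p - s) x = 0)"
  have "\<exists>h\<in>SP m. \<forall>x. GW f s x = h x *s x" if s: "0 < s" "s < p" for s
  proof -
   have two: "(2 :: 'k) ~= 0" using of_nat_neq_0[of 2] p3 by simp
   have w: "wedge x (GW f s x) = 0" for x
   proof -
    have "GW f (p - s) x = - GW f s x" using a s by (simp add: eq_neg_iff_add_eq_0 add.commute)
    hence "wedge x (GW f s x) = - wedge x (GW f s x)"
     using JZ_odd[OF f n s, of x] by (simp add: wedge_def)
    hence "2 * wedge x (GW f s x) = 0" by (simp only: mult_2) (metis add.right_inverse)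
    thus ?thesis using two by simp
   qed
   have SP: "(%x. GW f s x $ 2) : SP (Suc m)" "(%x. GW f s x $ 1) : SP (Suc m)"
    using JJ_SP(3)[OF fJ, of s] by (simp_all add: SP2_def m)
   have "x $ 1 * GW f s x $ 2 = x $ 2 * GW f s x $ 1" for x
    using w[of x] by (simp add: wedge_def)
   from SP_syzygy[OF SP this]
   obtain h where "h : SP m" "(%x. GW f s x $ 2) = (%x. x $ 2 * h x)" "(%x. GW f s x $ 1) = (%x. x $ 1 * h x)" .
   thus ?thesis by (intro bexI[of _ h]) (auto simp: fun_eq_iff vec_eq_iff forall_2 mult.commute)
  qed
  then obtain h where h: "\<And>s. 0 < s ==> s < p ==> h s : SP m" "\<And>s x. 0 < s ==> s < p ==> GW f s x = h s x *s x" by metis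
  \<comment> \<open>One member of each pair carries the primitive; s = 0 is left out because
    invariants of positive degree have no scalar on the Steinberg component.\<close>
  define h' where "h' s = (if 0 < s & 2 * s < p then h s else (%x. 0))" for s
  have h': "h' s : SP m" for s using h(1) by (auto simp: h'_def SP_0)
  have "f = zO (%s x. (h' s x - h' (p - s) x) *s x)"
  proof (rule zO_eqI[OF fJ n], rule ext)
   fix s x assume s: "0 < s" "s < p"
   have "GW f s x = - GW f (p - s) x" using a s by (simp add: eq_neg_iff_add_eq_0)
   hence "GW f s x = (- h (p - s) x) *s x"
    using s h(2)[of "p - s" x] by (simp add: vec_eq_iff)
   moreover have "2 * s < p & ~ 2 * (p - s) < p | ~ 2 * s < p & 2 * (p - s) < p"
    using s odd_p by (cases "2 * s = p") auto
   ultimately show "GW f s x = (h' s x - h' (p - s) x) *s x"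
    using s h(2)[of s x] by (auto simp: h'_def)
  qed
  hence "f = dI m (zE h' (%s x. 0))" by (simp add: dI_zE[OF m(2)])
  moreover have "zE h' (%s x. 0) : JJ m" using h' m(2) by (intro zE_in_JJ) (auto simp: SP_0 h'_def)
  ultimately show "f : JB n" by (simp add: JB_def m)
 qed
qed

lemma G_gI:
 assumes f: "f : JJ n"
 shows "even n ==> s < p ==> G0 (gI g f) s = (%x. G0 f s (sl2_mat (inverse (frob g)) *v x))"
  and "even n ==> 0 < s ==> s < p ==> G3 (gI g f) s = (%x. G3 f s (sl2_mat (inverse (frob g)) *v x))"
  and "odd n ==> 0 < s ==> s < p ==> GW (gI g f) s = (%x. sl2_mat (frob g) *v GW f s (sl2_mat (inverse (frob g)) *v x))"
 using gI_zE[of g "G0 f" "G3 f"] gI_zO[of g "GW f"] JJ_even[OF f] JJ_odd[OF f]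
 by (auto simp: G0_zE G3_zE GW_zO frob_inverse)

text \<open>Scalars are symmetric in s <-> p - s, which leaves s = 0, ..., q; the coefficients of
  \<open>eps\<close> at s = 1, ..., p - 1 are free. This makes (q + 1) + 2q trivial
  summands.\<close>

lemma HH_0: "frob_untwist (HH 0 DA) \<cong>\<^sub>G power_gmod ((3 * p - 1) div 2) triv_gmod"
proof -
 define q where "q = (p - 1) div 2"
 have q: "2 * q < p" "p <= Suc (2 * q)" using odd_p by (auto simp: q_def elim!: oddE)
 have N: "(3 * p - 1) div 2 = Suc (q + 2 * q)" using q by linarith
 define P where "P u i = (if i <= q then G0 u i 0 else G3 u (i - q) 0)" for u :: "'k tef" and i
 have J1: "u : JJ 0" if "u : JZ 0" for u using that by (simp add: JZ_def)
 have J2: "G0 u s = G0 u (p - s)" if "u : JZ 0" "s < p" "0 < s" for u s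
  using JZ_even[OF J1[OF that(1)] even_zero] that by blast
 have c: "f x = f 0" if "f : SP 0" for f :: "'k ^ 2 => 'k" and x using SP_0_eq[OF that] by metis
 show ?thesis unfolding N
 proof (rule JZ_power_iso[where P = P])
  show "\<exists>u\<in>JZ 0. \<forall>i<Suc (q + 2 * q). P u i = y i" for y
  proof -
   define a where "a s = (%x :: 'k ^ 2. y (if s <= q then s else p - s))" for s
   define b where "b s = (%x :: 'k ^ 2. y (q + s))" for s
   have J': "zE a b : JJ 0" by (intro zE_in_JJ) (simp_all add: a_def b_def SP_const)
   have "G0 (zE a b) s = G0 (zE a b) (p - s)" if "0 < s" "s < p" for s
    using q that by (simp add: G0_zE) (auto simp: a_def fun_eq_iff)
   hence "zE a b : JZ 0" unfolding JZ_even[OF J' even_zero] by blast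
   moreover have "\<forall>i<Suc (q + 2 * q). P (zE a b) i = y i"
    using q by (auto simp: P_def G0_zE G3_zE a_def b_def)
   ultimately show ?thesis by blast
  qed
  show "(\<forall>i<Suc (q + 2 * q). P u i = P h i) \<longleftrightarrow> u - h : JB 0" if "u : JZ 0" "h : JZ 0" for u h
  proof
   assume a: "\<forall>i<Suc (q + 2 * q). P u i = P h i"
   have Z: "u - h : JZ 0" by (rule JZ_diff[OF that])
   have g0: "G0 (u - h) s 0 = 0" if "s <= q" for s using a[rule_format, of s] that by (simp add: P_def G_diff)
   have g3: "G3 (u - h) s 0 = 0" if "0 < s" "s < p" for s
    using q a[rule_format, of "s + q"] that by (simp add: P_def G_diff)
   have g0': "G0 (u - h) s 0 = 0" if "s < p" for s
    using q g0[of s] g0[of "p - s"] J2[OF Z that] by (cases "s <= q") auto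
   have "u - h = zE (%s x. 0) (%s x. 0)"
   proof (rule zE_eqI[OF J1[OF Z] even_zero]; rule ext)
    show "G0 (u - h) s x = 0" if "s < p" for s x
     using g0'[OF that] c[OF JJ_SP(1)[OF J1[OF Z]]] by metis
    show "G3 (u - h) s x = 0" if "0 < s" "s < p" for s x
     using g3[OF that] c[OF JJ_SP(2)[OF J1[OF Z]]] by metis
   qed
   thus "u - h : JB 0" by (simp add: JB_def zE_def fun_eq_iff fun_app)
  next
   assume "u - h : JB 0"
   thus "\<forall>i<Suc (q + 2 * q). P u i = P h i" by (simp add: JB_def)
  qed
  show "P (gI g u) i = act triv_gmod (frob g) (P u i)" if "u : JZ 0" "i < Suc (q + 2 * q)" for g u i
   using q that G_gI[OF J1[OF that(1)]] by (auto simp: P_def triv_gmod_def gmod_def)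
 qed (auto simp: P_def triv_gmod_def gmod_def G_linear)
qed

text \<open>In positive even degree the Steinberg scalar is absent, and coefficients of
  \<open>eps\<close> count only through sums over pairs {s, p - s}: q scalars and q sums, all of
  them forms of degree n.\<close>

lemma HH_even:
 assumes n: "even n" "n > 0" shows "frob_untwist (HH n DA) \<cong>\<^sub>G power_gmod (p - 1) (Smod n)"
proof -
 define q where "q = (p - 1) div 2"
 have q: "2 * q < p" "p <= Suc (2 * q)" using odd_p by (auto simp: q_def elim!: oddE)
 hence N: "p - 1 = 2 * q" by linarith
 define P where "P f i = (if i < q then G0 f (Suc i)
  else (%x. G3 f (Suc (i - q)) x + G3 f (p - Suc (i - q)) x))" for f :: "'k tef" and i
 have J1: "f : JJ n" if "f : JZ n" for f using that by (simp add: JZ_def)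
 have J2: "G0 f s = G0 f (p - s)" if "f : JZ n" "s < p" "0 < s" for f s
  using JZ_even[OF J1[OF that(1)] n(1)] that by blast
 show ?thesis unfolding N
 proof (rule JZ_power_iso[where P = P])
  show "\<exists>f\<in>JZ n. \<forall>i<2 * q. P f i = y i" if y: "\<And>i. i < 2 * q ==> y i : carrier (Smod n)" for y
  proof -
   \<comment> \<open>Representatives: a is symmetric in s <-> p - s and zero at s = 0, while b is
     supported on s <= q, so that each pair sum is a single value.\<close>
   define a where "a s = (if s = 0 then (%x. 0) else if s <= q then y (s - 1) else y (p - s - 1))" for s
   define b where "b s = (if 0 < s & s <= q then y (q + s - 1) else (%x. 0))" for s
   have y': "y i : SP n" if "i < 2 * q" for i using y[OF that] by (simp add: Smod_def gmod_def)
   have J': "zE a b : JJ n" using q n by (intro zE_in_JJ) (auto simp: a_def b_def SP_0 intro!: y')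
   have "G0 (zE a b) s = G0 (zE a b) (p - s)" if "0 < s" "s < p" for s
    using q that by (simp add: G0_zE) (auto simp: a_def)
   hence "zE a b : JZ n" unfolding JZ_even[OF J' n(1)] by blast
   moreover have "\<forall>i<2 * q. P (zE a b) i = y i"
    using q by (auto simp: P_def G0_zE G3_zE a_def b_def fun_eq_iff)
   ultimately show ?thesis by blast
  qed
  show "(\<forall>i<2 * q. P f i = P h i) \<longleftrightarrow> f - h : JB n" if "f : JZ n" "h : JZ n" for f h
  proof -
   have Z: "f - h : JZ n" by (rule JZ_diff[OF that])
   have "(\<forall>i<2 * q. P f i = P h i) \<longleftrightarrow> (\<forall>s. 0 < s --> s <= q -->
    (\<forall>x. G0 (f - h) s x = 0 & G3 (f - h) s x + G3 (f - h) (p - s) x = 0))"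
   proof (intro iffI allI impI conjI)
    fix s x assume a: "\<forall>i<2 * q. P f i = P h i" and s: "0 < s" "s <= q"
    obtain i where i: "s = Suc i" using s by (cases s) auto
    show "G0 (f - h) s x = 0" using a[rule_format, of i] s by (simp add: P_def G_diff i flip: add_diff_add)
    show "G3 (f - h) s x + G3 (f - h) (p - s) x = 0"
     using fun_cong[OF a[rule_format, of "q + i"], of x] s by (simp add: P_def G_diff i flip: add_diff_add)
   next
    fix i assume a: "\<forall>s. 0 < s --> s <= q --> (\<forall>x. G0 (f - h) s x = 0 & G3 (f - h) s x + G3 (f - h) (p - s) x = 0)"
     and i: "i < 2 * q"
    show "P f i = P h i"
    proof (cases "i < q")
     case True thus ?thesis using a[rule_format, of "Suc i"] by (simp add: P_def G_diff fun_eq_iff)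
    next
     case False thus ?thesis using a[rule_format, of "Suc (i - q)"] i
      by (simp add: P_def G_diff fun_eq_iff flip: add_diff_add)
    qed
   qed
   also have "... \<longleftrightarrow> f - h : JB n"
    unfolding JB_even[OF J1[OF Z] n]
   proof (intro iffI allI impI)
    fix s x assume a: "\<forall>s. 0 < s --> s <= q --> (\<forall>x. G0 (f - h) s x = 0 & G3 (f - h) s x + G3 (f - h) (p - s) x = 0)"
     and s: "0 < s" "s < p"
    show "G0 (f - h) s x = 0 & G3 (f - h) s x + G3 (f - h) (p - s) x = 0"
     using q a[rule_format, of s x] a[rule_format, of "p - s" x] s J2[OF Z s(2,1)]
     by (cases "s <= q") (auto simp: add.commute)
   qed (use q in auto)
   finally show ?thesis .
  qed
  show "P (gI g f) i = act (Smod n) (frob g) (P f i)" if "f : JZ n" "i < 2 * q" for g f i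
   using q that G_gI[OF J1[OF that(1)]] n by (auto simp: P_def Smod_def gmod_def)
 qed (auto simp: P_def Smod_def gmod_def G_linear fun_eq_iff algebra_simps dest!: J1 intro!: SP_add JJ_SP)
qed

text \<open>A class is the family of sums over pairs {s, p - s}. Symmetric families are closed, so
  half of a prescribed sum placed at both members gives a preimage; 2 is invertible.\<close>

lemma HH_odd:
 assumes n: "odd n" shows "frob_untwist (HH n DA) \<cong>\<^sub>G power_gmod ((p - 1) div 2) (Pmod n)"
proof -
 define q where "q = (p - 1) div 2"
 have q: "2 * q < p" "p <= Suc (2 * q)" using odd_p by (auto simp: q_def elim!: oddE)
 define P where "P u i = (%x. GW u (Suc i) x + GW u (p - Suc i) x)" for u :: "'k tef" and i
 have J: "u : JJ n" if "u : JZ n" for u using that by (simp add: JZ_def)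
 have A: "(%x. f x + h x) : SP2 n" if "f : SP2 n" "h : SP2 n" for f h :: "'k ^ 2 => 'k ^ 2"
  using that by (simp add: SP2_def SP_add)
 show ?thesis unfolding q_def[symmetric]
 proof (rule JZ_power_iso[where P = P])
  show "\<exists>u\<in>JZ n. \<forall>i<q. P u i = y i" if y: "\<And>i. i < q ==> y i : carrier (Pmod n)" for y
  proof -
   have "(2 :: 'k) ~= 0" using of_nat_neq_0[of 2] p3 by simp
   hence "2 * inverse 2 = (1 :: 'k)" by (rule right_inverse)
   then obtain h :: 'k where h: "h + h = 1" unfolding mult_2 by (rule that)
   define w where "w s = (if s = 0 then (%x. 0) else (%x. h *s y (if s <= q then s - 1 else p - s - 1) x))" for s
   have y': "y i : SP2 n" if "i < q" for i using y[OF that] by (simp add: Pmod_def gmod_def)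
   have w: "w s : SP2 n" if "s < p" for s
    using q y'[of "if s <= q then s - 1 else p - s - 1"] that by (auto simp: w_def SP2_def SP_0 intro!: SP_cmult)
   have ws: "w (p - s) = w s" if "0 < s" "s < p" for s using q that by (auto simp: w_def fun_eq_iff)
   have "dI n (zO w) = zE (%s x. 0) (%s x. wedge x (w s x) - wedge x (w (p - s) x))" by (rule dI_zO[OF n])
   also have "... = 0"
   proof (rule ext, rule te_pr_eqI)
    fix x s assume "s < p"
    thus "zE (%s x. 0) (%s x. wedge x (w s x) - wedge x (w (p - s) x)) x * pr s = 0 x * pr s"
     using ws[of s] by (cases "s = 0") (simp_all add: zE_pr zero_fun_apply mult.assoc eps_pr_0)
   qed
   finally have "zO w : JZ n" using zO_in_JJ[OF w n] by (simp add: JZ_def)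
   moreover have "P (zO w) i = y i" if "i < q" for i
   proof -
    have "P (zO w) i = (%x. w (Suc i) x + w (Suc i) x)" using q that ws[of "Suc i"] by (simp add: P_def GW_zO)
    also have "... = y i" using that h by (simp add: w_def fun_eq_iff vec_eq_iff flip: distrib_right)
    finally show ?thesis .
   qed
   ultimately show ?thesis by blast
  qed
  show "(\<forall>i<q. P u i = P v i) \<longleftrightarrow> u - v : JB n" if "u : JZ n" "v : JZ n" for u v
   unfolding JB_odd[OF JZ_diff[OF that] n]
  proof (intro iffI allI impI)
   fix s x assume a: "\<forall>i<q. P u i = P v i" and s: "0 < s" "s < p"
   have *: "GW (u - v) (Suc i) x + GW (u - v) (p - Suc i) x = 0" if "i < q" for i
    using fun_cong[OF a[rule_format, OF that], of x] by (simp add: P_def G_diff flip: add_diff_add)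
   obtain i where "i < q" "s = Suc i | p - s = Suc i & p - Suc i = s"
    using s q that[of "s - 1"] that[of "p - s - 1"] by (cases "s <= q") auto
   thus "GW (u - v) s x + GW (u - v) (p - s) x = 0" using *[of i] by (auto simp: add.commute)
  next
   fix i assume a: "\<forall>s. 0 < s --> s < p --> (\<forall>x. GW (u - v) s x + GW (u - v) (p - s) x = 0)" and i: "i < q"
   show "P u i = P v i"
    using q a[rule_format, of "Suc i"] i by (simp add: P_def G_diff fun_eq_iff flip: add_diff_add)
  qed
  show "P (gI g u) i = act (Pmod n) (frob g) (P u i)" if "u : JZ n" "i < q" for g u i
   using q that G_gI(3)[OF J[OF that(1)] n]
   by (simp add: P_def Pmod_def gmod_def matrix_vector_right_distrib)
 qed (auto simp: P_def Pmod_def gmod_def G_linear fun_eq_iff vec_eq_iff algebra_simps dest!: J intro!: A JJ_SP)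
qed

end

section \<open>Quotients of free modules\<close>

definition fadd where "fadd S f h = (\<lambda>x\<in>S. f x + h x :: 'k::comm_ring_1)"
definition fsm where "fsm S c f = (\<lambda>x\<in>S. c * f x :: 'k::comm_ring_1)"
definition fsub where "fsub S f h = (\<lambda>x\<in>S. f x - h x :: 'k::comm_ring_1)"

definition lin_closed :: "'x set => ('x => 'k::comm_ring_1) set => bool"
 where "lin_closed S H \<longleftrightarrow> (\<forall>f\<in>H. \<forall>h\<in>H. fadd S f h : H) & (\<forall>c. \<forall>f\<in>H. fsm S c f : H) & (\<lambda>x\<in>S. 0) : H"

definition cong_mod :: "('x => 'k::comm_ring_1) set => 'x set => ('x => 'k) => ('x => 'k) => bool"
 where "cong_mod H S f h \<longleftrightarrow> fsub S f h : H"

lemma cong_mod_props: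
 assumes H: "lin_closed S H"
 shows cong_mod_refl: "cong_mod H S f f"
  and cong_mod_sym: "cong_mod H S f h ==> cong_mod H S h f"
  and cong_mod_trans: "cong_mod H S f h ==> cong_mod H S h k ==> cong_mod H S f k"
  and cong_mod_add: "cong_mod H S f f' ==> cong_mod H S h h' ==> cong_mod H S (fadd S f h) (fadd S f' h')"
  and cong_mod_sm: "cong_mod H S f h ==> cong_mod H S (fsm S c f) (fsm S c h)"
proof -
 have e: "fsub S f f = (\<lambda>x\<in>S. 0)" "fsub S h f = fsm S (- 1) (fsub S f h)" "fsub S f k = fadd S (fsub S f h) (fsub S h k)"
  "fsub S (fadd S f h) (fadd S f' h') = fadd S (fsub S f f') (fsub S h h')" "fsub S (fsm S c f) (fsm S c h) = fsm S c (fsub S f h)"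
  for f f' h h' k c by (auto simp: fsub_def fadd_def fsm_def fun_eq_iff algebra_simps)
 show "cong_mod H S f f" using H by (simp add: cong_mod_def e(1) lin_closed_def)
 show "cong_mod H S h f" if "cong_mod H S f h"
  using H that unfolding cong_mod_def lin_closed_def e(2)[of h f] by blast
 show "cong_mod H S f k" if "cong_mod H S f h" "cong_mod H S h k"
  using H that unfolding cong_mod_def lin_closed_def e(3)[of f k h] by blast
 show "cong_mod H S (fadd S f h) (fadd S f' h')" if "cong_mod H S f f'" "cong_mod H S h h'"
  using H that unfolding cong_mod_def lin_closed_def e(4) by blast
 show "cong_mod H S (fsm S c f) (fsm S c h)" if "cong_mod H S f h"
  using H that unfolding cong_mod_def lin_closed_def e(5) by blast
qed

lemma free_gmod_simps:
 "carrier (free_gmod S \<alpha>) = {f : S \<rightarrow>\<^sub>E UNIV. finite {x : S. f x ~= 0}}" "f +[free_gmod S \<alpha>] h = fadd S f h"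
 "c *[free_gmod S \<alpha>] f = fsm S c f" "\<zero>\<^bsub>free_gmod S \<alpha>\<^esub> = (\<lambda>x\<in>S. 0)"
 "act (free_gmod S \<alpha>) g f = (\<lambda>y\<in>S. \<Sum>x | x : S & f x ~= 0 & \<alpha> g x = y. f x)"
 by (simp_all add: free_gmod_def fun_gmod_def gmod_def triv_gmod_def fadd_def fsm_def)

lemma free_gmod_in:
 "free_gen S x : carrier (free_gmod S \<alpha>)" "(\<lambda>x\<in>S. 0) : carrier (free_gmod S \<alpha>)"
 "f : carrier (free_gmod S \<alpha>) ==> h : carrier (free_gmod S \<alpha>) ==> fadd S f h : carrier (free_gmod S \<alpha>)"
 "f : carrier (free_gmod S \<alpha>) ==> h : carrier (free_gmod S \<alpha>) ==> fsub S f h : carrier (free_gmod S \<alpha>)"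
 "f : carrier (free_gmod S \<alpha>) ==> fsm S c f : carrier (free_gmod S \<alpha>)"
proof -
 assume f: "f : carrier (free_gmod S \<alpha>)"
 hence ff: "finite {x : S. f x ~= 0}" by (simp add: free_gmod_simps)
 show "fsm S c f : carrier (free_gmod S \<alpha>)"
  unfolding free_gmod_simps by (auto simp: fsm_def intro: finite_subset[OF _ ff])
 assume h: "h : carrier (free_gmod S \<alpha>)"
 hence fin: "finite ({x : S. f x ~= 0} \<union> {x : S. h x ~= 0})" using ff by (simp add: free_gmod_simps)
 thus "fadd S f h : carrier (free_gmod S \<alpha>)" "fsub S f h : carrier (free_gmod S \<alpha>)"
  unfolding free_gmod_simps by (auto simp: fadd_def fsub_def intro: finite_subset[OF _ fin])
next
 have "{y : S. free_gen S x y ~= 0} \<subseteq> {x}" by (auto simp: free_gen_def)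
 thus "free_gen S x : carrier (free_gmod S \<alpha>)"
  unfolding free_gmod_simps by (auto simp: free_gen_def intro: finite_subset)
qed (simp add: free_gmod_simps)

lemma free_gmod_minus:
 assumes "h : carrier (free_gmod S \<alpha>)"
 shows "\<ominus>\<^bsub>free_gmod S \<alpha>\<^esub> h = fsm S (- 1) h" "f \<ominus>\<^bsub>free_gmod S \<alpha>\<^esub> h = fsub S f h"
proof -
 have "k = fsm S (- 1) h" if "k : carrier (free_gmod S \<alpha>)" "fadd S h k = (\<lambda>x\<in>S. 0)" for k
 proof
  fix x show "k x = fsm S (- 1) h x"
   using that(1) fun_cong[OF that(2), of x]
   by (cases "x : S") (auto simp: free_gmod_simps fadd_def fsm_def eq_neg_iff_add_eq_0 add.commute)
 qed
 moreover have "fadd S h (fsm S (- 1) h) = (\<lambda>x\<in>S. 0)" "fadd S (fsm S (- 1) h) h = (\<lambda>x\<in>S. 0)"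
  by (auto simp: fadd_def fsm_def)
 ultimately show *: "\<ominus>\<^bsub>free_gmod S \<alpha>\<^esub> h = fsm S (- 1) h"
  unfolding a_inv_def m_inv_def using free_gmod_in(5)[OF assms]
  by (intro the_equality) (auto simp: free_gmod_simps(2,4))
 show "f \<ominus>\<^bsub>free_gmod S \<alpha>\<^esub> h = fsub S f h"
  unfolding a_minus_def * free_gmod_simps by (auto simp: fadd_def fsm_def fsub_def)
qed

text \<open>Recognises a quotient of a free module as a known W: q evaluates generators and T is a
  section of the evaluation. The congruences are required for every linear H containing R, which
  avoids describing the elements of the generated submodule.\<close>

locale free_quotient =
 fixes S :: "'x set" and d :: "'g => 'x => 'x" and B :: "'g set" and R :: "('x => 'k::field) set"
  and W :: "'w::ab_group_add set" and sm :: "'k => 'w => 'w" and rh :: "'g => 'w => 'w"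
  and q :: "'x => 'w" and T :: "'w => 'x => 'k"
 assumes W_0: "0 : W" and W_add: "y : W ==> z : W ==> y + z : W" and W_sm: "y : W ==> sm c y : W"
  and sm_add_left: "sm (a + b) y = sm a y + sm b y" and sm_add: "sm a (y + z) = sm a y + sm a z"
  and sm_sm: "sm a (sm b y) = sm (a * b) y" and sm_1: "sm 1 y = y"
  and rh_add: "g : B ==> rh g (y + z) = rh g y + rh g z" and rh_sm: "g : B ==> rh g (sm c y) = sm c (rh g y)"
  and d_in: "g : B ==> x : S ==> d g x : S" and q_d: "g : B ==> x : S ==> q (d g x) = rh g (q x)"
  and q_in: "x : S ==> q x : W"
  and T_in: "y : W ==> T y : carrier (free_gmod S d)"
  and R_in: "r : R ==> r : carrier (free_gmod S d)"
  and T_gen: "lin_closed S H ==> R \<subseteq> H ==> x : S ==> cong_mod H S (free_gen S x) (T (q x))"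
  and T_add: "lin_closed S H ==> R \<subseteq> H ==> y : W ==> z : W ==> cong_mod H S (fadd S (T y) (T z)) (T (y + z))"
  and T_sm: "lin_closed S H ==> R \<subseteq> H ==> y : W ==> cong_mod H S (fsm S c (T y)) (T (sm c y))"
begin

abbreviation FS :: "('x => 'k) set" where "FS \<equiv> carrier (free_gmod S d)"

definition L :: "('x => 'k) => 'w" where "L f = (\<Sum>x | x : S & f x ~= 0. sm (f x) (q x))"

lemma sm_0 [simp]: "sm 0 y = 0" "sm c 0 = 0"
 using sm_add_left[of 0 0 y] sm_add[of c 0 0] by simp_all

lemma L_eq: "finite A ==> A \<subseteq> S ==> (\<And>x. x : S ==> x \<notin> A ==> f x = 0) ==> L f = (\<Sum>x\<in>A. sm (f x) (q x))"
 unfolding L_def by (intro sum.mono_neutral_left) auto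

lemma L_gen: "x : S ==> L (free_gen S x) = q x"
 by (subst L_eq[of "{x}"]) (auto simp: free_gen_def sm_1)

lemma L_fadd:
 assumes "f : FS" "h : FS"
 shows "L (fadd S f h) = L f + L h"
proof -
 define A where "A = {x : S. f x ~= 0} \<union> {x : S. h x ~= 0}"
 have A: "finite A" "A \<subseteq> S" using assms by (auto simp: A_def free_gmod_simps)
 have e: "L k = (\<Sum>x\<in>A. sm (k x) (q x))" if "k : {f, h, fadd S f h}" for k
  using that by (intro L_eq A) (auto simp: A_def fadd_def)
 have "sm (fadd S f h x) (q x) = sm (f x) (q x) + sm (h x) (q x)" if "x : A" for x
  using that A by (auto simp: fadd_def sm_add_left)
 thus ?thesis by (simp add: e sum.distrib)
qed

lemma L_fsm: "f : FS ==> L (fsm S c f) = sm c (L f)"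
proof -
 assume f: "f : FS"
 have s: "sm c (\<Sum>x\<in>A. u x) = (\<Sum>x\<in>A. sm c (u x))" if "finite A" for A and u :: "'x => 'w"
  using that by (induction A rule: finite_induct) (auto simp: sm_add)
 have "L (fsm S c f) = (\<Sum>x | x : S & f x ~= 0. sm (fsm S c f x) (q x))"
  using f by (intro L_eq) (auto simp: free_gmod_simps fsm_def)
 also have "... = sm c (L f)"
  using f unfolding L_def by (subst s) (auto simp: free_gmod_simps fsm_def sm_sm intro!: sum.cong)
 finally show ?thesis .
qed

lemma L_fsub: "f : FS ==> h : FS ==> L (fsub S f h) = L f - L h"
proof -
 assume *: "f : FS" "h : FS"
 have "fadd S (fsub S f h) h = f"
  using *(1) by (auto simp: fadd_def fsub_def free_gmod_simps fun_eq_iff restrict_def PiE_def extensional_def)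
 thus ?thesis using L_fadd[OF free_gmod_in(4)[OF *] *(2)] by simp
qed

lemma L_in: "L f : W"
proof -
 have "(\<Sum>x\<in>A. sm (f x) (q x)) : W" if "A \<subseteq> S" for A
  using that by (induction A rule: infinite_finite_induct) (auto intro: W_0 W_add W_sm q_in)
 thus ?thesis unfolding L_def by auto
qed

lemma L_act:
 assumes f: "f : FS" and g: "g : B" shows "L (act (free_gmod S d) g f) = rh g (L f)"
  "act (free_gmod S d) g f : FS"
proof -
 define A where "A = {x : S. f x ~= 0}"
 have A: "finite A" "A \<subseteq> S" using f by (auto simp: A_def free_gmod_simps)
 have AS: "d g ` A \<subseteq> S" using d_in[OF g] A by auto
 have e: "act (free_gmod S d) g f y = (\<Sum>x\<in>{x \<in> A. d g x = y}. f x)" if "y : S" for y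
  using that by (auto simp: free_gmod_simps A_def intro!: sum.cong)
 have 0: "act (free_gmod S d) g f y = 0" if "y : S" "y \<notin> d g ` A" for y
  unfolding e[OF that(1)] using that(2) by (intro sum.neutral) auto
 have s: "sm (\<Sum>x\<in>C. f x) y = (\<Sum>x\<in>C. sm (f x) y)" if "finite C" for C y
  using that by (induction C rule: finite_induct) (auto simp: sm_add_left)
 have r: "rh g (\<Sum>x\<in>C. u x) = (\<Sum>x\<in>C. rh g (u x))" for C and u :: "'x => 'w"
  using rh_sm[OF g, of 0 0] by (induction C rule: infinite_finite_induct) (auto simp: rh_add[OF g])
 have "L (act (free_gmod S d) g f) = (\<Sum>y\<in>d g ` A. sm (act (free_gmod S d) g f y) (q y))"
  using A AS 0 by (intro L_eq) auto
 also have "... = (\<Sum>y\<in>d g ` A. \<Sum>x\<in>{x \<in> A. d g x = y}. sm (f x) (q (d g x)))"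
  using AS A by (intro sum.cong refl) (auto simp: e s)
 also have "... = (\<Sum>x\<in>A. sm (f x) (q (d g x)))" by (rule sum.image_gen[OF A(1), symmetric])
 also have "... = (\<Sum>x\<in>A. rh g (sm (f x) (q x)))"
  using A q_d[OF g] by (intro sum.cong) (auto simp: rh_sm[OF g])
 also have "... = rh g (L f)" by (simp add: L_def A_def r)
 finally show "L (act (free_gmod S d) g f) = rh g (L f)" .
 have "finite {y : S. act (free_gmod S d) g f y ~= 0}" by (rule finite_subset[OF _ finite_imageI[OF A(1), of "d g"]]) (use 0 in auto)
 thus "act (free_gmod S d) g f : FS" by (simp add: free_gmod_simps)
qed

text \<open>Generator by generator, each f is congruent to T of its value; so anything of value 0
  already lies in H.\<close>

lemma cong_T:
 assumes H: "lin_closed S H" "R \<subseteq> H" and f: "f : FS"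
 shows "cong_mod H S f (T (L f))"
proof -
 have z: "cong_mod H S (\<lambda>x\<in>S. 0) (T 0)"
 proof -
  have "fsm S 0 (T 0) = (\<lambda>x\<in>S. 0)" by (simp add: fsm_def)
  thus ?thesis using T_sm[OF H W_0, of 0] by simp
 qed
 have "cong_mod H S f (T (\<Sum>x\<in>A. sm (f x) (q x)))"
  if "finite A" "A \<subseteq> S" "f : S \<rightarrow>\<^sub>E UNIV" "\<And>x. x : S ==> x \<notin> A ==> f x = 0" for A f
  using that
 proof (induction A arbitrary: f rule: finite_induct)
  case empty
  hence "f = (\<lambda>x\<in>S. 0)" by (auto simp: fun_eq_iff restrict_def PiE_def extensional_def)
  thus ?case using z by (simp only: sum.empty)
 next
  case (insert x A)
  define f' where "f' = (\<lambda>y\<in>S. if y = x then 0 else f y)"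
  have x: "x : S" using insert by simp
  have "cong_mod H S f' (T (\<Sum>y\<in>A. sm (f' y) (q y)))"
   using insert by (intro insert.IH) (auto simp: f'_def)
  moreover have "(\<Sum>y\<in>A. sm (f' y) (q y)) = (\<Sum>y\<in>A. sm (f y) (q y))"
   using insert by (intro sum.cong) (auto simp: f'_def)
  ultimately have 1: "cong_mod H S f' (T (\<Sum>y\<in>A. sm (f y) (q y)))" by simp
  have 2: "cong_mod H S (fsm S (f x) (free_gen S x)) (T (sm (f x) (q x)))"
   by (rule cong_mod_trans[OF H(1) cong_mod_sm[OF H(1) T_gen[OF H x]] T_sm[OF H q_in[OF x]]])
  have W: "(\<Sum>y\<in>A. sm (f y) (q y)) : W"
   using insert(1,4) by (induction A rule: finite_induct) (auto intro: W_0 W_add W_sm q_in)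
  have "f = fadd S (fsm S (f x) (free_gen S x)) f'"
   using insert.prems(2) by (auto simp: fadd_def fsm_def free_gen_def f'_def fun_eq_iff restrict_def PiE_def extensional_def)
  hence "cong_mod H S f (T (sm (f x) (q x) + (\<Sum>y\<in>A. sm (f y) (q y))))"
   using cong_mod_trans[OF H(1) cong_mod_add[OF H(1) 2 1] T_add[OF H W_sm[OF q_in[OF x]] W]] by simp
  thus ?case using insert by simp
 qed
 from this[of "{x : S. f x ~= 0}" f] show ?thesis unfolding L_def using f by (simp add: free_gmod_simps)
qed

text \<open>The zero is tracked separately: \<open>gmod_iso_on\<close> does not mention it, and the
  finite sums in the induced module depend on it.\<close>

theorem quotient:
 assumes R: "\<And>r. r : R ==> L r = 0" and T: "\<And>y. y : W ==> L (T y) = y"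
 defines "Q \<equiv> quot_gmod (free_gmod S d) (submod_gen (free_gmod S d) R)"
 obtains j where "gmod_iso_on B Q (gmod W (+) 0 sm rh) j" "\<zero>\<^bsub>Q\<^esub> : carrier Q" "j \<zero>\<^bsub>Q\<^esub> = 0"
proof -
 define F :: "('k, 'x => 'k, 'g) gmodule" where "F = free_gmod S d"
 define H where "H = submod_gen F R"
 define K where "K = {f : carrier F. L f = 0}"
 have F: "free_gen S x : carrier F" "(\<lambda>x\<in>S. 0) : carrier F" "f : carrier F ==> h : carrier F ==> fadd S f h : carrier F"
  "f : carrier F ==> h : carrier F ==> fsub S f h : carrier F" "f : carrier F ==> fsm S c f : carrier F"
  "f +[F] h = fadd S f h" "c *[F] f = fsm S c f" "\<zero>\<^bsub>F\<^esub> = (\<lambda>x\<in>S. 0)" for x f h c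
  unfolding F_def by (rule free_gmod_in free_gmod_simps; assumption?)+
 note LF = L_fadd[folded F_def] L_fsm[folded F_def]
 have minus: "h : carrier F ==> \<ominus>\<^bsub>F\<^esub> h = fsm S (- 1) h" for h unfolding F_def by (rule free_gmod_minus)
 have "L (\<lambda>x\<in>S. 0) = 0" by (simp add: L_def)
 hence "submodule K (ring_of_type_algebra :: 'k ring) F"
  by unfold_locales (auto simp: K_def F LF minus[unfolded a_inv_def F(8)])
 hence HK: "H \<subseteq> K" unfolding H_def submod_gen_def
  using R R_in by (intro hull_minimal) (auto simp: K_def F_def)
 have lc: "lin_closed S H"
  unfolding lin_closed_def H_def submod_gen_def hull_def
  using submodule.smult_closed[where M = F and R = ring_of_type_algebra]
   subgroup.m_closed[where G = "add_monoid F"] subgroup.one_closed[where G = "add_monoid F"]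
  by (auto simp: submodule_def F(6-8) ring_of_type_algebra_def)
 have RH: "R \<subseteq> H" unfolding H_def submod_gen_def by (rule hull_subset)
 have cT: "cong_mod H S f (T (L f))" if "f : carrier F" for f using cong_T[OF lc RH] that by (simp add: F_def)
 have cos: "H +>\<^bsub>F\<^esub> f = {f' : carrier F. L f' = L f}" if f: "f : carrier F" for f
 proof
  show "H +>\<^bsub>F\<^esub> f \<subseteq> {f' : carrier F. L f' = L f}"
   using HK f F(3) by (auto simp: a_r_coset_def' F(6) K_def L_fadd[folded F_def])
  show "{f' : carrier F. L f' = L f} \<subseteq> H +>\<^bsub>F\<^esub> f"
  proof
   fix f' assume "f' : {f' : carrier F. L f' = L f}"
   hence f': "f' : carrier F" "L f' = L f" by auto
   hence "fsub S f' f : H"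
    using cong_mod_trans[OF lc cT[OF f'(1)] cong_mod_sym[OF lc]] cT[OF f] by (simp add: cong_mod_def)
   moreover have "f' = fadd S (fsub S f' f) f"
    using f'(1) by (auto simp: fadd_def fsub_def F_def free_gmod_simps fun_eq_iff restrict_def PiE_def extensional_def)
   ultimately show "f' : H +>\<^bsub>F\<^esub> f" unfolding a_r_coset_def' F(6) by blast
  qed
 qed
 define N where "N = (gmod W (+) 0 sm rh :: ('k, 'w, 'g) gmodule)"
 have N: "carrier N = W" "x +[N] y = x + y" "c *[N] x = sm c x" "act N g x = rh g x" for x y c g
  by (simp_all add: N_def gmod_def)
 obtain j where j: "gmod_iso_on B ((quot_gmod F H)\<lparr>act := %g. act (quot_gmod F H) g\<rparr>) N j"
  "\<And>y. y : carrier N ==> j {f. f : carrier F & L f = y} = y"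
 proof (rule quot_gmod_iso[where R = "%f y. f : carrier F & L f = y" and M = F and N = N and \<tau> = "%g. g" and B = B and H = H])
  show "(h +[F] f) +[F] f' = h +[F] (f +[F] f')" for h f f'
   by (auto simp: F(6) fadd_def add.assoc)
 qed (use T T_in cos in \<open>auto simp: N F F_def[symmetric] L_in L_fadd[folded F_def] L_fsm[folded F_def] L_act[folded F_def]\<close>)
 have QF: "(quot_gmod F H)\<lparr>act := %g. act (quot_gmod F H) g\<rparr> = Q"
  by (simp add: Q_def F_def H_def quot_gmod_def gmod_def)
 have "H = {f : carrier F. L f = 0}"
 proof
  show "H \<subseteq> {f : carrier F. L f = 0}" using HK by (simp add: K_def)
  have "H +>\<^bsub>F\<^esub> (\<lambda>x\<in>S. 0) \<subseteq> H"
   using lc by (auto simp: a_r_coset_def' F(6) lin_closed_def)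
  thus "{f : carrier F. L f = 0} \<subseteq> H" using cos[OF F(2)] \<open>L (\<lambda>x\<in>S. 0) = 0\<close> by simp
 qed
 hence j0: "j H = 0" using j(2)[of 0] W_0 by (simp add: N)
 have "H = H +>\<^bsub>F\<^esub> (\<lambda>x\<in>S. 0)" using cos[OF F(2)] \<open>L (\<lambda>x\<in>S. 0) = 0\<close> \<open>H = {f : carrier F. L f = 0}\<close> by simp
 hence "H : carrier Q" using F(2) by (auto simp: Q_def quot_gmod_def gmod_def A_RCOSETS_def' F_def[symmetric] H_def[symmetric])
 moreover have "\<zero>\<^bsub>Q\<^esub> = H" by (simp add: Q_def quot_gmod_def gmod_def H_def F_def)
 ultimately show ?thesis using that j(1)[unfolded QF N_def] j0 by simp
qed

end

section \<open>Tensor products and symmetric powers\<close>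

text \<open>A common shape for the Borel modules below, all of which turn out to be
  one-dimensional.\<close>

definition line :: "('g => 'k::field) => ('k, 'k, 'g) gmodule"
 where "line u = gmod UNIV (+) 0 (*) (%g x. u g * x)"

lemma line_simps: "carrier (line u) = UNIV" "x +[line u] y = x + y" "c *[line u] x = c * x" "act (line u) g x = u g * x"
 "\<zero>\<^bsub>line u\<^esub> = 0"
 by (simp_all add: line_def gmod_def)

lemma gmod_iso_on_D:
 assumes "gmod_iso_on B M N j"
 shows "x : carrier M ==> j x : carrier N" "x : carrier M ==> y : carrier M ==> x +[M] y : carrier M"
  "x : carrier M ==> y : carrier M ==> j (x +[M] y) = j x +[N] j y"
  "x : carrier M ==> c *[M] x : carrier M" "x : carrier M ==> j (c *[M] x) = c *[N] j x"
  "g : B ==> x : carrier M ==> act M g x : carrier M" "g : B ==> x : carrier M ==> j (act M g x) = act N g (j x)"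
  "x : carrier M ==> y : carrier M ==> j x = j y ==> x = y"
  "z : carrier N ==> \<exists>x\<in>carrier M. j x = z"
proof -
 have "j ` carrier M = carrier N" using assms by (simp add: gmod_iso_on_def bij_betw_def)
 thus "z : carrier N ==> \<exists>x\<in>carrier M. j x = z" by (metis imageE)
qed (use assms in \<open>auto simp: gmod_iso_on_def bij_betw_def inj_on_def\<close>)

definition trel :: "('k::comm_ring_1, 'v, 'g) gmodule => ('k, 'w, 'g) gmodule => ('v \<times> 'w => 'k) set"
 where "trel M N = (let S = carrier M \<times> carrier N; e = (%v w. free_gen S (v, w)) in
  {fsub S (e (v +[M] v') w) (fadd S (e v w) (e v' w)) | v v' w. v : carrier M & v' : carrier M & w : carrier N} \<union>
  {fsub S (e v (w +[N] w')) (fadd S (e v w) (e v w')) | v w w'. v : carrier M & w : carrier N & w' : carrier N} \<union>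
  {fsub S (e (c *[M] v) w) (fsm S c (e v w)) | c v w. v : carrier M & w : carrier N} \<union>
  {fsub S (e v (c *[N] w)) (fsm S c (e v w)) | c v w. v : carrier M & w : carrier N})"

lemma tensor_gmod_eq:
 "tensor_gmod M N = (let F = free_gmod (carrier M \<times> carrier N) (%g (v, w). (act M g v, act N g w))
  in quot_gmod F (submod_gen F (trel M N)))"
 unfolding tensor_gmod_def trel_def Let_def
 by (simp add: free_gmod_minus free_gmod_in free_gmod_simps(2,3))

lemma trel_in: "r : trel M N ==> r : carrier (free_gmod (carrier M \<times> carrier N) \<alpha>)"
 unfolding trel_def Let_def by (auto intro!: free_gmod_in)

lemma trel_cong:
 assumes "trel M N \<subseteq> H" and "S = carrier M \<times> carrier N"
 shows "v : carrier M ==> v' : carrier M ==> w : carrier N ==>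
   cong_mod H S (free_gen S (v +[M] v', w)) (fadd S (free_gen S (v, w)) (free_gen S (v', w)))"
  and "v : carrier M ==> w : carrier N ==> w' : carrier N ==>
   cong_mod H S (free_gen S (v, w +[N] w')) (fadd S (free_gen S (v, w)) (free_gen S (v, w')))"
  and "v : carrier M ==> w : carrier N ==> cong_mod H S (free_gen S (c *[M] v, w)) (fsm S c (free_gen S (v, w)))"
  and "v : carrier M ==> w : carrier N ==> cong_mod H S (free_gen S (v, c *[N] w)) (fsm S c (free_gen S (v, w)))"
 unfolding cong_mod_def assms(2) by (rule subsetD[OF assms(1)], unfold trel_def Let_def, blast)+

lemma trel_cases:
 assumes "r : trel M N" and "S = carrier M \<times> carrier N"
 obtains v v' w where "r = fsub S (free_gen S (v +[M] v', w)) (fadd S (free_gen S (v, w)) (free_gen S (v', w)))"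
   "v : carrier M" "v' : carrier M" "w : carrier N"
  | v w w' where "r = fsub S (free_gen S (v, w +[N] w')) (fadd S (free_gen S (v, w)) (free_gen S (v, w')))"
   "v : carrier M" "w : carrier N" "w' : carrier N"
  | c v w where "r = fsub S (free_gen S (c *[M] v, w)) (fsm S c (free_gen S (v, w)))" "v : carrier M" "w : carrier N"
  | c v w where "r = fsub S (free_gen S (v, c *[N] w)) (fsm S c (free_gen S (v, w)))" "v : carrier M" "w : carrier N"
 using assms(1) unfolding trel_def Let_def assms(2)[symmetric] by blast

text \<open>With i v0 = 1 every v (x) w is congruent to v0 (x) i(v) w, so one scalar parameter
  remains.\<close>

lemma tensor_line:
 fixes M :: "('k::field, 'v, 'g) gmodule"
 assumes i: "gmod_iso_on B M (line u) i"
 obtains j where "gmod_iso_on B (tensor_gmod M (line u')) (line (%g. u g * u' g)) j"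
  "\<zero>\<^bsub>tensor_gmod M (line u')\<^esub> : carrier (tensor_gmod M (line u'))" "j \<zero>\<^bsub>tensor_gmod M (line u')\<^esub> = 0"
proof -
 note D = gmod_iso_on_D[OF i, unfolded line_simps]
 obtain v0 where v0: "v0 : carrier M" "i v0 = 1" using D(9) by blast
 define S where "S = carrier M \<times> carrier (line u' :: ('k, 'k, 'g) gmodule)"
 have S: "S = carrier M \<times> UNIV" by (simp add: S_def line_simps)
 interpret free_quotient S "%g (v, w). (act M g v, act (line u') g w)" B "trel M (line u')" UNIV "(*)"
  "%g x. u g * u' g * x" "%(v, w). i v * w" "%y. free_gen S (v0, y)"
 proof unfold_locales
  fix H assume lc: "lin_closed S H" and RH: "trel M (line u') \<subseteq> H"
  note c2 = trel_cong(2)[OF RH S_def, unfolded line_simps, OF v0(1) UNIV_I UNIV_I]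
   trel_cong(3)[OF RH S_def, unfolded line_simps, OF v0(1) UNIV_I] trel_cong(4)[OF RH S_def, unfolded line_simps, OF v0(1) UNIV_I]
  show "cong_mod H S (fadd S (free_gen S (v0, y)) (free_gen S (v0, z))) (free_gen S (v0, y + z))" for y z
   by (rule cong_mod_sym[OF lc c2(1)])
  show "cong_mod H S (fsm S a (free_gen S (v0, y))) (free_gen S (v0, a * y))" for a y
   by (rule cong_mod_sym[OF lc c2(3)])
  show "cong_mod H S (free_gen S x) (free_gen S (v0, case x of (v, w) => i v * w))" if "x : S" for x
  proof -
   obtain v w where x: "x = (v, w)" "v : carrier M" using \<open>x : S\<close> by (auto simp: S)
   have "v = i v *[M] v0" using D(8)[OF x(2) D(4)[OF v0(1)]] D(5)[OF v0(1)] v0(2) by simp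
   thus ?thesis using cong_mod_trans[OF lc c2(2)[of "i v" w] cong_mod_sym[OF lc c2(3)[of "i v" w]]] x(1) by simp
  qed
 next
  show "r : carrier (free_gmod S \<alpha>)" if "r : trel M (line u')" for r and \<alpha> :: "'g => 'v \<times> 'k => 'v \<times> 'k"
   unfolding S_def by (rule trel_in[OF that])
 qed (auto simp: S D line_simps algebra_simps intro: free_gmod_in)
 have Lg: "L (free_gen S (v, w)) = i v * w" if "v : carrier M" for v w
  using L_gen[of "(v, w)"] that S by auto
 note LL = L_fsub L_fadd L_fsm Lg free_gmod_in
 obtain j where "gmod_iso_on B (tensor_gmod M (line u')) (line (%g. u g * u' g)) j"
  "\<zero>\<^bsub>tensor_gmod M (line u')\<^esub> : carrier (tensor_gmod M (line u'))" "j \<zero>\<^bsub>tensor_gmod M (line u')\<^esub> = 0"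
 proof (rule quotient)
  show "L r = 0" if "r : trel M (line u')" for r
   by (cases rule: trel_cases[OF that S_def]; simp add: LL D line_simps; simp add: algebra_simps)
  show "L (free_gen S (v0, y)) = y" for y using v0 by (simp add: Lg)
 qed (simp add: tensor_gmod_eq Let_def S_def line_def[of "%g. u g * u' g"])
 thus ?thesis by (rule that)
qed

text \<open>Expanding the second factor in the standard basis turns tensors into pairs of forms; T
  writes a pair as its two coordinates tensored with e1 and e2.\<close>

lemma tensor_L1:
 fixes M :: "('k::alg_closed_field, 'v, 'k sl2) gmodule"
 assumes i: "gmod_iso_on UNIV M (Smod n) i"
 obtains j where "gmod_iso_on UNIV (tensor_gmod M L1) (Pmod n) j"
proof -
 have Sm: "carrier (Smod n) = SP n" "f +[Smod n] h = (%u. f u + h u)" "c *[Smod n] f = (%u. c * f u)"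
  "act (Smod n) g f = (%u. f (sl2_mat (inverse g) *v u))" for f h :: "'k ^ 2 => 'k" and c g
  by (simp_all add: Smod_def gmod_def)
 have L1: "carrier L1 = (UNIV :: ('k ^ 2) set)" "v +[L1] w = v + w" "c *[L1] v = c *s v" "act L1 g v = sl2_mat g *v v"
  for v w :: "'k ^ 2" and c g by (simp_all add: L1_def gmod_def)
 note D = gmod_iso_on_D[OF i, unfolded Sm]
 define k where "k = inv_into (carrier M) i"
 have k: "k f : carrier M" "i (k f) = f" if "f : SP n" for f
  using D(9)[OF that] inv_into_into[of f i "carrier M"] f_inv_into_f[of f i "carrier M"] by (auto simp: k_def)
 have ki: "k (i v) = v" if "v : carrier M" for v using k[OF D(1)[OF that]] D(8) that by simp
 have kadd: "k (%u. f u + h u) = k f +[M] k h" if "f : SP n" "h : SP n" for f h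
  by (rule D(8)) (simp_all add: k that SP_add D)
 have ksm: "k (%u. c * f u) = c *[M] k f" if "f : SP n" for f c
  by (rule D(8)) (simp_all add: k that SP_cmult D)
 define S where "S = carrier M \<times> carrier (L1 :: ('k, 'k ^ 2, 'k sl2) gmodule)"
 have S: "S = carrier M \<times> UNIV" by (simp add: S_def L1)
 define e1 e2 :: "'k ^ 2" where "e1 = vec2 1 0" and "e2 = vec2 0 1"
 define T :: "('k ^ 2 => 'k ^ 2) => 'v \<times> ('k ^ 2) => 'k" where "T w = fadd S (free_gen S (k (%u. w u $ 1), e1)) (free_gen S (k (%u. w u $ 2), e2))" for w
 define sm where "sm c f = (%u. c *s f u)" for c and f :: "'k ^ 2 => 'k ^ 2"
 define r where "r g f = (%u. sl2_mat g *v f (sl2_mat (inverse g) *v u))" for g and f :: "'k ^ 2 => 'k ^ 2"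
 define ps where "ps = (%(f, v :: 'k ^ 2). %u. i f u *s v)"
 have SP2: "w : SP2 n ==> (%u. w u $ 1) : SP n" "w : SP2 n ==> (%u. w u $ 2) : SP n" for w :: "'k ^ 2 => 'k ^ 2" by (auto simp: SP2_def)
 interpret free_quotient S "%g (v, w). (act M g v, act L1 g w)" UNIV "trel M L1" "SP2 n" sm r ps T
 proof unfold_locales
  fix H assume lc: "lin_closed S H" and RH: "trel M L1 \<subseteq> H"
  note c = trel_cong[OF RH S_def, unfolded L1]
  have mid: "cong_mod H S (fadd S (fadd S a b) (fadd S a' b')) h" if "cong_mod H S (fadd S (fadd S a a') (fadd S b b')) h" for a b a' b' h
  proof -
   have "fadd S (fadd S a b) (fadd S a' b') = fadd S (fadd S a a') (fadd S b b')" by (auto simp: fadd_def)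
   thus ?thesis using that by simp
  qed
  show "cong_mod H S (fadd S (T y) (T z)) (T (y + z))" if "y : SP2 n" "z : SP2 n" for y z
   unfolding T_def plus_fun_apply vector_add_component kadd[OF SP2(1)[OF that(1)] SP2(1)[OF that(2)]] kadd[OF SP2(2)[OF that(1)] SP2(2)[OF that(2)]]
   by (rule mid, rule cong_mod_add[OF lc cong_mod_sym[OF lc c(1)] cong_mod_sym[OF lc c(1)]]) (simp_all add: k SP2 that)
  show "cong_mod H S (fsm S a (T y)) (T (sm a y))" if "y : SP2 n" for a y
  proof -
   have "fsm S a (T y) = fadd S (fsm S a (free_gen S (k (%u. y u $ 1), e1))) (fsm S a (free_gen S (k (%u. y u $ 2), e2)))"
    by (auto simp: T_def fadd_def fsm_def algebra_simps)
   moreover have "T (sm a y) = fadd S (free_gen S (a *[M] k (%u. y u $ 1), e1)) (free_gen S (a *[M] k (%u. y u $ 2), e2))"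
    by (simp add: T_def sm_def ksm SP2 that)
   ultimately show ?thesis
    using cong_mod_add[OF lc cong_mod_sym[OF lc c(3)] cong_mod_sym[OF lc c(3)]] k(1) SP2[OF that] by simp
  qed
  show "cong_mod H S (free_gen S x) (T (ps x))" if xS: "x : S" for x
  proof -
   obtain f v where x: "x = (f, v)" "f : carrier M" using xS by (auto simp: S)
   have v: "v = v $ 1 *s e1 + v $ 2 *s e2" by (simp add: vec_eq_iff forall_2 e1_def e2_def)
   have s: "cong_mod H S (free_gen S (f, a *s e)) (free_gen S (a *[M] f, e))" for a e
    using cong_mod_trans[OF lc c(4) cong_mod_sym[OF lc c(3)]] x(2) by simp
   have t: "k (%u. i f u * a) = a *[M] f" for a using ksm[OF D(1)[OF x(2)], of a] ki[OF x(2)] by (simp add: mult.commute)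
   have "cong_mod H S (free_gen S (f, v $ 1 *s e1 + v $ 2 *s e2)) (fadd S (free_gen S (v $ 1 *[M] f, e1)) (free_gen S (v $ 2 *[M] f, e2)))"
    using cong_mod_trans[OF lc c(2) cong_mod_add[OF lc s s]] x(2) by simp
   thus ?thesis using x(1) by (simp add: T_def ps_def t flip: v)
  qed
 next
  show "ps (case x of (v, w) => (act M g v, act L1 g w)) = r g (ps x)" if "x : S" for g x
   using that by (auto simp: S ps_def r_def D L1 vector_scalar_commute)
  show "ps x : SP2 n" if "x : S" for x
   using that SP_cmult[OF D(1)] by (auto simp: S ps_def SP2_def mult.commute[of "i _ _"])
  show "y + z : SP2 n" if "y : SP2 n" "z : SP2 n" for y z
   using that by (simp add: SP2_def plus_fun_apply SP_add)
  show "sm c y : SP2 n" if "y : SP2 n" for c y using that by (simp add: SP2_def sm_def SP_cmult)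
  show "t : carrier (free_gmod S \<alpha>)" if "t : trel M L1" for t and \<alpha> :: "'k sl2 => 'v \<times> ('k ^ 2) => 'v \<times> ('k ^ 2)"
   unfolding S_def by (rule trel_in[OF that])
 qed (auto simp: S D L1 sm_def r_def T_def fun_eq_iff plus_fun_apply vec_eq_iff algebra_simps vector_scalar_commute matrix_vector_right_distrib
   SP2_def zero_fun_apply SP_0 intro: free_gmod_in)
 have Lg: "L (free_gen S (f, v)) = (%u. i f u *s v)" if "f : carrier M" for f v
  using L_gen[of "(f, v)"] that S by (auto simp: ps_def)
 note LL = L_fsub L_fadd L_fsm Lg free_gmod_in
 have pl: "(%f h u. f u + h u) = ((+) :: ('k ^ 2 => 'k ^ 2) => _)" by (simp add: fun_eq_iff plus_fun_apply)
 have P: "Pmod n = gmod (SP2 n) (+) 0 sm r"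
  by (simp add: Pmod_def sm_def[abs_def] r_def[abs_def] pl zero_fun_def)
 obtain j where "gmod_iso_on UNIV (tensor_gmod M L1) (Pmod n) j"
 proof (rule quotient)
  show "L t = 0" if "t : trel M L1" for t
   by (cases rule: trel_cases[OF that S_def]; simp add: LL D L1 sm_def; simp add: fun_eq_iff fun_app vec_eq_iff algebra_simps)
  show "L (T y) = y" if "y : SP2 n" for y
   using SP2[OF that] k
   by (simp add: T_def LL) (simp add: fun_eq_iff plus_fun_apply vec_eq_iff forall_2 e1_def e2_def)
 qed (simp add: tensor_gmod_eq Let_def S_def P)
 thus ?thesis by (rule that)
qed

text \<open>Homogeneity in one slot after another replaces the entries by v0, so a word is congruent
  to the product of its coordinates times v0^m.\<close>

lemma sym_power_line:
 fixes M :: "('k::field, 'v, 'g) gmodule"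
 assumes i: "gmod_iso_on B M (line u) i"
 obtains j where "gmod_iso_on B (sym_power_gmod m M) (line (%g. u g ^ m)) j"
proof -
 note D = gmod_iso_on_D[OF i, unfolded line_simps]
 obtain v0 where v0: "v0 : carrier M" "i v0 = 1" using D(9) by blast
 define S where "S = tuples M m"
 define e :: "'v list => 'v list => 'k" where "e = free_gen S"
 define R where "R =
   {fsub S (e (xs[l := v +[M] w])) (fadd S (e (xs[l := v])) (e (xs[l := w]))) | xs l v w.
     xs : S & l < m & v : carrier M & w : carrier M} \<union>
   {fsub S (e (xs[l := c *[M] v])) (fsm S c (e (xs[l := v]))) | xs l c v. xs : S & l < m & v : carrier M} \<union>
   {fsub S (e xs) (e ys) | xs ys. xs : S & ys : S & mset xs = mset ys}"
 have sym: "sym_power_gmod m M = (let F = free_gmod S (%g. map (act M g)) in quot_gmod F (submod_gen F R))"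
  unfolding sym_power_gmod_def R_def Let_def S_def[symmetric] e_def
  by (simp add: free_gmod_minus free_gmod_in free_gmod_simps(2,3))
 have S: "xs : S \<longleftrightarrow> length xs = m & set xs \<subseteq> carrier M" for xs by (simp add: S_def tuples_def)
 have upd: "xs[l := v] : S" if "xs : S" "v : carrier M" for xs l v
  using that set_update_subset_insert[of xs l v] by (auto simp: S)
 define ps where "ps xs = prod_list (map i xs)" for xs
 define x0 where "x0 = replicate m v0"
 have x0: "x0 : S" "ps x0 = 1" using v0 by (auto simp: x0_def S ps_def)
 have psu: "ps (xs[l := v]) = ps (take l xs) * i v * ps (drop (Suc l) xs)" if "l < length xs" for xs l v
  using that by (simp add: ps_def list_update_split mult.assoc)
 interpret free_quotient S "%g. map (act M g)" B R UNIV "(*)" "%g x. u g ^ m * x" ps "%y. fsm S y (e x0)"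
 proof unfold_locales
  show "ps (map (act M g) x) = u g ^ m * ps x" if "g : B" "x : S" for g x
  proof -
   have "prod_list (map i (map (act M g) xs)) = u g ^ length xs * prod_list (map i xs)" if "set xs \<subseteq> carrier M" for xs
    using that \<open>g : B\<close> by (induction xs) (auto simp: D)
   thus ?thesis using that by (simp add: S ps_def)
  qed
  show "cong_mod H S (fadd S (fsm S y (e x0)) (fsm S z (e x0))) (fsm S (y + z) (e x0))" if "lin_closed S H" for H y z
   using cong_mod_refl[OF that] by (simp add: fadd_def fsm_def distrib_right cong: restrict_cong)
  show "cong_mod H S (fsm S a (fsm S y (e x0))) (fsm S (a * y) (e x0))" if "lin_closed S H" for H y a
   using cong_mod_refl[OF that] by (simp add: fsm_def mult.assoc cong: restrict_cong)
  show "cong_mod H S (free_gen S xs) (fsm S (ps xs) (e x0))" if H: "lin_closed S H" "R \<subseteq> H" and xs: "xs : S" for H xs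
  proof -
   have sm: "cong_mod H S (e (xs[l := c *[M] v])) (fsm S c (e (xs[l := v])))" if "xs : S" "l < m" "v : carrier M" for xs l c v
    using H(2) that unfolding cong_mod_def R_def by blast
   have "cong_mod H S (e xs) (fsm S (ps (take l xs)) (e (replicate l v0 @ drop l xs)))" if "l <= m" for l
    using that
   proof (induction l)
    case 0
    have "fsm S 1 (e xs) = e xs" by (auto simp: fsm_def e_def free_gen_def)
    thus ?case using cong_mod_refl[OF H(1)] by (simp add: ps_def)
   next
    case (Suc l)
    define y where "y = xs ! l"
    define ys where "ys = replicate l v0 @ drop l xs"
    have l: "l < length xs" using Suc xs by (simp add: S)
    hence y: "y : carrier M" using xs nth_mem[OF l] by (auto simp: S y_def)
    hence yy: "y = i y *[M] v0" using D(8)[OF _ D(4)[OF v0(1)]] D(5)[OF v0(1)] v0(2) by simp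
    have d: "drop l xs = y # drop (Suc l) xs" using l by (simp add: y_def Cons_nth_drop_Suc)
    have "ys : S" using xs l v0(1) by (auto simp: ys_def S dest!: in_set_dropD)
    have u: "ys[l := w] = replicate l v0 @ w # drop (Suc l) xs" for w
     unfolding ys_def d using list_update_length[of "replicate l v0" y "drop (Suc l) xs" w] by simp
    have "cong_mod H S (e ys) (fsm S (i y) (e (replicate (Suc l) v0 @ drop (Suc l) xs)))"
     using sm[OF \<open>ys : S\<close> _ v0(1), of l "i y"] Suc(2) unfolding u yy[symmetric]
     by (simp add: ys_def d replicate_append_same flip: replicate_Suc) (simp add: replicate_app_Cons_same)
    hence "cong_mod H S (fsm S (ps (take l xs)) (e ys))
     (fsm S (ps (take l xs)) (fsm S (i y) (e (replicate (Suc l) v0 @ drop (Suc l) xs))))"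
     by (rule cong_mod_sm[OF H(1)])
    moreover have "ps (take (Suc l) xs) = ps (take l xs) * i y"
     using l by (simp add: ps_def take_Suc_conv_app_nth y_def)
    hence "fsm S (ps (take l xs)) (fsm S (i y) h) = fsm S (ps (take (Suc l) xs)) h" for h
     by (simp add: fsm_def mult.assoc cong: restrict_cong)
    ultimately show ?case using Suc cong_mod_trans[OF H(1)] by (simp add: ys_def)
   qed
   from this[of m] show ?thesis using xs by (simp add: S e_def x0_def)
  qed
 qed (auto simp: algebra_simps S D R_def e_def intro: free_gmod_in)
 note LL = L_fsub L_fadd L_fsm free_gmod_in
 have Le: "L (e xs) = ps xs" if "xs : S" for xs unfolding e_def by (rule L_gen[OF that])
 obtain j where "gmod_iso_on B (sym_power_gmod m M) (line (%g. u g ^ m)) j"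
 proof (rule quotient)
  show "L t = 0" if tR: "t : R" for t
  proof -
   consider xs l v w where "t = fsub S (e (xs[l := v +[M] w])) (fadd S (e (xs[l := v])) (e (xs[l := w])))"
     "xs : S" "l < m" "v : carrier M" "w : carrier M"
    | xs l c v where "t = fsub S (e (xs[l := c *[M] v])) (fsm S c (e (xs[l := v])))" "xs : S" "l < m" "v : carrier M"
    | xs ys where "t = fsub S (e xs) (e ys)" "xs : S" "ys : S" "mset xs = mset ys"
    using tR unfolding R_def by blast
   thus ?thesis
   proof cases
    case 1
    thus ?thesis using D Le upd by (simp add: e_def LL) (simp add: psu S D algebra_simps flip: e_def)
   next
    case 2
    thus ?thesis using D Le upd by (simp add: e_def LL) (simp add: psu S D algebra_simps flip: e_def)
   next
    case 3
    have "mset (map i xs) = mset (map i ys)" using 3 by simp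
    hence "ps xs = ps ys" unfolding ps_def by (metis prod_mset_prod_list)
    thus ?thesis using 3 Le by (simp add: e_def LL)
   qed
  qed
  show "L (fsm S y (e x0)) = y" for y using Le[OF x0(1)] x0(2) by (simp add: e_def LL)
 qed (simp add: sym Let_def line_def[of "%g. u g ^ m"])
 thus ?thesis by (rule that)
qed

section \<open>The nilpotent cone and induced modules\<close>

lemma gmod_iso_on_sym:
 assumes "gmod_iso_on B M N j" obtains i where "gmod_iso_on B N M i"
proof -
 note D = gmod_iso_on_D[OF assms]
 define i where "i = inv_into (carrier M) j"
 have i: "i y : carrier M" "j (i y) = y" if "y : carrier N" for y
  using D(9)[OF that] inv_into_into[of y j "carrier M"] f_inv_into_f[of y j "carrier M"] by (auto simp: i_def)
 have ji: "i y = x" if "x : carrier M" "j x = y" for x y using D(8)[OF i(1)] i(2) D(1) that by metis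
 have "bij_betw i (carrier N) (carrier M)"
  unfolding i_def using assms by (auto simp: gmod_iso_on_def intro: bij_betw_inv_into)
 moreover have "x +[N] y : carrier N & i (x +[N] y) = i x +[M] i y" if "x : carrier N" "y : carrier N" for x y
  using D(2,3)[OF i(1)[OF that(1)] i(1)[OF that(2)]] i(2)[OF that(1)] i(2)[OF that(2)] D(1) ji by metis
 moreover have "c *[N] x : carrier N & i (c *[N] x) = c *[M] i x" if "x : carrier N" for c x
  using D(4,5)[OF i(1)[OF that], of c] i(2)[OF that] D(1) ji by metis
 moreover have "act N g x : carrier N & i (act N g x) = act M g (i x)" if "g : B" "x : carrier N" for g x
  using D(6,7)[OF that(1) i(1)[OF that(2)]] i(2)[OF that(2)] D(1) ji by metis
 ultimately have "gmod_iso_on B N M i" by (simp add: gmod_iso_on_def)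
 thus ?thesis by (rule that)
qed

lemma gmod_iso_trans: "M \<cong>\<^sub>G N ==> N \<cong>\<^sub>G K ==> M \<cong>\<^sub>G K"
proof -
 assume "M \<cong>\<^sub>G N" "N \<cong>\<^sub>G K"
 then obtain f h where f: "bij_betw f (carrier M) (carrier N)"
   "\<forall>x\<in>carrier M. \<forall>y\<in>carrier M. f (x +[M] y) = f x +[N] f y" "\<forall>c. \<forall>x\<in>carrier M. f (c *[M] x) = c *[N] f x"
   "\<forall>g. \<forall>x\<in>carrier M. f (act M g x) = act N g (f x)"
  and h: "bij_betw h (carrier N) (carrier K)"
   "\<forall>x\<in>carrier N. \<forall>y\<in>carrier N. h (x +[N] y) = h x +[K] h y" "\<forall>c. \<forall>x\<in>carrier N. h (c *[N] x) = c *[K] h x"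
   "\<forall>g. \<forall>x\<in>carrier N. h (act N g x) = act K g (h x)"
  unfolding gmod_iso_def by blast
 have "f x : carrier N" if "x : carrier M" for x using f(1) that by (auto simp: bij_betw_def)
 thus ?thesis unfolding gmod_iso_def
  using f h bij_betw_trans[OF f(1) h(1)] by (intro exI[of _ "h \<circ> f"]) simp
qed

lemma power_gmod_iso: "M \<cong>\<^sub>G N ==> power_gmod n M \<cong>\<^sub>G power_gmod n N"
proof -
 assume "M \<cong>\<^sub>G N"
 then obtain f where f: "bij_betw f (carrier M) (carrier N)"
   "\<forall>x\<in>carrier M. \<forall>y\<in>carrier M. f (x +[M] y) = f x +[N] f y" "\<forall>c. \<forall>x\<in>carrier M. f (c *[M] x) = c *[N] f x"
   "\<forall>g. \<forall>x\<in>carrier M. f (act M g x) = act N g (f x)"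
  unfolding gmod_iso_def by blast
 define F where "F x = (\<lambda>i\<in>{..<n}. f (x i))" for x
 have fin: "f x : carrier N" if "x : carrier M" for x using f(1) that by (auto simp: bij_betw_def)
 have "bij_betw F ({..<n} \<rightarrow>\<^sub>E carrier M) ({..<n} \<rightarrow>\<^sub>E carrier N)"
 proof (rule bij_betw_imageI)
  show "inj_on F ({..<n} \<rightarrow>\<^sub>E carrier M)"
  proof (rule inj_onI, rule PiE_ext)
   fix x y i assume *: "x : {..<n} \<rightarrow>\<^sub>E carrier M" "y : {..<n} \<rightarrow>\<^sub>E carrier M" "F x = F y" "i : {..<n}"
   hence "f (x i) = f (y i)" by (metis F_def restrict_apply')
   thus "x i = y i" using f(1) * by (metis bij_betw_def inj_onD PiE_mem)
  qed
  show "F ` ({..<n} \<rightarrow>\<^sub>E carrier M) = {..<n} \<rightarrow>\<^sub>E carrier N"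
  proof
   show "F ` ({..<n} \<rightarrow>\<^sub>E carrier M) \<subseteq> {..<n} \<rightarrow>\<^sub>E carrier N" proof
    fix y assume "y : F ` ({..<n} \<rightarrow>\<^sub>E carrier M)"
    then obtain x where x: "x : {..<n} \<rightarrow>\<^sub>E carrier M" "y = F x" by blast
    have "f (x i) : carrier N" if "i : {..<n}" for i using fin[OF PiE_mem[OF x(1) that]] .
    thus "y : {..<n} \<rightarrow>\<^sub>E carrier N" by (simp add: x(2) F_def)
   qed
   show "{..<n} \<rightarrow>\<^sub>E carrier N \<subseteq> F ` ({..<n} \<rightarrow>\<^sub>E carrier M)"
   proof
    fix y assume y: "y : {..<n} \<rightarrow>\<^sub>E carrier N"
    define x where "x = (\<lambda>i\<in>{..<n}. inv_into (carrier M) f (y i))"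
    have *: "y i : f ` carrier M" if "i < n" for i using y f(1) that by (auto simp: bij_betw_def)
    have "x : {..<n} \<rightarrow>\<^sub>E carrier M" using * by (auto simp: x_def inv_into_into)
    moreover have "F x i = y i" for i
     using y * by (cases "i < n") (auto simp: F_def x_def f_inv_into_f PiE_def extensional_def)
    hence "F x = y" by blast
    ultimately show "y : F ` ({..<n} \<rightarrow>\<^sub>E carrier M)" by blast
   qed
  qed
 qed
 moreover have "x i : carrier M" if "x : {..<n} \<rightarrow>\<^sub>E carrier M" "i < n" for x i using PiE_mem[OF that(1)] that(2) by simp
 ultimately show ?thesis unfolding gmod_iso_def power_gmod_simps
  using f by (intro exI[of _ F]) (auto simp: F_def intro!: restrict_ext)
qed

text \<open>The column v times the row (v2, -v1): a quadratic map of the plane onto the nilpotent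
  cone, equivariant by \<open>nil_mat_conj\<close>. It identifies v and -v, which is why forms of
  even degree appear.\<close>

definition nil_mat :: "'k::field ^ 2 => 'k ^ 2 ^ 2"
 where "nil_mat v = (\<chi> i. if i = 1 then vec2 (v $ 1 * v $ 2) (- (v $ 1)\<^sup>2) else vec2 ((v $ 2)\<^sup>2) (- (v $ 1 * v $ 2)))"

lemma nil_mat_nth [simp]: "nil_mat v $ 1 $ 1 = v $ 1 * v $ 2" "nil_mat v $ 1 $ 2 = - (v $ 1)\<^sup>2"
 "nil_mat v $ 2 $ 1 = (v $ 2)\<^sup>2" "nil_mat v $ 2 $ 2 = - (v $ 1 * v $ 2)"
 by (simp_all add: nil_mat_def)

lemma mat_2_mult: "(A ** C) $ i $ j = A $ i $ 1 * C $ 1 $ j + A $ i $ 2 * C $ 2 $ j" for A C :: "'k::field ^ 2 ^ 2"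
 by (simp add: matrix_matrix_mult_def sum_2)

text \<open>Nilpotency forces determinant 0, so the square of the entry 11 is minus the product of
  the entries 12 and 21; square roots of -Z12 and Z21 give v, with one sign adjusted to match
  Z11.\<close>

lemma nilcone_eq: "nilcone = range (nil_mat :: 'k::alg_closed_field ^ 2 => _)"
proof
 show "range nil_mat \<subseteq> (nilcone :: ('k ^ 2 ^ 2) set)"
 proof clarsimp
  fix v :: "'k ^ 2"
  have "(((**) (nil_mat v)) ^^ 2) (mat 1) = 0"
   by (simp add: numeral_2_eq_2 vec_eq_iff forall_2 mat_2_mult power2_eq_square algebra_simps)
  thus "nil_mat v : nilcone" by (auto simp: nilcone_def lie_sl2_def trace_def sum_2)
 qed
 show "nilcone \<subseteq> range (nil_mat :: 'k ^ 2 => _)"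
 proof
  fix Z :: "'k ^ 2 ^ 2" assume Z: "Z : nilcone"
  then obtain n where n: "(((**) Z) ^^ n) (mat 1) = 0" by (auto simp: nilcone_def)
  have "det ((((**) Z) ^^ n) (mat 1)) = det Z ^ n" by (induction n) (simp_all add: det_mul)
  hence "det Z = 0" using n by (simp add: det_2 power_0_left split: if_splits)
  moreover have t: "Z $ 2 $ 2 = - Z $ 1 $ 1"
   using Z by (simp add: nilcone_def lie_sl2_def trace_def sum_2 eq_neg_iff_add_eq_0 add.commute)
  ultimately have "Z $ 1 $ 1 * Z $ 2 $ 2 = Z $ 1 $ 2 * Z $ 2 $ 1" by (simp add: det_2)
  moreover have "(Z $ 1 $ 1)\<^sup>2 = - (Z $ 1 $ 1 * Z $ 2 $ 2)" by (simp add: t power2_eq_square)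
  ultimately have d: "(Z $ 1 $ 1)\<^sup>2 = - (Z $ 1 $ 2) * Z $ 2 $ 1" by simp
  obtain x where x: "x ^ 2 = - Z $ 1 $ 2" using nth_root_exists[of 2] by auto
  obtain y where y: "y ^ 2 = Z $ 2 $ 1" using nth_root_exists[of 2] by auto
  have "(x * y)\<^sup>2 = (Z $ 1 $ 1)\<^sup>2" by (simp add: power_mult_distrib x y d)
  hence "x * y = Z $ 1 $ 1 | x * - y = Z $ 1 $ 1" by (auto simp: power2_eq_iff)
  then obtain y' where y': "x * y' = Z $ 1 $ 1" "y' ^ 2 = Z $ 2 $ 1" using y by (metis power2_minus)
  have "Z = nil_mat (vec2 x y')"
   using x y' t by (simp add: vec_eq_iff forall_2)
  thus "Z : range nil_mat" by simp
 qed
qed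

lemma nil_mat_conj:
 fixes g :: "'k::field sl2"
 shows "nil_mat (sl2_mat g *v v) = sl2_mat g ** nil_mat v ** sl2_mat (inverse g)"
 by (simp add: vec_eq_iff forall_2 mat_2_mult matvec_2 sl2_mat_inverse_entries power2_eq_square algebra_simps)

text \<open>The m linear forms whose product restricts to v1^j v2^(2m-j): j div 2 factors v1^2, one
  factor v1 v2 if j is odd, and factors v2^2 for the rest.\<close>

definition nil_lin :: "nat => nat => nat => 'k::field ^ 2 ^ 2 => 'k"
 where "nil_lin m j i = (\<lambda>Z\<in>lie_sl2. if i < j div 2 then - Z $ 1 $ 2 else if i < j div 2 + j mod 2 then Z $ 1 $ 1 else Z $ 2 $ 1)"

lemma nil_mat_lie: "nil_mat v : lie_sl2" by (simp add: lie_sl2_def trace_def sum_2)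

lemma prod_split_3:
 fixes a b c :: "'a::comm_monoid_mult"
 assumes "k + r <= m"
 shows "(\<Prod>i<m. if i < k then a else if i < k + r then b else c) = a ^ k * b ^ r * c ^ (m - k - r)"
proof -
 define Y where "Y = {..<m} \<inter> - {i. i < k}"
 have "(\<Prod>i<m. if i < k then a else if i < k + r then b else c)
  = (\<Prod>i\<in>{..<m} \<inter> {i. i < k}. a) * ((\<Prod>i\<in>Y \<inter> {i. i < k + r}. b) * (\<Prod>i\<in>Y \<inter> - {i. i < k + r}. c))"
  by (simp add: prod.If_cases Y_def)
 moreover have "{..<m} \<inter> {i. i < k} = {..<k}" "Y \<inter> {i. i < k + r} = {k..<k + r}" "Y \<inter> - {i. i < k + r} = {k + r..<m}"
  using assms by (auto simp: Y_def)
 ultimately show ?thesis by (simp add: mult.assoc)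
qed

lemma prod_nil_lin:
 assumes "j <= 2 * m"
 shows "(\<Prod>i<m. nil_lin m j i (nil_mat v)) = (v $ 1) ^ j * (v $ 2) ^ (2 * m - j)"
proof -
 have le: "j div 2 + j mod 2 <= m" using assms by presburger
 have "(\<Prod>i<m. nil_lin m j i (nil_mat v))
  = (\<Prod>i<m. if i < j div 2 then (v $ 1)\<^sup>2 else if i < j div 2 + j mod 2 then v $ 1 * v $ 2 else (v $ 2)\<^sup>2)"
  by (rule prod.cong) (auto simp: nil_lin_def nil_mat_lie)
 also have "... = ((v $ 1)\<^sup>2) ^ (j div 2) * (v $ 1 * v $ 2) ^ (j mod 2) * ((v $ 2)\<^sup>2) ^ (m - j div 2 - j mod 2)"
  by (rule prod_split_3[OF le])
 also have "... = (v $ 1) ^ (2 * (j div 2) + j mod 2) * (v $ 2) ^ (j mod 2 + 2 * (m - j div 2 - j mod 2))"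
  by (simp only: power_mult power_add power_mult_distrib mult_ac)
 also have "2 * (j div 2) + j mod 2 = j" by simp
 also have "j mod 2 + 2 * (m - j div 2 - j mod 2) = 2 * m - j" using le mult_div_mod_eq[of 2 j] by linarith
 finally show ?thesis .
qed

lemma dual_lie_sl2:
 "carrier (dual_gmod (adjoint_gmod lie_sl2)) = {l :: 'k::field ^ 2 ^ 2 => 'k. l : lie_sl2 \<rightarrow>\<^sub>E UNIV \<and>
  (\<forall>x\<in>lie_sl2. \<forall>y\<in>lie_sl2. l (x + y) = l x + l y) & (\<forall>c. \<forall>x\<in>lie_sl2. l (\<chi> i. c *s x $ i) = c * l x)}"
 by (simp add: dual_gmod_def fun_gmod_def gmod_def adjoint_gmod_def)

lemma nil_lin_in: "nil_lin m j i : carrier (dual_gmod (adjoint_gmod lie_sl2))"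
proof -
 have "x + y : lie_sl2" if "x : lie_sl2" "y : lie_sl2" for x y :: "'a ^ 2 ^ 2"
  using that by (simp add: lie_sl2_def trace_def sum_2 flip: eq_neg_iff_add_eq_0)
 moreover have "(\<chi> i. c *s x $ i) : lie_sl2" if "x : lie_sl2" for x :: "'a ^ 2 ^ 2" and c
  using that by (simp add: lie_sl2_def trace_def sum_2 flip: distrib_left)
 ultimately show ?thesis unfolding dual_lie_sl2 by (auto simp: nil_lin_def)
qed

lemma lin_nil_mat:
 fixes l :: "'k::alg_closed_field ^ 2 ^ 2 => 'k"
 assumes "l : carrier (dual_gmod (adjoint_gmod lie_sl2))" shows "(%v. l (nil_mat v)) : SP 2"
proof -
 define e :: "'k => 'k => 'k => 'k ^ 2 ^ 2" where "e a b c = (\<chi> i. if i = 1 then vec2 a b else vec2 c (- a))" for a b c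
 have en: "e a b c $ 1 $ 1 = a" "e a b c $ 1 $ 2 = b" "e a b c $ 2 $ 1 = c" "e a b c $ 2 $ 2 = - a" for a b c
  by (simp_all add: e_def)
 have el: "e a b c : lie_sl2" for a b c by (simp add: lie_sl2_def trace_def sum_2 en)
 have add: "l (e a b c + e a' b' c') = l (e a b c) + l (e a' b' c')" for a b c a' b' c'
  using assms el unfolding dual_lie_sl2 by blast
 have sm: "l (\<chi> i. s *s e a b c $ i) = s * l (e a b c)" for a b c s
  using assms el unfolding dual_lie_sl2 by blast
 have *: "l (nil_mat v) = l (e 0 (- 1) 0) * ((v $ 1) ^ 2 * (v $ 2) ^ (2 - 2)) + l (e 1 0 0) * ((v $ 1) ^ 1 * (v $ 2) ^ (2 - 1))
  + l (e 0 0 1) * ((v $ 1) ^ 0 * (v $ 2) ^ (2 - 0))" for v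
 proof -
  have s: "(\<chi> i. s *s e a b c $ i) = e (s * a) (s * b) (s * c)" for s a b c by (simp add: vec_eq_iff forall_2 en)
  have a: "e a b c + e a' b' c' = e (a + a') (b + b') (c + c')" for a b c a' b' c' by (simp add: vec_eq_iff forall_2 en)
  have "nil_mat v = e 0 ((v $ 1)\<^sup>2 * - 1) 0 + e (v $ 1 * v $ 2) 0 0 + e 0 0 ((v $ 2)\<^sup>2)"
   by (simp add: vec_eq_iff forall_2 en)
  also have "l ... = l (e 0 ((v $ 1)\<^sup>2 * - 1) 0) + l (e (v $ 1 * v $ 2) 0 0) + l (e 0 0 ((v $ 2)\<^sup>2))"
   unfolding a add[symmetric] ..
  finally show ?thesis
   using sm[of "(v $ 1)\<^sup>2" 0 "- 1" 0] sm[of "v $ 1 * v $ 2" 1 0 0] sm[of "(v $ 2)\<^sup>2" 0 0 1]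
   unfolding s by (simp add: mult.commute)
 qed
 show ?thesis unfolding * by (intro SP_add SP_cmult SP_mon) simp_all
qed

text \<open>\<open>inv_into\<close> picks one of the preimages v and -v, but the result is
  independent of the choice, because for each form h some f in the coordinate ring satisfies
  f(nil_mat v) = h v.\<close>

lemma nilcone_coord_iso:
 obtains I where "gmod_iso_on UNIV (Smod (2 * m)) (nilcone_coord m :: ('k::alg_closed_field, _, _) gmodule) I"
proof -
 define I :: "('k ^ 2 => 'k) => 'k ^ 2 ^ 2 => 'k" where "I h = (\<lambda>Z\<in>nilcone. h (inv_into UNIV nil_mat Z))" for h
 define C where "C = {(\<lambda>Z\<in>nilcone. \<Sum>j<r. c j * (\<Prod>i<m. l j i Z)) | (r :: nat) c l.
    \<forall>j<r. \<forall>i<m. l j i : carrier (dual_gmod (adjoint_gmod (lie_sl2 :: ('k ^ 2 ^ 2) set)))}"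
 have nc: "carrier (nilcone_coord m) = C" "f +[nilcone_coord m] h = (\<lambda>Z\<in>nilcone. f Z + h Z)"
  "c *[nilcone_coord m] f = (\<lambda>Z\<in>nilcone. c * f Z)"
  "act (nilcone_coord m) g f = (\<lambda>Z\<in>nilcone. f (sl2_mat (inverse g) ** Z ** sl2_mat g))" for f h :: "'k ^ 2 ^ 2 => 'k" and c g
  by (simp_all add: nilcone_coord_def fun_gmod_def gmod_def triv_gmod_def C_def)
 have "\<exists>f\<in>C. \<forall>v. f (nil_mat v) = h v" if h: "h : SP (2 * m)" for h :: "'k ^ 2 => 'k"
 proof -
  obtain c where c: "h = (%v. \<Sum>j\<le>2 * m. c j * (v $ 1 ^ j * v $ 2 ^ (2 * m - j)))" using h by (rule SP_E)
  define f where "f = (\<lambda>Z\<in>nilcone. \<Sum>j<Suc (2 * m). c j * (\<Prod>i<m. nil_lin m j i Z))"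
  have "f : C" unfolding f_def C_def using nil_lin_in by blast
  moreover have "f (nil_mat v) = h v" for v
   unfolding f_def c lessThan_Suc_atMost by (simp add: nilcone_eq, intro sum.cong refl, simp add: prod_nil_lin)
  ultimately show ?thesis by blast
 qed
 then obtain f0 where f0: "f0 h : C" "f0 h (nil_mat v) = h v" if "h : SP (2 * m)" for h v by metis
 have f0I: "f0 h = I h" if h: "h : SP (2 * m)" for h
 proof
  fix Z
  show "f0 h Z = I h Z"
  proof (cases "Z : nilcone")
   case True
   hence "Z = nil_mat (inv_into UNIV nil_mat Z)" by (simp add: nilcone_eq f_inv_into_f)
   thus ?thesis using True f0(2)[OF h, of "inv_into UNIV nil_mat Z"] by (simp add: I_def)
  next
   case False
   thus ?thesis using f0(1)[OF h] by (auto simp: C_def I_def)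
  qed
 qed
 hence I: "I h : C" "I h (nil_mat v) = h v" if "h : SP (2 * m)" for h v using f0 that by auto
 have eqI: "f = f'" if "f : C" "f' : extensional nilcone" "\<And>v. f (nil_mat v) = f' (nil_mat v)" for f f'
  by (rule extensionalityI[of _ nilcone]) (use that in \<open>auto simp: C_def nilcone_eq\<close>)
 have Csub: "(%v. f (nil_mat v)) : SP (2 * m)" if f: "f : C" for f
 proof -
  have P: "(%v. \<Prod>i<k. l i (nil_mat v)) : SP (2 * k)" if "\<And>i. i < k ==> l i : carrier (dual_gmod (adjoint_gmod lie_sl2))"
   for k and l :: "nat => 'k ^ 2 ^ 2 => 'k"
   using that
  proof (induction k)
   case (Suc k)
   have "(%v. (\<Prod>i<k. l i (nil_mat v)) * l k (nil_mat v)) : SP (2 * k + 2)"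
    by (rule SP_mult[OF Suc.IH lin_nil_mat]) (simp_all add: Suc.prems)
   thus ?case by simp
  qed (simp add: SP_const)
  obtain r :: nat and c l where "f = (\<lambda>Z\<in>nilcone. \<Sum>j<r. c j * (\<Prod>i<m. l j i Z))"
    "\<forall>j<r. \<forall>i<m. l j i : carrier (dual_gmod (adjoint_gmod (lie_sl2 :: ('k ^ 2 ^ 2) set)))"
   using f unfolding C_def by blast
  thus ?thesis by (simp add: nilcone_eq) (intro SP_sum SP_cmult P, auto)
 qed
 have "gmod_iso_on UNIV (Smod (2 * m)) (nilcone_coord m) I"
  unfolding gmod_iso_on_def nc
 proof (intro conjI ballI allI)
  show "bij_betw I (carrier (Smod (2 * m))) C"
   unfolding Smod_def gmod_def partial_object.select_convs
  proof (rule bij_betwI'; clarsimp?)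
   show "I h = I h' \<longleftrightarrow> h = h'" if "h : SP (2 * m)" "h' : SP (2 * m)" for h h'
    using I(2)[OF that(1)] I(2)[OF that(2)] by (metis ext)
   show "I h : C" if "h : SP (2 * m)" for h by (rule I(1)[OF that])
   show "\<exists>h\<in>SP (2 * m). f = I h" if f: "f : C" for f
   proof (rule bexI[OF _ Csub[OF f]], rule eqI[OF f])
    show "I (%v. f (nil_mat v)) : extensional nilcone" by (simp add: I_def)
   qed (simp add: I(2)[OF Csub[OF f]])
  qed
 next
  fix h assume "h : carrier (Smod (2 * m) :: ('k, _, _) gmodule)"
  hence h: "h : SP (2 * m)" by (simp add: Smod_def gmod_def)
  show "act (Smod (2 * m)) g h : carrier (Smod (2 * m))" "c *[Smod (2 * m)] h : carrier (Smod (2 * m))" for g c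
   using h by (simp_all add: Smod_def gmod_def SP_subst SP_cmult)
  show "I (c *[Smod (2 * m)] h) = (\<lambda>Z\<in>nilcone. c * I h Z)" for c
   by (simp add: Smod_def gmod_def I_def cong: restrict_cong)
  show "I (act (Smod (2 * m)) g h) = (\<lambda>Z\<in>nilcone. I h (sl2_mat (inverse g) ** Z ** sl2_mat g))" for g
  proof (rule eqI)
   have *: "(%x. h (sl2_mat (inverse g) *v x)) : SP (2 * m)" by (rule SP_subst[OF h])
   thus "I (act (Smod (2 * m)) g h) : C" using I(1) by (simp add: Smod_def gmod_def)
   show "I (act (Smod (2 * m)) g h) (nil_mat v) = (\<lambda>Z\<in>nilcone. I h (sl2_mat (inverse g) ** Z ** sl2_mat g)) (nil_mat v)" for v
    using I(2)[OF *, of v] I(2)[OF h, of "sl2_mat (inverse g) *v v"]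
    by (simp add: Smod_def gmod_def nilcone_eq nil_mat_conj)
  qed simp
  fix h' assume "h' : carrier (Smod (2 * m) :: ('k, _, _) gmodule)"
  hence h': "h' : SP (2 * m)" by (simp add: Smod_def gmod_def)
  show "h +[Smod (2 * m)] h' : carrier (Smod (2 * m))" using h h' by (simp add: Smod_def gmod_def SP_add)
  show "I (h +[Smod (2 * m)] h') = (\<lambda>Z\<in>nilcone. I h Z + I h' Z)"
   by (simp add: Smod_def gmod_def I_def cong: restrict_cong)
 qed
 thus ?thesis by (rule that)
qed

text \<open>A functional on the line spanned by the lower left matrix unit is its value there, and
  conjugation by a lower triangular matrix rescales that line by the square of a diagonal
  entry.\<close>

lemma u_dual_line: obtains i where "gmod_iso_on borel_sl2 (u_dual :: ('k::field, _, _) gmodule) (line (%b. (sl2_mat b $ 1 $ 1)\<^sup>2)) i"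
proof -
 define E :: "'k ^ 2 ^ 2" where "E = (\<chi> i j. if i = 2 & j = 1 then 1 else 0)"
 have En: "E $ 1 $ 1 = 0" "E $ 1 $ 2 = 0" "E $ 2 $ 1 = 1" "E $ 2 $ 2 = 0" by (simp_all add: E_def)
 define C where "C = {l :: 'k ^ 2 ^ 2 => 'k. l : lie_u \<rightarrow>\<^sub>E UNIV \<and>
  (\<forall>x\<in>lie_u. \<forall>y\<in>lie_u. l (x + y) = l x + l y) & (\<forall>c. \<forall>x\<in>lie_u. l (\<chi> i. c *s x $ i) = c * l x)}"
 have ud: "carrier u_dual = C" "l +[u_dual] l' = (\<lambda>Z\<in>lie_u. l Z + l' Z)" "c *[u_dual] l = (\<lambda>Z\<in>lie_u. c * l Z)"
  "act u_dual b l = (\<lambda>Z\<in>lie_u. l (sl2_mat (inverse b) ** Z ** sl2_mat b))" for l l' :: "'k ^ 2 ^ 2 => 'k" and c b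
  by (simp_all add: u_dual_def dual_gmod_def fun_gmod_def gmod_def adjoint_gmod_def triv_gmod_def C_def)
 have El: "E : lie_u" by (simp add: lie_u_def En)
 have ZE: "Z = (\<chi> i. Z $ 2 $ 1 *s E $ i)" if "Z : lie_u" for Z
  using that by (simp add: lie_u_def vec_eq_iff forall_2 En)
 have lE: "l Z = Z $ 2 $ 1 * l E" if "l : C" "Z : lie_u" for l Z
 proof -
  have "l (\<chi> i. Z $ 2 $ 1 *s E $ i) = Z $ 2 $ 1 * l E" using that(1) El unfolding C_def by blast
  thus ?thesis using ZE[OF that(2)] by simp
 qed
 have CI: "(\<lambda>Z\<in>lie_u. Z $ 2 $ 1 * y) : C" for y by (auto simp: C_def lie_u_def algebra_simps)
 have Ceq: "l = (\<lambda>Z\<in>lie_u. Z $ 2 $ 1 * y)" if "l : C" "l E = y" for l y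
  using lE[OF that(1)] that by (auto simp: C_def PiE_def extensional_def fun_eq_iff restrict_def)
 have conj: "sl2_mat (inverse b) ** Z ** sl2_mat b : lie_u \<and>
   (sl2_mat (inverse b) ** Z ** sl2_mat b) $ 2 $ 1 = (sl2_mat b $ 1 $ 1)\<^sup>2 * Z $ 2 $ 1"
  if "b : borel_sl2" "Z : lie_u" for b and Z :: "'k ^ 2 ^ 2"
  using that by (simp add: borel_sl2_def lie_u_def mat_2_mult sl2_mat_inverse_entries power2_eq_square)
 have "gmod_iso_on borel_sl2 u_dual (line (%b. (sl2_mat b $ 1 $ 1)\<^sup>2)) (%l. l E)"
  unfolding gmod_iso_on_def ud line_simps
 proof (intro conjI ballI allI)
  show "bij_betw (%l. l E) C UNIV"
  proof (rule bij_betwI')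
   show "l E = l' E \<longleftrightarrow> l = l'" if "l : C" "l' : C" for l l' using Ceq that by metis
   show "\<exists>l\<in>C. y = l E" for y by (rule bexI[OF _ CI[of y]]) (simp add: El En)
  qed simp
 next
  fix l assume l: "l : C"
  have "(\<lambda>Z\<in>lie_u. c * l Z) = (\<lambda>Z\<in>lie_u. Z $ 2 $ 1 * (c * l E))" for c
   by (rule restrict_ext) (subst lE[OF l], simp_all)
  thus "(\<lambda>Z\<in>lie_u. c * l Z) E = c * l E" "(\<lambda>Z\<in>lie_u. c * l Z) : C" for c
   using El CI by (simp_all add: En)
  have "(\<lambda>Z\<in>lie_u. l (sl2_mat (inverse b) ** Z ** sl2_mat b)) = (\<lambda>Z\<in>lie_u. Z $ 2 $ 1 * ((sl2_mat b $ 1 $ 1)\<^sup>2 * l E))"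
   if b: "b : borel_sl2" for b
   using conj[OF b] by (intro restrict_ext) (subst lE[OF l], simp_all)
  thus "(\<lambda>Z\<in>lie_u. l (sl2_mat (inverse b) ** Z ** sl2_mat b)) : C"
   "(\<lambda>Z\<in>lie_u. l (sl2_mat (inverse b) ** Z ** sl2_mat b)) E = (sl2_mat b $ 1 $ 1)\<^sup>2 * l E" if b: "b : borel_sl2" for b
   using CI El b by (simp_all add: En)
  fix l' assume l': "l' : C"
  have "(\<lambda>Z\<in>lie_u. l Z + l' Z) = (\<lambda>Z\<in>lie_u. Z $ 2 $ 1 * (l E + l' E))"
   by (rule restrict_ext) (subst lE[OF l], simp, subst lE[OF l'], simp_all add: distrib_left)
  thus "(\<lambda>Z\<in>lie_u. l Z + l' Z) : C" "(\<lambda>Z\<in>lie_u. l Z + l' Z) E = l E + l' E"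
   using El CI by (simp_all add: En)
 qed
 thus ?thesis by (rule that)
qed

section \<open>Induction from the Borel subgroup and forms on the plane\<close>

definition smat :: "'k::field => 'k => 'k => 'k => 'k sl2"
 where "smat a b c d = Abs_sl2 (\<chi> i. if i = 1 then vec2 a b else vec2 c d)"

lemma smat_nth:
 assumes "a * d - b * c = 1"
 shows "sl2_mat (smat a b c d) $ 1 $ 1 = a" "sl2_mat (smat a b c d) $ 1 $ 2 = b"
  "sl2_mat (smat a b c d) $ 2 $ 1 = c" "sl2_mat (smat a b c d) $ 2 $ 2 = d"
proof -
 have "sl2_mat (smat a b c d) = (\<chi> i. if i = 1 then vec2 a b else vec2 c d)"
  unfolding smat_def by (rule Abs_sl2_inverse) (use assms in \<open>simp add: det_2\<close>)
 thus "sl2_mat (smat a b c d) $ 1 $ 1 = a" "sl2_mat (smat a b c d) $ 1 $ 2 = b"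
  "sl2_mat (smat a b c d) $ 2 $ 1 = c" "sl2_mat (smat a b c d) $ 2 $ 2 = d" by simp_all
qed

lemma polyfun_regular:
 assumes "F : regular_funs" "\<And>i j. polyfun (%t. sl2_mat (c t) $ i $ j)"
 shows "polyfun (%t. F (c t))"
 using assms(1) by (induction rule: regular_funs.induct) (auto intro: assms(2))

text \<open>Reversing r clears the denominators and allows coefficients to be compared; the extra
  factor x makes the identity hold at 0 too.\<close>

lemma homogeneous_polynomial_of_charts:
 fixes q r :: "'k::alg_closed_field poly"
 assumes "\<And>x. x ~= 0 ==> poly q x = x ^ n * poly r (inverse x)"
 shows "i > n ==> coeff q i = 0" "coeff q n = coeff r 0"
proof -
 have "poly ([:0, 1:] * (monom 1 (degree r) * q)) x = poly ([:0, 1:] * (monom 1 n * reflect_poly r)) x" for x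
  using assms[of x] by (cases "x = 0") (simp_all add: poly_monom poly_reflect_poly_nz)
 hence "[:0, 1:] * (monom 1 (degree r) * q) = [:0, 1:] * (monom 1 n * reflect_poly r)"
  by (simp only: poly_fun_eq_iff[symmetric]) simp
 hence "monom 1 (degree r) * q = monom 1 n * reflect_poly r" by simp
 hence c: "coeff (monom 1 (degree r) * q) (degree r + i) = coeff (monom 1 n * reflect_poly r) (degree r + i)" for i by simp
 show "coeff q i = 0" if "i > n" using c[of i] that by (simp add: coeff_monom_mult coeff_reflect_poly)
 show "coeff q n = coeff r 0" using c[of n] by (simp add: coeff_monom_mult coeff_reflect_poly)
qed

text \<open>A function on \<open>SL\<^sub>2\<close> that is semi-invariant under \<open>B\<close> factors through the second column; it is
 polynomial because it is so on the two charts of the projective line.\<close>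

lemma regular_semi_invariant:
 fixes F :: "'k::alg_closed_field sl2 => 'k"
 assumes F: "F : regular_funs" and inv: "\<And>g b. b : borel_sl2 ==> F (g * b) = (sl2_mat b $ 2 $ 2) ^ n * F g"
 obtains h where "h : SP n" "\<And>g. F g = h (sl2_mat g *v vec2 0 1)"
proof -
 \<comment> \<open>Matrices with second column (x, 1) and (1, y) give the two standard charts of the
   projective line G/B.\<close>
 have "polyfun (%x. sl2_mat (smat 1 x 0 1) $ i $ j :: 'k)" "polyfun (%y. sl2_mat (smat 0 1 (- 1) y) $ i $ j :: 'k)" for i j
  using exhaust_2[of i] exhaust_2[of j] by (auto simp: smat_nth)
 hence U: "polyfun (%x. F (smat 1 x 0 1))" and V: "polyfun (%y. F (smat 0 1 (- 1) y))"
  by (auto intro: polyfun_regular[OF F])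
 obtain q where q: "F (smat 1 x 0 1) = poly q x" for x using U by (metis polyfunE)
 obtain r where r: "F (smat 0 1 (- 1) y) = poly r y" for y using V by (metis polyfunE)
 have e: "F g = (sl2_mat (inverse k * g) $ 2 $ 2) ^ n * F k" if "sl2_mat (inverse k * g) $ 1 $ 2 = 0" for g k
  using inv[of "inverse k * g" k] that by (simp add: borel_sl2_def)
 have col: "sl2_mat g *v vec2 0 1 = vec2 (sl2_mat g $ 1 $ 2) (sl2_mat g $ 2 $ 2)" for g :: "'k sl2"
  by (rule vec2_eqI) (simp_all add: matvec_2)
 have 1: "F g = d ^ n * poly q (b / d)" if "d ~= 0" "sl2_mat g $ 1 $ 2 = b" "sl2_mat g $ 2 $ 2 = d" for g b d
  using e[of "smat 1 (b / d) 0 1" g] that smat_nth[of 1 1 "b / d" 0]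
  by (simp add: sl2_mat_mult_entry sl2_mat_inverse_entries q)
 have 2: "F g = b ^ n * poly r (d / b)" if "b ~= 0" "sl2_mat g $ 1 $ 2 = b" "sl2_mat g $ 2 $ 2 = d" for g b d
  using e[of "smat 0 1 (- 1) (d / b)" g] that smat_nth[of 0 "d / b" 1 "- 1"]
  by (simp add: sl2_mat_mult_entry sl2_mat_inverse_entries r)
 have "poly q x = x ^ n * poly r (inverse x)" if "x ~= 0" for x
  using 2[of x "smat 1 x 0 1" 1] that smat_nth[of 1 1 x 0] by (simp add: q divide_inverse)
 note qr = homogeneous_polynomial_of_charts[OF this]
 define h where "h z = (\<Sum>i\<le>n. coeff q i * (z $ 1 ^ i * z $ 2 ^ (n - i)))" for z :: "'k ^ 2"
 have deg: "degree q <= n" using qr(1) by (intro degree_le) auto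
 have "F g = h (sl2_mat g *v vec2 0 1)" for g
 proof -
  obtain b d where bd: "sl2_mat g $ 1 $ 2 = b" "sl2_mat g $ 2 $ 2 = d" by blast
  show ?thesis
  proof (cases "d = 0")
   case False
   have "poly q (b / d) = (\<Sum>i\<le>n. coeff q i * (b / d) ^ i)"
    unfolding poly_altdef using deg by (intro sum.mono_neutral_left) (auto simp: coeff_eq_0)
   hence "F g = (\<Sum>i\<le>n. d ^ n * (coeff q i * (b / d) ^ i))"
    using 1[OF False bd] by (simp add: sum_distrib_left)
   also have "... = (\<Sum>i\<le>n. coeff q i * (b ^ i * d ^ (n - i)))"
   proof (rule sum.cong)
    fix i assume "i : {..n}"
    hence "d ^ n = d ^ i * d ^ (n - i)" by (simp flip: power_add)
    thus "d ^ n * (coeff q i * (b / d) ^ i) = coeff q i * (b ^ i * d ^ (n - i))"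
     using False by (simp add: power_divide)
   qed simp
   finally show ?thesis by (simp add: h_def col bd)
  next
   case True
   have "sl2_mat g $ 1 $ 1 * d - b * sl2_mat g $ 2 $ 1 = 1" using det_sl2_mat[of g] by (simp add: det_2 bd)
   hence b: "b ~= 0" using True by auto
   have "h (vec2 b 0) = (\<Sum>i\<in>{n}. coeff q i * (b ^ i * 0 ^ (n - i)))"
    unfolding h_def by (simp only: vec2_nth) (rule sum.mono_neutral_right; auto simp: power_0_left)
   thus ?thesis using 2[OF b bd] qr(2) by (simp add: col bd True poly_0_coeff_0 mult.commute)
  qed
 qed
 moreover have "h : SP n" by (rule SP_I[OF h_def])
 ultimately show ?thesis using that by blast
qed

lemma SP_scale: "h : SP n ==> h (c *s x) = c ^ n * h x"
proof -
 assume "h : SP n"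
 then obtain a where h: "h = (%x. \<Sum>i\<le>n. a i * (x $ 1 ^ i * x $ 2 ^ (n - i)))" by (rule SP_E)
 have "c ^ n = c ^ i * c ^ (n - i)" if "i <= n" for i using that by (simp flip: power_add)
 thus ?thesis unfolding h sum_distrib_left by (intro sum.cong) (auto simp: power_mult_distrib mult_ac)
qed

text \<open>Right translation by a lower triangular b multiplies the second column of g by b22, the
  inverse of b11; so a section is a function of that column, homogeneous of degree n.\<close>

lemma ind_line:
 fixes M :: "('k::alg_closed_field, 'v, 'k sl2) gmodule"
 assumes j: "gmod_iso_on borel_sl2 M (line (%b. (sl2_mat b $ 1 $ 1) ^ n)) j" and z: "\<zero>\<^bsub>M\<^esub> : carrier M" "j \<zero>\<^bsub>M\<^esub> = 0"
 obtains I where "gmod_iso_on UNIV (Smod n) (ind_B_G M) I"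
proof -
 note D = gmod_iso_on_D[OF j, unfolded line_simps]
 define k where "k = inv_into (carrier M) j"
 have "x : j ` carrier M" for x using D(9)[OF UNIV_I] by (metis image_eqI)
 hence k: "k x : carrier M" "j (k x) = x" for x unfolding k_def by (simp_all add: inv_into_into f_inv_into_f)
 have kI: "v = k x" if "v : carrier M" "j v = x" for v x using D(8)[OF that(1) k(1)] k(2) that(2) by simp
 interpret abelian_monoid M
 proof (rule abelian_monoidI)
  fix x y v assume "x : carrier M" "y : carrier M" "v : carrier M"
  thus "x +[M] y +[M] v = x +[M] (y +[M] v)" by (intro D(8)) (simp_all add: D add.assoc)
 next
  fix x y assume "x : carrier M" "y : carrier M"
  thus "x +[M] y = y +[M] x" by (intro D(8)) (simp_all add: D add.commute)
 next
  fix x assume "x : carrier M"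
  thus "\<zero>\<^bsub>M\<^esub> +[M] x = x" using z by (intro D(8)) (simp_all add: D)
 qed (simp_all add: D z)
 have js: "j (\<Oplus>\<^bsub>M\<^esub>i\<in>A. f i) = (\<Sum>i\<in>A. j (f i))" if "finite A" "f : A \<rightarrow> carrier M" for A :: "nat set" and f
  using that by (induction A rule: finite_induct) (auto simp: z D)
 define C where "C = {f. (\<exists>(r :: nat) u v. (\<forall>i<r. u i : regular_funs & v i : carrier M) \<and>
      f = (%g. \<Oplus>\<^bsub>M\<^esub>i\<in>{..<r}. u i g *[M] v i)) \<and>
     (\<forall>g. \<forall>b\<in>borel_sl2. f (g * b) = act M (inverse b) (f g))}"
 have ind: "carrier (ind_B_G M) = C" "f +[ind_B_G M] h = (%x. f x +[M] h x)" "c *[ind_B_G M] f = (%x. c *[M] f x)"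
  "act (ind_B_G M) g f = (%x. f (inverse g * x))" for f h c g
  by (simp_all add: ind_B_G_def fun_gmod_def gmod_def C_def restrict_def)
 define I where "I h = (%g :: 'k sl2. k (h (sl2_mat g *v vec2 0 1)))" for h
 have ib: "inverse b : borel_sl2" "sl2_mat (inverse b) $ 1 $ 1 = sl2_mat b $ 2 $ 2" if "b : borel_sl2" for b :: "'k sl2"
  using that by (simp_all add: borel_sl2_def sl2_mat_inverse_entries)
 have IC: "I h : C" if h: "h : SP n" for h
 proof -
  obtain a where a: "h = (%t. \<Sum>i\<le>n. a i * (t $ 1 ^ i * t $ 2 ^ (n - i)))" using h by (rule SP_E)
  have rs: "(%g. \<Sum>i\<in>A. f i g) : regular_funs" if "\<And>i. i : A ==> f i : regular_funs" for A :: "nat set" and f :: "nat => 'k sl2 => 'k"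
   using that by (induction A rule: infinite_finite_induct) (auto intro: regular_funs.intros)
  have "(%g. h (sl2_mat g *v vec2 0 1)) : regular_funs"
   unfolding a by (simp add: matvec_2) (intro rs regular_cmult regular_funs.mult regular_power regular_funs.entry)
  moreover have "I h = (%g. \<Oplus>\<^bsub>M\<^esub>i\<in>{..<Suc 0}. h (sl2_mat g *v vec2 0 1) *[M] k 1)"
  proof
   fix g
   have "(\<Oplus>\<^bsub>M\<^esub>i\<in>{..<Suc 0}. h (sl2_mat g *v vec2 0 1) *[M] k 1) = h (sl2_mat g *v vec2 0 1) *[M] k 1"
    by (simp add: lessThan_Suc D k z finsum_insert r_zero)
   also have "... = I h g" unfolding I_def by (rule kI) (simp_all add: D k)
   finally show "I h g = (\<Oplus>\<^bsub>M\<^esub>i\<in>{..<Suc 0}. h (sl2_mat g *v vec2 0 1) *[M] k 1)" by simp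
  qed
  moreover have "I h (g * b) = act M (inverse b) (I h g)" if b: "b : borel_sl2" for g b
  proof -
   have "sl2_mat (g * b) *v vec2 0 1 = sl2_mat b $ 2 $ 2 *s (sl2_mat g *v vec2 0 1)"
    using b by (simp add: vec_eq_iff forall_2 matvec_2 sl2_mat_mult_entry borel_sl2_def mult.commute)
   hence "I h (g * b) = k ((sl2_mat b $ 2 $ 2) ^ n * h (sl2_mat g *v vec2 0 1))"
    by (simp add: I_def SP_scale[OF h])
   also have "... = act M (inverse b) (I h g)"
    unfolding I_def by (rule kI[symmetric]) (simp_all add: D ib[OF b] k)
   finally show ?thesis .
  qed
  ultimately show ?thesis unfolding C_def using k(1)
   by (intro CollectI conjI exI[of _ "Suc 0"] exI[of _ "%_ g. h (sl2_mat g *v vec2 0 1)"] exI[of _ "%_. k 1"]) auto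
 qed
 have surj: "\<exists>h\<in>SP n. I h = f" if f: "f : C" for f
 proof -
  obtain r :: nat and u v where r: "\<forall>i<r. u i : regular_funs & v i : carrier M" "f = (%g. \<Oplus>\<^bsub>M\<^esub>i\<in>{..<r}. u i g *[M] v i)"
   and eq: "\<forall>g. \<forall>b\<in>borel_sl2. f (g * b) = act M (inverse b) (f g)" using f unfolding C_def by blast
  have fM: "f g : carrier M" for g unfolding r(2) by (rule finsum_closed) (use r(1) D in auto)
  have jf: "j (f g) = (\<Sum>i<r. u i g * j (v i))" for g unfolding r(2) by (subst js) (use r(1) D in auto)
  have "(%g. \<Sum>i\<in>A. u i g * j (v i)) : regular_funs" if "A \<subseteq> {..<r}" for A
   using that r(1) by (induction A rule: infinite_finite_induct)
    (auto intro!: regular_funs.const regular_funs.add regular_funs.mult[OF _ regular_funs.const])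
  hence "(%g. j (f g)) : regular_funs" unfolding jf by simp
  moreover have "j (f (g * b)) = (sl2_mat b $ 2 $ 2) ^ n * j (f g)" if "b : borel_sl2" for g b
   using eq that fM by (simp add: D ib)
  ultimately obtain h where h: "h : SP n" "\<And>g. j (f g) = h (sl2_mat g *v vec2 0 1)"
   using regular_semi_invariant[of "%g. j (f g)" n] by blast
  have "I h = f"
  proof
   fix g show "I h g = f g" unfolding I_def by (rule kI[symmetric]) (simp_all add: fM h)
  qed
  thus ?thesis using h by blast
 qed
 have inj: "h = h'" if "h : SP n" "h' : SP n" "I h = I h'" for h h'
 proof
  fix t
  have "h t - h' t = 0" if "t ~= 0" for t
  proof -
   obtain g where "sl2_mat g *v vec2 0 1 = t"
   proof (cases "t $ 2 = 0")
    case True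
    hence "t $ 1 ~= 0" using \<open>t ~= 0\<close> by (auto simp: vec_eq_iff forall_2)
    thus ?thesis using smat_nth[of 0 "t $ 2" "t $ 1" "- inverse (t $ 1)"]
     by (intro that[of "smat 0 (t $ 1) (- inverse (t $ 1)) (t $ 2)"]) (simp add: vec_eq_iff forall_2 matvec_2)
   next
    case False
    thus ?thesis using smat_nth[of "inverse (t $ 2)" "t $ 2" "t $ 1" 0]
     by (intro that[of "smat (inverse (t $ 2)) (t $ 1) 0 (t $ 2)"]) (simp add: vec_eq_iff forall_2 matvec_2)
   qed
   thus ?thesis using arg_cong[OF fun_cong[OF \<open>I h = I h'\<close>, of g], of j] by (simp add: I_def k)
  qed
  hence "h t - h' t = 0" by (rule SP_eq_0[OF SP_diff[OF that(1,2)]])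
  thus "h t = h' t" by simp
 qed
 have Sm: "carrier (Smod n) = SP n" "f +[Smod n] h = (%t. f t + h t)" "c *[Smod n] f = (%t. c * f t)"
  "act (Smod n) g f = (%t. f (sl2_mat (inverse g) *v t))" for f h :: "'k ^ 2 => 'k" and c g
  by (simp_all add: Smod_def gmod_def)
 have "gmod_iso_on UNIV (Smod n) (ind_B_G M) I"
  unfolding gmod_iso_on_def ind Sm
 proof (intro conjI ballI allI)
  show "bij_betw I (SP n) C"
   using IC surj inj by (intro bij_betw_imageI inj_onI) blast+
  fix h h' :: "'k ^ 2 => 'k" and g c assume h: "h : SP n"
  show "(%t. c * h t) : SP n" "(%t. h (sl2_mat (inverse g) *v t)) : SP n" using h by (rule SP_cmult, rule SP_subst)
  show "I (%t. c * h t) = (%x. c *[M] I h x)"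
   unfolding I_def by (rule ext, rule kI[symmetric]) (simp_all add: D k)
  show "I (%t. h (sl2_mat (inverse g) *v t)) = (%x. I h (inverse g * x))"
   by (simp add: I_def sl2_mat_mult matrix_vector_mul_assoc)
  assume h': "h' : SP n"
  show "(%t. h t + h' t) : SP n" using h h' by (rule SP_add)
  show "I (%t. h t + h' t) = (%x. I h x +[M] I h' x)"
   unfolding I_def by (rule ext, rule kI[symmetric]) (simp_all add: D k)
 qed
 thus ?thesis by (rule that)
qed

text \<open>The weights 2m and 1 add up, so induction gives the forms of degree 2m + 1, and
  tensoring with L(1) gives pairs of such forms.\<close>

lemma odd_target_iso:
 "Pmod (2 * m + 1) \<cong>\<^sub>G
  tensor_gmod (ind_B_G (tensor_gmod (sym_power_gmod m u_dual) omega)) (L1 :: ('k::alg_closed_field, 'k ^ 2, 'k sl2) gmodule)"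
proof -
 obtain i1 where "gmod_iso_on borel_sl2 (u_dual :: ('k, _, _) gmodule) (line (%b. (sl2_mat b $ 1 $ 1)\<^sup>2)) i1" by (rule u_dual_line)
 then obtain i2 where i2: "gmod_iso_on borel_sl2 (sym_power_gmod m (u_dual :: ('k, _, _) gmodule)) (line (%b. ((sl2_mat b $ 1 $ 1)\<^sup>2) ^ m)) i2"
  by (rule sym_power_line)
 define M where "M = tensor_gmod (sym_power_gmod m (u_dual :: ('k, _, _) gmodule)) omega"
 have M: "M = tensor_gmod (sym_power_gmod m u_dual) (line (%b. sl2_mat b $ 1 $ 1))"
  by (simp add: M_def line_def omega_def)
 obtain i3 where i3: "gmod_iso_on borel_sl2 M (line (%b. ((sl2_mat b $ 1 $ 1)\<^sup>2) ^ m * sl2_mat b $ 1 $ 1)) i3"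
  "\<zero>\<^bsub>M\<^esub> : carrier M" "i3 \<zero>\<^bsub>M\<^esub> = 0"
  using tensor_line[OF i2, of "%b. sl2_mat b $ 1 $ 1"] unfolding M by blast
 have "((sl2_mat b $ 1 $ 1)\<^sup>2) ^ m * sl2_mat b $ 1 $ 1 = sl2_mat b $ 1 $ 1 ^ (2 * m + 1)" for b :: "'k sl2"
  by (simp only: power_mult power_add power_one_right)
 hence "gmod_iso_on borel_sl2 M (line (%b. sl2_mat b $ 1 $ 1 ^ (2 * m + 1))) i3" using i3(1) by (simp only:)
 from ind_line[OF this i3(2,3)] obtain I1 where "gmod_iso_on UNIV (Smod (2 * m + 1)) (ind_B_G M) I1" .
 then obtain I2 where "gmod_iso_on UNIV (ind_B_G M) (Smod (2 * m + 1)) I2" by (rule gmod_iso_on_sym)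
 then obtain I3 where "gmod_iso_on UNIV (tensor_gmod (ind_B_G M) L1) (Pmod (2 * m + 1)) I3" by (rule tensor_L1)
 then obtain I4 where "gmod_iso_on UNIV (Pmod (2 * m + 1)) (tensor_gmod (ind_B_G M) L1) I4" by (rule gmod_iso_on_sym)
 thus ?thesis unfolding M_def by (rule gmod_iso_on_UNIV)
qed

theorem theorem4p3p2:
  fixes p :: nat
  assumes "CHAR('k::alg_closed_field) = p" and "p \<ge> 3"
  shows "(frob_untwist (HH 0 (Dist_G1 :: ('k, ('k sl2 \<Rightarrow> 'k) \<Rightarrow> 'k, 'k sl2) gmodule))
            \<cong>\<^sub>G power_gmod ((3 * p - 1) div 2) triv_gmod) \<and>
    (\<forall>m>0. frob_untwist (HH (2 * m) (Dist_G1 :: ('k, ('k sl2 \<Rightarrow> 'k) \<Rightarrow> 'k, 'k sl2) gmodule))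
            \<cong>\<^sub>G power_gmod (p - 1) (nilcone_coord m)) \<and>
    (\<forall>m. frob_untwist (HH (2 * m + 1) (Dist_G1 :: ('k, ('k sl2 \<Rightarrow> 'k) \<Rightarrow> 'k, 'k sl2) gmodule))
            \<cong>\<^sub>G power_gmod ((p - 1) div 2)
                 (tensor_gmod (ind_B_G (tensor_gmod (sym_power_gmod m u_dual) omega)) L1))"
  proof -
 interpret charp p "TYPE('k)" by unfold_locales (use assms in auto)
 have "frob_untwist (HH (2 * m) DA) \<cong>\<^sub>G power_gmod (p - 1) (nilcone_coord m)" if "m > 0" for m
 proof -
  have "Smod (2 * m) \<cong>\<^sub>G (nilcone_coord m :: ('k, _, _) gmodule)"
   by (rule nilcone_coord_iso) (rule gmod_iso_on_UNIV)
  thus ?thesis using HH_even[of "2 * m"] that gmod_iso_trans power_gmod_iso by fastforce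
 qed
 moreover have "frob_untwist (HH (2 * m + 1) DA) \<cong>\<^sub>G power_gmod ((p - 1) div 2)
   (tensor_gmod (ind_B_G (tensor_gmod (sym_power_gmod m u_dual) omega)) L1)" for m
  by (rule gmod_iso_trans[OF HH_odd power_gmod_iso[OF odd_target_iso]]) simp
 ultimately show ?thesis using HH_0 by blast
qed

end
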